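(* Let $k$ be an algebraically closed field, let $n\geq 4$, and let $f\in k[x_1,\dots,x_n]$ be a homogeneous polynomial of degree $\geq 2$ such that $\operatorname{char} k\nmid \deg f$. Assume that the quotient ring $R=k[x_1,\dots,x_n]/(f)$ is a domain with an isolated singularity. Then the following facts hold. (1) For every $q\geq 1$, $\operatorname{frk}_R\mathrm{Sym}^q_R(\Omega_{R/k})=0$. (2) The differential symmetric signature of $R$ is $s_{\mathrm{d}\sigma}(R)=0$.
   Context: Polynomial rings carry the standard grading and $R$ the induced grading. "Isolated singularity" means that $R_{\mathfrak p}$ is regular for every prime $\mathfrak p$ of $R$ different from the homogeneous maximal ideal $\mathfrak m_R=(x_1,\dots,x_n)R$. The condition $\operatorname{char} k\nmid\deg f$ is automatic in characteristic $0$. $\Omega_{R/k}$ is the (graded) module of Kähler differentials of $R$ over $k$. For a finitely generated graded $R$-module $M$, $\operatorname{rank}_R M$ is the usual rank (the dimension of $M\otimes_R \mathrm{Frac}(R)$ over $\mathrm{Frac}(R)$), and the free rank is $$\operatorname{frk}_R M=\max\{m\in\mathbb{N}:\ \text{there is a surjection } M\twoheadrightarrow L,\ \text{homogeneous of degree } 0,\ \text{with } L \text{ a free graded } R\text{-module of rank } m\}$$ (free graded modules may have shifted generators). With $(-)^*=\mathrm{Hom}_R(-,R)$ and $\mathcal{C}^q=\left(\mathrm{Sym}^q_R(\Omega_{R/k})\right)^{**}$ for $q\in\mathbb{N}$, the differential symmetric signature of $R$ is $$s_{\mathrm{d}\sigma}(R)=\lim_{N\to+\infty}\frac{\sum_{q=0}^N\operatorname{frk}_R\mathcal{C}^q}{\sum_{q=0}^N\operatorname{rank}_R\mathcal{C}^q},$$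 provided the limit exists. *)

theory Defs
  imports
    "HOL-Algebra.Algebra"
    "HOL-Computational_Algebra.Polynomial"
    "HOL-Library.Poly_Mapping"
    "HOL-Library.Extended_Nat"
    "HOL-Library.Multiset"
    "Jordan_Normal_Form.Missing_VectorSpace"
begin

section \<open>Modules given by generators and relations\<close>

text \<open>The fields \<^const>\<open>monoid.mult\<close> and \<^const>\<open>monoid.one\<close> that a module record inherits from ring
  records carry no meaning for modules; they are filled with dummies throughout.\<close>

definition free_module :: "('a, 'c) ring_scheme \<Rightarrow> 'g set \<Rightarrow> ('a, 'g \<Rightarrow> 'a) module" where
  "free_module R G =
    \<lparr>carrier = {v. (\<forall>g. v g \<in> carrier R) \<and> finite {g. v g \<noteq> \<zero>\<^bsub>R\<^esub>} \<and> {g. v g \<noteq> \<zero>\<^bsub>R\<^esub>} \<subseteq> G},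
     monoid.mult = (\<lambda>v w g. \<zero>\<^bsub>R\<^esub>), one = (\<lambda>g. \<zero>\<^bsub>R\<^esub>),
     ring.zero = (\<lambda>g. \<zero>\<^bsub>R\<^esub>), ring.add = (\<lambda>v w g. v g \<oplus>\<^bsub>R\<^esub> w g),
     module.smult = (\<lambda>r v g. r \<otimes>\<^bsub>R\<^esub> v g)\<rparr>"

definition free_gen :: "('a, 'c) ring_scheme \<Rightarrow> 'g \<Rightarrow> 'g \<Rightarrow> 'a" where
  "free_gen R x = (\<lambda>g. if g = x then \<one>\<^bsub>R\<^esub> else \<zero>\<^bsub>R\<^esub>)"

definition quotient_module ::
  "('a, 'b, 'c) module_scheme \<Rightarrow> 'b set \<Rightarrow> ('a, 'b set) module" where
  "quotient_module M N =
    \<lparr>carrier = a_rcosets\<^bsub>M\<^esub> N, monoid.mult = (\<lambda>U V. N), one = N,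
     ring.zero = N, ring.add = set_add M,
     module.smult = (\<lambda>r U. \<Union>x\<in>U. N +>\<^bsub>M\<^esub> (r \<odot>\<^bsub>M\<^esub> x))\<rparr>"

definition relation_module :: "('a, 'c) ring_scheme \<Rightarrow> 'g set \<Rightarrow> ('g \<Rightarrow> 'a) set \<Rightarrow> ('g \<Rightarrow> 'a) set" where
  "relation_module R G rels = LinearCombinations.module.span R (free_module R G) rels"

definition presented_module ::
  "('a, 'c) ring_scheme \<Rightarrow> 'g set \<Rightarrow> ('g \<Rightarrow> 'a) set \<Rightarrow> ('a, ('g \<Rightarrow> 'a) set) module" where
  "presented_module R G rels = quotient_module (free_module R G) (relation_module R G rels)"

definition presented_gen ::
  "('a, 'c) ring_scheme \<Rightarrow> 'g set \<Rightarrow> ('g \<Rightarrow> 'a) set \<Rightarrow> 'g \<Rightarrow> ('g \<Rightarrow> 'a) set" where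
  "presented_gen R G rels x = relation_module R G rels +>\<^bsub>free_module R G\<^esub> free_gen R x"


section \<open>Graded rings and modules\<close>

text \<open>The gradings are by \<^typ>\<open>int\<close>: \<open>ring_part R e\<close> and \<open>module_part M e\<close> are the sets of
  homogeneous elements of degree \<open>e\<close> (zero included).\<close>

record 'a graded_ring = "'a ring" +
  ring_part :: "int \<Rightarrow> 'a set"

record ('a, 'b) graded_module = "('a, 'b) module" +
  module_part :: "int \<Rightarrow> 'b set"

definition with_grading ::
  "('a, 'b) module \<Rightarrow> (int \<Rightarrow> 'b set) \<Rightarrow> ('a, 'b) graded_module" where
  "with_grading M g =
    \<lparr>carrier = carrier M, monoid.mult = monoid.mult M, one = monoid.one M,
     ring.zero = ring.zero M, ring.add = ring.add M, module.smult = module.smult M, module_part = g\<rparr>"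

definition graded_hom ::
  "('a, 'c) graded_ring_scheme \<Rightarrow> ('a, 'b1, 'd1) graded_module_scheme \<Rightarrow>
   ('a, 'b2, 'd2) graded_module_scheme \<Rightarrow> int \<Rightarrow> ('b1 \<Rightarrow> 'b2) set" where
  "graded_hom R M N e =
    {\<phi> \<in> LinearCombinations.module_hom R M N.
      \<forall>i. \<phi> ` module_part M i \<subseteq> module_part N (i + e)}"

text \<open>The direct sum of the \<open>R(- a i)\<close> over \<open>i < m\<close>, so the \<open>i\<close>-th basis vector has degree \<open>a i\<close>.
  Up to isomorphism these are all the graded free modules of rank \<open>m\<close>.\<close>

definition graded_free_module ::
  "('a, 'c) graded_ring_scheme \<Rightarrow> nat \<Rightarrow> (nat \<Rightarrow> int) \<Rightarrow> ('a, nat \<Rightarrow> 'a) graded_module" where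
  "graded_free_module R m a =
    with_grading (free_module R {..<m})
      (\<lambda>e. {v \<in> carrier (free_module R {..<m}). \<forall>i<m. v i \<in> ring_part R (e - a i)})"

definition free_rank ::
  "('a, 'c) graded_ring_scheme \<Rightarrow> ('a, 'b, 'd) graded_module_scheme \<Rightarrow> nat" where
  "free_rank R M =
    Max {m. \<exists>a. \<exists>\<phi> \<in> graded_hom R M (graded_free_module R m a) 0.
              \<phi> ` carrier M = carrier (graded_free_module R m a)}"

definition ring_as_module ::
  "('a, 'c) graded_ring_scheme \<Rightarrow> ('a, 'a) graded_module" where
  "ring_as_module R =
    \<lparr>carrier = carrier R, monoid.mult = monoid.mult R, one = \<one>\<^bsub>R\<^esub>,
     ring.zero = \<zero>\<^bsub>R\<^esub>, ring.add = ring.add R, module.smult = monoid.mult R, module_part = ring_part R\<rparr>"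

text \<open>For a finitely generated graded \<open>M\<close>, the module \<open>Hom\<^sub>R(M, R)\<close> is the direct sum of its
  subgroups of homomorphisms that are homogeneous of a given degree.\<close>

definition dual_module ::
  "('a, 'c) graded_ring_scheme \<Rightarrow> ('a, 'b, 'd) graded_module_scheme \<Rightarrow>
   ('a, 'b \<Rightarrow> 'a) graded_module" where
  "dual_module R M =
    \<lparr>carrier = LinearCombinations.module_hom R M (ring_as_module R) \<inter> extensional (carrier M),
     monoid.mult = (\<lambda>\<phi> \<psi>. \<lambda>x\<in>carrier M. \<zero>\<^bsub>R\<^esub>), one = (\<lambda>x\<in>carrier M. \<zero>\<^bsub>R\<^esub>),
     ring.zero = (\<lambda>x\<in>carrier M. \<zero>\<^bsub>R\<^esub>),
     ring.add = (\<lambda>\<phi> \<psi>. \<lambda>x\<in>carrier M. \<phi> x \<oplus>\<^bsub>R\<^esub> \<psi> x),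
     module.smult = (\<lambda>r \<phi>. \<lambda>x\<in>carrier M. r \<otimes>\<^bsub>R\<^esub> \<phi> x),
     module_part =
       (\<lambda>e. graded_hom R M (ring_as_module R) e \<inter> extensional (carrier M))\<rparr>"


section \<open>Kaehler differentials and symmetric powers\<close>

text \<open>The base ring enters only through its image \<open>K\<close> in \<open>R\<close>; the generator indexed by
  \<open>a \<in> carrier R\<close> is the symbol \<open>da\<close>.\<close>

definition kaehler_relations ::
  "('a, 'c) ring_scheme \<Rightarrow> 'a set \<Rightarrow> ('a \<Rightarrow> 'a) set" where
  "kaehler_relations R K =
    (let F = free_module R (carrier R); \<delta> = free_gen R in
      {\<delta> (a \<oplus>\<^bsub>R\<^esub> b) \<ominus>\<^bsub>F\<^esub> (\<delta> a \<oplus>\<^bsub>F\<^esub> \<delta> b) | a b. a \<in> carrier R \<and> b \<in> carrier R}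
      \<union> {\<delta> (a \<otimes>\<^bsub>R\<^esub> b) \<ominus>\<^bsub>F\<^esub> (a \<odot>\<^bsub>F\<^esub> \<delta> b \<oplus>\<^bsub>F\<^esub> b \<odot>\<^bsub>F\<^esub> \<delta> a) | a b. a \<in> carrier R \<and> b \<in> carrier R}
      \<union> \<delta> ` K)"

definition kaehler_module ::
  "('a, 'c) ring_scheme \<Rightarrow> 'a set \<Rightarrow> ('a, ('a \<Rightarrow> 'a) set) module" where
  "kaehler_module R K = presented_module R (carrier R) (kaehler_relations R K)"

definition kaehler_d :: "('a, 'c) ring_scheme \<Rightarrow> 'a set \<Rightarrow> 'a \<Rightarrow> ('a \<Rightarrow> 'a) set" where
  "kaehler_d R K = presented_gen R (carrier R) (kaehler_relations R K)"

text \<open>The grading for which \<open>d\<close> is homogeneous of degree \<open>0\<close>.\<close>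

definition kaehler_differentials ::
  "('a, 'c) graded_ring_scheme \<Rightarrow> 'a set \<Rightarrow> ('a, ('a \<Rightarrow> 'a) set) graded_module" where
  "kaehler_differentials R K =
    with_grading (kaehler_module R K)
      (\<lambda>e. generate (add_monoid (kaehler_module R K))
        {a \<odot>\<^bsub>kaehler_module R K\<^esub> kaehler_d R K b | a b i j.
          a \<in> ring_part R i \<and> b \<in> ring_part R j \<and> i + j = e})"

text \<open>A multiset \<open>{#x\<^sub>1, \<dots>, x\<^sub>q#}\<close> stands for the symbol of the commutative product
  \<open>x\<^sub>1 \<cdots> x\<^sub>q\<close>, so that symmetry is built into the generators and only multilinearity
  has to be imposed.  For \<open>q = 0\<close> the only generator is the empty product, and there are no relations.\<close>

definition sym_generators :: "('a, 'b, 'd) module_scheme \<Rightarrow> nat \<Rightarrow> 'b multiset set" where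
  "sym_generators M q = {U. set_mset U \<subseteq> carrier M \<and> size U = q}"

definition sym_relations ::
  "('a, 'c) ring_scheme \<Rightarrow> ('a, 'b, 'd) module_scheme \<Rightarrow> nat \<Rightarrow> ('b multiset \<Rightarrow> 'a) set" where
  "sym_relations R M q =
    (let F = free_module R (sym_generators M q); \<delta> = free_gen R in
      {\<delta> (add_mset (x \<oplus>\<^bsub>M\<^esub> y) U) \<ominus>\<^bsub>F\<^esub> (\<delta> (add_mset x U) \<oplus>\<^bsub>F\<^esub> \<delta> (add_mset y U)) | x y U p.
         x \<in> carrier M \<and> y \<in> carrier M \<and> U \<in> sym_generators M p \<and> q = Suc p}
      \<union> {\<delta> (add_mset (r \<odot>\<^bsub>M\<^esub> x) U) \<ominus>\<^bsub>F\<^esub> (r \<odot>\<^bsub>F\<^esub> \<delta> (add_mset x U)) | r x U p.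
         r \<in> carrier R \<and> x \<in> carrier M \<and> U \<in> sym_generators M p \<and> q = Suc p})"

definition sym_module ::
  "('a, 'c) ring_scheme \<Rightarrow> nat \<Rightarrow> ('a, 'b, 'd) module_scheme \<Rightarrow>
   ('a, ('b multiset \<Rightarrow> 'a) set) module" where
  "sym_module R q M = presented_module R (sym_generators M q) (sym_relations R M q)"

definition sym_product ::
  "('a, 'c) ring_scheme \<Rightarrow> nat \<Rightarrow> ('a, 'b, 'd) module_scheme \<Rightarrow>
   'b multiset \<Rightarrow> ('b multiset \<Rightarrow> 'a) set" where
  "sym_product R q M = presented_gen R (sym_generators M q) (sym_relations R M q)"

text \<open>In the grading, \<open>D\<close> is a multiset of \<open>q\<close> homogeneous elements, each paired with its degree.\<close>

definition sym_power ::
  "('a, 'c) graded_ring_scheme \<Rightarrow> nat \<Rightarrow> ('a, 'b, 'd) graded_module_scheme \<Rightarrow>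
   ('a, ('b multiset \<Rightarrow> 'a) set) graded_module" where
  "sym_power R q M =
    with_grading (sym_module R q M)
      (\<lambda>e. generate (add_monoid (sym_module R q M))
        {a \<odot>\<^bsub>sym_module R q M\<^esub> sym_product R q M (image_mset snd D) | a i D.
          a \<in> ring_part R i \<and> size D = q \<and> (\<forall>(j, x) \<in> set_mset D. x \<in> module_part M j)
          \<and> i + sum_mset (image_mset fst D) = e})"


section \<open>Localization, rank and regularity\<close>

definition fraction_rel :: "('a, 'c) ring_scheme \<Rightarrow> 'a set \<Rightarrow> (('a \<times> 'a) \<times> ('a \<times> 'a)) set" where
  "fraction_rel R S =
    {((a, s), (b, t)). a \<in> carrier R \<and> s \<in> S \<and> b \<in> carrier R \<and> t \<in> S \<and>
      (\<exists>u\<in>S. u \<otimes>\<^bsub>R\<^esub> (a \<otimes>\<^bsub>R\<^esub> t) = u \<otimes>\<^bsub>R\<^esub> (b \<otimes>\<^bsub>R\<^esub> s))}"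

definition fraction :: "('a, 'c) ring_scheme \<Rightarrow> 'a set \<Rightarrow> 'a \<Rightarrow> 'a \<Rightarrow> ('a \<times> 'a) set" where
  "fraction R S a s = fraction_rel R S `` {(a, s)}"

definition localization :: "('a, 'c) ring_scheme \<Rightarrow> 'a set \<Rightarrow> ('a \<times> 'a) set ring" where
  "localization R S =
    \<lparr>carrier = (carrier R \<times> S) // fraction_rel R S,
     monoid.mult = (\<lambda>U V. \<Union>(a, s)\<in>U. \<Union>(b, t)\<in>V. fraction R S (a \<otimes>\<^bsub>R\<^esub> b) (s \<otimes>\<^bsub>R\<^esub> t)),
     one = fraction R S \<one>\<^bsub>R\<^esub> \<one>\<^bsub>R\<^esub>,
     ring.zero = fraction R S \<zero>\<^bsub>R\<^esub> \<one>\<^bsub>R\<^esub>,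
     ring.add = (\<lambda>U V. \<Union>(a, s)\<in>U. \<Union>(b, t)\<in>V.
              fraction R S (a \<otimes>\<^bsub>R\<^esub> t \<oplus>\<^bsub>R\<^esub> b \<otimes>\<^bsub>R\<^esub> s) (s \<otimes>\<^bsub>R\<^esub> t))\<rparr>"

abbreviation fraction_field :: "('a, 'c) ring_scheme \<Rightarrow> ('a \<times> 'a) set ring" where
  "fraction_field R \<equiv> localization R (carrier R - {\<zero>\<^bsub>R\<^esub>})"

text \<open>\<open>M \<otimes>\<^sub>R L\<close> as an \<open>L\<close>-module, for a ring homomorphism \<open>\<iota> : R \<rightarrow> L\<close>; the generator indexed by \<open>x\<close>
  is \<open>x \<otimes> 1\<close>.\<close>

definition extend_scalars ::
  "('a, 'c) ring_scheme \<Rightarrow> ('l, 'd) ring_scheme \<Rightarrow> ('a \<Rightarrow> 'l) \<Rightarrow>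
   ('a, 'b, 'e) module_scheme \<Rightarrow> ('l, ('b \<Rightarrow> 'l) set) module" where
  "extend_scalars R L \<iota> M =
    (let F = free_module L (carrier M); \<delta> = free_gen L in
      presented_module L (carrier M)
       ({\<delta> (x \<oplus>\<^bsub>M\<^esub> y) \<ominus>\<^bsub>F\<^esub> (\<delta> x \<oplus>\<^bsub>F\<^esub> \<delta> y) | x y. x \<in> carrier M \<and> y \<in> carrier M}
        \<union> {\<delta> (r \<odot>\<^bsub>M\<^esub> x) \<ominus>\<^bsub>F\<^esub> (\<iota> r \<odot>\<^bsub>F\<^esub> \<delta> x) | r x. r \<in> carrier R \<and> x \<in> carrier M}))"

definition module_rank :: "('a, 'c) ring_scheme \<Rightarrow> ('a, 'b, 'd) module_scheme \<Rightarrow> nat" where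
  "module_rank R M =
    vectorspace.dim (fraction_field R)
      (extend_scalars R (fraction_field R)
        (\<lambda>r. fraction R (carrier R - {\<zero>\<^bsub>R\<^esub>}) r \<one>\<^bsub>R\<^esub>) M)"

definition krull_dim :: "('a, 'c) ring_scheme \<Rightarrow> enat" where
  "krull_dim R =
    Sup {enat n | n. \<exists>P. (\<forall>i\<le>n. primeideal (P i) R) \<and> (\<forall>i<n. P i \<subset> P (Suc i))}"

definition embedding_dim :: "('a, 'c) ring_scheme \<Rightarrow> 'a set \<Rightarrow> nat" where
  "embedding_dim R I =
    (LEAST r. \<exists>A \<subseteq> carrier R. finite A \<and> card A = r \<and> genideal R A = I)"

definition regular_local_ring :: "('a, 'c) ring_scheme \<Rightarrow> bool" where
  "regular_local_ring R \<longleftrightarrow>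
    cring R \<and> noetherian_ring R \<and>
    (\<exists>I. maximalideal I R \<and> (\<forall>J. maximalideal J R \<longrightarrow> J = I) \<and>
         krull_dim R = enat (embedding_dim R I))"

definition regular_outside :: "('a, 'c) ring_scheme \<Rightarrow> 'a set \<Rightarrow> bool" where
  "regular_outside R I \<longleftrightarrow>
    (\<forall>P. primeideal P R \<and> P \<noteq> I \<longrightarrow> regular_local_ring (localization R (carrier R - P)))"


section \<open>Projective hypersurface rings\<close>

text \<open>The polynomial ring in the \<open>n\<close> variables with indices \<open>0, \<dots>, n - 1\<close>.  A monomial is its
  finitely supported exponent function.\<close>

definition mpoly_ring :: "nat \<Rightarrow> ((nat \<Rightarrow>\<^sub>0 nat) \<Rightarrow>\<^sub>0 'k::field) ring" where
  "mpoly_ring n =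
    \<lparr>carrier = {p. \<forall>m \<in> Poly_Mapping.keys p. Poly_Mapping.keys m \<subseteq> {..<n}},
     monoid.mult = (*), one = 1, ring.zero = 0, ring.add = (+)\<rparr>"

definition mpoly_const :: "'k::field \<Rightarrow> (nat \<Rightarrow>\<^sub>0 nat) \<Rightarrow>\<^sub>0 'k" where
  "mpoly_const c = Poly_Mapping.single 0 c"

definition mpoly_var :: "nat \<Rightarrow> (nat \<Rightarrow>\<^sub>0 nat) \<Rightarrow>\<^sub>0 'k::field" where
  "mpoly_var i = Poly_Mapping.single (Poly_Mapping.single i 1) 1"

definition monomial_degree :: "(nat \<Rightarrow>\<^sub>0 nat) \<Rightarrow> nat" where
  "monomial_degree m = (\<Sum>i\<in>Poly_Mapping.keys m. Poly_Mapping.lookup m i)"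

text \<open>The zero polynomial is homogeneous of every degree.\<close>

definition homogeneous_of_degree :: "nat \<Rightarrow> ((nat \<Rightarrow>\<^sub>0 nat) \<Rightarrow>\<^sub>0 'k::field) \<Rightarrow> bool" where
  "homogeneous_of_degree d p \<longleftrightarrow> (\<forall>m \<in> Poly_Mapping.keys p. monomial_degree m = d)"

definition residue_class ::
  "nat \<Rightarrow> ((nat \<Rightarrow>\<^sub>0 nat) \<Rightarrow>\<^sub>0 'k::field) \<Rightarrow> ((nat \<Rightarrow>\<^sub>0 nat) \<Rightarrow>\<^sub>0 'k) \<Rightarrow> ((nat \<Rightarrow>\<^sub>0 nat) \<Rightarrow>\<^sub>0 'k) set" where
  "residue_class n f p = cgenideal (mpoly_ring n) f +>\<^bsub>mpoly_ring n\<^esub> p"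

definition hypersurface_ring ::
  "nat \<Rightarrow> ((nat \<Rightarrow>\<^sub>0 nat) \<Rightarrow>\<^sub>0 'k::field) \<Rightarrow> ((nat \<Rightarrow>\<^sub>0 nat) \<Rightarrow>\<^sub>0 'k) set graded_ring" where
  "hypersurface_ring n f =
    (let Q = mpoly_ring n Quot cgenideal (mpoly_ring n) f in
      \<lparr>carrier = carrier Q, monoid.mult = monoid.mult Q, one = monoid.one Q,
       ring.zero = ring.zero Q, ring.add = ring.add Q,
       ring_part = (\<lambda>e. {residue_class n f p | p d.
         p \<in> carrier (mpoly_ring n) \<and> homogeneous_of_degree d p \<and> e = int d}
         \<union> {\<zero>\<^bsub>Q\<^esub>})\<rparr>)"

definition hypersurface_scalars ::
  "nat \<Rightarrow> ((nat \<Rightarrow>\<^sub>0 nat) \<Rightarrow>\<^sub>0 'k::field) \<Rightarrow> ((nat \<Rightarrow>\<^sub>0 nat) \<Rightarrow>\<^sub>0 'k) set set" where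
  "hypersurface_scalars n f = range (\<lambda>c. residue_class n f (mpoly_const c))"

definition hypersurface_maxideal ::
  "nat \<Rightarrow> ((nat \<Rightarrow>\<^sub>0 nat) \<Rightarrow>\<^sub>0 'k::field) \<Rightarrow> ((nat \<Rightarrow>\<^sub>0 nat) \<Rightarrow>\<^sub>0 'k) set set" where
  "hypersurface_maxideal n f =
    genideal (hypersurface_ring n f) ((\<lambda>i. residue_class n f (mpoly_var i)) ` {..<n})"


section \<open>The differential symmetric signature\<close>

definition reflexive_sym_differentials ::
  "('a, 'c) graded_ring_scheme \<Rightarrow> 'a set \<Rightarrow> nat \<Rightarrow>
   ('a, ((('a \<Rightarrow> 'a) set multiset \<Rightarrow> 'a) set \<Rightarrow> 'a) \<Rightarrow> 'a) graded_module" where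
  "reflexive_sym_differentials R K q =
    dual_module R (dual_module R (sym_power R q (kaehler_differentials R K)))"

definition signature_quotient :: "('a, 'c) graded_ring_scheme \<Rightarrow> 'a set \<Rightarrow> nat \<Rightarrow> real" where
  "signature_quotient R K N =
    real (\<Sum>q\<le>N. free_rank R (reflexive_sym_differentials R K q)) /
    real (\<Sum>q\<le>N. module_rank R (reflexive_sym_differentials R K q))"

text \<open>Meaningful only if the limit exists, i.e. if \<^term>\<open>convergent (signature_quotient R K)\<close>.\<close>

definition differential_symmetric_signature ::
  "('a, 'c) graded_ring_scheme \<Rightarrow> 'a set \<Rightarrow> real" where
  "differential_symmetric_signature R K = lim (signature_quotient R K)"

end

theory Submission
  imports Defs
begin

text \<open>The base of the argument is that the partial derivatives of \<open>f\<close> generate an ideal containing all forms of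
some degree (\<open>jacobian_full\<close>). Otherwise they have a common zero \<open>Q \<noteq> 0\<close>
(\<open>projective_nullstellensatz\<close>), which lies on the hypersurface by Euler's formula; here the hypothesis
on the characteristic enters. At such a \<open>Q\<close> the differential of \<open>f\<close> vanishes, so the maximal ideal of the local
ring of the cone at \<open>Q\<close> needs \<open>n\<close> generators, one for each direction (\<open>few_generators\<close>), although
the dimension is at most \<open>n - 1\<close> (\<open>krull_dim_bound\<close>). This contradicts regularity. By counting
dimensions, fewer than \<open>n\<close> forms never generate all forms of some degree, so the partial derivatives are
linearly independent over \<open>k\<close> (\<open>full_imp_independent\<close>).

The module of differentials is generated by \<open>dx\<^sub>1, \<dots>, dx\<^sub>n\<close> subject to \<open>df = 0\<close>. Writing \<open>T\<^sub>i\<close> for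
\<open>dx\<^sub>i\<close>, its symmetric algebra is the polynomial ring in \<open>T\<^sub>1, \<dots>, T\<^sub>n\<close> over \<open>R\<close> modulo the linear form
\<open>df = \<Sum> (\<partial>f/\<partial>x\<^sub>i) T\<^sub>i\<close>. Only one half of this isomorphism has to be made explicit: elements of
the symmetric powers lift to polynomials, canonically modulo \<open>f\<close> and \<open>df\<close>, and are recovered from their
lifts (\<open>Psi_lamq\<close>).

A homogeneous surjection of a symmetric power of degree \<open>q \<ge> 1\<close> onto a nonzero free module has a coordinate that is
a homogeneous functional with value \<open>1\<close> somewhere. Hence some generator \<open>T\<^sup>m\<close> has a value of degree \<open>0\<close>,
and then all generators have constant values \<open>k\<^sub>m\<close>. The relations \<open>T\<^sup>l df = 0\<close> say that
\<open>\<Sum> k\<^bsub>l+e\<^sub>i\<^esub> (\<partial>f/\<partial>x\<^sub>i)\<close> is divisible by \<open>f\<close>, so it vanishes for degree reasons, and the linear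
independence of the partial derivatives makes every \<open>k\<^sub>m\<close> zero (\<open>no_unimodular_functional\<close>).

The same conclusion holds for the reflexive hulls because the symmetric powers are already reflexive. This is where
\<open>n \<ge> 4\<close> is used: a line through the origin on which \<open>f\<close> does not vanish lies in three further independent
hyperplanes, whose equations \<open>x\<close>, \<open>y\<close>, \<open>z\<close> form a regular sequence with \<open>f\<close>. As the coefficients of
\<open>df\<close> generate an ideal that contains powers of \<open>y\<close> and of \<open>z\<close>, the form \<open>df\<close> is a nonzero divisor
modulo \<open>f, x\<close> and modulo \<open>f, x, y\<close>; thus \<open>x, y\<close> is a regular sequence modulo \<open>f, df\<close>
(\<open>regular_x_I\<close>, \<open>regular_y_I\<close>). On the other hand, after inverting any element of the Jacobian ideal
the symmetric powers become direct summands of free modules (\<open>splitting_identity\<close>). An element of the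
bidual is therefore an evaluation after multiplication by powers of \<open>x\<close> and of \<open>y\<close>, and the two
denominators can be removed by regularity (\<open>reflexive_by_regular_pair\<close>).

Consequently the numerators of the signature quotients are all equal to the free rank for \<open>q = 0\<close>. Every symmetric
power is nonzero and torsion-free, so its rank is at least \<open>1\<close>, the denominators tend to infinity, and the
limit is \<open>0\<close>.\<close>

section \<open>Polynomials as finitely supported functions\<close>

type_synonym 'r mpoly = "(nat \<Rightarrow>\<^sub>0 nat) \<Rightarrow>\<^sub>0 'r"

abbreviation "lookup \<equiv> Poly_Mapping.lookup"
abbreviation "keys \<equiv> Poly_Mapping.keys"
abbreviation "single \<equiv> Poly_Mapping.single"

abbreviation pconst :: "'r::zero \<Rightarrow> 'r mpoly" where
  "pconst c \<equiv> single 0 c"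

abbreviation pvar :: "nat \<Rightarrow> ('r::zero_neq_one) mpoly" where
  "pvar i \<equiv> single (single i 1) 1"

lemma poly_mapping_induct_sum [case_names zero single add]:
  fixes p :: "'m \<Rightarrow>\<^sub>0 'r::comm_monoid_add"
  assumes "P 0" "\<And>m c. P (single m c)" "\<And>p q. P p \<Longrightarrow> P q \<Longrightarrow> P (p + q)"
  shows "P p"
proof (induction p rule: Poly_Mapping.update_induct)
  case const then show ?case by (simp add: assms)
next
  case (update f a b)
  have "Poly_Mapping.update a b f = f + single a b"
    using update(1) by (intro poly_mapping_eqI)
      (auto simp: lookup_update lookup_add lookup_single in_keys_iff when_def)
  then show ?case using assms(2,3) update by metis
qed

lemma poly_mapping_sum_single:
  fixes p :: "'m \<Rightarrow>\<^sub>0 'r::comm_monoid_add"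
  assumes "finite A" "keys p \<subseteq> A"
  shows "p = (\<Sum>m\<in>A. single m (lookup p m))"
proof (rule poly_mapping_eqI)
  fix k
  have "(\<Sum>m\<in>A. lookup (single m (lookup p m)) k) = (\<Sum>m\<in>A. if m = k then lookup p k else 0)"
    by (intro sum.cong) (auto simp: lookup_single when_def)
  then show "lookup p k = lookup (\<Sum>m\<in>A. single m (lookup p m)) k"
    using assms by (auto simp: lookup_sum sum.delta in_keys_iff)
qed

text \<open>Evaluation and differentiation are both sums over the terms of a polynomial of an expression that is additive in
the coefficient. Their additivity is proved once, for such sums.\<close>

definition additive_extension :: "('m \<Rightarrow> 'r \<Rightarrow> 'c::comm_monoid_add) \<Rightarrow> ('m \<Rightarrow>\<^sub>0 'r::comm_monoid_add) \<Rightarrow> 'c" where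
  "additive_extension F p = (\<Sum>m\<in>keys p. F m (lookup p m))"

definition termwise_additive :: "('m \<Rightarrow> 'r::comm_monoid_add \<Rightarrow> 'c::comm_monoid_add) \<Rightarrow> bool" where
  "termwise_additive F \<longleftrightarrow> (\<forall>m. F m 0 = 0) \<and> (\<forall>m a b. F m (a + b) = F m a + F m b)"

lemma additive_extension_add:
  "termwise_additive F \<Longrightarrow> additive_extension F (p + q) = additive_extension F p + additive_extension F q"
  unfolding additive_extension_def termwise_additive_def
  by (rule setsum_keys_plus_distrib) auto

lemma additive_extension_zero [simp]: "additive_extension F 0 = 0"
  by (simp add: additive_extension_def)

lemma additive_extension_single [simp]:
  "termwise_additive F \<Longrightarrow> additive_extension F (single m c) = F m c"
  by (cases "c = 0") (auto simp: additive_extension_def termwise_additive_def)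

lemma lookup_single_mult:
  fixes p :: "('r::comm_ring_1) mpoly"
  shows "lookup (single m c * p) (m + l) = c * lookup p l"
proof (induction p rule: poly_mapping_induct_sum)
  case (add p q)
  then show ?case by (simp add: distrib_left lookup_add)
qed (auto simp: mult_single lookup_single when_def)

lemma lookup_single_mult_not:
  fixes p :: "('r::comm_ring_1) mpoly"
  assumes "\<And>l. k \<noteq> m + l"
  shows "lookup (single m c * p) k = 0"
proof (induction p rule: poly_mapping_induct_sum)
  case (add p q)
  then show ?case by (simp add: distrib_left lookup_add)
next
  case (single l b)
  then show ?case using assms[of l] by (auto simp: mult_single lookup_single when_def)
qed auto

lemma lookup_const_mult:
  fixes p :: "('r::comm_ring_1) mpoly"
  shows "lookup (single 0 c * p) k = c * lookup p k"
  using lookup_single_mult[of 0 c p k] by simp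

lemma lookup_var_mult:
  fixes p :: "('r::comm_ring_1) mpoly"
  shows "lookup (single (single i 1) c * p) k =
    (if lookup k i = 0 then 0 else c * lookup p (k - single i 1))"
proof (cases "lookup k i = 0")
  case True
  have "k \<noteq> single i 1 + l" for l
  proof
    assume "k = single i 1 + l"
    then have "lookup k i = 1 + lookup l i" by (simp add: lookup_add)
    then show False using True by simp
  qed
  then show ?thesis using True by (simp add: lookup_single_mult_not)
next
  case False
  then have "k = single i 1 + (k - single i 1)"
    by (intro poly_mapping_eqI) (auto simp: lookup_add lookup_minus lookup_single when_def)
  then show ?thesis using False lookup_single_mult[of "single i 1" c p "k - single i 1"] by simp
qed

lemma single_mult_eq:
  fixes p :: "('r::comm_ring_1) mpoly"
  shows "single m c = single 0 c * single m (1::'r)"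
  unfolding mult_single by simp

subsection \<open>Evaluation\<close>

definition monomial_value :: "(nat \<Rightarrow> 'r::comm_ring_1) \<Rightarrow> (nat \<Rightarrow>\<^sub>0 nat) \<Rightarrow> 'r" where
  "monomial_value s m = (\<Prod>v\<in>keys m. s v ^ lookup m v)"

lemma monomial_value_superset:
  "finite A \<Longrightarrow> keys m \<subseteq> A \<Longrightarrow> monomial_value s m = (\<Prod>v\<in>A. s v ^ lookup m v)"
  unfolding monomial_value_def by (rule prod.mono_neutral_left) (auto simp: in_keys_iff)

lemma monomial_value_zero [simp]: "monomial_value s 0 = 1"
  by (simp add: monomial_value_def)

lemma monomial_value_add: "monomial_value s (m + l) = monomial_value s m * monomial_value s l"
proof -
  let ?A = "keys m \<union> keys l"
  have "keys (m + l) \<subseteq> ?A" by (rule keys_add)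
  then show ?thesis
    by (simp add: monomial_value_superset[of ?A] prod.distrib [symmetric] lookup_add power_add)
qed

lemma monomial_value_single [simp]: "monomial_value s (single i a) = s i ^ a"
  by (cases "a = 0") (auto simp: monomial_value_def)

definition coefficient_hom :: "('r::comm_ring_1 \<Rightarrow> 's::comm_ring_1) \<Rightarrow> bool" where
  "coefficient_hom g \<longleftrightarrow> g 0 = 0 \<and> g 1 = 1 \<and> (\<forall>a b. g (a + b) = g a + g b) \<and> (\<forall>a b. g (a * b) = g a * g b)"

lemma coefficient_hom_id [simp]: "coefficient_hom (\<lambda>x. x)"
  by (simp add: coefficient_hom_def)

lemma coefficient_hom_single [simp]: "coefficient_hom (single (0::nat \<Rightarrow>\<^sub>0 nat))"
  by (auto simp: coefficient_hom_def single_add mult_single)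

text \<open>The map \<open>g\<close> on the coefficients makes evaluation at points, substitution of polynomials, and
specialization of the coefficients of polynomials in the differentials instances of one notion.\<close>

definition peval :: "('r::comm_ring_1 \<Rightarrow> 's::comm_ring_1) \<Rightarrow> (nat \<Rightarrow> 's) \<Rightarrow> 'r mpoly \<Rightarrow> 's" where
  "peval g s = additive_extension (\<lambda>m c. g c * monomial_value s m)"

context
  fixes g :: "'r::comm_ring_1 \<Rightarrow> 's::comm_ring_1" and s :: "nat \<Rightarrow> 's"
  assumes g: "coefficient_hom g"
begin

lemma peval_termwise: "termwise_additive (\<lambda>m c. g c * monomial_value s m)"
  using g by (auto simp: termwise_additive_def coefficient_hom_def distrib_right)

lemma peval_zero: "peval g s 0 = 0" by (simp add: peval_def)

lemma peval_add: "peval g s (p + q) = peval g s p + peval g s q"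
  unfolding peval_def by (rule additive_extension_add[OF peval_termwise])

lemma peval_single: "peval g s (single m c) = g c * monomial_value s m"
  unfolding peval_def by (rule additive_extension_single[OF peval_termwise])

lemma peval_var: "peval g s (single (single i 1) 1) = s i"
  using g by (simp add: peval_single coefficient_hom_def)

lemma peval_const: "peval g s (single 0 c) = g c"
  by (simp add: peval_single)

lemma peval_one: "peval g s 1 = 1"
  using peval_const[of 1] g by (simp add: coefficient_hom_def)

lemma peval_uminus: "peval g s (- p) = - peval g s p"
  using peval_add[of p "- p"] by (simp add: peval_zero eq_neg_iff_add_eq_0 add.commute)

lemma peval_minus: "peval g s (p - q) = peval g s p - peval g s q"
  using peval_add[of p "- q"] by (simp add: peval_uminus)

lemma peval_mult: "peval g s (p * q) = peval g s p * peval g s q"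
proof (induction p rule: poly_mapping_induct_sum)
  case zero then show ?case by (simp add: peval_zero)
next
  case (single m c)
  show ?case
  proof (induction q rule: poly_mapping_induct_sum)
    case (single l b)
    then show ?case using g
      by (simp add: mult_single peval_single coefficient_hom_def monomial_value_add mult_ac)
  qed (auto simp: peval_zero peval_add distrib_left)
next
  case (add p1 p2) then show ?case by (simp add: peval_add distrib_right)
qed

lemma peval_power: "peval g s (p ^ e) = peval g s p ^ e"
  by (induction e) (auto simp: peval_one peval_mult)

lemma peval_sum: "peval g s (sum F A) = (\<Sum>a\<in>A. peval g s (F a))"
  by (induction A rule: infinite_finite_induct) (auto simp: peval_zero peval_add)

end

subsection \<open>Partial derivatives\<close>

definition pderivative :: "nat \<Rightarrow> ('r::comm_ring_1) mpoly \<Rightarrow> 'r mpoly" where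
  "pderivative i = additive_extension
     (\<lambda>m c. single (m - single i 1) (c * of_nat (lookup m i)))"

lemma pderivative_termwise:
  "termwise_additive (\<lambda>m c. single (m - single i 1) (c * of_nat (lookup m i) :: 'r::comm_ring_1))"
  by (simp add: termwise_additive_def single_add distrib_right)

lemma pderivative_zero [simp]: "pderivative i 0 = 0"
  by (simp add: pderivative_def)

lemma pderivative_add: "pderivative i (p + q) = pderivative i p + pderivative i q"
  unfolding pderivative_def by (rule additive_extension_add[OF pderivative_termwise])

lemma pderivative_single:
  "pderivative i (single m c) =
    single (m - single i 1) (c * of_nat (lookup m i))"
  unfolding pderivative_def by (rule additive_extension_single[OF pderivative_termwise])

lemma pderivative_const [simp]: "pderivative i (single 0 c) = 0"
  by (simp add: pderivative_single)

lemma pderivative_uminus: "pderivative i (- p) = - pderivative i p"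
  using pderivative_add[of i p "- p"] by (simp add: eq_neg_iff_add_eq_0 add.commute)

lemma pderivative_minus: "pderivative i (p - q) = pderivative i p - pderivative i q"
  using pderivative_add[of i p "- q"] by (simp add: pderivative_uminus)

lemma pderivative_mult: "pderivative i (p * q) = p * pderivative i q + q * pderivative i p"
proof (induction p rule: poly_mapping_induct_sum)
  case (single m c)
  show ?case
  proof (induction q rule: poly_mapping_induct_sum)
    case (single l b)
    have 1: "m + l - single i 1 = m + (l - single i 1)" if "lookup l i \<noteq> 0"
      using that by (intro poly_mapping_eqI) (auto simp: lookup_add lookup_minus lookup_single when_def)
    have 2: "m + l - single i 1 = l + (m - single i 1)" if "lookup m i \<noteq> 0"
      using that by (intro poly_mapping_eqI) (auto simp: lookup_add lookup_minus lookup_single when_def)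
    show ?case
      apply (cases "lookup l i = 0"; cases "lookup m i = 0")
      using 1 2
      by (auto simp: mult_single pderivative_single lookup_add single_add [symmetric] algebra_simps)
  qed (auto simp: pderivative_add algebra_simps)
qed (auto simp: pderivative_add algebra_simps)

subsection \<open>Degrees and variables\<close>

lemma monomial_degree_superset:
  "finite A \<Longrightarrow> keys m \<subseteq> A \<Longrightarrow> monomial_degree m = (\<Sum>i\<in>A. lookup m i)"
  unfolding monomial_degree_def by (rule sum.mono_neutral_left) (auto simp: in_keys_iff)

lemma monomial_degree_zero [simp]: "monomial_degree 0 = 0"
  by (simp add: monomial_degree_def)

lemma monomial_degree_single [simp]: "monomial_degree (single i a) = a"
  by (cases "a = 0") (auto simp: monomial_degree_def)

lemma monomial_degree_add: "monomial_degree (m + l) = monomial_degree m + monomial_degree l"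
proof -
  let ?A = "keys m \<union> keys l"
  have "keys (m + l) \<subseteq> ?A" by (rule keys_add)
  then show ?thesis
    by (simp add: monomial_degree_superset[of ?A] sum.distrib [symmetric] lookup_add)
qed

lemma monomial_degree_eq_0: "monomial_degree m = 0 \<longleftrightarrow> m = 0"
  by (auto simp: monomial_degree_def in_keys_iff intro!: poly_mapping_eqI)

lemma lookup_le_monomial_degree: "lookup m i \<le> monomial_degree m"
  by (cases "i \<in> keys m")
    (auto simp: monomial_degree_def in_keys_iff intro: member_le_sum)

text \<open>The step of inductions on the degree: a nontrivial monomial has a variable as a factor.\<close>

lemma monomial_split:
  assumes "lookup m i \<noteq> 0"
  shows "m = single i 1 + (m - single i (1::nat))"
  using assms by (intro poly_mapping_eqI) (auto simp: lookup_add lookup_minus lookup_single when_def)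

definition monomials :: "nat \<Rightarrow> nat \<Rightarrow> (nat \<Rightarrow>\<^sub>0 nat) set" where
  "monomials n q = {m. keys m \<subseteq> {..<n} \<and> monomial_degree m = q}"

lemma
  assumes V: "finite (V :: nat set)"
  shows finite_box: "finite {m :: nat \<Rightarrow>\<^sub>0 nat. keys m \<subseteq> V \<and> (\<forall>i. lookup m i \<le> D)}"
  and card_box: "card {m :: nat \<Rightarrow>\<^sub>0 nat. keys m \<subseteq> V \<and> (\<forall>i. lookup m i \<le> D)} = (D + 1) ^ card V"
proof -
  let ?B = "{m :: nat \<Rightarrow>\<^sub>0 nat. keys m \<subseteq> V \<and> (\<forall>i. lookup m i \<le> D)}"
  have b: "bij_betw (\<lambda>m. \<lambda>i\<in>V. lookup m i) ?B (V \<rightarrow>\<^sub>E {..D})"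
  proof (rule bij_betwI')
    fix m l assume ml: "m \<in> ?B" "l \<in> ?B"
    show "((\<lambda>i\<in>V. lookup m i) = (\<lambda>i\<in>V. lookup l i)) = (m = l)"
    proof
      assume e: "(\<lambda>i\<in>V. lookup m i) = (\<lambda>i\<in>V. lookup l i)"
      show "m = l"
      proof (rule poly_mapping_eqI)
        fix i
        show "lookup m i = lookup l i"
        proof (cases "i \<in> V")
          case True then show ?thesis using fun_cong[OF e, of i] by simp
        next
          case False
          then have "i \<notin> keys m" "i \<notin> keys l" using ml by auto
          then show ?thesis by (simp add: in_keys_iff)
        qed
      qed
    qed simp
  next
    fix m assume "m \<in> ?B"
    then show "(\<lambda>i\<in>V. lookup m i) \<in> V \<rightarrow>\<^sub>E {..D}" by auto
  next
    fix h assume h: "h \<in> V \<rightarrow>\<^sub>E {..D}"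
    define m where "m = Abs_poly_mapping (\<lambda>i. if i \<in> V then h i else 0)"
    have l: "lookup m = (\<lambda>i. if i \<in> V then h i else 0)"
      unfolding m_def by (rule lookup_Abs_poly_mapping) (use V in \<open>auto intro: finite_subset[of _ V]\<close>)
    have "m \<in> ?B" using h by (auto simp: in_keys_iff l PiE_iff split: if_splits)
    moreover have "h = (\<lambda>i\<in>V. lookup m i)"
      using h by (auto simp: l PiE_iff extensional_def restrict_def)
    ultimately show "\<exists>m\<in>?B. h = (\<lambda>i\<in>V. lookup m i)" by blast
  qed
  have f: "finite (V \<rightarrow>\<^sub>E {..D})" using V by (intro finite_PiE) auto
  then show "finite ?B" using bij_betw_finite[OF b] by simp
  show "card ?B = (D + 1) ^ card V" using bij_betw_same_card[OF b] using V by (simp add: card_PiE)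
qed

lemma monomials_subset_box: "monomials n q \<subseteq> {m. keys m \<subseteq> {..<n} \<and> (\<forall>i. lookup m i \<le> q)}"
  using lookup_le_monomial_degree by (auto simp: monomials_def)

lemma finite_monomials [simp]: "finite (monomials n q)"
  by (rule finite_subset[OF monomials_subset_box finite_box[OF finite_lessThan]])

lemma monomials_0: "monomials n 0 = {0}"
  by (auto simp: monomials_def monomial_degree_eq_0)

lemma monomials_SucE:
  assumes "m \<in> monomials n (Suc q)"
  obtains i l where "i < n" "l \<in> monomials n q" "m = single i 1 + l"
proof -
  have "m \<noteq> 0" using assms by (auto simp: monomials_def)
  then obtain i where i: "lookup m i \<noteq> 0" by (metis lookup_zero poly_mapping_eqI)
  define l where "l = m - single i 1"
  have m: "m = single i 1 + l" unfolding l_def by (rule monomial_split[OF i])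
  have "i \<in> keys m" using i by (simp add: in_keys_iff)
  then have "i < n" using assms by (auto simp: monomials_def)
  have "keys l \<subseteq> keys m"
    unfolding l_def by (auto simp: in_keys_iff lookup_minus)
  then have "l \<in> monomials n q" using assms m
    by (auto simp: monomials_def monomial_degree_add)
  then show ?thesis using that \<open>i < n\<close> m by blast
qed

lemma monomials_add: "m \<in> monomials n q \<Longrightarrow> l \<in> monomials n r \<Longrightarrow> m + l \<in> monomials n (q + r)"
  using keys_add[of m l] by (auto simp: monomials_def monomial_degree_add)

lemma monomials_var: "i < n \<Longrightarrow> single i 1 \<in> monomials n 1"
  by (auto simp: monomials_def)

lemma mpoly_carrier_iff: "p \<in> carrier (mpoly_ring n) \<longleftrightarrow> (\<forall>m \<in> keys p. keys m \<subseteq> {..<n})"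
  by (simp add: mpoly_ring_def)

lemma mpoly_carrier_zero [simp]: "0 \<in> carrier (mpoly_ring n)"
  by (simp add: mpoly_carrier_iff)

lemma mpoly_carrier_single: "c = 0 \<or> keys m \<subseteq> {..<n} \<Longrightarrow> single m c \<in> carrier (mpoly_ring n)"
  by (auto simp: mpoly_carrier_iff)

lemma mpoly_carrier_const [simp]: "single 0 c \<in> carrier (mpoly_ring n)"
  by (simp add: mpoly_carrier_single)

lemma mpoly_carrier_one [simp]: "1 \<in> carrier (mpoly_ring n)"
  using mpoly_carrier_const[of 1 n] by simp

lemma mpoly_carrier_var: "i < n \<Longrightarrow> single (single i 1) c \<in> carrier (mpoly_ring n)"
  by (rule mpoly_carrier_single) simp

lemma mpoly_carrier_add [simp, intro]: "p \<in> carrier (mpoly_ring n) \<Longrightarrow> q \<in> carrier (mpoly_ring n) \<Longrightarrow> p + q \<in> carrier (mpoly_ring n)"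
  using keys_add[of p q] by (auto simp: mpoly_carrier_iff)

lemma mpoly_carrier_uminus [simp, intro]: "p \<in> carrier (mpoly_ring n) \<Longrightarrow> - p \<in> carrier (mpoly_ring n)"
  by (auto simp: mpoly_carrier_iff in_keys_iff)

lemma mpoly_carrier_minus [simp, intro]: "p \<in> carrier (mpoly_ring n) \<Longrightarrow> q \<in> carrier (mpoly_ring n) \<Longrightarrow> p - q \<in> carrier (mpoly_ring n)"
  using mpoly_carrier_add[of p n "- q"] by simp

lemma mpoly_carrier_mult [simp, intro]: "p \<in> carrier (mpoly_ring n) \<Longrightarrow> q \<in> carrier (mpoly_ring n) \<Longrightarrow> p * q \<in> carrier (mpoly_ring n)"
  using keys_mult[of p q] by (fastforce simp: mpoly_carrier_iff dest: set_mp[OF keys_add])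

lemma mpoly_carrier_power [simp, intro]: "p \<in> carrier (mpoly_ring n) \<Longrightarrow> p ^ e \<in> carrier (mpoly_ring n)"
  by (induction e) auto

lemma mpoly_carrier_sum [intro]: "(\<And>a. a \<in> A \<Longrightarrow> F a \<in> carrier (mpoly_ring n)) \<Longrightarrow> sum F A \<in> carrier (mpoly_ring n)"
  by (induction A rule: infinite_finite_induct) auto

lemma mpoly_carrier_prod [intro]: "(\<And>a. a \<in> A \<Longrightarrow> F a \<in> carrier (mpoly_ring n)) \<Longrightarrow> prod F A \<in> carrier (mpoly_ring n)"
  by (induction A rule: infinite_finite_induct) auto

lemma mpoly_carrier_pderivative:
  assumes "p \<in> carrier (mpoly_ring n)"
  shows "pderivative i p \<in> carrier (mpoly_ring n)"
  unfolding pderivative_def additive_extension_def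
proof (rule mpoly_carrier_sum)
  fix m assume "m \<in> keys p"
  then have "keys m \<subseteq> {..<n}" using assms by (auto simp: mpoly_carrier_iff)
  moreover have "keys (m - single i 1) \<subseteq> keys m"
    by (auto simp: in_keys_iff lookup_minus)
  ultimately show "single (m - single i 1)
           (lookup p m * of_nat (lookup m i)) \<in> carrier (mpoly_ring n)"
    by (intro mpoly_carrier_single) auto
qed

lemma homogeneous_zero [simp]: "homogeneous_of_degree d 0"
  by (simp add: homogeneous_of_degree_def)

lemma homogeneous_single: "c = 0 \<or> monomial_degree m = d \<Longrightarrow> homogeneous_of_degree d (single m c)"
  by (auto simp: homogeneous_of_degree_def)

lemma homogeneous_add: "homogeneous_of_degree d p \<Longrightarrow> homogeneous_of_degree d q \<Longrightarrow> homogeneous_of_degree d (p + q)"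
  using keys_add[of p q] by (auto simp: homogeneous_of_degree_def)

lemma homogeneous_uminus: "homogeneous_of_degree d p \<Longrightarrow> homogeneous_of_degree d (- p)"
  by (auto simp: homogeneous_of_degree_def in_keys_iff)

lemma homogeneous_minus: "homogeneous_of_degree d p \<Longrightarrow> homogeneous_of_degree d q \<Longrightarrow> homogeneous_of_degree d (p - q)"
  using homogeneous_add[of d p "- q"] homogeneous_uminus by auto

lemma homogeneous_mult: "homogeneous_of_degree d p \<Longrightarrow> homogeneous_of_degree e q \<Longrightarrow> homogeneous_of_degree (d + e) (p * q)"
  using keys_mult[of p q] by (fastforce simp: homogeneous_of_degree_def monomial_degree_add)

lemma homogeneous_sum: "(\<And>a. a \<in> A \<Longrightarrow> homogeneous_of_degree d (F a)) \<Longrightarrow> homogeneous_of_degree d (sum F A)"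
  by (induction A rule: infinite_finite_induct) (auto intro: homogeneous_add)

lemma homogeneous_pderivative:
  assumes "homogeneous_of_degree (Suc e) p"
  shows "homogeneous_of_degree e (pderivative i p)"
  unfolding pderivative_def additive_extension_def
proof (rule homogeneous_sum, rule homogeneous_single)
  fix m assume "m \<in> keys p"
  then have d: "monomial_degree m = Suc e" using assms by (auto simp: homogeneous_of_degree_def)
  show "lookup p m * of_nat (lookup m i) = 0 \<or> monomial_degree (m - single i 1) = e"
  proof (cases "lookup m i = 0")
    case False
    then show ?thesis using d monomial_split[OF False] monomial_degree_add[of "single i 1" "m - single i 1"] by simp
  qed simp
qed

text \<open>Multiplying \<open>\<partial>/\<partial>x\<^sub>i\<close> by \<open>x\<^sub>i\<close> multiplies a monomial by its exponent at \<open>i\<close>, and the exponents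
add up to the degree.\<close>

lemma euler_identity:
  assumes "homogeneous_of_degree d p" "p \<in> carrier (mpoly_ring n)"
  shows "(\<Sum>i<n. single (single i 1) 1 * pderivative i p) = of_nat d * p"
proof -
  have *: "(\<Sum>i<n. single (single i 1) 1 * pderivative i (single m c)) = of_nat d * single m c"
    if "m \<in> keys p" for m and c :: 'a
  proof -
    have k: "keys m \<subseteq> {..<n}" "monomial_degree m = d"
      using that assms by (auto simp: homogeneous_of_degree_def mpoly_carrier_iff)
    have "single (single i 1) 1 * pderivative i (single m c) = single m (c * of_nat (lookup m i))" for i
      using monomial_split[of m i] by (cases "lookup m i = 0") (auto simp: pderivative_single mult_single)
    then have "(\<Sum>i<n. single (single i 1) 1 * pderivative i (single m c)) = (\<Sum>i<n. single m (c * of_nat (lookup m i)))" by simp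
    also have "\<dots> = single m (\<Sum>i<n. c * of_nat (lookup m i))"
      by (intro poly_mapping_eqI) (simp add: lookup_sum lookup_single when_def)
    also have "(\<Sum>i<n. c * of_nat (lookup m i)) = c * of_nat d"
      using k by (simp add: monomial_degree_superset[of "{..<n}"] flip: sum_distrib_left of_nat_sum)
    also have "single m (c * of_nat d) = of_nat d * single m c"
      by (simp add: mult_single mult.commute flip: single_of_nat)
    finally show ?thesis .
  qed
  let ?K = "keys p"
  have pd: "pderivative i (sum F A) = (\<Sum>a\<in>A. pderivative i (F a))" for i F and A :: "(nat \<Rightarrow>\<^sub>0 nat) set"
    by (induction A rule: infinite_finite_induct) (auto simp: pderivative_add)
  define s where "s m = single m (lookup p m)" for m
  have ps: "p = (\<Sum>m\<in>?K. s m)"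
    unfolding s_def by (rule poly_mapping_sum_single) auto
  have "(\<Sum>i<n. single (single i 1) 1 * pderivative i (\<Sum>m\<in>?K. s m)) =
    (\<Sum>m\<in>?K. \<Sum>i<n. single (single i 1) 1 * pderivative i (s m))"
    unfolding pd sum_distrib_left by (rule sum.swap)
  also have "\<dots> = (\<Sum>m\<in>?K. of_nat d * s m)"
    using * by (intro sum.cong) (auto simp: s_def)
  finally show ?thesis using ps by (simp flip: sum_distrib_left)
qed

subsection \<open>Linear systems and growth\<close>

text \<open>Gaussian elimination: an equation with a nonzero coefficient is used to eliminate one unknown.\<close>

lemma homogeneous_system_solvable:
  fixes M :: "'a \<Rightarrow> 'b \<Rightarrow> 'k::field"
  assumes "finite B" "finite A" "card B < card A"
  shows "\<exists>c. (\<exists>a\<in>A. c a \<noteq> 0) \<and> (\<forall>b\<in>B. (\<Sum>a\<in>A. c a * M a b) = 0)"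
  using assms
proof (induction B arbitrary: A M rule: finite_induct)
  case empty
  then obtain a where "a \<in> A" by fastforce
  then show ?case by (intro exI[of _ "\<lambda>_. 1"]) auto
next
  case (insert b B)
  show ?case
  proof (cases "\<forall>a\<in>A. M a b = 0")
    case True
    obtain c where "\<exists>a\<in>A. c a \<noteq> 0" "\<forall>b\<in>B. (\<Sum>a\<in>A. c a * M a b) = 0"
      using insert.IH[of A M] insert.prems insert.hyps by auto
    then show ?thesis using True by (intro exI[of _ c]) auto
  next
    case False
    then obtain e where e: "e \<in> A" "M e b \<noteq> 0" by blast
    define N where "N a b' = M a b' - M a b * M e b' / M e b" for a b'
    have "card B < card (A - {e})" using insert.prems insert.hyps e by auto
    then obtain c where c: "\<exists>a\<in>A-{e}. c a \<noteq> 0" "\<forall>b\<in>B. (\<Sum>a\<in>A-{e}. c a * N a b) = 0"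
      using insert.IH[of "A - {e}" N] insert.prems by auto
    define c' where "c' a = (if a = e then - (\<Sum>a\<in>A-{e}. c a * M a b) / M e b else c a)" for a
    have s: "(\<Sum>a\<in>A. c' a * M a b') = - (\<Sum>a\<in>A-{e}. c a * M a b) / M e b * M e b' + (\<Sum>a\<in>A-{e}. c a * M a b')" for b'
      using insert.prems(1) e(1) by (subst sum.remove[of A e]) (auto simp: c'_def intro!: sum.cong)
    have "(\<Sum>a\<in>A. c' a * M a b') = (\<Sum>a\<in>A-{e}. c a * N a b')" for b'
      unfolding s N_def
      by (simp add: sum_subtractf right_diff_distrib sum_distrib_right sum_distrib_left sum_divide_distrib mult_ac sum_negf)
    then have "\<forall>b'\<in>B. (\<Sum>a\<in>A. c' a * M a b') = 0" using c(2) by simp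
    moreover have "(\<Sum>a\<in>A. c' a * M a b) = 0" unfolding s using e(2) by simp
    moreover have "\<exists>a\<in>A. c' a \<noteq> 0" using c(1) unfolding c'_def by auto
    ultimately show ?thesis by blast
  qed
qed

text \<open>The comparison behind all dimension counts below: the number of monomials in \<open>k + 1\<close> variables with exponents
at most \<open>D\<close> eventually exceeds any constant multiple of the number of monomials in \<open>k\<close> variables with
exponents at most \<open>s D\<close>.\<close>

lemma polynomial_growth_beats: "\<exists>D. A * (s * D + 1) ^ k < (D + 1) ^ (k + 1)" for A s k :: nat
proof -
  define D where "D = A * (s + 1) ^ k"
  have "A * (s * D + 1) ^ k \<le> A * ((s + 1) * (D + 1)) ^ k"
    by (intro mult_left_mono power_mono) auto
  also have "\<dots> = D * (D + 1) ^ k" unfolding power_mult_distrib D_def by (simp only: mult.assoc)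
  also have "\<dots> < (D + 1) * (D + 1) ^ k" by simp
  finally show ?thesis by (intro exI[of _ D]) simp
qed

section \<open>The projective Nullstellensatz\<close>

definition graded_piece :: "nat \<Rightarrow> nat \<Rightarrow> ('k::field) mpoly set" where
  "graded_piece n i = {p \<in> carrier (mpoly_ring n). homogeneous_of_degree i p}"

lemma graded_piece_iff: "p \<in> graded_piece n i \<longleftrightarrow> keys p \<subseteq> monomials n i"
  by (auto simp: graded_piece_def mpoly_carrier_iff homogeneous_of_degree_def monomials_def)

lemma graded_piece_carrier: "p \<in> graded_piece n i \<Longrightarrow> p \<in> carrier (mpoly_ring n)"
  by (simp add: graded_piece_def)

lemma graded_piece_zero [simp]: "0 \<in> graded_piece n i"
  by (simp add: graded_piece_def)

lemma graded_piece_add: "p \<in> graded_piece n i \<Longrightarrow> q \<in> graded_piece n i \<Longrightarrow> p + q \<in> graded_piece n i"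
  by (simp add: graded_piece_def homogeneous_add)

lemma graded_piece_minus: "p \<in> graded_piece n i \<Longrightarrow> q \<in> graded_piece n i \<Longrightarrow> p - q \<in> graded_piece n i"
  by (simp add: graded_piece_def homogeneous_minus)

lemma graded_piece_mult: "p \<in> graded_piece n i \<Longrightarrow> q \<in> graded_piece n j \<Longrightarrow> p * q \<in> graded_piece n (i + j)"
  by (simp add: graded_piece_def homogeneous_mult)

lemma graded_piece_const [simp]: "pconst c \<in> graded_piece n 0"
  by (simp add: graded_piece_def homogeneous_single)

lemma graded_piece_var: "v < n \<Longrightarrow> pvar v \<in> graded_piece n 1"
  unfolding graded_piece_iff using monomials_var[of v n] by simp

lemma graded_piece_single: "m \<in> monomials n i \<Longrightarrow> single m c \<in> graded_piece n i"
  by (simp add: graded_piece_iff)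

lemma graded_piece_cmult: "p \<in> graded_piece n i \<Longrightarrow> pconst c * p \<in> graded_piece n i"
  using graded_piece_mult[OF graded_piece_const, of p n i c] by simp

lemma graded_piece_sum: "(\<And>a. a \<in> A \<Longrightarrow> F a \<in> graded_piece n i) \<Longrightarrow> sum F A \<in> graded_piece n i"
  by (induction A rule: infinite_finite_induct) (auto intro: graded_piece_add)

lemma graded_piece_power: "p \<in> graded_piece n i \<Longrightarrow> p ^ e \<in> graded_piece n (i * e)"
proof (induction e)
  case 0
  then show ?case using graded_piece_const[of 1 n] by simp
next
  case (Suc e)
  then show ?case using graded_piece_mult[of p n i "p ^ e" "i * e"] by simp
qed

text \<open>A homogeneous ideal, given by the family of its homogeneous parts.\<close>

definition graded_ideal :: "nat \<Rightarrow> (nat \<Rightarrow> ('k::field) mpoly set) \<Rightarrow> bool" where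
  "graded_ideal n G \<longleftrightarrow> (\<forall>i. G i \<subseteq> graded_piece n i \<and> 0 \<in> G i \<and> (\<forall>p\<in>G i. \<forall>q\<in>G i. p + q \<in> G i) \<and>
    (\<forall>c. \<forall>p\<in>G i. pconst c * p \<in> G i) \<and> (\<forall>v<n. \<forall>p\<in>G i. pvar v * p \<in> G (Suc i)))"

context
  fixes n :: nat and G :: "nat \<Rightarrow> ('k::field) mpoly set"
  assumes G: "graded_ideal n G"
begin

lemma graded_ideal_piece: "p \<in> G i \<Longrightarrow> p \<in> graded_piece n i"
  and graded_ideal_zero: "0 \<in> G i"
  and graded_ideal_add: "p \<in> G i \<Longrightarrow> q \<in> G i \<Longrightarrow> p + q \<in> G i"
  and graded_ideal_cmult: "p \<in> G i \<Longrightarrow> pconst c * p \<in> G i"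
  and graded_ideal_var: "v < n \<Longrightarrow> p \<in> G i \<Longrightarrow> pvar v * p \<in> G (Suc i)"
  using G unfolding graded_ideal_def by auto

lemma graded_ideal_uminus: "p \<in> G i \<Longrightarrow> - p \<in> G i"
  using graded_ideal_cmult[of p i "-1"] by (simp add: single_uminus)

lemma graded_ideal_minus: "p \<in> G i \<Longrightarrow> q \<in> G i \<Longrightarrow> p - q \<in> G i"
  using graded_ideal_add[of p i "- q"] graded_ideal_uminus[of q] by simp

lemma graded_ideal_sum: "(\<And>a. a \<in> A \<Longrightarrow> F a \<in> G i) \<Longrightarrow> sum F A \<in> G i"
  by (induction A rule: infinite_finite_induct) (auto intro: graded_ideal_add graded_ideal_zero)

lemma graded_ideal_single:
  assumes "p \<in> G i" "m \<in> monomials n j"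
  shows "single m c * p \<in> G (j + i)"
  using assms(2)
proof (induction j arbitrary: m)
  case 0
  then show ?case using assms(1) graded_ideal_cmult by (simp add: monomials_0)
next
  case (Suc j)
  obtain v l where "v < n" "l \<in> monomials n j" "m = single v 1 + l"
    using Suc.prems by (rule monomials_SucE)
  then have "pvar v * (single l c * p) \<in> G (Suc (j + i))"
    using Suc.IH graded_ideal_var by blast
  moreover have "pvar v * (single l c * p) = single m c * p"
    unfolding \<open>m = _\<close> by (simp only: mult_single mult_1 flip: mult.assoc)
  ultimately show ?case by (simp only: add_Suc)
qed

lemma graded_ideal_mult:
  assumes "p \<in> G i" "u \<in> graded_piece n j"
  shows "u * p \<in> G (j + i)"
proof -
  have u: "u = (\<Sum>m\<in>monomials n j. single m (lookup u m))"
    using assms(2) by (intro poly_mapping_sum_single) (auto simp: graded_piece_iff)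
  have "u * p = (\<Sum>m\<in>monomials n j. single m (lookup u m) * p)"
    by (subst u) (rule sum_distrib_right)
  also have "\<dots> \<in> G (j + i)" using assms(1) by (intro graded_ideal_sum graded_ideal_single)
  finally show ?thesis .
qed

lemma graded_ideal_full_Suc:
  assumes "graded_piece n i \<subseteq> G i"
  shows "graded_piece n (Suc i) \<subseteq> G (Suc i)"
proof
  fix p :: "'k mpoly" assume p: "p \<in> graded_piece n (Suc i)"
  have "single m c \<in> G (Suc i)" if m: "m \<in> monomials n (Suc i)" for m and c
  proof -
    obtain v l where v: "v < n" "l \<in> monomials n i" "m = single v 1 + l"
      using m by (rule monomials_SucE)
    then have "pvar v * single l c \<in> G (Suc i)"
      using assms graded_piece_single graded_ideal_var by blast
    then show ?thesis using v by (simp add: mult_single)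
  qed
  then have "(\<Sum>m\<in>monomials n (Suc i). single m (lookup p m)) \<in> G (Suc i)"
    by (intro graded_ideal_sum)
  then show "p \<in> G (Suc i)"
    using poly_mapping_sum_single[of "monomials n (Suc i)" p] p by (simp add: graded_piece_iff)
qed

lemma graded_ideal_full_mono:
  assumes "graded_piece n i \<subseteq> G i" "i \<le> j"
  shows "graded_piece n j \<subseteq> G j"
  using assms(2) by (induction j rule: dec_induct) (use assms(1) graded_ideal_full_Suc in auto)

end

text \<open>The homogeneous ideal generated by \<open>G\<close> and the linear form \<open>l\<close>.\<close>

definition adjoin_linear :: "nat \<Rightarrow> (nat \<Rightarrow> ('k::field) mpoly set) \<Rightarrow> 'k mpoly \<Rightarrow> nat \<Rightarrow> 'k mpoly set" where
  "adjoin_linear n G l i = {g + l * u | g u. g \<in> G i \<and> (case i of 0 \<Rightarrow> u = 0 | Suc j \<Rightarrow> u \<in> graded_piece n j)}"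

text \<open>Multiplication by the form \<open>w\<close> of degree \<open>r\<close> is surjective in high degrees on the quotient by \<open>G\<close>.\<close>

definition eventually_onto :: "nat \<Rightarrow> (nat \<Rightarrow> ('k::field) mpoly set) \<Rightarrow> 'k mpoly \<Rightarrow> nat \<Rightarrow> bool" where
  "eventually_onto n G w r \<longleftrightarrow> (\<exists>j. \<forall>i\<ge>j. \<forall>p\<in>graded_piece n (i + r). \<exists>g\<in>G (i + r). \<exists>u\<in>graded_piece n i. p = g + w * u)"

context
  fixes n :: nat and G :: "nat \<Rightarrow> ('k::field) mpoly set"
  assumes G: "graded_ideal n G"
begin

lemma adjoin_linear_superset: "G i \<subseteq> adjoin_linear n G l i"
proof
  fix g assume "g \<in> G i"
  then show "g \<in> adjoin_linear n G l i"
    unfolding adjoin_linear_def by (intro CollectI exI[of _ g] exI[of _ 0]) (auto split: nat.split)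
qed

lemma adjoin_linear_self: "l \<in> adjoin_linear n G l 1"
  unfolding adjoin_linear_def using graded_ideal_zero[OF G] graded_piece_const[of 1 n]
  by (intro CollectI exI[of _ 0] exI[of _ 1]) auto

lemma graded_ideal_adjoin_linear:
  assumes l: "l \<in> graded_piece n 1"
  shows "graded_ideal n (adjoin_linear n G l)"
  unfolding graded_ideal_def
proof (intro allI conjI ballI impI)
  fix i
  show "adjoin_linear n G l i \<subseteq> graded_piece n i"
    using graded_piece_mult[OF l] graded_ideal_piece[OF G] graded_piece_add
    by (cases i) (auto simp: adjoin_linear_def, force)
  show "0 \<in> adjoin_linear n G l i" using adjoin_linear_superset graded_ideal_zero[OF G] by blast
  fix p assume "p \<in> adjoin_linear n G l i"
  then obtain g u where p: "p = g + l * u" "g \<in> G i" "case i of 0 \<Rightarrow> u = 0 | Suc j \<Rightarrow> u \<in> graded_piece n j"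
    by (auto simp: adjoin_linear_def)
  { fix q assume "q \<in> adjoin_linear n G l i"
    then obtain h v where q: "q = h + l * v" "h \<in> G i" "case i of 0 \<Rightarrow> v = 0 | Suc j \<Rightarrow> v \<in> graded_piece n j"
      by (auto simp: adjoin_linear_def)
    have "p + q = (g + h) + l * (u + v)" using p q by (simp add: algebra_simps)
    then show "p + q \<in> adjoin_linear n G l i" unfolding adjoin_linear_def
      using p q graded_ideal_add[OF G] graded_piece_add by (intro CollectI exI[of _ "g + h"] exI[of _ "u + v"]) (auto split: nat.splits) }
  { fix c
    have "pconst c * p = pconst c * g + l * (pconst c * u)" using p by (simp add: algebra_simps)
    then show "pconst c * p \<in> adjoin_linear n G l i" unfolding adjoin_linear_def
      using p graded_ideal_cmult[OF G] graded_piece_cmult by (intro CollectI exI[of _ "pconst c * g"] exI[of _ "pconst c * u"]) (auto split: nat.splits) }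
  { fix v assume v: "v < n"
    have "pvar v * p = pvar v * g + l * (pvar v * u)" using p by (simp add: algebra_simps)
    then show "pvar v * p \<in> adjoin_linear n G l (Suc i)" unfolding adjoin_linear_def
      using p v graded_ideal_var[OF G] graded_piece_mult[OF graded_piece_var[OF v]]
      by (intro CollectI exI[of _ "pvar v * g"] exI[of _ "pvar v * u"]) (auto split: nat.splits) }
qed

text \<open>If adjoining \<open>l\<close> to \<open>G\<close> yields everything in some degree, it does so in all higher degrees, which means
surjectivity of the multiplication by \<open>l\<close>.\<close>

lemma eventually_onto_linear:
  assumes "l \<in> graded_piece n 1" "graded_piece n j \<subseteq> adjoin_linear n G l j"
  shows "eventually_onto n G l 1"
  unfolding eventually_onto_def
proof (rule exI[of _ j], intro allI impI ballI)
  fix i and p :: "'k mpoly" assume "j \<le> i" "p \<in> graded_piece n (i + 1)"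
  then have "p \<in> adjoin_linear n G l (i + 1)"
    using graded_ideal_full_mono[OF graded_ideal_adjoin_linear[OF assms(1)] assms(2), of "i + 1"] by auto
  then show "\<exists>g\<in>G (i + 1). \<exists>u\<in>graded_piece n i. p = g + l * u"
    by (auto simp: adjoin_linear_def)
qed

lemma eventually_onto_mult:
  assumes w: "w \<in> graded_piece n r" and "eventually_onto n G w r" "eventually_onto n G w' r'"
  shows "eventually_onto n G (w * w') (r + r')"
proof -
  obtain j where j: "\<And>i p. i \<ge> j \<Longrightarrow> p \<in> graded_piece n (i + r) \<Longrightarrow> \<exists>g\<in>G (i + r). \<exists>u\<in>graded_piece n i. p = g + w * u"
    using assms(2) unfolding eventually_onto_def by blast
  obtain j' where j': "\<And>i p. i \<ge> j' \<Longrightarrow> p \<in> graded_piece n (i + r') \<Longrightarrow> \<exists>g\<in>G (i + r'). \<exists>u\<in>graded_piece n i. p = g + w' * u"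
    using assms(3) unfolding eventually_onto_def by blast
  show ?thesis unfolding eventually_onto_def
  proof (rule exI[of _ "max j j'"], intro allI impI ballI)
    fix i and p :: "'k mpoly" assume i: "max j j' \<le> i" and p: "p \<in> graded_piece n (i + (r + r'))"
    have "p \<in> graded_piece n ((i + r') + r)" using p by (simp add: add_ac)
    then obtain g u where g: "g \<in> G ((i + r') + r)" "u \<in> graded_piece n (i + r')" "p = g + w * u"
      using j[of "i + r'" p] i by auto
    then obtain g' u' where g': "g' \<in> G (i + r')" "u' \<in> graded_piece n i" "u = g' + w' * u'"
      using j'[of i u] i by auto
    have "p = (g + w * g') + w * w' * u'" using g g' by (simp add: algebra_simps)
    moreover have "w * g' \<in> G (r + (i + r'))" by (rule graded_ideal_mult[OF G g'(1) w])
    then have "g + w * g' \<in> G (i + (r + r'))"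
      using g(1) graded_ideal_add[OF G, of g "i + (r + r')" "w * g'"] by (simp add: add_ac)
    ultimately show "\<exists>g\<in>G (i + (r + r')). \<exists>u\<in>graded_piece n i. p = g + w * w' * u"
      using g'(2) by blast
  qed
qed

lemma eventually_onto_const:
  assumes "c \<noteq> 0"
  shows "eventually_onto n G (pconst c) 0"
  unfolding eventually_onto_def
proof (rule exI[of _ 0], intro allI impI ballI)
  fix i and p :: "'k mpoly" assume "p \<in> graded_piece n (i + 0)"
  moreover have "p = 0 + pconst c * (pconst (1 / c) * p)"
    using assms by (simp add: mult_single flip: mult.assoc)
  ultimately show "\<exists>g\<in>G (i + 0). \<exists>u\<in>graded_piece n i. p = g + pconst c * u"
    using graded_ideal_zero[OF G, of i] graded_piece_cmult[of p n i "1 / c"] by (metis add.right_neutral)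
qed

lemma eventually_onto_power:
  assumes "l \<in> graded_piece n 1" "eventually_onto n G l 1"
  shows "eventually_onto n G (l ^ r) r"
proof (induction r)
  case 0 then show ?case using eventually_onto_const[of 1] by simp
next
  case (Suc r) then show ?case using eventually_onto_mult[OF assms Suc] by simp
qed

end

text \<open>The homogenization of \<open>q\<close> to degree \<open>r\<close> in the variables \<open>a\<close> and \<open>b\<close>, with \<open>a\<close> as homogenizing
variable.\<close>

definition binary_form :: "nat \<Rightarrow> nat \<Rightarrow> nat \<Rightarrow> 'k::field poly \<Rightarrow> 'k mpoly" where
  "binary_form a b r q = (\<Sum>j\<le>r. pconst (Polynomial.coeff q j) * pvar a ^ (r - j) * pvar b ^ j)"

lemma binary_form_piece:
  assumes "a < n" "b < n"
  shows "binary_form a b r q \<in> graded_piece n r"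
  unfolding binary_form_def
proof (rule graded_piece_sum)
  fix j assume "j \<in> {..r}"
  then show "pconst (Polynomial.coeff q j) * pvar a ^ (r - j) * pvar b ^ j \<in> graded_piece n r"
    using graded_piece_mult[OF graded_piece_cmult[OF graded_piece_power[OF graded_piece_var[OF assms(1)]]]
      graded_piece_power[OF graded_piece_var[OF assms(2)]], of "Polynomial.coeff q j" "r - j" j]
    by simp
qed

text \<open>Homogenization turns a linear factor \<open>t - c\<close> into the linear form \<open>x\<^sub>b - c x\<^sub>a\<close>.\<close>

lemma binary_form_root:
  assumes "Polynomial.degree q \<le> r"
  shows "binary_form a b (Suc r) ([:- c, 1:] * q) = (pvar b - pconst c * pvar a) * binary_form a b r q"
proof -
  let ?X = "pvar a :: 'a mpoly" and ?Y = "pvar b :: 'a mpoly"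
  have coeff: "Polynomial.coeff ([:- c, 1:] * q) j = (case j of 0 \<Rightarrow> 0 | Suc i \<Rightarrow> Polynomial.coeff q i) - c * Polynomial.coeff q j" for j
    by (cases j) auto
  have top: "Polynomial.coeff q (Suc r) = 0" using assms by (intro coeff_eq_0) auto
  have "binary_form a b (Suc r) ([:- c, 1:] * q) =
    (\<Sum>j\<le>Suc r. pconst (case j of 0 \<Rightarrow> 0 | Suc i \<Rightarrow> Polynomial.coeff q i) * ?X ^ (Suc r - j) * ?Y ^ j) -
    (\<Sum>j\<le>Suc r. pconst (c * Polynomial.coeff q j) * ?X ^ (Suc r - j) * ?Y ^ j)"
    unfolding binary_form_def coeff by (simp add: single_diff left_diff_distrib sum_subtractf)
  also have "(\<Sum>j\<le>Suc r. pconst (case j of 0 \<Rightarrow> 0 | Suc i \<Rightarrow> Polynomial.coeff q i) * ?X ^ (Suc r - j) * ?Y ^ j) =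
    ?Y * binary_form a b r q"
    unfolding sum.atMost_Suc_shift binary_form_def sum_distrib_left by (simp add: mult_ac)
  also have "(\<Sum>j\<le>Suc r. pconst (c * Polynomial.coeff q j) * ?X ^ (Suc r - j) * ?Y ^ j) =
    (\<Sum>j\<le>r. pconst (c * Polynomial.coeff q j) * ?X ^ (Suc r - j) * ?Y ^ j)"
    using top by simp
  also have "\<dots> = (\<Sum>j\<le>r. pconst c * ?X * (pconst (Polynomial.coeff q j) * ?X ^ (r - j) * ?Y ^ j))"
  proof (rule sum.cong)
    fix j assume "j \<in> {..r}"
    then have "Suc r - j = Suc (r - j)" by auto
    moreover have "pconst (c * Polynomial.coeff q j) = pconst c * pconst (Polynomial.coeff q j)"
      by (simp add: mult_single)
    ultimately show "pconst (c * Polynomial.coeff q j) * ?X ^ (Suc r - j) * ?Y ^ j =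
      pconst c * ?X * (pconst (Polynomial.coeff q j) * ?X ^ (r - j) * ?Y ^ j)"
      by (simp add: mult_ac del: mult_single)
  qed simp
  also have "\<dots> = pconst c * ?X * binary_form a b r q"
    unfolding binary_form_def sum_distrib_left ..
  finally show ?thesis by (simp add: left_diff_distrib)
qed

lemma linear_form_piece: "a < n \<Longrightarrow> b < n \<Longrightarrow> pvar b - pconst c * pvar a \<in> graded_piece n 1"
  by (intro graded_piece_minus graded_piece_cmult graded_piece_var)

text \<open>Over an algebraically closed field a binary form is a product of linear forms.\<close>

lemma eventually_onto_binary_form:
  fixes q :: "'k::alg_closed_field poly"
  assumes G: "graded_ideal n G" and ab: "a < n" "b < n"
    and X: "eventually_onto n G (pvar a) 1"
    and Y: "\<And>c. eventually_onto n G (pvar b - pconst c * pvar a) 1"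
    and "q \<noteq> 0" "Polynomial.degree q \<le> r"
  shows "eventually_onto n G (binary_form a b r q) r"
  using assms(6,7)
proof (induction r arbitrary: q)
  case 0
  then obtain c where "q = [:c:]" "c \<noteq> 0" by (auto elim: degree_eq_zeroE)
  then show ?case using eventually_onto_const[OF G, of c] by (simp add: binary_form_def)
next
  case (Suc r)
  show ?case
  proof (cases "Polynomial.degree q = 0")
    case True
    then obtain c where q: "q = [:c:]" "c \<noteq> 0" using Suc.prems by (auto elim: degree_eq_zeroE)
    have "binary_form a b (Suc r) q = pconst c * pvar a ^ Suc r"
      unfolding binary_form_def q sum.atMost_Suc_shift by simp
    then show ?thesis
      using eventually_onto_mult[OF G graded_piece_const eventually_onto_const[OF G q(2)]
          eventually_onto_power[OF G graded_piece_var[OF ab(1)] X, of "Suc r"]] by simp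
  next
    case False
    then obtain c where "poly q c = 0" using alg_closed_imp_poly_has_root[of q] by auto
    then obtain q' where q': "q = [:- c, 1:] * q'" by (auto simp: poly_eq_0_iff_dvd elim: dvdE)
    then have nz: "q' \<noteq> 0" using Suc.prems by auto
    then have "Polynomial.degree q = Suc (Polynomial.degree q')" unfolding q' by (subst degree_mult_eq) auto
    then have d: "Polynomial.degree q' \<le> r" using Suc.prems by simp
    show ?thesis unfolding q' binary_form_root[OF d]
      using eventually_onto_mult[OF G linear_form_piece[OF ab] Y Suc.IH[OF nz d]] by simp
  qed
qed

text \<open>If no linear form in the pencil spanned by \<open>x\<^sub>a\<close> and \<open>x\<^sub>b\<close> could be adjoined, then every nonzero binary form
in \<open>x\<^sub>a\<close>, \<open>x\<^sub>b\<close> would act surjectively in high degrees on the quotient by \<open>G\<close>. But the quotient has bounded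
dimension in high degrees, since multiplication by \<open>x\<^sub>a\<close> is surjective, so a linear dependence yields binary forms that
annihilate it. A surjective zero map forces the quotient to vanish in high degrees.\<close>

lemma graded_ideal_descent:
  fixes G :: "nat \<Rightarrow> ('k::alg_closed_field) mpoly set"
  assumes G: "graded_ideal n G" and never: "\<And>i. \<not> graded_piece n i \<subseteq> G i" and ab: "a < n" "b < n"
  shows "\<exists>l. (l = pvar a \<or> (\<exists>c. l = pvar b - pconst c * pvar a)) \<and> (\<forall>i. \<not> graded_piece n i \<subseteq> adjoin_linear n G l i)"
proof (rule ccontr)
  assume "\<not> ?thesis"
  then have X: "\<exists>i. graded_piece n i \<subseteq> adjoin_linear n G (pvar a) i"
    and Y: "\<And>c. \<exists>i. graded_piece n i \<subseteq> adjoin_linear n G (pvar b - pconst c * pvar a) i" by blast+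
  let ?x = "pvar a :: 'k mpoly" and ?y = "pvar b :: 'k mpoly"
  have X': "eventually_onto n G ?x 1"
    using X eventually_onto_linear[OF G graded_piece_var[OF ab(1)]] by blast
  have Y': "eventually_onto n G (pvar b - pconst c * pvar a) 1" for c
    using Y[of c] eventually_onto_linear[OF G linear_form_piece[OF ab]] by blast
  obtain d where d: "\<And>i p. i \<ge> d \<Longrightarrow> p \<in> graded_piece n (i + 1) \<Longrightarrow> \<exists>g\<in>G (i + 1). \<exists>u\<in>graded_piece n i. p = g + ?x * u"
    using X' unfolding eventually_onto_def by blast
  (* Modulo \<open>G\<close>, forms of degree \<open>d + m\<close> are \<open>x\<^sub>a\<^sup>m\<close> times forms of degree \<open>d\<close>. *)
  have reduce: "\<exists>g\<in>G (d + m). \<exists>u\<in>graded_piece n d. p = g + ?x ^ m * u" if "p \<in> graded_piece n (d + m)" for m p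
    using that
  proof (induction m arbitrary: p)
    case 0
    then show ?case using graded_ideal_zero[OF G, of d] by (intro bexI[of _ 0] bexI[of _ p]) auto
  next
    case (Suc m)
    obtain g u where g: "g \<in> G (d + m + 1)" "u \<in> graded_piece n (d + m)" "p = g + ?x * u"
      using d[of "d + m" p] Suc.prems by auto
    obtain g' u' where g': "g' \<in> G (d + m)" "u' \<in> graded_piece n d" "u = g' + ?x ^ m * u'"
      using Suc.IH[OF g(2)] by blast
    have "g + ?x * g' \<in> G (d + Suc m)"
      using g(1) graded_ideal_var[OF G ab(1) g'(1)] graded_ideal_add[OF G] by simp
    moreover have "p = (g + ?x * g') + ?x ^ Suc m * u'" using g g' by (simp add: algebra_simps)
    ultimately show ?case using g'(2) by blast
  qed
  define r where "r = card (monomials n d)"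
  (* The \<open>r + 1\<close> products of \<open>e\<close> with the binary monomials of degree \<open>r\<close> are dependent modulo \<open>G\<close>, as there are only \<open>r\<close> monomials of degree \<open>d\<close>. *)
  have kill: "\<exists>q. q \<noteq> 0 \<and> Polynomial.degree q \<le> r \<and> binary_form a b r q * e \<in> G (r + d)"
    if e: "e \<in> graded_piece n d" for e
  proof -
    have "\<forall>j. \<exists>g u. j \<le> r \<longrightarrow> g \<in> G (d + r) \<and> u \<in> graded_piece n d \<and> ?x ^ (r - j) * ?y ^ j * e = g + ?x ^ r * u"
    proof
      fix j
      have "?x ^ (r - j) * ?y ^ j * e \<in> graded_piece n (d + r)" if "j \<le> r"
        using graded_piece_mult[OF graded_piece_mult[OF graded_piece_power[OF graded_piece_var[OF ab(1)]]
              graded_piece_power[OF graded_piece_var[OF ab(2)]]] e, of "r - j" j] that by (simp add: add_ac)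
      then show "\<exists>g u. j \<le> r \<longrightarrow> g \<in> G (d + r) \<and> u \<in> graded_piece n d \<and> ?x ^ (r - j) * ?y ^ j * e = g + ?x ^ r * u"
        using reduce by metis
    qed
    then obtain g u where gu: "\<And>j. j \<le> r \<Longrightarrow> g j \<in> G (d + r) \<and> u j \<in> graded_piece n d \<and> ?x ^ (r - j) * ?y ^ j * e = g j + ?x ^ r * u j"
      by metis
    obtain c where c: "\<exists>j\<in>{..r}. c j \<noteq> 0" "\<forall>m\<in>monomials n d. (\<Sum>j\<le>r. c j * lookup (u j) m) = 0"
      using homogeneous_system_solvable[of "monomials n d" "{..r}" "\<lambda>j. lookup (u j)"] by (auto simp: r_def)
    define q where "q = (\<Sum>j\<le>r. Polynomial.monom (c j) j)"
    have coeff: "Polynomial.coeff q j = (if j \<le> r then c j else 0)" for j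
      unfolding q_def by (auto simp: coeff_sum)
    have "(\<Sum>j\<le>r. pconst (c j) * u j) = 0"
    proof (rule poly_mapping_eqI)
      fix m
      show "lookup (\<Sum>j\<le>r. pconst (c j) * u j) m = lookup 0 m"
      proof (cases "m \<in> monomials n d")
        case True then show ?thesis using c(2) by (simp add: lookup_sum lookup_const_mult)
      next
        case False
        then have "j \<le> r \<Longrightarrow> lookup (u j) m = 0" for j
          using gu[of j] by (auto simp: graded_piece_iff in_keys_iff)
        then show ?thesis by (simp add: lookup_sum lookup_const_mult)
      qed
    qed
    then have "?x ^ r * (\<Sum>j\<le>r. pconst (c j) * u j) = 0" by (simp only: mult_zero_right)
    then have z: "(\<Sum>j\<le>r. pconst (c j) * (?x ^ r * u j)) = 0"
      by (simp only: sum_distrib_left mult.left_commute)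
    have "binary_form a b r q * e = (\<Sum>j\<le>r. pconst (c j) * (?x ^ (r - j) * ?y ^ j * e))"
      unfolding binary_form_def sum_distrib_right by (intro sum.cong) (auto simp: coeff mult_ac)
    also have "\<dots> = (\<Sum>j\<le>r. pconst (c j) * g j) + (\<Sum>j\<le>r. pconst (c j) * (?x ^ r * u j))"
      using gu by (simp add: distrib_left sum.distrib [symmetric])
    also have "\<dots> = (\<Sum>j\<le>r. pconst (c j) * g j)" using z by simp
    also have "\<dots> \<in> G (d + r)" using gu by (intro graded_ideal_sum[OF G] graded_ideal_cmult[OF G]) auto
    finally have "binary_form a b r q * e \<in> G (r + d)" by (simp add: add.commute)
    moreover have "q \<noteq> 0" using c(1) coeff by (metis atMost_iff coeff_0)
    moreover have "Polynomial.degree q \<le> r" by (rule degree_le) (simp add: coeff)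
    ultimately show ?thesis by blast
  qed
  then obtain q where q: "\<And>e. e \<in> graded_piece n d \<Longrightarrow> q e \<noteq> 0 \<and> Polynomial.degree (q e) \<le> r \<and> binary_form a b r (q e) * e \<in> G (r + d)"
    by metis
  define \<chi> where "\<chi> m = binary_form a b r (q (single m 1))" for m
  have \<chi>_piece: "\<chi> m \<in> graded_piece n r" for m unfolding \<chi>_def by (rule binary_form_piece[OF ab])
  have \<chi>: "eventually_onto n G (\<chi> m) r" "\<chi> m * single m 1 \<in> G (r + d)" if "m \<in> monomials n d" for m
    using q[OF graded_piece_single[OF that, of 1]] eventually_onto_binary_form[OF G ab X' Y'] unfolding \<chi>_def by blast+
  have prod: "prod \<chi> A \<in> graded_piece n (r * card A) \<and> eventually_onto n G (prod \<chi> A) (r * card A)"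
    if "finite A" "A \<subseteq> monomials n d" for A
    using that
  proof (induction A rule: finite_induct)
    case empty
    then show ?case using eventually_onto_const[OF G, of 1] graded_piece_const[of 1 n] by simp
  next
    case (insert m A)
    then show ?case
      using graded_piece_mult[OF \<chi>_piece[of m], of "prod \<chi> A" "r * card A"]
        eventually_onto_mult[OF G \<chi>_piece \<chi>(1), of m "prod \<chi> A" "r * card A"] by auto
  qed
  (* The product \<open>w\<close> annihilates all forms of degree \<open>d\<close> modulo \<open>G\<close> and still acts surjectively. *)
  define w where "w = prod \<chi> (monomials n d)"
  define R where "R = r * card (monomials n d)"
  have w: "w \<in> graded_piece n R" "eventually_onto n G w R"
    using prod[of "monomials n d"] by (auto simp: w_def R_def)
  have wkill: "w * u \<in> G (R + d)" if u: "u \<in> graded_piece n d" for u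
  proof -
    have "w * single m c \<in> G (R + d)" if m: "m \<in> monomials n d" for m c
    proof -
      let ?A = "monomials n d - {m}"
      have "prod \<chi> ?A \<in> graded_piece n (r * card ?A)" using prod[of ?A] by auto
      then have "pconst c * prod \<chi> ?A * (\<chi> m * single m 1) \<in> G (r * card ?A + (r + d))"
        using graded_piece_cmult graded_ideal_mult[OF G \<chi>(2)[OF m]] by blast
      moreover have "w * single m c = pconst c * prod \<chi> ?A * (\<chi> m * single m 1)"
        unfolding w_def using m by (subst prod.remove[of _ m], simp, simp, subst single_mult_eq) (simp add: mult_ac del: mult_single)
      moreover have "R = r * card ?A + r" unfolding R_def using m
        by (metis add.commute card.remove finite_monomials mult_Suc_right)
      ultimately show ?thesis by (simp add: add_ac)
    qed
    then have "(\<Sum>m\<in>monomials n d. w * single m (lookup u m)) \<in> G (R + d)"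
      by (intro graded_ideal_sum[OF G])
    then show ?thesis using poly_mapping_sum_single[of "monomials n d" u] u
      by (simp add: graded_piece_iff flip: sum_distrib_left)
  qed
  obtain j where j: "\<And>i p. i \<ge> j \<Longrightarrow> p \<in> graded_piece n (i + R) \<Longrightarrow> \<exists>g\<in>G (i + R). \<exists>u\<in>graded_piece n i. p = g + w * u"
    using w(2) unfolding eventually_onto_def by blast
  have "graded_piece n (d + j + R) \<subseteq> G (d + j + R)"
  proof
    fix p :: "'k mpoly" assume "p \<in> graded_piece n (d + j + R)"
    then obtain g u where g: "g \<in> G (d + j + R)" "u \<in> graded_piece n (d + j)" "p = g + w * u"
      using j[of "d + j" p] by auto
    then obtain g' u' where g': "g' \<in> G (d + j)" "u' \<in> graded_piece n d" "u = g' + ?x ^ j * u'"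
      using reduce[of u j] by auto
    have "w * g' \<in> G (R + (d + j))" by (rule graded_ideal_mult[OF G g'(1) w(1)])
    moreover have "?x ^ j * (w * u') \<in> G (j + (R + d))"
      using graded_ideal_mult[OF G wkill[OF g'(2)] graded_piece_power[OF graded_piece_var[OF ab(1)], of j]] by simp
    moreover have "p = g + (w * g' + ?x ^ j * (w * u'))" using g g' by (simp add: algebra_simps)
    ultimately show "p \<in> G (d + j + R)"
      using g(1) graded_ideal_add[OF G] by (simp add: add_ac)
  qed
  then show False using never by blast
qed

text \<open>Linear forms are adjoined for all pairs of variables in turn. In the end the ideal contains
\<open>x\<^sub>b - Q\<^sub>b x\<^sub>a\<close> for a fixed \<open>a\<close> and all \<open>b\<close>, so modulo the ideal every form of degree \<open>i\<close> is its value at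
\<open>Q\<close> times \<open>x\<^sub>a\<^sup>i\<close>. A form in the ideal with nonzero value would put \<open>x\<^sub>a\<^sup>i\<close>, and with it all forms of
degree \<open>i\<close>, into the ideal.\<close>

lemma projective_nullstellensatz:
  fixes G :: "nat \<Rightarrow> ('k::alg_closed_field) mpoly set"
  assumes G: "graded_ideal n G" and never: "\<And>i. \<not> graded_piece n i \<subseteq> G i"
  shows "\<exists>Q. (\<exists>a<n. Q a \<noteq> 0) \<and> (\<forall>i. \<forall>p\<in>G i. peval (\<lambda>x. x) Q p = 0)"
proof -
  have "\<exists>H. graded_ideal n H \<and> (\<forall>i. \<not> graded_piece n i \<subseteq> H i) \<and> (\<forall>i. G i \<subseteq> H i) \<and>
     (\<forall>a b. (a, b) \<in> A \<longrightarrow> pvar a \<in> H 1 \<or> (\<exists>c. pvar b - pconst c * pvar a \<in> H 1))"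
    if "finite A" "A \<subseteq> {..<n} \<times> {..<n}" for A
    using that
  proof (induction A rule: finite_induct)
    case empty
    then show ?case using G never by (intro exI[of _ G]) auto
  next
    case (insert ab A)
    obtain a b where ab: "ab = (a, b)" "a < n" "b < n" using insert.prems by auto
    obtain H where H: "graded_ideal n H" "\<And>i. \<not> graded_piece n i \<subseteq> H i" "\<And>i. G i \<subseteq> H i"
     "\<And>a b. (a, b) \<in> A \<Longrightarrow> pvar a \<in> H 1 \<or> (\<exists>c. pvar b - pconst c * pvar a \<in> H 1)" using insert by auto
    obtain l where l: "l = pvar a \<or> (\<exists>c. l = pvar b - pconst c * pvar a)"
      "\<forall>i. \<not> graded_piece n i \<subseteq> adjoin_linear n H l i"
      using graded_ideal_descent[OF H(1,2) ab(2,3)] by blast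
    have lp: "l \<in> graded_piece n 1" using l(1) ab graded_piece_var linear_form_piece by blast
    have sup: "H i \<subseteq> adjoin_linear n H l i" for i by (rule adjoin_linear_superset[OF H(1)])
    show ?case
    proof (intro exI[of _ "adjoin_linear n H l"] conjI allI impI)
      show "graded_ideal n (adjoin_linear n H l)" by (rule graded_ideal_adjoin_linear[OF H(1) lp])
      show "\<not> graded_piece n i \<subseteq> adjoin_linear n H l i" for i using l(2) by blast
      show "G i \<subseteq> adjoin_linear n H l i" for i using H(3) sup by blast
      fix a' b' assume "(a', b') \<in> insert ab A"
      then consider "a' = a" "b' = b" | "(a', b') \<in> A" using ab by auto
      then show "pvar a' \<in> adjoin_linear n H l 1 \<or> (\<exists>c. pvar b' - pconst c * pvar a' \<in> adjoin_linear n H l 1)"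
      proof cases
        case 1 then show ?thesis using l(1) adjoin_linear_self[OF H(1), of l] by auto
      next
        case 2 then show ?thesis using H(4)[OF 2] sup[of 1] by blast
      qed
    qed
  qed
  from this[of "{..<n} \<times> {..<n}"] obtain H where H: "graded_ideal n H" "\<And>i. \<not> graded_piece n i \<subseteq> H i" "\<And>i. G i \<subseteq> H i"
     and rel: "\<And>a b. a < n \<Longrightarrow> b < n \<Longrightarrow> pvar a \<in> H 1 \<or> (\<exists>c. pvar b - pconst c * pvar a \<in> H 1)"
    by (metis SigmaI finite_SigmaI finite_lessThan lessThan_iff order_refl)
  obtain a where a: "a < n" "pvar a \<notin> H 1"
  proof (rule ccontr)
    assume "\<not> thesis"
    then have v: "\<And>a. a < n \<Longrightarrow> pvar a \<in> H 1" using that by blast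
    have "single m c \<in> H 1" if m: "m \<in> monomials n 1" for m c
    proof -
      obtain v l where "v < n" "l \<in> monomials n 0" "m = single v 1 + l"
        using m monomials_SucE[of m n 0] by auto
      then have "m = single v 1" by (simp add: monomials_0)
      then have "single m c = pconst c * pvar v" by (simp add: mult_single)
      then show ?thesis using graded_ideal_cmult[OF H(1) v[OF \<open>v < n\<close>]] by simp
    qed
    then have "p \<in> H 1" if "p \<in> graded_piece n 1" for p
      using poly_mapping_sum_single[of "monomials n 1" p] that graded_ideal_sum[OF H(1), of "monomials n 1" "\<lambda>m. single m (lookup p m)" 1]
      by (simp add: graded_piece_iff)
    then show False using H(2)[of 1] by blast
  qed
  obtain Q where Q: "\<And>b. b < n \<Longrightarrow> pvar b - pconst (Q b) * pvar a \<in> H 1"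
    using rel[OF a(1)] a(2) by metis
  have Qa: "Q a = 1"
  proof (rule ccontr)
    assume ne: "Q a \<noteq> 1"
    have "pconst (1 / (1 - Q a)) * (pvar a - pconst (Q a) * pvar a) \<in> H 1"
      using graded_ideal_cmult[OF H(1) Q[OF a(1)]] by blast
    moreover have "pvar a - pconst (Q a) * pvar a = pconst (1 - Q a) * pvar a"
      by (simp add: single_diff left_diff_distrib)
    then have "pconst (1 / (1 - Q a)) * (pvar a - pconst (Q a) * pvar a) = pvar a"
      using ne by (simp add: mult_single flip: mult.assoc)
    ultimately show False using a(2) by simp
  qed
  have mono: "single m 1 - pconst (monomial_value Q m) * pvar a ^ i \<in> H i" if "m \<in> monomials n i" for m i
    using that
  proof (induction i arbitrary: m)
    case 0
    then show ?case using graded_ideal_zero[OF H(1)] by (simp add: monomials_0)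
  next
    case (Suc i)
    obtain v l where v: "v < n" "l \<in> monomials n i" "m = single v 1 + l"
      using Suc.prems by (rule monomials_SucE)
    have m: "single m (1::'k) = pvar v * single l 1" using v by (simp add: mult_single)
    have "pconst (monomial_value Q l) * pvar a ^ i \<in> graded_piece n i"
      using graded_piece_cmult[OF graded_piece_power[OF graded_piece_var[OF a(1)], of i]] by simp
    then have "pconst (monomial_value Q l) * pvar a ^ i * (pvar v - pconst (Q v) * pvar a) \<in> H (i + 1)"
      by (rule graded_ideal_mult[OF H(1) Q[OF v(1)]])
    moreover have "pvar v * (single l 1 - pconst (monomial_value Q l) * pvar a ^ i) \<in> H (Suc i)"
      using graded_ideal_var[OF H(1) v(1) Suc.IH[OF v(2)]] .
    ultimately have "pvar v * (single l 1 - pconst (monomial_value Q l) * pvar a ^ i) +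
      pconst (monomial_value Q l) * pvar a ^ i * (pvar v - pconst (Q v) * pvar a) \<in> H (Suc i)"
      using graded_ideal_add[OF H(1)] by simp
    moreover have "pvar v * (single l 1 - pconst (monomial_value Q l) * pvar a ^ i) +
      pconst (monomial_value Q l) * pvar a ^ i * (pvar v - pconst (Q v) * pvar a) =
      single m 1 - pconst (monomial_value Q m) * pvar a ^ Suc i"
    proof -
      have e: "pconst (monomial_value Q m) = pconst (monomial_value Q l) * pconst (Q v)"
        unfolding v(3) by (simp add: monomial_value_add mult_single mult.commute)
      show ?thesis unfolding m e by (simp add: algebra_simps del: mult_single)
    qed
    ultimately show ?case by simp
  qed
  have gen: "p - pconst (peval (\<lambda>x. x) Q p) * pvar a ^ i \<in> H i" if p: "p \<in> graded_piece n i" for p i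
  proof -
    let ?c = "lookup p"
    have ps: "p = (\<Sum>m\<in>monomials n i. single m (?c m))"
      using p by (intro poly_mapping_sum_single) (auto simp: graded_piece_iff)
    have "peval (\<lambda>x. x) Q p = (\<Sum>m\<in>monomials n i. ?c m * monomial_value Q m)"
      by (subst ps) (simp add: peval_sum[OF coefficient_hom_id] peval_single[OF coefficient_hom_id])
    then have "pconst (peval (\<lambda>x. x) Q p) = (\<Sum>m\<in>monomials n i. pconst (?c m * monomial_value Q m))"
      by (intro poly_mapping_eqI) (simp add: lookup_sum lookup_single when_def)
    then have "p - pconst (peval (\<lambda>x. x) Q p) * pvar a ^ i = (\<Sum>m\<in>monomials n i. single m (?c m) - pconst (?c m * monomial_value Q m) * pvar a ^ i)"
      using ps by (simp add: sum_subtractf sum_distrib_right)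
    also have "\<dots> = (\<Sum>m\<in>monomials n i. pconst (?c m) * (single m 1 - pconst (monomial_value Q m) * pvar a ^ i))"
    proof (rule sum.cong)
      fix m
      have "pconst (?c m * monomial_value Q m) = pconst (?c m) * pconst (monomial_value Q m)" by (simp add: mult_single)
      then show "single m (?c m) - pconst (?c m * monomial_value Q m) * pvar a ^ i =
        pconst (?c m) * (single m 1 - pconst (monomial_value Q m) * pvar a ^ i)"
        by (subst single_mult_eq) (simp add: algebra_simps del: mult_single)
    qed simp
    also have "\<dots> \<in> H i" by (intro graded_ideal_sum[OF H(1)] graded_ideal_cmult[OF H(1)] mono)
    finally show ?thesis .
  qed
  have "peval (\<lambda>x. x) Q p = 0" if p: "p \<in> G i" for p i
  proof (rule ccontr)
    let ?e = "peval (\<lambda>x. x) Q p"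
    assume ne: "?e \<noteq> 0"
    have pH: "p \<in> H i" using p H(3) by blast
    have "p - (p - pconst ?e * pvar a ^ i) \<in> H i"
      using graded_ideal_minus[OF H(1) pH gen[OF graded_ideal_piece[OF H(1) pH]]] .
    then have "pconst (1 / ?e) * (pconst ?e * pvar a ^ i) \<in> H i" using graded_ideal_cmult[OF H(1)] by simp
    then have x: "pvar a ^ i \<in> H i" using ne by (simp add: mult_single flip: mult.assoc)
    have "graded_piece n i \<subseteq> H i"
    proof
      fix u :: "'k mpoly" assume u: "u \<in> graded_piece n i"
      have "(u - pconst (peval (\<lambda>x. x) Q u) * pvar a ^ i) + pconst (peval (\<lambda>x. x) Q u) * pvar a ^ i \<in> H i"
        using graded_ideal_add[OF H(1) gen[OF u] graded_ideal_cmult[OF H(1) x]] .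
      then show "u \<in> H i" by simp
    qed
    then show False using H(2) by blast
  qed
  then show ?thesis using a(1) Qa by (intro exI[of _ Q]) auto
qed

section \<open>Ideals that contain all forms of some degree\<close>

text \<open>The part of degree \<open>i\<close> of the ideal generated by the forms \<open>h v\<close> of degree \<open>e\<close>. Below degree \<open>e\<close> it is zero,
which the truncated difference \<open>i - e\<close> would not express.\<close>

definition form_ideal :: "nat \<Rightarrow> nat set \<Rightarrow> (nat \<Rightarrow> ('k::field) mpoly) \<Rightarrow> nat \<Rightarrow> nat \<Rightarrow> 'k mpoly set" where
  "form_ideal n V h e i = {\<Sum>v\<in>V. h v * u v | u. \<forall>v\<in>V. u v \<in> (if e \<le> i then graded_piece n (i - e) else {0})}"

lemma form_idealI:
  "(\<And>v. v \<in> V \<Longrightarrow> u v \<in> graded_piece n j) \<Longrightarrow> i = j + e \<Longrightarrow> (\<Sum>v\<in>V. h v * u v) \<in> form_ideal n V h e i"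
  unfolding form_ideal_def by auto

lemma graded_ideal_form_ideal:
  assumes h: "\<And>v. v \<in> V \<Longrightarrow> h v \<in> graded_piece n e"
  shows "graded_ideal n (form_ideal n V h e)"
proof -
  let ?U = "\<lambda>i. if e \<le> i then graded_piece n (i - e) else {0}"
  have U: "u + w \<in> ?U i" "pconst c * u \<in> ?U i" "v < n \<Longrightarrow> pvar v * u \<in> ?U (Suc i)"
    if "u \<in> ?U i" "w \<in> ?U i" for u w i v c
    using that graded_piece_add graded_piece_cmult[of u n "i - e" c] graded_piece_mult[OF graded_piece_var[of v n], of u "i - e"]
    by (auto split: if_splits simp: Suc_diff_le)
  have sub: "\<exists>u'. (\<Sum>v\<in>V. h v * u v) = (\<Sum>v\<in>V. h v * u' v) \<and> (\<forall>v\<in>V. u' v \<in> ?U i)"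
    if "\<forall>v\<in>V. u v \<in> ?U i" for u i using that by blast
  show ?thesis unfolding graded_ideal_def
  proof (intro allI conjI ballI impI subsetI)
    fix i p assume "p \<in> form_ideal n V h e i"
    then obtain u where u: "p = (\<Sum>v\<in>V. h v * u v)" "\<forall>v\<in>V. u v \<in> ?U i" unfolding form_ideal_def by blast
    show "p \<in> graded_piece n i" unfolding u(1)
    proof (rule graded_piece_sum)
      fix v assume "v \<in> V"
      then show "h v * u v \<in> graded_piece n i"
        using u(2) graded_piece_mult[OF h, of v "u v" "i - e"] by (auto split: if_splits)
    qed
  next
    fix i show "0 \<in> form_ideal n V h e i" unfolding form_ideal_def
      by (intro CollectI exI[of _ "\<lambda>_. 0"]) auto
  next
    fix i p q assume "p \<in> form_ideal n V h e i" "q \<in> form_ideal n V h e i"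
    then obtain u w where u: "p = (\<Sum>v\<in>V. h v * u v)" "\<forall>v\<in>V. u v \<in> ?U i"
      and w: "q = (\<Sum>v\<in>V. h v * w v)" "\<forall>v\<in>V. w v \<in> ?U i" unfolding form_ideal_def by blast
    show "p + q \<in> form_ideal n V h e i" unfolding form_ideal_def
      using u w U(1)[of "u _" i "w _"]
      by (intro CollectI exI[of _ "\<lambda>v. u v + w v"] conjI ballI) (simp_all add: sum.distrib distrib_left)
  next
    fix i p c assume "p \<in> form_ideal n V h e i"
    then obtain u where u: "p = (\<Sum>v\<in>V. h v * u v)" "\<forall>v\<in>V. u v \<in> ?U i" unfolding form_ideal_def by blast
    show "pconst c * p \<in> form_ideal n V h e i" unfolding form_ideal_def
    proof (intro CollectI exI[of _ "\<lambda>v. pconst c * u v"] conjI ballI)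
      show "pconst c * p = (\<Sum>v\<in>V. h v * (pconst c * u v))" unfolding u(1) sum_distrib_left by (simp add: mult_ac)
      fix v assume "v \<in> V" then show "pconst c * u v \<in> ?U i" using u(2) U(2)[of "u v" i "u v"] by simp
    qed
  next
    fix i p x assume "p \<in> form_ideal n V h e i" and x: "x < n"
    then obtain u where u: "p = (\<Sum>v\<in>V. h v * u v)" "\<forall>v\<in>V. u v \<in> ?U i" unfolding form_ideal_def by blast
    show "pvar x * p \<in> form_ideal n V h e (Suc i)" unfolding form_ideal_def
    proof (intro CollectI exI[of _ "\<lambda>v. pvar x * u v"] conjI ballI)
      show "pvar x * p = (\<Sum>v\<in>V. h v * (pvar x * u v))" unfolding u(1) sum_distrib_left by (simp add: mult_ac)
      fix v assume "v \<in> V" then show "pvar x * u v \<in> ?U (Suc i)" using u(2) U(3)[of "u v" i "u v"] x by blast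
    qed
  qed
qed

inductive_set bounded_span :: "(nat \<Rightarrow>\<^sub>0 nat) set \<Rightarrow> nat set \<Rightarrow> (nat \<Rightarrow> ('k::field) mpoly) \<Rightarrow> nat \<Rightarrow> 'k mpoly set"
  for A V h D where
  base: "a \<in> A \<Longrightarrow> keys b \<subseteq> V \<Longrightarrow> \<forall>i. lookup b i \<le> D \<Longrightarrow>
     single a c * monomial_value h b \<in> bounded_span A V h D"
| zero: "0 \<in> bounded_span A V h D"
| add: "p \<in> bounded_span A V h D \<Longrightarrow> q \<in> bounded_span A V h D \<Longrightarrow> p + q \<in> bounded_span A V h D"

lemma bounded_span_sum: "(\<And>x. x \<in> Z \<Longrightarrow> F x \<in> bounded_span A V h D) \<Longrightarrow> sum F Z \<in> bounded_span A V h D"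
  by (induction Z rule: infinite_finite_induct) (auto intro: bounded_span.intros)

lemma bounded_span_mult:
  assumes "p \<in> bounded_span A V h D" "v \<in> V"
  shows "h v * p \<in> bounded_span A V h (Suc D)"
  using assms(1)
proof induction
  case (base a b c)
  have "h v * (single a c * monomial_value h b) =
    single a c * monomial_value h (single v 1 + b)"
    by (simp add: monomial_value_add mult_ac)
  moreover have "\<forall>i. lookup (single v 1 + b) i \<le> Suc D"
    using base(3) by (auto simp: lookup_add lookup_single when_def intro: le_SucI)
  moreover have "keys (single v 1 + b) \<subseteq> V"
    using base(2) assms(2) keys_add[of "single v 1" b] by (auto split: if_splits)
  ultimately show ?case using bounded_span.base[OF base(1)] by metis
qed (auto intro: bounded_span.intros simp: distrib_left)

lemma bounded_span_coefficients:
  assumes "p \<in> bounded_span A V h D" "finite A" "finite V"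
  shows "\<exists>c. p = (\<Sum>(a, b)\<in>A \<times> {b. keys b \<subseteq> V \<and> (\<forall>i. lookup b i \<le> D)}.
      pconst (c a b) * (single a 1 * monomial_value h b))"
  using assms(1)
proof induction
  let ?B = "{b. keys b \<subseteq> V \<and> (\<forall>i. lookup b i \<le> D)}"
  note fin = assms(2) finite_box[OF assms(3), of D]
  case (base a b c)
  let ?c = "\<lambda>a' b'. if (a', b') = (a, b) then c else 0"
  have "(\<Sum>(a', b')\<in>A \<times> ?B. pconst (?c a' b') * (single a' 1 * monomial_value h b')) =
    (\<Sum>x\<in>A \<times> ?B. if x = (a, b) then pconst c * (single a 1 * monomial_value h b) else 0)"
    by (intro sum.cong) (auto split: if_splits)
  also have "\<dots> = pconst c * (single a 1 * monomial_value h b)"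
    using fin base by (subst sum.delta) auto
  also have "\<dots> = single a c * monomial_value h b"
    by (simp add: mult_single flip: mult.assoc)
  finally show ?case by (intro exI[of _ ?c]) (rule sym)
next
  case zero
  show ?case by (rule exI[of _ "\<lambda>_ _. 0"]) auto
next
  case (add p q)
  then obtain c d where "p = (\<Sum>(a, b)\<in>A \<times> {b. keys b \<subseteq> V \<and> (\<forall>i. lookup b i \<le> D)}.
      pconst (c a b) * (single a 1 * monomial_value h b))"
    "q = (\<Sum>(a, b)\<in>A \<times> {b. keys b \<subseteq> V \<and> (\<forall>i. lookup b i \<le> D)}.
      pconst (d a b) * (single a 1 * monomial_value h b))" by blast
  then show ?case
    by (intro exI[of _ "\<lambda>a b. c a b + d a b"]) (simp add: single_add distrib_right sum.distrib case_prod_unfold)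
qed

text \<open>If the \<open>h v\<close> generate all forms of degree \<open>N\<close>, the polynomial ring is a finite module over the subalgebra
generated by them, with the monomials whose exponents are at most \<open>N\<close> as generators: forms of larger degree are combinations of
the \<open>h v\<close> with coefficients of smaller degree.\<close>

lemma bounded_span_exhausts:
  assumes h: "\<And>v. v \<in> V \<Longrightarrow> h v \<in> graded_piece n e" and e: "e \<ge> 1"
    and full: "graded_piece n N \<subseteq> form_ideal n V h e N"
    and p: "p \<in> graded_piece n i" and "i \<le> D"
  shows "p \<in> bounded_span {m. keys m \<subseteq> {..<n} \<and> (\<forall>i. lookup m i \<le> N)} V h D"
  using p \<open>i \<le> D\<close>
proof (induction D arbitrary: i p)
  case (0)
  have "p = (\<Sum>m\<in>monomials n i. single m (lookup p m))"
    using 0 by (intro poly_mapping_sum_single) (auto simp: graded_piece_iff)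
  also have "\<dots> \<in> bounded_span {m. keys m \<subseteq> {..<n} \<and> (\<forall>i. lookup m i \<le> N)} V h 0"
  proof (rule bounded_span_sum)
    fix m assume "m \<in> monomials n i"
    then have "m = 0" using 0 by (simp add: monomials_0)
    then show "single m (lookup p m) \<in> bounded_span {m. keys m \<subseteq> {..<n} \<and> (\<forall>i. lookup m i \<le> N)} V h 0"
      using bounded_span.base[of m _ 0 V 0 "lookup p m" h] by simp
  qed
  finally show ?case .
next
  case (Suc D)
  note G = graded_ideal_form_ideal[of V h n e, OF h]
  show ?case
  proof (cases "i \<le> N")
    case True
    have "p = (\<Sum>m\<in>monomials n i. single m (lookup p m))"
      using Suc.prems by (intro poly_mapping_sum_single) (auto simp: graded_piece_iff)
    also have "\<dots> \<in> bounded_span {m. keys m \<subseteq> {..<n} \<and> (\<forall>i. lookup m i \<le> N)} V h (Suc D)"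
    proof (rule bounded_span_sum)
      fix m assume "m \<in> monomials n i"
      then have "keys m \<subseteq> {..<n} \<and> (\<forall>i. lookup m i \<le> N)"
        using True lookup_le_monomial_degree[of m] by (auto simp: monomials_def intro: order_trans)
      then show "single m (lookup p m) \<in> bounded_span {m. keys m \<subseteq> {..<n} \<and> (\<forall>i. lookup m i \<le> N)} V h (Suc D)"
        using bounded_span.base[of m _ 0 V "Suc D" "lookup p m" h] by simp
    qed
    finally show ?thesis .
  next
    case False
    then have "p \<in> form_ideal n V h e i"
      using graded_ideal_full_mono[OF G full, of i] Suc.prems(1) by auto
    then obtain u where u: "p = (\<Sum>v\<in>V. h v * u v)" "\<forall>v\<in>V. u v \<in> (if e \<le> i then graded_piece n (i - e) else {0})"
      unfolding form_ideal_def by blast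
    show ?thesis unfolding u(1)
    proof (rule bounded_span_sum)
      fix v assume v: "v \<in> V"
      have "u v \<in> graded_piece n (i - e)" using u(2) v by (auto split: if_splits)
      then have "u v \<in> bounded_span {m. keys m \<subseteq> {..<n} \<and> (\<forall>i. lookup m i \<le> N)} V h D"
        using Suc.IH[of "u v" "i - e"] Suc.prems(2) e by auto
      then show "h v * u v \<in> bounded_span {m. keys m \<subseteq> {..<n} \<and> (\<forall>i. lookup m i \<le> N)} V h (Suc D)"
        using bounded_span_mult v by blast
    qed
  qed
qed

lemma dependent_if_too_many:
  fixes u :: "'a \<Rightarrow> ('k::field) mpoly"
  assumes "finite B" "finite A" "card B < card A"
    and "\<And>a. a \<in> A \<Longrightarrow> \<exists>c. u a = (\<Sum>b\<in>B. pconst (c b) * w b)"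
  shows "\<exists>c. (\<exists>a\<in>A. c a \<noteq> 0) \<and> (\<Sum>a\<in>A. pconst (c a) * u a) = 0"
proof -
  obtain M where M: "\<And>a. a \<in> A \<Longrightarrow> u a = (\<Sum>b\<in>B. pconst (M a b) * w b)"
    using assms(4) by metis
  obtain c where c: "\<exists>a\<in>A. c a \<noteq> 0" "\<forall>b\<in>B. (\<Sum>a\<in>A. c a * M a b) = 0"
    using homogeneous_system_solvable[OF assms(1-3), of M] by blast
  have "(\<Sum>a\<in>A. pconst (c a) * u a) = (\<Sum>a\<in>A. \<Sum>b\<in>B. pconst (c a * M a b) * w b)"
    by (intro sum.cong) (auto simp: M sum_distrib_left mult_single simp flip: mult.assoc)
  also have "\<dots> = (\<Sum>b\<in>B. \<Sum>a\<in>A. pconst (c a * M a b) * w b)" by (rule sum.swap)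
  also have "\<dots> = (\<Sum>b\<in>B. pconst (\<Sum>a\<in>A. c a * M a b) * w b)"
  proof (rule sum.cong)
    fix b
    have "pconst (\<Sum>a\<in>A. c a * M a b) = (\<Sum>a\<in>A. pconst (c a * M a b))"
      by (intro poly_mapping_eqI) (simp add: lookup_sum lookup_single when_def)
    then show "(\<Sum>a\<in>A. pconst (c a * M a b) * w b) = pconst (\<Sum>a\<in>A. c a * M a b) * w b"
      by (simp add: sum_distrib_right)
  qed simp
  also have "\<dots> = 0" using c(2) by simp
  finally show ?thesis using c(1) by blast
qed

text \<open>Otherwise the polynomial ring in \<open>n\<close> variables would be a finite module over an algebra with fewer than \<open>n\<close>
generators, and there would be more monomials than the span can hold.\<close>

lemma few_forms_not_full:
  fixes h :: "nat \<Rightarrow> ('k::field) mpoly"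
  assumes V: "finite V" "card V < n" and h: "\<And>v. v \<in> V \<Longrightarrow> h v \<in> graded_piece n e" and e: "e \<ge> 1"
  shows "\<not> graded_piece n N \<subseteq> form_ideal n V h e N"
proof
  assume full: "graded_piece n N \<subseteq> form_ideal n V h e N"
  define A where "A = {m :: nat \<Rightarrow>\<^sub>0 nat. keys m \<subseteq> {..<n} \<and> (\<forall>i. lookup m i \<le> N)}"
  (* Exponents up to \<open>D\<close> in \<open>n\<close> variables give degree at most \<open>n D\<close>. *)
  obtain D where D: "card A * (n * D + 1) ^ (n - 1) < (D + 1) ^ (n - 1 + 1)"
    using polynomial_growth_beats[of "card A" n "n - 1"] by blast
  define W where "W = {m :: nat \<Rightarrow>\<^sub>0 nat. keys m \<subseteq> {..<n} \<and> (\<forall>i. lookup m i \<le> D)}"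
  define B where "B = {b. keys b \<subseteq> V \<and> (\<forall>i. lookup b i \<le> n * D)}"
  have fin: "finite A" "finite W" "finite B" unfolding A_def W_def B_def using V finite_box by auto
  have "card (A \<times> B) = card A * (n * D + 1) ^ card V"
    using card_box[OF V(1), of "n * D"] by (simp add: B_def card_cartesian_product)
  also have "\<dots> \<le> card A * (n * D + 1) ^ (n - 1)" using V by (intro mult_left_mono power_increasing) auto
  also have "\<dots> < (D + 1) ^ n" using D V by simp
  also have "\<dots> = card W" using card_box[of "{..<n}" D] by (simp add: W_def)
  finally have card: "card (A \<times> B) < card W" .
  have "\<exists>c. single m (1::'k) = (\<Sum>x\<in>A \<times> B. pconst (c x) * (case x of (a, b) \<Rightarrow> single a 1 * monomial_value h b))"
    if m: "m \<in> W" for m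
  proof -
    have "monomial_degree m = (\<Sum>i<n. lookup m i)"
      using m by (intro monomial_degree_superset) (auto simp: W_def)
    also have "\<dots> \<le> (\<Sum>i<n. D)" using m by (intro sum_mono) (auto simp: W_def)
    finally have "monomial_degree m \<le> n * D" by simp
    moreover have "single m (1::'k) \<in> graded_piece n (monomial_degree m)"
      using m by (intro graded_piece_single) (auto simp: monomials_def W_def)
    ultimately have "single m (1::'k) \<in> bounded_span A V h (n * D)"
      unfolding A_def by (intro bounded_span_exhausts[OF h e full])
    then obtain c where "single m (1::'k) = (\<Sum>(a, b)\<in>A \<times> B. pconst (c a b) * (single a 1 * monomial_value h b))"
      using bounded_span_coefficients[of _ A V h "n * D"] fin V unfolding B_def by blast
    then show ?thesis by (intro exI[of _ "\<lambda>(a, b). c a b"]) (simp add: case_prod_unfold)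
  qed
  then obtain c where c: "\<exists>m\<in>W. c m \<noteq> 0" "(\<Sum>m\<in>W. pconst (c m) * single m (1::'k)) = 0"
    using dependent_if_too_many[of "A \<times> B" W "\<lambda>m. single m 1"] fin card by blast
  then obtain l where l: "l \<in> W" "c l \<noteq> 0" by blast
  have "lookup (\<Sum>m\<in>W. pconst (c m) * single m (1::'k)) l = (\<Sum>m\<in>W. if m = l then c l else 0)"
    unfolding lookup_sum by (intro sum.cong) (auto simp: mult_single lookup_single when_def)
  then show False using c(2) l fin by simp
qed

text \<open>A linear dependence would make one generator superfluous, leaving fewer than \<open>n\<close> of them.\<close>

lemma full_imp_independent:
  fixes h :: "nat \<Rightarrow> ('k::field) mpoly"
  assumes h: "\<And>v. v < n \<Longrightarrow> h v \<in> graded_piece n e" and e: "e \<ge> 1"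
    and full: "graded_piece n N \<subseteq> form_ideal n {..<n} h e N"
    and dep: "(\<Sum>v<n. pconst (c v) * h v) = 0" and "w < n"
  shows "c w = 0"
proof (rule ccontr)
  assume cw: "c w \<noteq> 0"
  let ?V = "{..<n} - {w}"
  have "pconst (c w) * h w = - (\<Sum>v\<in>?V. pconst (c v) * h v)"
    using dep \<open>w < n\<close> by (simp add: sum.remove[of "{..<n}" w] eq_neg_iff_add_eq_0)
  then have "pconst (- 1 / c w) * (pconst (c w) * h w) = pconst (1 / c w) * (\<Sum>v\<in>?V. pconst (c v) * h v)"
    by (simp add: single_uminus)
  moreover have "pconst (- 1 / c w) * (pconst (c w) * h w) = - h w"
    using cw by (simp add: mult_single single_uminus flip: mult.assoc)
  ultimately have hw: "h w = (\<Sum>v\<in>?V. h v * pconst (- c v / c w))"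
    by (simp add: sum_distrib_left sum_negf mult_single single_uminus mult_ac flip: mult.assoc)
  have "graded_piece n N \<subseteq> form_ideal n ?V h e N"
  proof
    fix p :: "'k mpoly" assume "p \<in> graded_piece n N"
    then obtain u where u: "p = (\<Sum>v<n. h v * u v)" "\<forall>v<n. u v \<in> (if e \<le> N then graded_piece n (N - e) else {0})"
      using full unfolding form_ideal_def by fastforce
    have "p = h w * u w + (\<Sum>v\<in>?V. h v * u v)" using u(1) \<open>w < n\<close> by (simp add: sum.remove)
    also have "h w * u w = (\<Sum>v\<in>?V. h v * (pconst (- c v / c w) * u w))"
      by (subst hw) (simp add: sum_distrib_right mult.assoc)
    finally have p: "p = (\<Sum>v\<in>?V. h v * (pconst (- c v / c w) * u w + u v))"
      by (simp add: distrib_left sum.distrib)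
    show "p \<in> form_ideal n ?V h e N" unfolding form_ideal_def
      using u(2) \<open>w < n\<close>
      by (intro CollectI exI[of _ "\<lambda>v. pconst (- c v / c w) * u w + u v"] conjI p)
        (auto split: if_splits intro!: graded_piece_add graded_piece_cmult)
  qed
  moreover have "card ?V < n" using \<open>w < n\<close> by simp
  ultimately show False using few_forms_not_full[of ?V n h e N] h e by auto
qed

section \<open>Chains of prime ideals in polynomial rings\<close>

text \<open>A bound on the total degree, for polynomials that need not be homogeneous.\<close>

definition degree_bounded :: "nat \<Rightarrow> ('k::field) mpoly \<Rightarrow> bool" where
  "degree_bounded E p \<longleftrightarrow> (\<forall>m\<in>keys p. monomial_degree m \<le> E)"

lemma degree_bounded_mult: "degree_bounded E p \<Longrightarrow> degree_bounded F q \<Longrightarrow> degree_bounded (E + F) (p * q)"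
  using keys_mult[of p q] by (fastforce simp: degree_bounded_def monomial_degree_add intro: add_mono)

lemma degree_bounded_power: "degree_bounded E p \<Longrightarrow> degree_bounded (e * E) (p ^ e)"
  by (induction e) (auto simp: degree_bounded_def[of 0] degree_bounded_mult)

lemma degree_bounded_prod:
  "(\<And>x. x \<in> Z \<Longrightarrow> degree_bounded (E x) (F x)) \<Longrightarrow> degree_bounded (sum E Z) (prod F Z)"
  by (induction Z rule: infinite_finite_induct) (auto simp: degree_bounded_def[of 0] degree_bounded_mult)

lemma degree_bounded_mono: "degree_bounded E p \<Longrightarrow> E \<le> F \<Longrightarrow> degree_bounded F p"
  by (auto simp: degree_bounded_def)

lemma degree_bounded_exists: "\<exists>E. degree_bounded E p"
  by (rule exI[of _ "\<Sum>m\<in>keys p. monomial_degree m"])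
    (auto simp: degree_bounded_def intro: member_le_sum)

text \<open>There are more monomials of bounded exponents in the \<open>n + 1\<close> polynomials than monomials in \<open>n\<close> variables
of the degrees that occur in them.\<close>

lemma algebraically_dependent:
  fixes y :: "nat \<Rightarrow> ('k::field) mpoly"
  assumes y: "\<And>j. j \<le> n \<Longrightarrow> y j \<in> carrier (mpoly_ring n)"
  shows "\<exists>g. g \<noteq> 0 \<and> (\<forall>m\<in>keys g. keys m \<subseteq> {..n}) \<and> peval pconst y g = 0"
proof -
  define E where "E j = (SOME E. degree_bounded E (y j))" for j
  have E: "degree_bounded (E j) (y j)" for j
    unfolding E_def using degree_bounded_exists by (rule someI_ex)
  define F where "F = (\<Sum>j\<le>n. E j)"
  have F: "degree_bounded F (y j)" if "j \<le> n" for j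
    using degree_bounded_mono[OF E[of j], of F] that by (auto simp: F_def intro: member_le_sum)
  obtain D where D: "1 * (((n + 1) * F) * D + 1) ^ n < (D + 1) ^ (n + 1)"
    using polynomial_growth_beats by blast
  define W where "W = {m :: nat \<Rightarrow>\<^sub>0 nat. keys m \<subseteq> {..n} \<and> (\<forall>i. lookup m i \<le> D)}"
  define B where "B = {m :: nat \<Rightarrow>\<^sub>0 nat. keys m \<subseteq> {..<n} \<and> (\<forall>i. lookup m i \<le> (n + 1) * F * D)}"
  have fin: "finite W" "finite B" unfolding W_def B_def using finite_box by auto
  have "card B < card W"
    using D card_box[of "{..<n}" "(n + 1) * F * D"] card_box[of "{..n}" D] unfolding W_def B_def by simp
  have "\<exists>c. monomial_value y b = (\<Sum>m\<in>B. pconst (c m) * single m 1)" if b: "b \<in> W" for b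
  proof -
    have mv: "monomial_value y b = (\<Prod>j\<le>n. y j ^ lookup b j)"
      using b by (intro monomial_value_superset) (auto simp: W_def)
    have "monomial_value y b \<in> carrier (mpoly_ring n)"
      unfolding mv using y by (intro mpoly_carrier_prod mpoly_carrier_power) auto
    moreover have "degree_bounded (\<Sum>j\<le>n. lookup b j * F) (monomial_value y b)"
      unfolding mv using F by (intro degree_bounded_prod degree_bounded_power) auto
    moreover have "(\<Sum>j\<le>n. lookup b j * F) \<le> (\<Sum>j\<le>n. D * F)"
      using b by (intro sum_mono mult_right_mono) (auto simp: W_def)
    ultimately have "keys (monomial_value y b) \<subseteq> B"
      unfolding B_def degree_bounded_def mpoly_carrier_iff
      using lookup_le_monomial_degree by (fastforce simp: mult_ac intro: order_trans)
    from poly_mapping_sum_single[OF fin(2) this]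
    have "monomial_value y b = (\<Sum>m\<in>B. single m (lookup (monomial_value y b) m))" .
    also have "\<dots> = (\<Sum>m\<in>B. pconst (lookup (monomial_value y b) m) * single m 1)"
      by (simp add: mult_single)
    finally show ?thesis by blast
  qed
  then obtain c where c: "\<exists>b\<in>W. c b \<noteq> 0" "(\<Sum>b\<in>W. pconst (c b) * monomial_value y b) = 0"
    using dependent_if_too_many[OF fin(2,1) \<open>card B < card W\<close>, of "monomial_value y" "\<lambda>m. single m 1"] by blast
  define g where "g = (\<Sum>b\<in>W. single b (c b))"
  have lg: "lookup g m = (if m \<in> W then c m else 0)" for m
  proof -
    have "lookup g m = (\<Sum>b\<in>W. if b = m then c m else 0)"
      unfolding g_def lookup_sum by (intro sum.cong) (auto simp: lookup_single when_def)
    then show ?thesis using fin by simp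
  qed
  have "g \<noteq> 0" using c(1) lg by (metis lookup_zero)
  moreover have "keys g \<subseteq> W" by (auto simp: in_keys_iff lg split: if_splits)
  moreover have "peval pconst y g = 0"
    unfolding g_def using c(2) by (simp add: peval_sum peval_single)
  ultimately show ?thesis unfolding W_def by blast
qed

lemma divide_by_power:
  fixes h :: "('k::field) mpoly"
  assumes "\<And>k. k \<in> keys h \<Longrightarrow> e \<le> lookup k j"
  obtains h' where "h = single (single j e) 1 * h'"
    "\<And>l. lookup h' l = lookup h (single j e + l)"
proof -
  let ?h = "\<Sum>k\<in>keys h. single (k - single j e) (lookup h k)"
  have "single (single j e) 1 * ?h =
    (\<Sum>k\<in>keys h. single k (lookup h k))"
    unfolding sum_distrib_left
  proof (rule sum.cong)
    fix k assume "k \<in> keys h"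
    then have "single j e + (k - single j e) = k"
      using assms[of k] by (intro poly_mapping_eqI) (auto simp: lookup_add lookup_minus lookup_single when_def)
    then show "single (single j e) 1 * single (k - single j e) (lookup h k) =
      single k (lookup h k)" by (simp add: mult_single)
  qed simp
  also have "\<dots> = h" using poly_mapping_sum_single[of "keys h" h] by simp
  finally have h: "h = single (single j e) 1 * ?h" by simp
  moreover have "lookup ?h l = lookup h (single j e + l)" for l
    by (subst (2) h) (simp only: lookup_single_mult mult_1)
  ultimately show thesis using that by blast
qed

lemma (in primeideal) prime_power_cancel:
  assumes "a \<in> carrier R" "w \<in> carrier R" "a \<notin> I" "a [^] (e::nat) \<otimes> w \<in> I"
  shows "w \<in> I"
  using assms(4)
proof (induction e)
  case 0 then show ?case using assms by simp
next
  case (Suc e)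
  have "a \<otimes> (a [^] e \<otimes> w) \<in> I"
    using Suc.prems assms by (simp add: m_ac nat_pow_Suc)
  then show ?case using I_prime[of a "a [^] e \<otimes> w"] assms Suc.IH by blast
qed

text \<open>Choose \<open>y j\<close> in \<open>C (j + 1)\<close> but not in \<open>C j\<close>. The \<open>n + 1\<close> polynomials so obtained satisfy a relation
\<open>g\<close>. In a relation modulo \<open>C j\<close> the largest power of the \<open>j\<close>-th variable can be cancelled, since \<open>C j\<close> is prime and
\<open>y j\<close> lies outside; the terms still divisible by that variable then lie in \<open>C (j + 1)\<close>. This eliminates the
variables one after the other, and a nonzero constant remains in the last prime ideal.\<close>

lemma no_long_prime_chain:
  fixes C :: "nat \<Rightarrow> ('k::field) mpoly set"
  assumes C: "\<And>j. j \<le> n + 1 \<Longrightarrow> primeideal (C j) (mpoly_ring n)" and strict: "\<And>j. j \<le> n \<Longrightarrow> C j \<subset> C (j + 1)"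
  shows False
proof -
  have "\<forall>j. \<exists>z. j \<le> n \<longrightarrow> z \<in> C (j + 1) \<and> z \<notin> C j" using strict by blast
  from choice[OF this] obtain y where y: "\<And>j. j \<le> n \<Longrightarrow> y j \<in> C (j + 1) \<and> y j \<notin> C j"
    by blast
  have ideal: "j \<le> n + 1 \<Longrightarrow> ideal (C j) (mpoly_ring n)" for j using C primeideal.axioms(1) by blast
  have sub: "C j \<subseteq> carrier (mpoly_ring n)" if "j \<le> n + 1" for j
    using ideal[OF that] by (simp add: ideal.Icarr subsetI)
  have yc: "y j \<in> carrier (mpoly_ring n)" if "j \<le> n" for j using y[OF that] sub[of "j + 1"] that by auto
  have pe: "peval pconst y h \<in> carrier (mpoly_ring n)"
    if "\<forall>m\<in>keys h. keys m \<subseteq> {..n}" for h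
    unfolding peval_def additive_extension_def monomial_value_def
    using that yc by (intro mpoly_carrier_sum mpoly_carrier_mult mpoly_carrier_prod mpoly_carrier_power) auto
  have pow: "p [^]\<^bsub>mpoly_ring n\<^esub> e = p ^ e" for p :: "'k mpoly" and e :: nat
    by (induction e) (simp_all add: mpoly_ring_def nat_pow_def mult.commute)
  have "\<exists>g. g \<noteq> 0 \<and> (\<forall>m\<in>keys g. keys m \<subseteq> {j..n}) \<and> peval pconst y g \<in> C j"
    if "j \<le> n + 1" for j
    using that
  proof (induction j)
    case 0
    have "0 \<in> C 0" using additive_subgroup.zero_closed[OF ideal.axioms(1)[OF ideal[of 0]]] by (simp add: mpoly_ring_def)
    then show ?case using algebraically_dependent[of n y, OF yc] by (auto simp: atLeast0AtMost)
  next
    case (Suc j)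
    then obtain g where g: "g \<noteq> 0" "\<forall>m\<in>keys g. keys m \<subseteq> {j..n}" "peval pconst y g \<in> C j"
      by auto
    have jn: "j \<le> n" using Suc.prems by simp
    interpret prj: primeideal "C j" "mpoly_ring n" using C[of j] jn by simp
    interpret prS: primeideal "C (Suc j)" "mpoly_ring n" using C[of "Suc j"] jn by simp
    define e where "e = Min ((\<lambda>k. lookup k j) ` keys g)"
    have ne: "keys g \<noteq> {}" using g(1) by simp
    have "e \<in> (\<lambda>k. lookup k j) ` keys g" unfolding e_def using ne by (intro Min_in) auto
    then obtain k0 where k0: "k0 \<in> keys g" "lookup k0 j = e" by blast
    have "e \<le> lookup k j" if "k \<in> keys g" for k
      unfolding e_def using that by (intro Min_le) auto
    then obtain g' where g': "g = single (single j e) 1 * g'"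
      "\<And>l. lookup g' l = lookup g (single j e + l)"
      using divide_by_power[of g e j] by metis
    have g'v: "\<forall>m\<in>keys g'. keys m \<subseteq> {j..n}"
    proof (intro ballI subsetI)
      fix m i assume m: "m \<in> keys g'" "i \<in> keys m"
      then have "single j e + m \<in> keys g" using g'(2) by (simp add: in_keys_iff)
      moreover have "i \<in> keys (single j e + m)" using m by (simp add: in_keys_iff lookup_add)
      ultimately show "i \<in> {j..n}" using g(2) by blast
    qed
    have pg': "peval pconst y g' \<in> carrier (mpoly_ring n)" using g'v by (intro pe) fastforce
    have "y j ^ e * peval pconst y g' \<in> C j"
      using g(3) unfolding g'(1) by (simp add: peval_mult peval_single)
    then have "y j [^]\<^bsub>mpoly_ring n\<^esub> e \<otimes>\<^bsub>mpoly_ring n\<^esub> peval pconst y g' \<in> C j"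
      unfolding pow by (simp add: mpoly_ring_def)
    then have "peval pconst y g' \<in> C j"
      using prj.prime_power_cancel[OF yc[OF jn] pg'] y[OF jn] by blast
    then have in1: "peval pconst y g' \<in> C (Suc j)" using strict[OF jn] by auto
    define g0 where "g0 = (\<Sum>k\<in>{k\<in>keys g'. lookup k j = 0}. single k (lookup g' k))"
    have l0: "lookup g0 m = (if lookup m j = 0 then lookup g' m else 0)" for m
    proof -
      have "lookup g0 m = (\<Sum>k\<in>{k\<in>keys g'. lookup k j = 0}. if k = m then lookup g' m else 0)"
        unfolding g0_def lookup_sum by (intro sum.cong) (auto simp: lookup_single when_def)
      then show ?thesis by (auto simp: in_keys_iff)
    qed
    have k0': "k0 = single j e + (k0 - single j e)"
      using k0 by (intro poly_mapping_eqI) (auto simp: lookup_add lookup_minus lookup_single when_def)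
    have "lookup g' (k0 - single j e) \<noteq> 0"
      using k0(1) k0' unfolding g'(2) by (simp add: in_keys_iff)
    moreover have "lookup (k0 - single j e) j = 0" using k0(2) by (simp add: lookup_minus)
    ultimately have "g0 \<noteq> 0" using l0 by (metis lookup_zero)
    moreover have "\<forall>m\<in>keys g0. keys m \<subseteq> {Suc j..n}"
    proof (intro ballI subsetI)
      fix m i assume m: "m \<in> keys g0" "i \<in> keys m"
      then have "m \<in> keys g'" "i \<noteq> j" using l0 by (auto simp: in_keys_iff split: if_splits)
      then have "i \<in> {j..n}" using g'v m by blast
      then show "i \<in> {Suc j..n}" using \<open>i \<noteq> j\<close> by auto
    qed
    moreover have "peval pconst y g0 \<in> C (Suc j)"
    proof -
      have "1 \<le> lookup k j" if "k \<in> keys (g' - g0)" for k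
        using that l0 by (auto simp: in_keys_iff lookup_minus split: if_splits)
      then obtain r where r: "g' - g0 = single (single j 1) 1 * r"
        "\<And>l. lookup r l = lookup (g' - g0) (single j 1 + l)"
        using divide_by_power[of "g' - g0" 1 j] by metis
      have "\<forall>m\<in>keys r. keys m \<subseteq> {..n}"
      proof (intro ballI subsetI)
        fix m i assume m: "m \<in> keys r" "i \<in> keys m"
        then have "single j 1 + m \<in> keys g'"
          using r(2) l0 by (auto simp: in_keys_iff lookup_minus split: if_splits)
        moreover have "i \<in> keys (single j 1 + m)" using m by (simp add: in_keys_iff lookup_add)
        ultimately show "i \<in> {..n}" using g'v by fastforce
      qed
      then have rc: "peval pconst y r \<in> carrier (mpoly_ring n)" by (rule pe)
      have "y j * peval pconst y r \<in> C (Suc j)"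
        using prS.I_r_closed[of "y j" "peval pconst y r"] y[OF jn] rc by (simp add: mpoly_ring_def)
      moreover have "peval pconst y g0 = peval pconst y g' - y j * peval pconst y r"
      proof -
        have "peval pconst y (g' - g0) = y j * peval pconst y r"
          unfolding r(1) by (simp add: peval_mult[OF coefficient_hom_single] peval_single[OF coefficient_hom_single])
        then show ?thesis by (simp add: peval_minus[OF coefficient_hom_single] algebra_simps)
      qed
      moreover have "a - b \<in> C (Suc j)" if "a \<in> C (Suc j)" "b \<in> C (Suc j)" for a b
      proof -
        have "pconst (-1) * b \<in> C (Suc j)"
          using prS.I_l_closed[of b "pconst (-1)"] that by (simp add: mpoly_ring_def)
        then have "a + pconst (-1) * b \<in> C (Suc j)"
          using prS.a_closed[of a "pconst (-1) * b"] that by (simp add: mpoly_ring_def)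
        then show ?thesis by (simp add: single_uminus)
      qed
      ultimately show ?thesis using in1 by simp
    qed
    ultimately show ?case by blast
  qed
  from this[of "n + 1"] obtain g where g: "g \<noteq> 0" "\<forall>m\<in>keys g. keys m \<subseteq> {n + 1..n}"
    "peval pconst y g \<in> C (n + 1)" by auto
  have "keys g \<subseteq> {0}" using g(2) by auto
  then have gc: "g = pconst (lookup g 0)" using poly_mapping_sum_single[of "{0}" g] by simp
  define c where "c = lookup g 0"
  have "c \<noteq> 0" using g(1) gc by (auto simp: c_def)
  have "peval pconst y g = pconst c" by (subst gc) (simp add: peval_const c_def)
  then have "pconst c \<in> C (n + 1)" using g(3) by simp
  interpret pr: primeideal "C (n + 1)" "mpoly_ring n" using C by simp
  have "pconst (1 / c) \<otimes>\<^bsub>mpoly_ring n\<^esub> pconst c \<in> C (n + 1)"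
    by (rule pr.I_l_closed[OF \<open>pconst c \<in> _\<close>]) simp
  then have "\<one>\<^bsub>mpoly_ring n\<^esub> \<in> C (n + 1)" using \<open>c \<noteq> 0\<close> by (simp add: mpoly_ring_def mult_single)
  then show False using pr.one_imp_carrier pr.I_notcarr by blast
qed

section \<open>The hypersurface ring\<close>

lemma mpoly_ring_simps [simp]:
  "a \<otimes>\<^bsub>mpoly_ring n\<^esub> b = a * b" "a \<oplus>\<^bsub>mpoly_ring n\<^esub> b = a + b" "\<one>\<^bsub>mpoly_ring n\<^esub> = 1" "\<zero>\<^bsub>mpoly_ring n\<^esub> = 0"
  by (simp_all add: mpoly_ring_def)

lemma mpoly_ring_domain: "domain (mpoly_ring n :: ('k::field) mpoly ring)"
proof -
  let ?S = "mpoly_ring n :: 'k mpoly ring"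
  have "cring ?S"
  proof (rule cringI)
    show "abelian_group ?S"
    proof (rule abelian_groupI)
      fix x assume "x \<in> carrier ?S"
      then show "\<exists>y\<in>carrier ?S. y \<oplus>\<^bsub>?S\<^esub> x = \<zero>\<^bsub>?S\<^esub>"
        by (intro bexI[of _ "- x"]) auto
    qed (auto simp: add_ac)
    show "comm_monoid ?S" by (rule comm_monoidI) (auto simp: mult_ac)
  qed (simp add: distrib_right)
  then show ?thesis by (rule domain.intro) (unfold_locales, auto)
qed

lemma mpoly_ring_minus:
  "p \<in> carrier (mpoly_ring n) \<Longrightarrow> q \<in> carrier (mpoly_ring n) \<Longrightarrow> p \<ominus>\<^bsub>mpoly_ring n\<^esub> q = p - q"
proof -
  assume pq: "p \<in> carrier (mpoly_ring n)" "q \<in> carrier (mpoly_ring n)"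
  interpret domain "mpoly_ring n :: 'a mpoly ring" by (rule mpoly_ring_domain)
  have "\<ominus>\<^bsub>mpoly_ring n\<^esub> q = - q"
    using pq minus_equality[of "- q" q] by simp
  then show ?thesis by (simp add: a_minus_def)
qed

text \<open>Closure under differences is covered by multiplication with \<open>\<ominus> \<one>\<close>.\<close>

lemma idealI_closed:
  fixes R (structure)
  assumes R: "cring R" and sub: "I \<subseteq> carrier R" and z: "\<zero> \<in> I"
    and add: "\<And>a b. a \<in> I \<Longrightarrow> b \<in> I \<Longrightarrow> a \<oplus> b \<in> I"
    and mult: "\<And>a x. a \<in> I \<Longrightarrow> x \<in> carrier R \<Longrightarrow> x \<otimes> a \<in> I"
  shows "ideal I R"
proof -
  interpret cring R by (rule R)
  show ?thesis
  proof (rule idealI)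
    show "ring R" by (rule ring_axioms)
    show "subgroup I (add_monoid R)"
    proof (rule add.subgroupI)
      fix a assume a: "a \<in> I"
      then have "\<ominus> \<one> \<otimes> a \<in> I" using mult by simp
      then show "\<ominus> a \<in> I" using a sub by (metis l_minus l_one one_closed subsetD)
    qed (use sub z add in auto)
    show "x \<otimes> a \<in> I" if "a \<in> I" "x \<in> carrier R" for a x by (rule mult[OF that])
    show "a \<otimes> x \<in> I" if "a \<in> I" "x \<in> carrier R" for a x
      using mult[OF that] that sub m_comm[of a x] by auto
  qed
qed

text \<open>Polynomials are the working representation of the elements of \<open>R\<close>; \<open>rc\<close> passes to residue
classes and \<open>rep\<close> chooses a representative.\<close>

locale hypersurface =
  fixes n :: nat and f :: "('k::field) mpoly"
  assumes f_carrier: "f \<in> carrier (mpoly_ring n)"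
begin

abbreviation "S \<equiv> mpoly_ring n :: 'k mpoly ring"
abbreviation "R \<equiv> hypersurface_ring n f"
abbreviation "rc \<equiv> residue_class n f"

lemma I_ideal: "ideal (cgenideal S f) S"
proof -
  interpret domain S by (rule mpoly_ring_domain)
  show ?thesis by (rule cgenideal_ideal[OF f_carrier])
qed

lemma R_carrier: "carrier R = rc ` carrier S"
  by (auto simp: hypersurface_ring_def FactRing_def A_RCOSETS_def' residue_class_def)

lemma R_mult: "p \<in> carrier S \<Longrightarrow> q \<in> carrier S \<Longrightarrow> rc p \<otimes>\<^bsub>R\<^esub> rc q = rc (p * q)"
  using ideal.rcoset_mult_add[OF I_ideal, of p q]
  by (simp add: hypersurface_ring_def FactRing_def residue_class_def)

lemma R_add: "p \<in> carrier S \<Longrightarrow> q \<in> carrier S \<Longrightarrow> rc p \<oplus>\<^bsub>R\<^esub> rc q = rc (p + q)"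
  using ideal.a_rcos_sum[OF I_ideal, of p q]
  by (simp add: hypersurface_ring_def FactRing_def residue_class_def)

lemma R_one: "\<one>\<^bsub>R\<^esub> = rc 1"
  by (simp add: hypersurface_ring_def FactRing_def residue_class_def)

lemma R_zero: "\<zero>\<^bsub>R\<^esub> = rc 0"
proof -
  interpret ideal "cgenideal S f" S by (rule I_ideal)
  show ?thesis
    using a_coset_add_zero[of "cgenideal S f"] a_subset
    by (simp add: hypersurface_ring_def FactRing_def residue_class_def)
qed

lemma rc_eq_iff:
  assumes "p \<in> carrier S" "q \<in> carrier S"
  shows "rc p = rc q \<longleftrightarrow> (\<exists>s\<in>carrier S. p - q = f * s)"
proof -
  interpret domain S by (rule mpoly_ring_domain)
  have "rc p = rc q \<longleftrightarrow> p \<ominus>\<^bsub>S\<^esub> q \<in> cgenideal S f"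
    using quotient_eq_iff_same_a_r_cos[OF I_ideal assms] by (auto simp: residue_class_def)
  then show ?thesis using assms by (auto simp: mpoly_ring_minus cgenideal_def mult.commute)
qed

lemma R_cring: "cring R"
proof -
  interpret domain S by (rule mpoly_ring_domain)
  have "cring (S Quot cgenideal S f)" by (rule ideal.quotient_is_cring[OF I_ideal is_cring])
  then interpret Q: cring "S Quot cgenideal S f" .
  have eq: "carrier R = carrier (S Quot cgenideal S f)" "monoid.mult R = monoid.mult (S Quot cgenideal S f)"
    "ring.add R = ring.add (S Quot cgenideal S f)" "\<one>\<^bsub>R\<^esub> = \<one>\<^bsub>S Quot cgenideal S f\<^esub>" "\<zero>\<^bsub>R\<^esub> = \<zero>\<^bsub>S Quot cgenideal S f\<^esub>"
    by (simp_all add: hypersurface_ring_def Let_def)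
  show ?thesis
  proof (rule cringI)
    show "abelian_group R"
      by (rule abelian_groupI) (auto simp: eq Q.a_ac Q.l_neg intro: bexI[of _ "\<ominus>\<^bsub>S Quot cgenideal S f\<^esub> _"])
    show "comm_monoid R" by (rule comm_monoidI) (auto simp: eq Q.m_ac)
  qed (auto simp: eq Q.l_distr)
qed

lemma rc_closed [simp, intro]: "p \<in> carrier S \<Longrightarrow> rc p \<in> carrier R"
  by (simp add: R_carrier)

definition rep :: "'k mpoly set \<Rightarrow> 'k mpoly" where
  "rep a = (SOME p. p \<in> carrier S \<and> rc p = a)"

lemma rep:
  assumes "a \<in> carrier R"
  shows rep_closed: "rep a \<in> carrier S" and rc_rep: "rc (rep a) = a"
proof -
  have "\<exists>p. p \<in> carrier S \<and> rc p = a" using assms by (auto simp: R_carrier)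
  from someI_ex[OF this] show "rep a \<in> carrier S" "rc (rep a) = a" by (auto simp: rep_def)
qed

lemma rc_ring_hom: "ring_hom_ring S R rc"
proof -
  interpret domain S by (rule mpoly_ring_domain)
  interpret R: cring R by (rule R_cring)
  show ?thesis
    by (intro ring_hom_ringI2 ring_axioms R.ring_axioms ring_hom_memI) (auto simp: R_mult R_add R_one)
qed

lemma rc_eq_zero_iff: "p \<in> carrier S \<Longrightarrow> rc p = \<zero>\<^bsub>R\<^esub> \<longleftrightarrow> (\<exists>s\<in>carrier S. p = f * s)"
  using rc_eq_iff[of p 0] by (simp add: R_zero)

end

section \<open>Localization of a domain\<close>

text \<open>Over a domain the equality of fractions is cross multiplication, without the auxiliary factor of the general
definition.\<close>

locale domain_localization = domain R for R (structure) +
  fixes T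
  assumes T_sub: "T \<subseteq> carrier R" and T_one: "\<one> \<in> T" and T_mult: "\<And>s t. s \<in> T \<Longrightarrow> t \<in> T \<Longrightarrow> s \<otimes> t \<in> T"
    and T_zero: "\<zero> \<notin> T"
begin

abbreviation "L \<equiv> localization R T"
abbreviation "fr \<equiv> fraction R T"

lemma T_carrier [simp, intro]: "s \<in> T \<Longrightarrow> s \<in> carrier R" using T_sub by blast

lemma T_nonzero: "s \<in> T \<Longrightarrow> s \<noteq> \<zero>" using T_zero by blast

lemma fraction_rel_iff:
  "((a, s), (b, t)) \<in> fraction_rel R T \<longleftrightarrow>
    a \<in> carrier R \<and> s \<in> T \<and> b \<in> carrier R \<and> t \<in> T \<and> a \<otimes> t = b \<otimes> s"
proof -
  have "u \<otimes> (a \<otimes> t) = u \<otimes> (b \<otimes> s) \<longleftrightarrow> a \<otimes> t = b \<otimes> s"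
    if "a \<in> carrier R" "s \<in> T" "b \<in> carrier R" "t \<in> T" "u \<in> T" for u
    using that m_lcancel[of u "a \<otimes> t" "b \<otimes> s"] T_nonzero by auto
  then show ?thesis unfolding fraction_rel_def using T_one by auto
qed

lemma fraction_rel_equiv: "equiv (carrier R \<times> T) (fraction_rel R T)"
proof (rule equivI)
  show "fraction_rel R T \<subseteq> (carrier R \<times> T) \<times> carrier R \<times> T"
    by (auto simp: fraction_rel_def)
  show "refl_on (carrier R \<times> T) (fraction_rel R T)"
    by (rule refl_onI) (auto simp: fraction_rel_iff)
  show "sym (fraction_rel R T)"
    by (rule symI) (auto simp: fraction_rel_iff)
  show "trans (fraction_rel R T)"
  proof (rule transI)
    fix x y z assume xy: "(x, y) \<in> fraction_rel R T" and yz: "(y, z) \<in> fraction_rel R T"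
    obtain a s b t c u where e: "x = (a, s)" "y = (b, t)" "z = (c, u)" by (metis surj_pair)
    have c: "a \<in> carrier R" "s \<in> T" "b \<in> carrier R" "t \<in> T" "c \<in> carrier R" "u \<in> T"
      and 1: "a \<otimes> t = b \<otimes> s" and 2: "b \<otimes> u = c \<otimes> t"
      using xy yz unfolding e fraction_rel_iff by auto
    have "t \<otimes> (a \<otimes> u) = (a \<otimes> t) \<otimes> u" using c by (simp add: m_ac)
    also have "\<dots> = (b \<otimes> u) \<otimes> s" using c 1 by (simp add: m_ac)
    also have "\<dots> = t \<otimes> (c \<otimes> s)" using c 2 by (simp add: m_ac)
    finally have "a \<otimes> u = c \<otimes> s" using c m_lcancel[of t "a \<otimes> u" "c \<otimes> s"] T_nonzero by simp
    then show "(x, z) \<in> fraction_rel R T" unfolding e fraction_rel_iff using c by simp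
  qed
qed

lemma fraction_eq_iff:
  assumes "a \<in> carrier R" "s \<in> T" "b \<in> carrier R" "t \<in> T"
  shows "fr a s = fr b t \<longleftrightarrow> a \<otimes> t = b \<otimes> s"
  unfolding fraction_def using eq_equiv_class_iff[OF fraction_rel_equiv, of "(a, s)" "(b, t)"] assms
  by (simp add: fraction_rel_iff)

lemma localization_carrier: "carrier L = {fr a s | a s. a \<in> carrier R \<and> s \<in> T}"
  by (auto simp: localization_def fraction_def quotient_def)

lemma fraction_closed [simp, intro]: "a \<in> carrier R \<Longrightarrow> s \<in> T \<Longrightarrow> fr a s \<in> carrier L"
  by (auto simp: localization_carrier)

lemma in_fraction: "(a, s) \<in> fr b t \<longleftrightarrow> b \<in> carrier R \<and> t \<in> T \<and> a \<in> carrier R \<and> s \<in> T \<and> b \<otimes> s = a \<otimes> t"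
  by (simp add: fraction_def fraction_rel_iff)

lemma localization_mult:
  assumes "a \<in> carrier R" "s \<in> T" "b \<in> carrier R" "t \<in> T"
  shows "fr a s \<otimes>\<^bsub>L\<^esub> fr b t = fr (a \<otimes> b) (s \<otimes> t)"
proof -
  have "(\<Union>(a, s)\<in>fr a s. \<Union>(b, t)\<in>fr b t. fr (a \<otimes> b) (s \<otimes> t)) = fr (a \<otimes> b) (s \<otimes> t)"
  proof -
    have *: "fr (a' \<otimes> b') (s' \<otimes> t') = fr (a \<otimes> b) (s \<otimes> t)"
      if p: "(a', s') \<in> fr a s" "(b', t') \<in> fr b t" for a' s' b' t'
    proof -
      have c: "a' \<in> carrier R" "s' \<in> T" "b' \<in> carrier R" "t' \<in> T" and 1: "a \<otimes> s' = a' \<otimes> s" and 2: "b \<otimes> t' = b' \<otimes> t"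
        using p unfolding in_fraction by auto
      have "(a' \<otimes> b') \<otimes> (s \<otimes> t) = (a' \<otimes> s) \<otimes> (b' \<otimes> t)" using c assms by (simp add: m_ac)
      also have "\<dots> = (a \<otimes> s') \<otimes> (b \<otimes> t')" using 1 2 by simp
      also have "\<dots> = (a \<otimes> b) \<otimes> (s' \<otimes> t')" using c assms by (simp add: m_ac)
      finally show ?thesis using c assms T_mult by (simp add: fraction_eq_iff)
    qed
    have "(a, s) \<in> fr a s" "(b, t) \<in> fr b t" using assms by (auto simp: in_fraction)
    then show ?thesis using * by fast
  qed
  then show ?thesis by (simp add: localization_def)
qed

lemma localization_add:
  assumes "a \<in> carrier R" "s \<in> T" "b \<in> carrier R" "t \<in> T"
  shows "fr a s \<oplus>\<^bsub>L\<^esub> fr b t = fr (a \<otimes> t \<oplus> b \<otimes> s) (s \<otimes> t)"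
proof -
  have "(\<Union>(a, s)\<in>fr a s. \<Union>(b, t)\<in>fr b t. fr (a \<otimes> t \<oplus> b \<otimes> s) (s \<otimes> t)) = fr (a \<otimes> t \<oplus> b \<otimes> s) (s \<otimes> t)"
  proof -
    have *: "fr (a' \<otimes> t' \<oplus> b' \<otimes> s') (s' \<otimes> t') = fr (a \<otimes> t \<oplus> b \<otimes> s) (s \<otimes> t)"
      if p: "(a', s') \<in> fr a s" "(b', t') \<in> fr b t" for a' s' b' t'
    proof -
      have c: "a' \<in> carrier R" "s' \<in> T" "b' \<in> carrier R" "t' \<in> T" and 1: "a \<otimes> s' = a' \<otimes> s" and 2: "b \<otimes> t' = b' \<otimes> t"
        using p unfolding in_fraction by auto
      have "(a' \<otimes> t' \<oplus> b' \<otimes> s') \<otimes> (s \<otimes> t) = (a' \<otimes> s) \<otimes> (t' \<otimes> t) \<oplus> (b' \<otimes> t) \<otimes> (s' \<otimes> s)"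
        using c assms by (simp add: m_ac l_distr r_distr)
      also have "\<dots> = (a \<otimes> s') \<otimes> (t' \<otimes> t) \<oplus> (b \<otimes> t') \<otimes> (s' \<otimes> s)" using 1 2 by simp
      also have "\<dots> = (a \<otimes> t \<oplus> b \<otimes> s) \<otimes> (s' \<otimes> t')" using c assms by (simp add: m_ac l_distr r_distr)
      finally show ?thesis using c assms T_mult by (simp add: fraction_eq_iff)
    qed
    have "(a, s) \<in> fr a s" "(b, t) \<in> fr b t" using assms by (auto simp: in_fraction)
    then show ?thesis using * by fast
  qed
  then show ?thesis by (simp add: localization_def)
qed

lemma localization_one: "\<one>\<^bsub>L\<^esub> = fr \<one> \<one>" and localization_zero: "\<zero>\<^bsub>L\<^esub> = fr \<zero> \<one>"
  by (simp_all add: localization_def)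

lemma localizationE:
  assumes "x \<in> carrier L"
  obtains a s where "a \<in> carrier R" "s \<in> T" "x = fr a s"
  using assms by (auto simp: localization_carrier)

lemma localization_cring: "cring L"
proof (rule cringI)
  show "abelian_group L"
  proof (rule abelian_groupI)
    fix x y assume "x \<in> carrier L" "y \<in> carrier L"
    then show "x \<oplus>\<^bsub>L\<^esub> y \<in> carrier L"
      by (elim localizationE) (auto simp: localization_add intro!: fraction_closed T_mult)
  next
    show "\<zero>\<^bsub>L\<^esub> \<in> carrier L" using T_one by (auto simp: localization_zero)
  next
    fix x y z assume "x \<in> carrier L" "y \<in> carrier L" "z \<in> carrier L"
    then obtain a s b t c u where e: "x = fr a s" "y = fr b t" "z = fr c u"
      and c: "a \<in> carrier R" "s \<in> T" "b \<in> carrier R" "t \<in> T" "c \<in> carrier R" "u \<in> T"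
      by (elim localizationE) blast
    have "(a \<otimes> t \<oplus> b \<otimes> s) \<otimes> u \<oplus> c \<otimes> (s \<otimes> t) = a \<otimes> (t \<otimes> u) \<oplus> (b \<otimes> u \<oplus> c \<otimes> t) \<otimes> s"
      using c by (simp add: l_distr r_distr m_ac a_ac)
    then show "x \<oplus>\<^bsub>L\<^esub> y \<oplus>\<^bsub>L\<^esub> z = x \<oplus>\<^bsub>L\<^esub> (y \<oplus>\<^bsub>L\<^esub> z)"
      unfolding e using c T_mult by (simp add: localization_add m_assoc)
  next
    fix x y assume "x \<in> carrier L" "y \<in> carrier L"
    then obtain a s b t where e: "x = fr a s" "y = fr b t" and c: "a \<in> carrier R" "s \<in> T" "b \<in> carrier R" "t \<in> T"
      by (elim localizationE) blast
    show "x \<oplus>\<^bsub>L\<^esub> y = y \<oplus>\<^bsub>L\<^esub> x"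
      unfolding e using c by (simp add: localization_add m_comm a_comm)
  next
    fix x assume "x \<in> carrier L"
    then obtain a s where e: "x = fr a s" and c: "a \<in> carrier R" "s \<in> T" by (elim localizationE) blast
    show "\<zero>\<^bsub>L\<^esub> \<oplus>\<^bsub>L\<^esub> x = x" unfolding e localization_zero using c T_one by (simp add: localization_add)
    have "fr (\<ominus> a) s \<oplus>\<^bsub>L\<^esub> x = \<zero>\<^bsub>L\<^esub>"
      unfolding e localization_zero using c T_one T_mult
      by (simp add: localization_add fraction_eq_iff l_minus l_neg)
    then show "\<exists>y\<in>carrier L. y \<oplus>\<^bsub>L\<^esub> x = \<zero>\<^bsub>L\<^esub>" using c by (intro bexI[of _ "fr (\<ominus> a) s"]) auto
  qed
  show "comm_monoid L"
  proof (rule comm_monoidI)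
    fix x y assume "x \<in> carrier L" "y \<in> carrier L"
    then obtain a s b t where e: "x = fr a s" "y = fr b t" and c: "a \<in> carrier R" "s \<in> T" "b \<in> carrier R" "t \<in> T"
      by (elim localizationE) blast
    show "x \<otimes>\<^bsub>L\<^esub> y \<in> carrier L" unfolding e using c T_mult by (auto simp: localization_mult)
    show "x \<otimes>\<^bsub>L\<^esub> y = y \<otimes>\<^bsub>L\<^esub> x" unfolding e using c by (simp add: localization_mult m_comm)
  next
    show "\<one>\<^bsub>L\<^esub> \<in> carrier L" using T_one by (auto simp: localization_one)
  next
    fix x y z assume "x \<in> carrier L" "y \<in> carrier L" "z \<in> carrier L"
    then obtain a s b t c u where e: "x = fr a s" "y = fr b t" "z = fr c u"
      and c: "a \<in> carrier R" "s \<in> T" "b \<in> carrier R" "t \<in> T" "c \<in> carrier R" "u \<in> T"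
      by (elim localizationE) blast
    show "x \<otimes>\<^bsub>L\<^esub> y \<otimes>\<^bsub>L\<^esub> z = x \<otimes>\<^bsub>L\<^esub> (y \<otimes>\<^bsub>L\<^esub> z)"
      unfolding e using c T_mult by (simp add: localization_mult m_assoc)
  next
    fix x assume "x \<in> carrier L"
    then obtain a s where e: "x = fr a s" and c: "a \<in> carrier R" "s \<in> T" by (elim localizationE) blast
    show "\<one>\<^bsub>L\<^esub> \<otimes>\<^bsub>L\<^esub> x = x" unfolding e localization_one using c T_one by (simp add: localization_mult)
  qed
next
  fix x y z assume "x \<in> carrier L" "y \<in> carrier L" "z \<in> carrier L"
  then obtain a s b t c u where e: "x = fr a s" "y = fr b t" "z = fr c u"
    and c: "a \<in> carrier R" "s \<in> T" "b \<in> carrier R" "t \<in> T" "c \<in> carrier R" "u \<in> T"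
    by (elim localizationE) blast
  have "(a \<otimes> t \<oplus> b \<otimes> s) \<otimes> c \<otimes> ((s \<otimes> u) \<otimes> (t \<otimes> u)) = (a \<otimes> c \<otimes> (t \<otimes> u) \<oplus> b \<otimes> c \<otimes> (s \<otimes> u)) \<otimes> (s \<otimes> t \<otimes> u)"
    using c by (simp add: l_distr r_distr m_ac)
  then show "(x \<oplus>\<^bsub>L\<^esub> y) \<otimes>\<^bsub>L\<^esub> z = x \<otimes>\<^bsub>L\<^esub> z \<oplus>\<^bsub>L\<^esub> y \<otimes>\<^bsub>L\<^esub> z"
    unfolding e using c T_mult by (simp add: localization_add localization_mult fraction_eq_iff)
qed

lemma fraction_one_hom: "ring_hom_ring R L (\<lambda>a. fr a \<one>)"
proof -
  interpret L: cring L by (rule localization_cring)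
  show ?thesis
    by (intro ring_hom_ringI2 ring_axioms L.ring_axioms ring_hom_memI)
       (use T_one in \<open>auto simp: localization_mult localization_add localization_one\<close>)
qed

end

lemma (in "domain") fraction_field_localization: "domain_localization R (carrier R - {\<zero>})"
  by unfold_locales (auto dest: integral)

lemma (in "domain") fraction_field_is_field: "field (fraction_field R)"
proof -
  interpret domain_localization R "carrier R - {\<zero>}" by (rule fraction_field_localization)
  interpret L: cring L by (rule localization_cring)
  show ?thesis
  proof (rule L.cring_fieldI2)
    show "\<zero>\<^bsub>L\<^esub> \<noteq> \<one>\<^bsub>L\<^esub>" unfolding localization_one localization_zero by (simp add: fraction_eq_iff)
    fix x assume "x \<in> carrier L" and nz: "x \<noteq> \<zero>\<^bsub>L\<^esub>"
    then obtain a s where e: "x = fr a s" and c: "a \<in> carrier R" "s \<in> carrier R - {\<zero>}" by (elim localizationE) blast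
    have "a \<noteq> \<zero>" using nz c unfolding e localization_zero by (auto simp: fraction_eq_iff)
    then have "a \<otimes> s \<in> carrier R - {\<zero>}" using c integral[of a s] by auto
    then have "x \<otimes>\<^bsub>L\<^esub> fr s a = \<one>\<^bsub>L\<^esub>" unfolding e localization_one using c \<open>a \<noteq> \<zero>\<close>
      by (simp add: localization_mult fraction_eq_iff m_comm)
    then show "\<exists>b\<in>carrier L. x \<otimes>\<^bsub>L\<^esub> b = \<one>\<^bsub>L\<^esub>" using c \<open>a \<noteq> \<zero>\<close> by (intro bexI[of _ "fr s a"]) auto
  qed
qed

section \<open>Singular points\<close>

abbreviation point_value :: "(nat \<Rightarrow> 'k::field) \<Rightarrow> 'k mpoly \<Rightarrow> 'k" where
  "point_value \<equiv> peval (\<lambda>x. x)"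

lemmas point_value_simps = peval_zero[OF coefficient_hom_id] peval_add[OF coefficient_hom_id]
  peval_mult[OF coefficient_hom_id] peval_one[OF coefficient_hom_id] peval_minus[OF coefficient_hom_id]
  peval_single[OF coefficient_hom_id] peval_uminus[OF coefficient_hom_id]

definition directional :: "nat \<Rightarrow> (nat \<Rightarrow> 'k) \<Rightarrow> (nat \<Rightarrow> 'k::field) \<Rightarrow> 'k mpoly \<Rightarrow> 'k" where
  "directional n c Q p = (\<Sum>i<n. c i * point_value Q (pderivative i p))"

lemma directional_mult: "directional n c Q (p * q) = point_value Q p * directional n c Q q + point_value Q q * directional n c Q p"
  by (simp add: directional_def pderivative_mult point_value_simps distrib_left sum.distrib sum_distrib_left mult_ac)

lemma directional_add: "directional n c Q (p + q) = directional n c Q p + directional n c Q q"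
  by (simp add: directional_def pderivative_add point_value_simps distrib_left sum.distrib)

lemma directional_minus: "directional n c Q (p - q) = directional n c Q p - directional n c Q q"
  by (simp add: directional_def pderivative_minus point_value_simps right_diff_distrib sum_subtractf)

lemma directional_const: "directional n c Q (pconst a) = 0"
  by (simp add: directional_def point_value_simps)

lemma directional_var: "i < n \<Longrightarrow> directional n c Q (pvar i) = c i"
proof -
  assume i: "i < n"
  have "pderivative j (pvar i) = (if j = i then 1 else 0 :: 'a mpoly)" for j
    by (auto simp: pderivative_single lookup_single when_def)
  then have "directional n c Q (pvar i) = (\<Sum>j<n. if j = i then c i else 0)"
    unfolding directional_def by (intro sum.cong) (auto simp: point_value_simps)
  then show ?thesis using i by simp
qed

text \<open>A point of the affine cone at which \<open>f\<close> vanishes together with its differential. The ideal \<open>P\<close>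
consists of the functions that vanish at the point, and \<open>T\<close> is its complement.\<close>

locale singular_point = hypersurface n f for n and f :: "('k::field) mpoly" +
  fixes Q :: "nat \<Rightarrow> 'k"
  assumes f_nonzero: "f \<noteq> 0" and R_domain: "domain R" and n_pos: "n > 0"
    and f_value: "point_value Q f = 0" and f_deriv: "\<And>i. i < n \<Longrightarrow> point_value Q (pderivative i f) = 0"
begin

definition "P = {rc p | p. p \<in> carrier S \<and> point_value Q p = 0}"
definition "T = carrier R - P"

lemma rc_in_P: "p \<in> carrier S \<Longrightarrow> rc p \<in> P \<longleftrightarrow> point_value Q p = 0"
proof
  assume p: "p \<in> carrier S" and "rc p \<in> P"
  then obtain q where q: "q \<in> carrier S" "rc p = rc q" "point_value Q q = 0" by (auto simp: P_def)
  then obtain s where "p - q = f * s" using rc_eq_iff[OF p q(1)] by auto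
  then have "point_value Q (p - q) = 0" by (simp add: point_value_simps f_value)
  then show "point_value Q p = 0" using q by (simp add: point_value_simps)
qed (auto simp: P_def)

lemma rc_in_T: "p \<in> carrier S \<Longrightarrow> rc p \<in> T \<longleftrightarrow> point_value Q p \<noteq> 0"
  by (simp add: T_def rc_in_P)

lemma TE: assumes "x \<in> T" obtains p where "p \<in> carrier S" "x = rc p" "point_value Q p \<noteq> 0"
  using assms rc_in_T by (auto simp: T_def R_carrier)

lemma P_prime: "primeideal P R"
proof (rule primeidealI)
  show "cring R" by (rule R_cring)
  show "ideal P R"
  proof (rule idealI_closed[OF R_cring])
    show "P \<subseteq> carrier R" by (auto simp: P_def)
    show "\<zero>\<^bsub>R\<^esub> \<in> P" by (simp add: R_zero rc_in_P point_value_simps)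
    show "a \<oplus>\<^bsub>R\<^esub> b \<in> P" if ab: "a \<in> P" "b \<in> P" for a b
    proof -
      obtain p q where "a = rc p" "b = rc q" "p \<in> carrier S" "q \<in> carrier S" "point_value Q p = 0" "point_value Q q = 0"
        using ab by (auto simp: P_def)
      then show ?thesis by (simp add: R_add rc_in_P point_value_simps)
    qed
    show "x \<otimes>\<^bsub>R\<^esub> a \<in> P" if ab: "a \<in> P" "x \<in> carrier R" for a x
    proof -
      obtain p q where "a = rc p" "x = rc q" "p \<in> carrier S" "q \<in> carrier S" "point_value Q p = 0"
        using ab by (auto simp: P_def R_carrier)
      then show ?thesis by (simp add: R_mult rc_in_P point_value_simps)
    qed
  qed
  show "carrier R \<noteq> P"
  proof
    assume "carrier R = P"
    then have "rc 1 \<in> P" using rc_closed[of 1] mpoly_carrier_one[of n] by blast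
    then show False by (simp add: rc_in_P point_value_simps)
  qed
  fix a b assume ab: "a \<in> carrier R" "b \<in> carrier R" and prod: "a \<otimes>\<^bsub>R\<^esub> b \<in> P"
  obtain p where p: "a = rc p" "p \<in> carrier S" using ab(1) unfolding R_carrier by (rule imageE)
  obtain q where q: "b = rc q" "q \<in> carrier S" using ab(2) unfolding R_carrier by (rule imageE)
  show "a \<in> P \<or> b \<in> P" using prod unfolding p(1) q(1) using p(2) q(2) by (simp add: R_mult rc_in_P point_value_simps)
qed

sublocale loc: domain_localization R T
proof -
  interpret domain R by (rule R_domain)
  interpret primeideal P R by (rule P_prime)
  show "domain_localization R T"
  proof
    show "T \<subseteq> carrier R" by (auto simp: T_def)
    show "\<one>\<^bsub>R\<^esub> \<in> T" by (simp add: R_one rc_in_T point_value_simps)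
    show "s \<otimes>\<^bsub>R\<^esub> t \<in> T" if "s \<in> T" "t \<in> T" for s t using that I_prime by (auto simp: T_def)
    show "\<zero>\<^bsub>R\<^esub> \<notin> T" by (simp add: R_zero rc_in_T point_value_simps)
  qed
qed

text \<open>The germs that vanish at \<open>Q\<close> and whose derivative along \<open>c\<close> vanishes at \<open>Q\<close>. Every direction \<open>c\<close> is
admissible, because \<open>df\<close> vanishes at \<open>Q\<close>.\<close>

definition tangent_ideal :: "(nat \<Rightarrow> 'k) \<Rightarrow> ('k mpoly set \<times> 'k mpoly set) set set" where
  "tangent_ideal c = {loc.fr (rc p) (rc s) | p s. p \<in> carrier S \<and> s \<in> carrier S \<and>
     point_value Q s \<noteq> 0 \<and> point_value Q p = 0 \<and> directional n c Q p = 0}"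

lemma ideal_tangent_ideal: "ideal (tangent_ideal c) loc.L"
proof (rule idealI_closed[OF loc.localization_cring])
  show "tangent_ideal c \<subseteq> carrier loc.L" by (auto simp: tangent_ideal_def rc_in_T)
  show "\<zero>\<^bsub>loc.L\<^esub> \<in> tangent_ideal c"
    unfolding tangent_ideal_def loc.localization_zero R_zero R_one
    using directional_const[of n c Q 0]
    by (intro CollectI exI[of _ 0] exI[of _ 1]) (auto simp: point_value_simps)
next
  fix a b assume "a \<in> tangent_ideal c" "b \<in> tangent_ideal c"
  then obtain p s q t where e: "a = loc.fr (rc p) (rc s)" "b = loc.fr (rc q) (rc t)"
    and c: "p \<in> carrier S" "s \<in> carrier S" "q \<in> carrier S" "t \<in> carrier S"
    and v: "point_value Q s \<noteq> 0" "point_value Q t \<noteq> 0" "point_value Q p = 0" "directional n c Q p = 0"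
      "point_value Q q = 0" "directional n c Q q = 0"
    unfolding tangent_ideal_def by blast
  have "a \<oplus>\<^bsub>loc.L\<^esub> b = loc.fr (rc (p * t + q * s)) (rc (s * t))"
    unfolding e using c v by (simp add: loc.localization_add rc_in_T R_mult R_add)
  then show "a \<oplus>\<^bsub>loc.L\<^esub> b \<in> tangent_ideal c"
    unfolding tangent_ideal_def using c v
    by (intro CollectI exI[of _ "p * t + q * s"] exI[of _ "s * t"])
      (auto simp: point_value_simps directional_add directional_mult)
next
  fix a x assume "a \<in> tangent_ideal c" "x \<in> carrier loc.L"
  moreover obtain r t where "x = loc.fr r t" "r \<in> carrier R" "t \<in> T"
    using \<open>x \<in> carrier loc.L\<close> by (auto elim: loc.localizationE)
  moreover obtain q where "r = rc q" "q \<in> carrier S" using \<open>r \<in> carrier R\<close> by (auto simp: R_carrier)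
  moreover obtain t' where "t = rc t'" "t' \<in> carrier S" "point_value Q t' \<noteq> 0" using \<open>t \<in> T\<close> by (rule TE)
  ultimately obtain p s where e: "a = loc.fr (rc p) (rc s)" "x = loc.fr (rc q) (rc t')"
    and c: "p \<in> carrier S" "s \<in> carrier S" "q \<in> carrier S" "t' \<in> carrier S"
    and v: "point_value Q s \<noteq> 0" "point_value Q t' \<noteq> 0" "point_value Q p = 0" "directional n c Q p = 0"
    unfolding tangent_ideal_def by blast
  have "x \<otimes>\<^bsub>loc.L\<^esub> a = loc.fr (rc (q * p)) (rc (t' * s))"
    unfolding e using c v by (simp add: loc.localization_mult rc_in_T R_mult)
  then show "x \<otimes>\<^bsub>loc.L\<^esub> a \<in> tangent_ideal c"
    unfolding tangent_ideal_def using c v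
    by (intro CollectI exI[of _ "q * p"] exI[of _ "t' * s"]) (auto simp: point_value_simps directional_mult)
qed

text \<open>Derivations at the point pass to the quotient by \<open>f\<close>.\<close>

lemma directional_relation: "directional n c Q (f * s) = 0"
  unfolding directional_mult by (simp add: f_value) (simp add: directional_def f_deriv)

text \<open>The differentials at \<open>Q\<close> of fewer than \<open>n\<close> functions have a common zero \<open>c \<noteq> 0\<close>. The functions and the ideal they
generate then lie in the tangent ideal of \<open>c\<close>, but some coordinate function does not.\<close>

lemma few_generators:
  assumes A: "finite A" "A \<subseteq> carrier loc.L" "card A < n"
    and sub: "A \<subseteq> {loc.fr r s | r s. r \<in> P \<and> s \<in> T}"
  shows "\<exists>i<n. loc.fr (rc (pvar i - pconst (Q i))) (rc 1) \<notin> genideal loc.L A"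
proof (rule ccontr)
  assume neg: "\<not> ?thesis"
  have "\<forall>a. \<exists>p s. a \<in> A \<longrightarrow> a = loc.fr (rc p) (rc s) \<and> p \<in> carrier S \<and> point_value Q p = 0 \<and> s \<in> carrier S \<and> point_value Q s \<noteq> 0"
  proof
    fix a
    show "\<exists>p s. a \<in> A \<longrightarrow> a = loc.fr (rc p) (rc s) \<and> p \<in> carrier S \<and> point_value Q p = 0 \<and> s \<in> carrier S \<and> point_value Q s \<noteq> 0"
    proof (cases "a \<in> A")
      case True
      then obtain r t where a: "a = loc.fr r t" "r \<in> P" "t \<in> T" using sub by blast
      obtain p where "r = rc p" "p \<in> carrier S" "point_value Q p = 0" using a(2) by (auto simp: P_def)
      moreover obtain s where "t = rc s" "s \<in> carrier S" "point_value Q s \<noteq> 0" using a(3) by (rule TE)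
      ultimately show ?thesis using a(1) by blast
    qed simp
  qed
  from choice[OF this] obtain p where "\<forall>a. \<exists>s. a \<in> A \<longrightarrow> a = loc.fr (rc (p a)) (rc s) \<and> p a \<in> carrier S \<and> point_value Q (p a) = 0 \<and> s \<in> carrier S \<and> point_value Q s \<noteq> 0"
    by blast
  note p = this
  obtain c where c: "\<exists>i\<in>{..<n}. c i \<noteq> 0" "\<forall>a\<in>A. (\<Sum>i<n. c i * point_value Q (pderivative i (p a))) = 0"
    using homogeneous_system_solvable[OF A(1), of "{..<n}" "\<lambda>i a. point_value Q (pderivative i (p a))"] A(3) by auto
  have "A \<subseteq> tangent_ideal c"
  proof
    fix a assume a: "a \<in> A"
    then obtain s where "a = loc.fr (rc (p a)) (rc s)" "p a \<in> carrier S" "point_value Q (p a) = 0" "s \<in> carrier S" "point_value Q s \<noteq> 0"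
      using p by blast
    then show "a \<in> tangent_ideal c" unfolding tangent_ideal_def directional_def using c(2) a by blast
  qed
  interpret L: cring loc.L by (rule loc.localization_cring)
  have sub: "genideal loc.L A \<subseteq> tangent_ideal c"
    by (rule L.genideal_minimal[OF ideal_tangent_ideal \<open>A \<subseteq> tangent_ideal c\<close>])
  obtain i where i: "i < n" "c i \<noteq> 0" using c(1) by auto
  let ?x = "pvar i - pconst (Q i)"
  have xc: "?x \<in> carrier S" using mpoly_carrier_var[OF i(1)] by (intro mpoly_carrier_minus) auto
  have "loc.fr (rc ?x) (rc 1) \<in> tangent_ideal c" using neg sub i(1) by blast
  then obtain q s where q: "loc.fr (rc ?x) (rc 1) = loc.fr (rc q) (rc s)" "q \<in> carrier S" "s \<in> carrier S"
     "point_value Q s \<noteq> 0" "point_value Q q = 0" "directional n c Q q = 0"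
    unfolding tangent_ideal_def by blast
  have "rc ?x \<otimes>\<^bsub>R\<^esub> rc s = rc q \<otimes>\<^bsub>R\<^esub> rc 1"
    using q xc by (subst (asm) loc.fraction_eq_iff) (auto simp: rc_in_T point_value_simps)
  then have "rc (?x * s) = rc q" using xc q by (simp add: R_mult)
  then obtain w where "?x * s - q = f * w" using rc_eq_iff[of "?x * s" q] xc q by auto
  then have "directional n c Q (?x * s - q) = 0" by (simp add: directional_relation)
  moreover have "directional n c Q ?x = c i" "point_value Q ?x = 0"
    using directional_var[OF i(1), of c Q] by (simp_all add: directional_minus directional_const point_value_simps)
  ultimately have "point_value Q s * c i = 0" using q by (simp add: directional_minus directional_mult)
  then show False using q(4) i(2) by simp
qed

text \<open>A chain of primes of the local ring pulls back to the polynomial ring, where it can be extended by the zero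
ideal, since its members contain \<open>f\<close>.\<close>

lemma krull_dim_bound: "krull_dim loc.L \<le> enat (n - 1)"
  unfolding krull_dim_def
proof (rule Sup_least)
  fix x assume "x \<in> {enat m |m. \<exists>P. (\<forall>i\<le>m. primeideal (P i) loc.L) \<and> (\<forall>i<m. P i \<subset> P (Suc i))}"
  then obtain m C where m: "x = enat m" and C: "\<forall>i\<le>m. primeideal (C i) loc.L" "\<forall>i<m. C i \<subset> C (Suc i)" by blast
  have "m \<le> n - 1"
  proof (rule ccontr)
    assume "\<not> m \<le> n - 1"
    then have mn: "n \<le> m" using n_pos by simp
    interpret S: domain S by (rule mpoly_ring_domain)
    interpret L: cring loc.L by (rule loc.localization_cring)
    define h where "h p = loc.fr (rc p) \<one>\<^bsub>R\<^esub>" for p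
    have h: "ring_hom_ring S loc.L h"
    proof -
      have "(\<lambda>a. loc.fr a \<one>\<^bsub>R\<^esub>) \<circ> rc \<in> ring_hom S loc.L"
        using ring_hom_ring.homh[OF rc_ring_hom] ring_hom_ring.homh[OF loc.fraction_one_hom] by (rule ring_hom_trans)
      moreover have "(\<lambda>a. loc.fr a \<one>\<^bsub>R\<^esub>) \<circ> rc = h" by (auto simp: h_def)
      ultimately show ?thesis by (intro ring_hom_ringI2 S.ring_axioms L.ring_axioms) simp
    qed
    (* The pulled back chain, with the zero ideal below it. *)
    define B where "B j = (if j = 0 then {0} else {p \<in> carrier S. h p \<in> C (j - 1)})" for j
    have prime: "primeideal (B j) S" if "j \<le> n + 1" for j
    proof (cases "j = 0")
      case True then show ?thesis using S.zeroprimeideal by (simp add: B_def)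
    next
      case False
      then have "primeideal (C (j - 1)) loc.L" using C(1) that mn by auto
      then show ?thesis using ring_hom_ring.primeideal_vimage[OF h S.is_cring] False by (simp add: B_def)
    qed
    have strict: "B j \<subset> B (j + 1)" if j: "j \<le> n" for j
    proof (cases "j = 0")
      case True
      interpret c: primeideal "C 0" loc.L using C(1) by simp
      have "h f = \<zero>\<^bsub>loc.L\<^esub>"
        unfolding h_def loc.localization_zero using rc_eq_zero_iff[OF f_carrier] by (intro arg_cong2[of _ _ _ _ loc.fr]) (auto intro: bexI[of _ 1])
      then have "f \<in> B 1" using f_carrier by (simp add: B_def)
      moreover have "0 \<in> B 1" using additive_subgroup.zero_closed[OF ideal.axioms(1)[OF primeideal.axioms(1)[OF prime[of 1]]]] by simp
      ultimately show ?thesis using True f_nonzero by (auto simp: B_def[of 0])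
    next
      case False
      then have lt: "j - 1 < m" and Sj: "Suc (j - 1) = j" using j mn by auto
      have sub: "C (j - 1) \<subset> C j" using C(2) lt Sj by metis
      then obtain x where x: "x \<in> C j" "x \<notin> C (j - 1)" by blast
      interpret c0: primeideal "C (j - 1)" loc.L using C(1) lt by simp
      interpret c1: primeideal "C j" loc.L using C(1) lt Sj by simp
      obtain a s where a: "a \<in> carrier R" "s \<in> T" "x = loc.fr a s"
        by (rule loc.localizationE[OF c1.Icarr[OF x(1)]])
      obtain p where p: "p \<in> carrier S" "a = rc p" using a(1) by (auto simp: R_carrier)
      have "loc.fr a \<one>\<^bsub>R\<^esub> = x \<otimes>\<^bsub>loc.L\<^esub> loc.fr s \<one>\<^bsub>R\<^esub>"
        unfolding a(3) using a loc.T_one loc.T_mult by (simp add: loc.localization_mult loc.fraction_eq_iff)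
      then have "h p \<in> C j" unfolding h_def p(2)[symmetric] using c1.I_r_closed[OF x(1)] a loc.T_one by auto
      moreover have "h p \<notin> C (j - 1)"
      proof
        assume "h p \<in> C (j - 1)"
        then have "h p \<otimes>\<^bsub>loc.L\<^esub> loc.fr \<one>\<^bsub>R\<^esub> s \<in> C (j - 1)" using c0.I_r_closed a by auto
        moreover have "h p \<otimes>\<^bsub>loc.L\<^esub> loc.fr \<one>\<^bsub>R\<^esub> s = x"
          unfolding a(3) h_def p(2)[symmetric] using a loc.T_one loc.T_mult by (simp add: loc.localization_mult)
        ultimately show False using x(2) by simp
      qed
      moreover have "B j \<subseteq> B (j + 1)" using sub False by (auto simp: B_def)
      ultimately show ?thesis using p(1) False by (auto simp: B_def)
    qed
    show False using no_long_prime_chain[of n B] prime strict by blast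
  qed
  then show "x \<le> enat (n - 1)" using m by simp
qed

text \<open>The dimension is smaller than the number of generators of the maximal ideal.\<close>

lemma not_regular: "\<not> regular_local_ring loc.L"
proof
  assume "regular_local_ring loc.L"
  then obtain I where noeth: "noetherian_ring loc.L" and I: "maximalideal I loc.L"
    and dim: "krull_dim loc.L = enat (embedding_dim loc.L I)"
    unfolding regular_local_ring_def by blast
  interpret L: cring loc.L by (rule loc.localization_cring)
  interpret I: maximalideal I loc.L by (rule I)
  interpret P: primeideal P R by (rule P_prime)
  define M where "M = {loc.fr r s | r s. r \<in> P \<and> s \<in> T}"
  have M_ideal: "ideal M loc.L"
  proof (rule idealI_closed[OF loc.localization_cring])
    show "M \<subseteq> carrier loc.L" by (auto simp: M_def intro: P.Icarr)
    show "\<zero>\<^bsub>loc.L\<^esub> \<in> M" unfolding M_def loc.localization_zero using P.zero_closed loc.T_one by blast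
    fix a assume "a \<in> M"
    then obtain r s where a: "a = loc.fr r s" "r \<in> P" "s \<in> T" by (auto simp: M_def)
    { fix b assume "b \<in> M"
      then obtain q t where b: "b = loc.fr q t" "q \<in> P" "t \<in> T" by (auto simp: M_def)
      have "a \<oplus>\<^bsub>loc.L\<^esub> b = loc.fr (r \<otimes>\<^bsub>R\<^esub> t \<oplus>\<^bsub>R\<^esub> q \<otimes>\<^bsub>R\<^esub> s) (s \<otimes>\<^bsub>R\<^esub> t)"
        unfolding a b using a b P.Icarr by (intro loc.localization_add) auto
      moreover have "r \<otimes>\<^bsub>R\<^esub> t \<oplus>\<^bsub>R\<^esub> q \<otimes>\<^bsub>R\<^esub> s \<in> P"
        using a b by (intro P.a_closed P.I_r_closed) auto
      ultimately show "a \<oplus>\<^bsub>loc.L\<^esub> b \<in> M" unfolding M_def using loc.T_mult a b by blast }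
    { fix x assume "x \<in> carrier loc.L"
      then obtain q t where b: "x = loc.fr q t" "q \<in> carrier R" "t \<in> T" by (elim loc.localizationE)
      have "x \<otimes>\<^bsub>loc.L\<^esub> a = loc.fr (q \<otimes>\<^bsub>R\<^esub> r) (t \<otimes>\<^bsub>R\<^esub> s)"
        unfolding a b using a b P.Icarr by (intro loc.localization_mult) auto
      then show "x \<otimes>\<^bsub>loc.L\<^esub> a \<in> M" unfolding M_def using loc.T_mult a b P.I_l_closed by blast }
  qed
  have "\<one>\<^bsub>loc.L\<^esub> \<notin> M"
  proof
    assume "\<one>\<^bsub>loc.L\<^esub> \<in> M"
    then obtain r s where r: "loc.fr \<one>\<^bsub>R\<^esub> \<one>\<^bsub>R\<^esub> = loc.fr r s" "r \<in> P" "s \<in> T"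
      unfolding M_def loc.localization_one by blast
    then have "s = r" using P.Icarr loc.T_one by (subst (asm) loc.fraction_eq_iff) auto
    then show False using r by (simp add: T_def)
  qed
  then have M_ne: "M \<noteq> carrier loc.L" using L.one_closed by blast
  have "I \<subseteq> M"
  proof
    fix x assume x: "x \<in> I"
    obtain a s where a: "a \<in> carrier R" "s \<in> T" "x = loc.fr a s" by (rule loc.localizationE[OF I.Icarr[OF x]])
    have "a \<in> P"
    proof (rule ccontr)
      assume "a \<notin> P"
      then have aT: "a \<in> T" using a by (simp add: T_def)
      have "x \<otimes>\<^bsub>loc.L\<^esub> loc.fr s a \<in> I" using I.I_r_closed[OF x] a aT by auto
      moreover have "x \<otimes>\<^bsub>loc.L\<^esub> loc.fr s a = \<one>\<^bsub>loc.L\<^esub>"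
        unfolding a(3) loc.localization_one using a aT loc.T_one loc.T_mult
        by (simp add: loc.localization_mult loc.fraction_eq_iff loc.m_comm)
      ultimately show False using I.one_imp_carrier I.I_notcarr by auto
    qed
    then show "x \<in> M" using a by (auto simp: M_def)
  qed
  then have IM: "I = M" using I.I_maximal[OF M_ideal] M_ne ideal.Icarr[OF M_ideal] by blast
  obtain A where "A \<subseteq> carrier loc.L" "finite A" "genideal loc.L A = I"
    using noetherian_ring.finetely_gen[OF noeth I.is_ideal] by blast
  then have "\<exists>A\<subseteq>carrier loc.L. finite A \<and> card A = card A \<and> genideal loc.L A = I" by blast
  then have "\<exists>r. \<exists>A\<subseteq>carrier loc.L. finite A \<and> card A = r \<and> genideal loc.L A = I" by blast
  from LeastI_ex[OF this] obtain B where B: "B \<subseteq> carrier loc.L" "finite B" "card B = embedding_dim loc.L I" "genideal loc.L B = I"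
    unfolding embedding_dim_def by blast
  have "\<not> card B < n"
  proof
    assume "card B < n"
    moreover have "B \<subseteq> M" using L.genideal_self[OF B(1)] B(4) IM by simp
    ultimately obtain i where i: "i < n" "loc.fr (rc (pvar i - pconst (Q i))) (rc 1) \<notin> M"
      using few_generators[OF B(2,1)] B(4) IM unfolding M_def by blast
    have "pvar i - pconst (Q i) \<in> carrier S" using mpoly_carrier_var[OF i(1)] by (intro mpoly_carrier_minus) auto
    then have "rc (pvar i - pconst (Q i)) \<in> P" by (simp add: rc_in_P point_value_simps)
    moreover have "rc 1 \<in> T" by (simp add: rc_in_T point_value_simps)
    ultimately show False using i(2) unfolding M_def by blast
  qed
  then have "enat n \<le> krull_dim loc.L" using dim B(3) by simp
  then have "enat n \<le> enat (n - 1)" using krull_dim_bound order_trans by blast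
  then show False using n_pos by simp
qed

end

text \<open>By Euler's formula a common zero of the partial derivatives is a singular point of the cone, and it
differs from the vertex.\<close>

lemma (in hypersurface) partials_no_common_zero:
  assumes "f \<noteq> 0" "domain R" "homogeneous_of_degree d f" "\<not> CHAR('k) dvd d"
    and reg: "regular_outside R (hypersurface_maxideal n f)"
    and a: "a < n" "Q a \<noteq> 0" and zero: "\<And>i. i < n \<Longrightarrow> point_value Q (pderivative i f) = 0"
  shows False
proof -
  have "of_nat d * point_value Q f = point_value Q (of_nat d * f)"
  proof -
    have "of_nat d = (pconst (of_nat d) :: 'k mpoly)" by simp
    then show ?thesis by (metis point_value_simps(3) peval_const[OF coefficient_hom_id])
  qed
  also have "\<dots> = point_value Q (\<Sum>i<n. pvar i * pderivative i f)"
    using euler_identity[OF assms(3) f_carrier] by simp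
  also have "\<dots> = 0" using zero by (simp add: peval_sum[OF coefficient_hom_id] point_value_simps)
  finally have "point_value Q f = 0" using assms(4) by (simp add: of_nat_eq_0_iff_char_dvd)
  then have "singular_point n f Q"
    using assms(1,2) a(1) zero by (intro singular_point.intro hypersurface_axioms singular_point_axioms.intro) auto
  then interpret singular_point n f Q .
  have "rc (pvar a) \<in> hypersurface_maxideal n f"
  proof -
    have "(\<lambda>i. rc (mpoly_var i)) ` {..<n} \<subseteq> carrier R"
      using mpoly_carrier_var by (auto simp: mpoly_var_def)
    then show ?thesis unfolding hypersurface_maxideal_def
      using ring.genideal_self[OF cring.axioms(1)[OF R_cring]] a(1) by (simp add: subset_iff mpoly_var_def)
  qed
  moreover have "rc (pvar a) \<notin> P" using rc_in_P[OF mpoly_carrier_var[OF a(1)]] a(2) by (simp add: point_value_simps)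
  ultimately have "P \<noteq> hypersurface_maxideal n f" by blast
  then have "regular_local_ring (localization R (carrier R - P))"
    using reg P_prime unfolding regular_outside_def by blast
  then show False using not_regular by (simp add: T_def)
qed

text \<open>The Nullstellensatz turns the absence of common zeros into an effective statement on the generated ideal.\<close>

lemma jacobian_full:
  fixes f :: "('k::alg_closed_field) mpoly"
  assumes f: "f \<in> carrier (mpoly_ring n)" "f \<noteq> 0" "homogeneous_of_degree (Suc e) f" "\<not> CHAR('k) dvd Suc e"
    and dom: "domain (hypersurface_ring n f)"
    and reg: "regular_outside (hypersurface_ring n f) (hypersurface_maxideal n f)"
  shows "\<exists>N. graded_piece n N \<subseteq> form_ideal n {..<n} (\<lambda>i. pderivative i f) e N"
proof (rule ccontr)
  assume neg: "\<not> ?thesis"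
  interpret hypersurface n f by unfold_locales (rule f(1))
  let ?h = "\<lambda>i. pderivative i f"
  have h: "?h i \<in> graded_piece n e" for i
    using f by (simp add: graded_piece_def mpoly_carrier_pderivative homogeneous_pderivative)
  have "\<exists>Q. (\<exists>a<n. Q a \<noteq> 0) \<and> (\<forall>i. \<forall>p\<in>form_ideal n {..<n} ?h e i. point_value Q p = 0)"
    using neg by (intro projective_nullstellensatz graded_ideal_form_ideal h) blast
  then obtain Q a where a: "a < n" "Q a \<noteq> 0"
    and zero: "\<And>i p. p \<in> form_ideal n {..<n} ?h e i \<Longrightarrow> point_value Q p = 0" by blast
  have "point_value Q (?h i) = 0" if i: "i < n" for i
  proof (rule zero)
    have "(\<Sum>v<n. ?h v * (if v = i then pconst 1 else 0)) \<in> form_ideal n {..<n} ?h e e"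
      using graded_piece_const[of 1 n] by (intro form_idealI[of _ _ _ 0]) auto
    moreover have "(\<Sum>v<n. ?h v * (if v = i then pconst 1 else 0)) = (\<Sum>v<n. if v = i then ?h i else 0)"
      by (intro sum.cong) auto
    ultimately show "?h i \<in> form_ideal n {..<n} ?h e e" using i by simp
  qed
  then show False using partials_no_common_zero[of "Suc e" a Q] f dom reg a by blast
qed

section \<open>Regular sequences\<close>

text \<open>Three generators cover all ideals in the depth computations; unused places are filled with \<open>0\<close>.\<close>

definition gen3 :: "'r::comm_ring_1 \<Rightarrow> 'r \<Rightarrow> 'r \<Rightarrow> 'r set" where
  "gen3 a b c = {a * u + b * v + c * w | u v w. True}"

lemma gen3I: "x = a * u + b * v + c * w \<Longrightarrow> x \<in> gen3 a b c"
  by (auto simp: gen3_def)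

lemma gen3_zero [simp]: "0 \<in> gen3 a b c"
  by (rule gen3I[of _ _ 0 _ 0 _ 0]) simp

lemma gen3_add: "x \<in> gen3 a b c \<Longrightarrow> y \<in> gen3 a b c \<Longrightarrow> x + y \<in> gen3 a b c"
proof -
  assume "x \<in> gen3 a b c" "y \<in> gen3 a b c"
  then obtain u v w u' v' w' where "x = a * u + b * v + c * w" "y = a * u' + b * v' + c * w'"
    unfolding gen3_def by blast
  then show ?thesis by (intro gen3I[of _ _ "u + u'" _ "v + v'" _ "w + w'"]) (simp add: distrib_left)
qed

lemma gen3_mult: "x \<in> gen3 a b c \<Longrightarrow> r * x \<in> gen3 a b c"
proof -
  assume "x \<in> gen3 a b c"
  then obtain u v w where "x = a * u + b * v + c * w" unfolding gen3_def by blast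
  then show ?thesis by (intro gen3I[of _ _ "r * u" _ "r * v" _ "r * w"]) (simp add: algebra_simps)
qed

lemma gen3_minus: "x \<in> gen3 a b c \<Longrightarrow> y \<in> gen3 a b c \<Longrightarrow> x - y \<in> gen3 a b c"
  using gen3_add[of x a b c "- 1 * y"] gen3_mult[of y a b c "- 1"] by simp

lemma gen3_sum: "(\<And>i. i \<in> A \<Longrightarrow> F i \<in> gen3 a b c) \<Longrightarrow> sum F A \<in> gen3 a b c"
  by (induction A rule: infinite_finite_induct) (auto intro: gen3_add)

lemma gen3_radical_add:
  assumes "x ^ k * w \<in> gen3 a b c" "y ^ l * w \<in> gen3 a b c"
  shows "(x + y) ^ (k + l) * w \<in> gen3 a b c"
  unfolding binomial_ring sum_distrib_right
proof (rule gen3_sum)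
  fix i assume i: "i \<in> {..k + l}"
  show "of_nat (k + l choose i) * x ^ i * y ^ (k + l - i) * w \<in> gen3 a b c"
  proof (cases "k \<le> i")
    case True
    then have "x ^ i = x ^ (i - k) * x ^ k" by (simp flip: power_add)
    then have "of_nat (k + l choose i) * x ^ i * y ^ (k + l - i) * w =
      (of_nat (k + l choose i) * x ^ (i - k) * y ^ (k + l - i)) * (x ^ k * w)" by (simp add: mult_ac)
    then show ?thesis using gen3_mult[OF assms(1)] by simp
  next
    case False
    then have "y ^ (k + l - i) = y ^ (k - i) * y ^ l" by (simp flip: power_add)
    then have "of_nat (k + l choose i) * x ^ i * y ^ (k + l - i) * w =
      (of_nat (k + l choose i) * x ^ i * y ^ (k - i)) * (y ^ l * w)" by (simp add: mult_ac)
    then show ?thesis using gen3_mult[OF assms(2)] by simp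
  qed
qed

lemma gen3_radical_sum:
  assumes "finite A" "\<And>i. i \<in> A \<Longrightarrow> \<exists>k. g i ^ k * w \<in> gen3 a b c"
  shows "\<exists>k. (\<Sum>i\<in>A. h i * g i) ^ k * w \<in> gen3 a b c"
  using assms
proof (induction A rule: finite_induct)
  case empty
  then show ?case by (intro exI[of _ 1]) simp
next
  case (insert i A)
  obtain k where "g i ^ k * w \<in> gen3 a b c" using insert by blast
  then have k: "(h i * g i) ^ k * w \<in> gen3 a b c"
    using gen3_mult[of "g i ^ k * w" a b c "h i ^ k"] by (simp add: power_mult_distrib mult.assoc)
  obtain l where l: "(\<Sum>i\<in>A. h i * g i) ^ l * w \<in> gen3 a b c" using insert by blast
  show ?case using gen3_radical_add[OF k l] insert.hyps by (intro exI[of _ "k + l"]) simp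
qed

lemma gen3_coefficients:
  fixes z :: "('r::comm_ring_1) mpoly"
  shows "z \<in> gen3 (pconst a) (pconst b) (pconst c) \<longleftrightarrow> (\<forall>m. lookup z m \<in> gen3 a b c)"
proof
  assume "z \<in> gen3 (pconst a) (pconst b) (pconst c)"
  then obtain u v w where "z = pconst a * u + pconst b * v + pconst c * w" unfolding gen3_def by blast
  then show "\<forall>m. lookup z m \<in> gen3 a b c"
    by (auto simp: lookup_add lookup_const_mult intro: gen3I)
next
  assume "\<forall>m. lookup z m \<in> gen3 a b c"
  then have 1: "\<exists>u v w. lookup z m = a * u + b * v + c * w" for m unfolding gen3_def by blast
  have "single m (lookup z m) \<in> gen3 (pconst a) (pconst b) (pconst c)" for m
  proof -
    obtain u v w where "lookup z m = a * u + b * v + c * w" using 1 by blast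
    then show ?thesis
      by (intro gen3I[of _ _ "single m u" _ "single m v" _ "single m w"])
        (simp add: single_add mult_single)
  qed
  then have "(\<Sum>m\<in>keys z. single m (lookup z m)) \<in> gen3 (pconst a) (pconst b) (pconst c)"
    by (intro gen3_sum)
  then show "z \<in> gen3 (pconst a) (pconst b) (pconst c)"
    using poly_mapping_sum_single[of "keys z" z] by simp
qed

definition linear_poly :: "nat \<Rightarrow> (nat \<Rightarrow> 'r::comm_ring_1) \<Rightarrow> 'r mpoly" where
  "linear_poly n g = (\<Sum>i<n. single (single i 1) (g i))"

lemma lookup_linear_mult:
  "lookup (linear_poly n g * z) m =
    (\<Sum>i<n. if lookup m i = 0 then 0 else g i * lookup z (m - single i 1))"
  unfolding linear_poly_def sum_distrib_right lookup_sum lookup_var_mult ..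

text \<open>The coefficients of the product express \<open>g i\<close> times a coefficient of \<open>z\<close> through
coefficients of \<open>z\<close> whose exponent of the \<open>i\<close>-th variable is larger by one. As these exponents are bounded, a power of
\<open>g i\<close> annihilates all coefficients of \<open>z\<close> modulo the ideal.\<close>

lemma linear_coefficient_kills:
  fixes z :: "('r::comm_ring_1) mpoly"
  assumes Lz: "\<And>m. lookup (linear_poly n g * z) m \<in> gen3 a b c" and i: "i < n"
  shows "\<exists>k. \<forall>m. g i ^ k * lookup z m \<in> gen3 a b c"
proof -
  define E where "E = (\<Sum>m\<in>keys z. lookup m i)"
  have E: "lookup z m = 0" if "lookup m i > E" for m
  proof (rule ccontr)
    assume "lookup z m \<noteq> 0"
    then have "lookup m i \<le> E" unfolding E_def by (intro member_le_sum) (auto simp: in_keys_iff)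
    then show False using that by simp
  qed
  have "\<forall>m. lookup m i + k \<ge> E + 1 \<longrightarrow> g i ^ k * lookup z m \<in> gen3 a b c" for k
  proof (induction k)
    case 0
    then show ?case using E by simp
  next
    case (Suc k)
    show ?case
    proof (intro allI impI)
      fix m assume m: "lookup m i + Suc k \<ge> E + 1"
      let ?m = "m + single i 1"
      let ?F = "\<lambda>l. if lookup ?m l = 0 then 0 else g l * lookup z (?m - single l 1)"
      have "g i * lookup z m = ?F i" by (simp add: lookup_add)
      also have "\<dots> = lookup (linear_poly n g * z) ?m - (\<Sum>l\<in>{..<n} - {i}. ?F l)"
        unfolding lookup_linear_mult using i by (subst sum.remove[of _ i]) auto
      finally have eq: "g i ^ Suc k * lookup z m = g i ^ k * lookup (linear_poly n g * z) ?m - (\<Sum>l\<in>{..<n} - {i}. g i ^ k * ?F l)"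
        by (simp add: right_diff_distrib sum_distrib_left mult.assoc mult.left_commute[of "g i"])
      show "g i ^ Suc k * lookup z m \<in> gen3 a b c"
        unfolding eq
      proof (intro gen3_minus gen3_sum)
        show "g i ^ k * lookup (linear_poly n g * z) ?m \<in> gen3 a b c" by (rule gen3_mult[OF Lz])
        fix l assume l: "l \<in> {..<n} - {i}"
        then have "lookup (?m - single l 1) i + k \<ge> E + 1"
          using m by (auto simp: lookup_minus lookup_add lookup_single when_def)
        then have "g i ^ k * lookup z (?m - single l 1) \<in> gen3 a b c" using Suc by blast
        then have "g l * (g i ^ k * lookup z (?m - single l 1)) \<in> gen3 a b c" by (rule gen3_mult)
        then show "g i ^ k * ?F l \<in> gen3 a b c" by (auto simp: mult.left_commute)
      qed
    qed
  qed
  from this[of "E + 1"] have "\<forall>m. g i ^ (E + 1) * lookup z m \<in> gen3 a b c" by simp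
  then show ?thesis by (rule exI)
qed

text \<open>If the product of \<open>z\<close> with the linear form lies in the ideal, then a power of every coefficient of the form
annihilates \<open>z\<close> modulo the ideal, hence so does a power of \<open>s\<close>; but \<open>s\<close> is a nonzero divisor.\<close>

lemma linear_poly_regular:
  fixes z :: "('r::comm_ring_1) mpoly"
  assumes Lz: "linear_poly n g * z \<in> gen3 (pconst a) (pconst b) (pconst c)"
    and s: "s ^ N = (\<Sum>i<n. h i * g i)"
    and reg: "\<And>u. s * u \<in> gen3 a b c \<Longrightarrow> u \<in> gen3 a b c"
  shows "z \<in> gen3 (pconst a) (pconst b) (pconst c)"
  unfolding gen3_coefficients
proof
  fix m
  have "\<exists>k. g i ^ k * lookup z m \<in> gen3 a b c" if "i \<in> {..<n}" for i
    using linear_coefficient_kills[of n g z a b c i] Lz that unfolding gen3_coefficients by blast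
  then obtain k where "(\<Sum>i<n. h i * g i) ^ k * lookup z m \<in> gen3 a b c"
    using gen3_radical_sum[of "{..<n}" g "lookup z m" a b c h] by blast
  then have "s ^ (N * k) * lookup z m \<in> gen3 a b c" by (simp add: power_mult s)
  moreover have "s ^ j * u \<in> gen3 a b c \<Longrightarrow> u \<in> gen3 a b c" for j u
  proof (induction j)
    case (Suc j)
    then show ?case using reg[of "s ^ j * u"] by (simp add: mult.assoc)
  qed simp
  ultimately show "lookup z m \<in> gen3 a b c" by blast
qed

lemma mpoly_ring_induct [case_names const var add mult]:
  fixes p :: "('r::comm_ring_1) mpoly"
  assumes c: "\<And>c. P (pconst c)" and v: "\<And>i. P (pvar i)"
    and a: "\<And>p q. P p \<Longrightarrow> P q \<Longrightarrow> P (p + q)" and m: "\<And>p q. P p \<Longrightarrow> P q \<Longrightarrow> P (p * q)"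
  shows "P p"
proof (induction p rule: poly_mapping_induct_sum)
  case zero then show ?case using c[of 0] by simp
next
  case (single k d)
  show ?case
  proof (induction "monomial_degree k" arbitrary: k)
    case 0
    then have "k = 0" using monomial_degree_eq_0[of k] by simp
    then show ?case using c by simp
  next
    case (Suc e)
    then have "k \<noteq> 0" by auto
    then obtain i where i: "lookup k i \<noteq> 0" by (metis lookup_zero poly_mapping_eqI)
    let ?l = "k - single i 1"
    note k = monomial_split[OF i]
    have "e = monomial_degree ?l" using Suc(2) monomial_degree_add[of "single i 1" ?l] k by simp
    then have "P (pvar i * single ?l d)" using Suc(1) v m by blast
    moreover have "pvar i * single ?l d = single k d"
      using k by (simp add: mult_single)
    ultimately show ?case by simp
  qed
qed (rule a)

text \<open>Restriction to the subspace on which \<open>x\<^sub>v = c\<^sub>v x\<^sub>j\<close> for \<open>v \<in> V\<close>.\<close>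

definition collapse :: "nat \<Rightarrow> (nat \<Rightarrow> 'k::field) \<Rightarrow> nat set \<Rightarrow> 'k mpoly \<Rightarrow> 'k mpoly" where
  "collapse j c V = peval pconst (\<lambda>v. if v \<in> V then pconst (c v) * pvar j else pvar v)"

abbreviation line_form :: "nat \<Rightarrow> (nat \<Rightarrow> 'k::field) \<Rightarrow> nat \<Rightarrow> 'k mpoly" where
  "line_form j c v \<equiv> pvar v - pconst (c v) * pvar j"

lemma collapse_add: "collapse j c V (p + q) = collapse j c V p + collapse j c V q"
  and collapse_mult: "collapse j c V (p * q) = collapse j c V p * collapse j c V q"
  and collapse_minus: "collapse j c V (p - q) = collapse j c V p - collapse j c V q"
  and collapse_const: "collapse j c V (pconst a) = pconst a"
  and collapse_var: "collapse j c V (pvar v) = (if v \<in> V then pconst (c v) * pvar j else pvar v)"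
  and collapse_zero: "collapse j c V 0 = 0"
  unfolding collapse_def
  by (simp_all add: peval_add peval_mult peval_minus peval_const peval_zero peval_var[OF coefficient_hom_single, unfolded One_nat_def])

lemma collapse_line_form:
  assumes "j \<notin> V"
  shows "v \<in> V \<Longrightarrow> collapse j c V (line_form j c v) = 0"
    and "v \<notin> V \<Longrightarrow> collapse j c V (line_form j c v) = line_form j c v"
  using assms by (simp_all only: collapse_minus collapse_mult collapse_const collapse_var if_True if_False diff_self)

lemma line_form_nonzero: "v \<noteq> j \<Longrightarrow> line_form j c v \<noteq> 0"
proof
  assume v: "v \<noteq> j" and z: "line_form j c v = 0"
  have "lookup (line_form j c v) (single v 1) = 1"
    using v by (simp add: lookup_minus mult_single lookup_single when_def) (metis One_nat_def lookup_single_eq lookup_single_not_eq one_neq_zero)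
  then show False using z by simp
qed

text \<open>Modulo the line forms a variable \<open>x\<^sub>v\<close> equals \<open>c\<^sub>v x\<^sub>j\<close>, so a polynomial equals its restriction. The same
index may be given several times; this covers one and two forms.\<close>

lemma collapse_kernel:
  assumes "V \<subseteq> {x, y, z}" "x \<in> V" "y \<in> V" "z \<in> V" "collapse j c V p = 0"
  shows "p \<in> gen3 (line_form j c x) (line_form j c y) (line_form j c z)"
proof -
  let ?G = "gen3 (line_form j c x) (line_form j c y) (line_form j c z)"
  have V: "V = {x, y, z}" using assms by blast
  have "p - collapse j c V p \<in> ?G"
  proof (induction p rule: mpoly_ring_induct)
    case (const a)
    then show ?case by (simp add: collapse_const)
  next
    case (var i)
    show ?case
    proof (cases "i \<in> V")
      case False
      then show ?thesis by (simp only: collapse_var if_False diff_self gen3_zero)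
    next
      case True
      then have e: "pvar i - collapse j c V (pvar i) = line_form j c i" by (simp only: collapse_var if_True)
      consider "i = x" | "i = y" | "i = z" using True V by blast
      then show ?thesis unfolding e
      proof cases
        case 1 then show "line_form j c i \<in> ?G" by (intro gen3I[of _ _ 1 _ 0 _ 0]) simp
      next
        case 2 then show "line_form j c i \<in> ?G" by (intro gen3I[of _ _ 0 _ 1 _ 0]) simp
      next
        case 3 then show "line_form j c i \<in> ?G" by (intro gen3I[of _ _ 0 _ 0 _ 1]) simp
      qed
    qed
  next
    case (add p q)
    then show ?case using gen3_add[OF add] by (simp add: collapse_add algebra_simps)
  next
    case (mult p q)
    have "p * q - collapse j c V (p * q) = p * (q - collapse j c V q) + collapse j c V q * (p - collapse j c V p)"
      by (simp add: collapse_mult algebra_simps)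
    then show ?case using gen3_add[OF gen3_mult[OF mult(2)] gen3_mult[OF mult(1)]] by simp
  qed
  then show ?thesis using assms(5) by simp
qed

text \<open>Three linear forms that vanish on a linear subspace on which \<open>f\<close> does not vanish identically. Then \<open>f\<close> and
the three forms are a regular sequence in any order, because the forms are part of a system of coordinates.\<close>

locale three_line_forms =
  fixes j x y z :: nat and c :: "nat \<Rightarrow> 'k::field" and f :: "'k mpoly"
  assumes distinct: "x \<noteq> y" "x \<noteq> z" "y \<noteq> z" "j \<noteq> x" "j \<noteq> y" "j \<noteq> z"
    and f_restrict: "collapse j c {x, y, z} f \<noteq> 0"
begin

abbreviation "lf \<equiv> line_form j c"

lemma collapse_f: "V \<subseteq> {x, y, z} \<Longrightarrow> collapse j c V f \<noteq> 0"
proof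
  assume V: "V \<subseteq> {x, y, z}" and z: "collapse j c V f = 0"
  have "collapse j c {x, y, z} (collapse j c V p) = collapse j c {x, y, z} p" for p
  proof (induction p rule: mpoly_ring_induct)
    case (var i)
    show ?case
    proof (cases "i \<in> V")
      case True
      then have "i \<in> {x, y, z}" using V by blast
      moreover have "j \<notin> {x, y, z}" using distinct by blast
      ultimately show ?thesis using True by (simp only: collapse_var collapse_mult collapse_const if_True if_False)
    next
      case False
      then show ?thesis by (simp only: collapse_var[of j c V] if_False)
    qed
  qed (simp_all only: collapse_add collapse_mult collapse_const)
  from this[of f] show False using z f_restrict by (simp add: collapse_zero)
qed

lemma regular_x:
  assumes "lf x * u = f * w"
  shows "\<exists>t. u = f * t"
proof -
  have "collapse j c {x} (lf x * u) = collapse j c {x} (f * w)" using assms by simp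
  then have "collapse j c {x} w = 0"
    using collapse_f[of "{x}"] collapse_line_form(1)[of j "{x}" x c] distinct by (simp add: collapse_mult)
  then obtain a b d where w: "w = lf x * a + lf x * b + lf x * d"
    using collapse_kernel[of "{x}" x x x j c w] unfolding gen3_def by blast
  have "lf x * u = lf x * (f * (a + b + d))" using assms w by (simp add: algebra_simps)
  then show ?thesis using line_form_nonzero[of x j c] distinct by (auto simp: mult_left_cancel)
qed

text \<open>Restricting to the subspace of both forms shows that the multiplier of \<open>f\<close> lies in the ideal of the two forms;
after that \<open>f\<close> can be eliminated and the coordinates \<open>x\<close> and \<open>y\<close> compared.\<close>

lemma regular_y:
  assumes "lf y * u \<in> gen3 (lf x) f 0"
  shows "u \<in> gen3 (lf x) f 0"
proof -
  obtain v w where e: "lf y * u = lf x * v + f * w" using assms unfolding gen3_def by auto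
  then have "collapse j c {x, y} (lf y * u) = collapse j c {x, y} (lf x * v + f * w)" by simp
  then have "collapse j c {x, y} w = 0"
    using collapse_f[of "{x, y}"] collapse_line_form(1)[of j "{x, y}" x c] collapse_line_form(1)[of j "{x, y}" y c] distinct
    by (simp add: collapse_mult collapse_add)
  then obtain a b d where w: "w = lf x * a + lf y * b + lf y * d"
    using collapse_kernel[of "{x, y}" x y y j c w] unfolding gen3_def by blast
  have e2: "lf y * (u - f * (b + d)) = lf x * (v + f * a)" using e w by (simp add: algebra_simps)
  then have "collapse j c {x} (lf y * (u - f * (b + d))) = collapse j c {x} (lf x * (v + f * a))" by simp
  then have "collapse j c {x} (u - f * (b + d)) = 0"
    using collapse_line_form(1)[of j "{x}" x c] collapse_line_form(2)[of j "{x}" y c] line_form_nonzero[of y j c] distinct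
    by (simp add: collapse_mult)
  then obtain a' b' d' where "u - f * (b + d) = lf x * a' + lf x * b' + lf x * d'"
    using collapse_kernel[of "{x}" x x x j c] unfolding gen3_def by blast
  then have "u = lf x * (a' + b' + d') + f * (b + d) + 0 * 0" by (simp add: algebra_simps)
  then show ?thesis by (rule gen3I)
qed

lemma regular_z:
  assumes "lf z * u \<in> gen3 (lf x) (lf y) f"
  shows "u \<in> gen3 (lf x) (lf y) f"
proof -
  obtain v v' w where e: "lf z * u = lf x * v + lf y * v' + f * w" using assms unfolding gen3_def by auto
  then have "collapse j c {x, y, z} (lf z * u) = collapse j c {x, y, z} (lf x * v + lf y * v' + f * w)" by simp
  then have "collapse j c {x, y, z} w = 0"
    using collapse_f[of "{x, y, z}"] collapse_line_form(1)[of j "{x, y, z}" x c] collapse_line_form(1)[of j "{x, y, z}" y c]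
      collapse_line_form(1)[of j "{x, y, z}" z c] distinct
    by (simp add: collapse_mult collapse_add)
  then obtain a b d where w: "w = lf x * a + lf y * b + lf z * d"
    using collapse_kernel[of "{x, y, z}" x y z j c w] unfolding gen3_def by blast
  have e2: "lf z * (u - f * d) = lf x * (v + f * a) + lf y * (v' + f * b)" using e w by (simp add: algebra_simps)
  then have "collapse j c {x, y} (lf z * (u - f * d)) = collapse j c {x, y} (lf x * (v + f * a) + lf y * (v' + f * b))" by simp
  then have "collapse j c {x, y} (u - f * d) = 0"
    using collapse_line_form(1)[of j "{x, y}" x c] collapse_line_form(1)[of j "{x, y}" y c] collapse_line_form(2)[of j "{x, y}" z c]
      line_form_nonzero[of z j c] distinct
    by (simp add: collapse_mult collapse_add)
  then obtain a' b' d' where "u - f * d = lf x * a' + lf y * b' + lf y * d'"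
    using collapse_kernel[of "{x, y}" x y y j c] unfolding gen3_def by blast
  then have "u = lf x * a' + lf y * (b' + d') + f * d" by (simp add: algebra_simps)
  then show ?thesis by (rule gen3I)
qed

end

text \<open>The linear form \<open>df\<close> is formed with arbitrary coefficients \<open>g\<close>; it matters only that they
generate an ideal containing powers of \<open>y\<close> and of \<open>z\<close>.\<close>

locale regular_differential = three_line_forms j x y z c f
  for j x y z and c :: "nat \<Rightarrow> 'k::field" and f +
  fixes n :: nat and g :: "nat \<Rightarrow> 'k mpoly"
  assumes y_power: "\<exists>N h. lf y ^ N = (\<Sum>i<n. h i * g i)" and z_power: "\<exists>N h. lf z ^ N = (\<Sum>i<n. h i * g i)"
begin

abbreviation "df \<equiv> linear_poly n g"
abbreviation "I \<equiv> gen3 (pconst f) df 0"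

text \<open>The elements \<open>f, x, df\<close> form a regular sequence and \<open>f, x\<close> may be interchanged: a syzygy
between \<open>x\<close> and \<open>f, df\<close> has its \<open>df\<close>-coefficient in the ideal of \<open>x, f\<close>, since \<open>df\<close> is regular modulo \<open>x, f\<close>.\<close>

lemma regular_x_I:
  assumes "pconst (lf x) * u \<in> I"
  shows "u \<in> I"
proof -
  obtain v w where e: "pconst (lf x) * u = pconst f * v + df * w" using assms unfolding gen3_def by auto
  (* The coefficient of \<open>df\<close> in the syzygy is reduced to the ideal of \<open>x\<close> and \<open>f\<close>. *)
  have "df * w \<in> gen3 (pconst (lf x)) (pconst f) (pconst 0)"
    by (rule gen3I[of _ _ u _ "- v" _ 0]) (use e in \<open>simp add: algebra_simps\<close>)
  then have "w \<in> gen3 (pconst (lf x)) (pconst f) (pconst 0)"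
    using y_power linear_poly_regular[where a = "lf x" and b = f and c = 0 and g = g] regular_y by blast
  then obtain a b where w: "w = pconst (lf x) * a + pconst f * b" unfolding gen3_def by auto
  have e2: "pconst (lf x) * (u - df * a) = pconst f * (v + df * b)" using e w by (simp add: algebra_simps)
  have "u - df * a \<in> gen3 (pconst f) (pconst 0) (pconst 0)"
    unfolding gen3_coefficients
  proof
    fix m
    have "lf x * lookup (u - df * a) m = f * lookup (v + df * b) m"
      using e2 by (metis lookup_const_mult)
    then obtain t where "lookup (u - df * a) m = f * t" using regular_x by blast
    then show "lookup (u - df * a) m \<in> gen3 f 0 0" by (intro gen3I[of _ _ t _ 0 _ 0]) simp
  qed
  then obtain t where "u - df * a = pconst f * t" unfolding gen3_def by auto
  then have "u = pconst f * t + df * a + 0 * 0" by (simp add: algebra_simps)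
  then show ?thesis by (rule gen3I)
qed

text \<open>The same exchange one step further, now with \<open>df\<close> regular modulo \<open>x, y, f\<close>.\<close>

lemma regular_y_I:
  assumes "pconst (lf y) * u \<in> gen3 (pconst (lf x)) (pconst f) df"
  shows "u \<in> gen3 (pconst (lf x)) (pconst f) df"
proof -
  obtain v w s where e: "pconst (lf y) * u = pconst (lf x) * v + pconst f * w + df * s" using assms unfolding gen3_def by auto
  have "df * s \<in> gen3 (pconst (lf x)) (pconst (lf y)) (pconst f)"
    by (rule gen3I[of _ _ "- v" _ u _ "- w"]) (use e in \<open>simp add: algebra_simps\<close>)
  then have "s \<in> gen3 (pconst (lf x)) (pconst (lf y)) (pconst f)"
    using z_power linear_poly_regular[where a = "lf x" and b = "lf y" and c = f and g = g] regular_z by blast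
  then obtain a b d where s: "s = pconst (lf x) * a + pconst (lf y) * b + pconst f * d" unfolding gen3_def by auto
  have e2: "pconst (lf y) * (u - df * b) = pconst (lf x) * (v + df * a) + pconst f * (w + df * d)"
    using e s by (simp add: algebra_simps)
  have "u - df * b \<in> gen3 (pconst (lf x)) (pconst f) (pconst 0)"
    unfolding gen3_coefficients
  proof
    fix m
    have "lookup (pconst (lf y) * (u - df * b)) m =
      lookup (pconst (lf x) * (v + df * a) + pconst f * (w + df * d)) m" using e2 by simp
    then have "lf y * lookup (u - df * b) m =
      lf x * lookup (v + df * a) m + f * lookup (w + df * d) m + 0 * 0"
      by (simp only: lookup_const_mult lookup_add) simp
    then show "lookup (u - df * b) m \<in> gen3 (lf x) f 0" by (rule regular_y[OF gen3I])
  qed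
  then obtain p q where "u - df * b = pconst (lf x) * p + pconst f * q" unfolding gen3_def by auto
  then have "u = pconst (lf x) * p + pconst f * q + df * b" by (simp add: algebra_simps)
  then show ?thesis by (rule gen3I)
qed

lemma regular_x_power: "pconst (lf x) ^ k * u \<in> I \<Longrightarrow> u \<in> I"
proof (induction k)
  case (Suc k)
  have "pconst (lf x) * (pconst (lf x) ^ k * u) \<in> I" using Suc.prems by (simp only: power_Suc mult.assoc)
  then show ?case using Suc.IH regular_x_I by blast
qed simp

text \<open>Regularity of a sequence passes to powers of its members; the factors \<open>x\<close> are split off one at a time.\<close>

lemma regular_y_power:
  assumes "pconst (lf y) ^ l * u - pconst (lf x) ^ k * v \<in> I"
  shows "\<exists>w. u - pconst (lf x) ^ k * w \<in> I"
  using assms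
proof (induction k arbitrary: u v)
  case 0
  then show ?case by (intro exI[of _ u]) simp
next
  case (Suc k)
  let ?x = "pconst (lf x)" and ?y = "pconst (lf y)"
  have strip: "?y ^ l * u \<in> gen3 ?x (pconst f) df \<Longrightarrow> u \<in> gen3 ?x (pconst f) df" for l u
  proof (induction l)
    case (Suc l)
    have "?y * (?y ^ l * u) \<in> gen3 ?x (pconst f) df" using Suc.prems by (simp only: power_Suc mult.assoc)
    then show ?case using Suc.IH regular_y_I by blast
  qed simp
  obtain p q where pq: "?y ^ l * u - ?x ^ Suc k * v = pconst f * p + df * q" using Suc.prems unfolding gen3_def by auto
  then have "?y ^ l * u = ?x * (?x ^ k * v) + pconst f * p + df * q" by (simp add: algebra_simps)
  then have "u \<in> gen3 ?x (pconst f) df" by (rule strip[OF gen3I])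
  then obtain u' p' q' where u: "u = ?x * u' + pconst f * p' + df * q'" unfolding gen3_def by auto
  have "?x * (?y ^ l * u' - ?x ^ k * v) = pconst f * (p - ?y ^ l * p') + df * (q - ?y ^ l * q') + 0 * 0"
    using pq unfolding u by (simp add: algebra_simps)
  then have "?y ^ l * u' - ?x ^ k * v \<in> I" by (rule regular_x_I[OF gen3I])
  then obtain w where w: "u' - ?x ^ k * w \<in> I" using Suc.IH by blast
  have "u - ?x ^ Suc k * w = ?x * (u' - ?x ^ k * w) + (pconst f * p' + df * q' + 0 * 0)"
    unfolding u by (simp add: algebra_simps)
  then have "u - ?x ^ Suc k * w \<in> I" using gen3_add[OF gen3_mult[OF w] gen3I[OF refl]] by metis
  then show ?case by blast
qed

end

section \<open>A point outside the hypersurface\<close>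

text \<open>Induction on the number of variables: a coefficient with respect to the last variable is nonzero at some point
of the smaller space, and a nonzero univariate polynomial does not vanish everywhere over an infinite field.\<close>

lemma nonvanishing_point:
  fixes f :: "('k::alg_closed_field) mpoly"
  assumes "f \<in> carrier (mpoly_ring n)" "f \<noteq> 0"
  shows "\<exists>Q. point_value Q f \<noteq> 0"
  using assms
proof (induction n arbitrary: f)
  case 0
  then have "keys f \<subseteq> {0}" by (auto simp: mpoly_carrier_iff)
  then have e: "f = pconst (lookup f 0)" using poly_mapping_sum_single[of "{0}" f] by simp
  then have "lookup f 0 \<noteq> 0" using 0(2) by (metis single_zero)
  moreover have "point_value (\<lambda>_. 0) f = lookup f 0" by (subst e) (simp add: peval_single)
  ultimately show ?case by metis
next
  case (Suc n)
  obtain m0 where m0: "lookup f m0 \<noteq> 0" using Suc.prems(2) by (metis lookup_zero poly_mapping_eqI)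
  define k where "k = lookup m0 n"
  define g where "g = (\<Sum>m\<in>{m\<in>keys f. lookup m n = k}. single (m - single n k) (lookup f m))"
  have split: "m = single n e + (m - single n e)" if "lookup m n = e" for m e
    using that by (intro poly_mapping_eqI) (auto simp: lookup_add lookup_minus lookup_single when_def)
  have lg: "lookup g (m0 - single n k) = lookup f m0"
  proof -
    have "lookup g (m0 - single n k) =
      (\<Sum>m\<in>{m\<in>keys f. lookup m n = k}. if m = m0 then lookup f m0 else 0)"
      unfolding g_def lookup_sum
    proof (rule sum.cong)
      fix m assume m: "m \<in> {m\<in>keys f. lookup m n = k}"
      then have "m - single n k = m0 - single n k \<longleftrightarrow> m = m0"
        using split[of m k] split[of m0 k] by (auto simp: k_def)
      then show "lookup (single (m - single n k) (lookup f m)) (m0 - single n k) =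
        (if m = m0 then lookup f m0 else 0)" by (simp add: lookup_single when_def)
    qed simp
    then show ?thesis using m0 by (simp add: in_keys_iff k_def)
  qed
  have "g \<in> carrier (mpoly_ring n)" unfolding g_def
  proof (intro mpoly_carrier_sum mpoly_carrier_single disjI2)
    fix m assume m: "m \<in> {m\<in>keys f. lookup m n = k}"
    then have "keys m \<subseteq> {..<Suc n}" using Suc.prems(1) by (auto simp: mpoly_carrier_iff)
    then show "keys (m - single n k) \<subseteq> {..<n}"
      using m by (auto simp: in_keys_iff lookup_minus lookup_single when_def subset_iff less_Suc_eq split: if_splits)
  qed
  moreover have "g \<noteq> 0" using lg m0 by auto
  ultimately obtain Q where Q: "point_value Q g \<noteq> 0" using Suc.IH by blast
  (* The restriction of \<open>f\<close> to the line over \<open>Q\<close>, as a polynomial in the last variable. *)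
  define u where "u = (\<Sum>m\<in>keys f. Polynomial.monom (lookup f m * monomial_value Q (m - single n (lookup m n))) (lookup m n))"
  have "Polynomial.coeff u k = (\<Sum>m\<in>keys f. if lookup m n = k then lookup f m * monomial_value Q (m - single n k) else 0)"
    unfolding u_def coeff_sum by (intro sum.cong) auto
  also have "\<dots> = point_value Q g"
    unfolding g_def peval_sum[OF coefficient_hom_id] peval_single[OF coefficient_hom_id] by (simp add: sum.inter_filter)
  finally have "u \<noteq> 0" using Q by auto
  have "\<exists>t. poly u t \<noteq> 0"
  proof (cases "Polynomial.degree u = 0")
    case True
    then obtain d where "u = [:d:]" by (auto elim: degree_eq_zeroE)
    then show ?thesis using \<open>u \<noteq> 0\<close> by auto
  next
    case False
    (* A zero of \<open>u - 1\<close> is a point where \<open>u\<close> does not vanish. *)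
    then have "Polynomial.degree (u - 1) > 0" using degree_add_eq_left[of "-1" u] by simp
    then obtain t where "poly (u - 1) t = 0" using alg_closed_imp_poly_has_root by blast
    then show ?thesis by (intro exI[of _ t]) auto
  qed
  then obtain t where t: "poly u t \<noteq> 0" by blast
  define Q' where "Q' = Q(n := t)"
  have mv: "monomial_value Q' m = monomial_value Q (m - single n (lookup m n)) * t ^ lookup m n" for m
  proof -
    let ?l = "m - single n (lookup m n)"
    have "monomial_value Q' m = monomial_value Q' (single n (lookup m n)) * monomial_value Q' ?l"
      using split[of m "lookup m n"] by (metis monomial_value_add)
    moreover have "monomial_value Q' ?l = monomial_value Q ?l"
      unfolding monomial_value_def Q'_def by (intro prod.cong) (auto simp: in_keys_iff lookup_minus)
    ultimately show ?thesis by (simp add: Q'_def mult.commute)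
  qed
  have "point_value Q' f = poly u t"
    unfolding peval_def additive_extension_def u_def poly_sum poly_monom mv by (simp add: mult_ac)
  then have "point_value Q' f \<noteq> 0" using t by simp
  then show ?case by (intro exI[where x = Q'])
qed

section \<open>Presented modules\<close>

lemma free_module_simps [simp]:
  "\<zero>\<^bsub>free_module R G\<^esub> = (\<lambda>g. \<zero>\<^bsub>R\<^esub>)"
  "v \<oplus>\<^bsub>free_module R G\<^esub> w = (\<lambda>g. v g \<oplus>\<^bsub>R\<^esub> w g)"
  "r \<odot>\<^bsub>free_module R G\<^esub> v = (\<lambda>g. r \<otimes>\<^bsub>R\<^esub> v g)"
  by (simp_all add: free_module_def)

lemma free_module_carrier:
  "v \<in> carrier (free_module R G) \<longleftrightarrow>
    (\<forall>g. v g \<in> carrier R) \<and> finite {g. v g \<noteq> \<zero>\<^bsub>R\<^esub>} \<and> {g. v g \<noteq> \<zero>\<^bsub>R\<^esub>} \<subseteq> G"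
  by (simp add: free_module_def)

lemma (in cring) free_module_is_module: "module R (free_module R G)"
proof (rule module_criteria)
  let ?F = "free_module R G"
  show "cring R" by (rule is_cring)
  show "\<zero>\<^bsub>?F\<^esub> \<in> carrier ?F" by (simp add: free_module_carrier)
  have supp: "{g. v g \<oplus> w g \<noteq> \<zero>} \<subseteq> {g. v g \<noteq> \<zero>} \<union> {g. w g \<noteq> \<zero>}" for v w :: "'c \<Rightarrow> 'a" by auto
  show "\<forall>v w. v \<in> carrier ?F \<and> w \<in> carrier ?F \<longrightarrow> v \<oplus>\<^bsub>?F\<^esub> w \<in> carrier ?F"
  proof (intro allI impI)
    fix v w assume vw: "v \<in> carrier ?F \<and> w \<in> carrier ?F"
    then have "finite ({g. v g \<noteq> \<zero>} \<union> {g. w g \<noteq> \<zero>})" "{g. v g \<noteq> \<zero>} \<union> {g. w g \<noteq> \<zero>} \<subseteq> G"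
      by (auto simp: free_module_carrier)
    then show "v \<oplus>\<^bsub>?F\<^esub> w \<in> carrier ?F"
      using vw supp[of v w] finite_subset subset_trans unfolding free_module_carrier free_module_simps by blast
  qed
  show "\<forall>v\<in>carrier ?F. \<exists>neg_v\<in>carrier ?F. v \<oplus>\<^bsub>?F\<^esub> neg_v = \<zero>\<^bsub>?F\<^esub>"
  proof
    fix v assume v: "v \<in> carrier ?F"
    have "{g. \<ominus> v g \<noteq> \<zero>} = {g. v g \<noteq> \<zero>}" using v by (auto simp: free_module_carrier)
    then have "(\<lambda>g. \<ominus> v g) \<in> carrier ?F" using v by (auto simp: free_module_carrier)
    moreover have "v \<oplus>\<^bsub>?F\<^esub> (\<lambda>g. \<ominus> v g) = \<zero>\<^bsub>?F\<^esub>" using v by (auto simp: free_module_carrier r_neg)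
    ultimately show "\<exists>neg_v\<in>carrier ?F. v \<oplus>\<^bsub>?F\<^esub> neg_v = \<zero>\<^bsub>?F\<^esub>" by blast
  qed
  show "\<forall>c v. c \<in> carrier R \<and> v \<in> carrier ?F \<longrightarrow> c \<odot>\<^bsub>?F\<^esub> v \<in> carrier ?F"
  proof (intro allI impI)
    fix c v assume cv: "c \<in> carrier R \<and> v \<in> carrier ?F"
    then have "{g. c \<otimes> v g \<noteq> \<zero>} \<subseteq> {g. v g \<noteq> \<zero>}" by (auto simp: free_module_carrier)
    then show "c \<odot>\<^bsub>?F\<^esub> v \<in> carrier ?F" using cv finite_subset
      unfolding free_module_carrier free_module_simps by (meson m_closed subset_trans)
  qed
qed (auto simp: free_module_carrier a_ac m_ac l_distr r_distr fun_eq_iff)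

lemma (in cring) free_gen_closed: "x \<in> G \<Longrightarrow> free_gen R x \<in> carrier (free_module R G)"
  by (auto simp: free_module_carrier free_gen_def intro: finite_subset[of _ "{x}"])

lemma (in cring) free_module_induct [consumes 1, case_names zero gen add]:
  assumes v: "v \<in> carrier (free_module R G)"
    and zero: "P \<zero>\<^bsub>free_module R G\<^esub>"
    and gen: "\<And>r x. r \<in> carrier R \<Longrightarrow> x \<in> G \<Longrightarrow> P (r \<odot>\<^bsub>free_module R G\<^esub> free_gen R x)"
    and add: "\<And>v w. v \<in> carrier (free_module R G) \<Longrightarrow> w \<in> carrier (free_module R G) \<Longrightarrow> P v \<Longrightarrow> P w \<Longrightarrow> P (v \<oplus>\<^bsub>free_module R G\<^esub> w)"
  shows "P v"
proof -
  have "P v" if "finite A" "{g. v g \<noteq> \<zero>} \<subseteq> A" "A \<subseteq> G" "\<And>g. v g \<in> carrier R" for A v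
    using that
  proof (induction A arbitrary: v rule: finite_induct)
    case empty
    then have "v = \<zero>\<^bsub>free_module R G\<^esub>" by auto
    then show ?case using zero by simp
  next
    case (insert x A)
    let ?w = "\<lambda>g. if g = x then \<zero> else v g"
    have s: "{g. ?w g \<noteq> \<zero>} \<subseteq> A" using insert.prems by auto
    have w: "P ?w" by (rule insert.IH[OF s]) (use insert.prems in auto)
    have wc: "?w \<in> carrier (free_module R G)"
      unfolding free_module_carrier
    proof (intro conjI allI)
      show "finite {g. ?w g \<noteq> \<zero>}" by (rule finite_subset[OF s insert.hyps(1)])
      show "{g. ?w g \<noteq> \<zero>} \<subseteq> G" using s insert.prems(2) by blast
      show "?w g \<in> carrier R" for g using insert.prems(3)[of g] by simp
    qed
    have xG: "x \<in> G" using insert.prems by auto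
    interpret F: module R "free_module R G" by (rule free_module_is_module)
    have "v x \<odot>\<^bsub>free_module R G\<^esub> free_gen R x \<in> carrier (free_module R G)"
      using insert.prems free_gen_closed[OF xG] by (intro F.smult_closed) auto
    from add[OF wc this w gen] have "P (?w \<oplus>\<^bsub>free_module R G\<^esub> v x \<odot>\<^bsub>free_module R G\<^esub> free_gen R x)"
      using insert.prems xG by blast
    moreover have "?w \<oplus>\<^bsub>free_module R G\<^esub> v x \<odot>\<^bsub>free_module R G\<^esub> free_gen R x = v"
      using insert.prems by (auto simp: free_gen_def fun_eq_iff)
    ultimately show ?case by simp
  qed
  then show ?thesis using v by (auto simp: free_module_carrier)
qed

text \<open>The quotient module is a set of cosets, and scalar multiplication is defined on a coset as a union over
its members. Here its operations are reduced to representatives.\<close>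

locale module_quotient = module R M for R (structure) and M (structure) +
  fixes N
  assumes N: "submodule R N M"
begin

abbreviation "cls x \<equiv> N +>\<^bsub>M\<^esub> x"

lemma N_sub: "N \<subseteq> carrier M" and N_zero: "\<zero>\<^bsub>M\<^esub> \<in> N"
  and N_add: "x \<in> N \<Longrightarrow> y \<in> N \<Longrightarrow> x \<oplus>\<^bsub>M\<^esub> y \<in> N" and N_smult: "r \<in> carrier R \<Longrightarrow> x \<in> N \<Longrightarrow> r \<odot>\<^bsub>M\<^esub> x \<in> N"
  using N by (auto simp: submodule_def)

lemma N_abelian_subgroup: "abelian_subgroup N M"
proof (rule abelian_subgroupI3)
  show "additive_subgroup N M"
  proof (rule additive_subgroupI, rule M.add.subgroupI)
    fix a assume a: "a \<in> N"
    then have "(\<ominus> \<one>) \<odot>\<^bsub>M\<^esub> a \<in> N" by (intro N_smult) auto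
    moreover have "(\<ominus> \<one>) \<odot>\<^bsub>M\<^esub> a = \<ominus>\<^bsub>M\<^esub> a" using a N_sub smult_l_minus[of \<one> a] by auto
    ultimately show "\<ominus>\<^bsub>M\<^esub> a \<in> N" by simp
  qed (use N_sub N_zero N_add in auto)
  show "abelian_group M" by (rule M.abelian_group_axioms)
qed

lemma cls_eq_iff: "x \<in> carrier M \<Longrightarrow> y \<in> carrier M \<Longrightarrow> cls x = cls y \<longleftrightarrow> x \<ominus>\<^bsub>M\<^esub> y \<in> N"
proof -
  interpret abelian_subgroup N M by (rule N_abelian_subgroup)
  assume xy: "x \<in> carrier M" "y \<in> carrier M"
  have "cls x = cls y \<longleftrightarrow> x \<in> cls y"
    using a_rcos_self[OF xy(1)] a_repr_independence'[of x y] xy by auto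
  then show ?thesis using a_rcos_module[OF xy(2,1)] by (simp add: a_minus_def)
qed

abbreviation "Qm \<equiv> quotient_module M N"

lemma quotient_carrier: "carrier Qm = cls ` carrier M"
  by (auto simp: quotient_module_def A_RCOSETS_def')

lemma quotient_add: "x \<in> carrier M \<Longrightarrow> y \<in> carrier M \<Longrightarrow> cls x \<oplus>\<^bsub>Qm\<^esub> cls y = cls (x \<oplus>\<^bsub>M\<^esub> y)"
  using abelian_subgroup.a_rcos_sum[OF N_abelian_subgroup] by (simp add: quotient_module_def)

lemma quotient_zero: "\<zero>\<^bsub>Qm\<^esub> = cls \<zero>\<^bsub>M\<^esub>"
  using M.a_coset_add_zero[OF N_sub] by (simp add: quotient_module_def)

lemma quotient_smult:
  assumes r: "r \<in> carrier R" and x: "x \<in> carrier M"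
  shows "r \<odot>\<^bsub>Qm\<^esub> cls x = cls (r \<odot>\<^bsub>M\<^esub> x)"
proof -
  interpret abelian_subgroup N M by (rule N_abelian_subgroup)
  have *: "cls (r \<odot>\<^bsub>M\<^esub> y) = cls (r \<odot>\<^bsub>M\<^esub> x)" if y: "y \<in> cls x" for y
  proof -
    have yc: "y \<in> carrier M" using y x a_elemrcos_carrier by blast
    have "y \<ominus>\<^bsub>M\<^esub> x \<in> N" using a_rcos_module[OF x yc] y by (simp add: a_minus_def)
    then have "r \<odot>\<^bsub>M\<^esub> (y \<ominus>\<^bsub>M\<^esub> x) \<in> N" by (rule N_smult[OF r])
    then have "r \<odot>\<^bsub>M\<^esub> y \<ominus>\<^bsub>M\<^esub> r \<odot>\<^bsub>M\<^esub> x \<in> N"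
      using r x yc by (simp add: a_minus_def smult_r_distr smult_r_minus)
    then show ?thesis using r x yc by (simp add: cls_eq_iff)
  qed
  have ne: "cls x \<noteq> {}" using a_rcos_self[OF x] by blast
  have "r \<odot>\<^bsub>Qm\<^esub> cls x = (\<Union>y\<in>cls x. cls (r \<odot>\<^bsub>M\<^esub> y))" by (simp add: quotient_module_def)
  also have "\<dots> = (\<Union>y\<in>cls x. cls (r \<odot>\<^bsub>M\<^esub> x))" by (intro SUP_cong refl *)
  also have "\<dots> = cls (r \<odot>\<^bsub>M\<^esub> x)" using ne by (simp only: UN_constant if_False)
  finally show ?thesis .
qed

lemma quotientE:
  assumes "U \<in> carrier Qm" obtains x where "x \<in> carrier M" "U = cls x"
  using assms unfolding quotient_carrier by (rule imageE) blast

lemma cls_closed: "x \<in> carrier M \<Longrightarrow> cls x \<in> carrier Qm"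
  unfolding quotient_carrier by (rule imageI)

lemma quotient_is_module: "module R Qm"
proof (rule module_criteria)
  show "cring R" ..
  show "\<zero>\<^bsub>Qm\<^esub> \<in> carrier Qm" unfolding quotient_zero by (rule cls_closed) simp
  show "\<forall>v w. v \<in> carrier Qm \<and> w \<in> carrier Qm \<longrightarrow> v \<oplus>\<^bsub>Qm\<^esub> w \<in> carrier Qm"
    by (metis quotientE cls_closed quotient_add M.a_closed)
  show "\<forall>v\<in>carrier Qm. \<exists>neg_v\<in>carrier Qm. v \<oplus>\<^bsub>Qm\<^esub> neg_v = \<zero>\<^bsub>Qm\<^esub>"
    by (metis quotientE cls_closed quotient_add quotient_zero M.a_inv_closed M.r_neg)
  show "\<forall>c v. c \<in> carrier R \<and> v \<in> carrier Qm \<longrightarrow> c \<odot>\<^bsub>Qm\<^esub> v \<in> carrier Qm"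
    by (metis quotientE cls_closed quotient_smult smult_closed)
  show "\<forall>v w. v \<in> carrier Qm \<and> w \<in> carrier Qm \<longrightarrow> v \<oplus>\<^bsub>Qm\<^esub> w = w \<oplus>\<^bsub>Qm\<^esub> v"
    by (metis quotientE quotient_add M.a_comm)
  show "\<forall>v w x. v \<in> carrier Qm \<and> w \<in> carrier Qm \<and> x \<in> carrier Qm \<longrightarrow>
    v \<oplus>\<^bsub>Qm\<^esub> w \<oplus>\<^bsub>Qm\<^esub> x = v \<oplus>\<^bsub>Qm\<^esub> (w \<oplus>\<^bsub>Qm\<^esub> x)"
  proof (intro allI impI)
    fix v w x assume "v \<in> carrier Qm \<and> w \<in> carrier Qm \<and> x \<in> carrier Qm"
    then obtain a b c where "a \<in> carrier M" "b \<in> carrier M" "c \<in> carrier M" "v = cls a" "w = cls b" "x = cls c"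
      by (metis quotientE)
    then show "v \<oplus>\<^bsub>Qm\<^esub> w \<oplus>\<^bsub>Qm\<^esub> x = v \<oplus>\<^bsub>Qm\<^esub> (w \<oplus>\<^bsub>Qm\<^esub> x)" by (simp add: quotient_add M.a_assoc)
  qed
  show "\<forall>v\<in>carrier Qm. v \<oplus>\<^bsub>Qm\<^esub> \<zero>\<^bsub>Qm\<^esub> = v"
    by (metis quotientE quotient_add quotient_zero M.r_zero M.zero_closed)
  show "\<forall>a b v. a \<in> carrier R \<and> b \<in> carrier R \<and> v \<in> carrier Qm \<longrightarrow> (a \<otimes> b) \<odot>\<^bsub>Qm\<^esub> v = a \<odot>\<^bsub>Qm\<^esub> (b \<odot>\<^bsub>Qm\<^esub> v)"
  proof (intro allI impI)
    fix a b v assume ab: "a \<in> carrier R \<and> b \<in> carrier R \<and> v \<in> carrier Qm"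
    then obtain c where "c \<in> carrier M" "v = cls c" by (metis quotientE)
    then show "(a \<otimes> b) \<odot>\<^bsub>Qm\<^esub> v = a \<odot>\<^bsub>Qm\<^esub> (b \<odot>\<^bsub>Qm\<^esub> v)" using ab by (simp add: quotient_smult smult_assoc1)
  qed
  show "\<forall>v\<in>carrier Qm. \<one> \<odot>\<^bsub>Qm\<^esub> v = v"
    by (metis quotientE quotient_smult smult_one R.one_closed)
  show "\<forall>a b v. a \<in> carrier R \<and> b \<in> carrier R \<and> v \<in> carrier Qm \<longrightarrow>
    (a \<oplus> b) \<odot>\<^bsub>Qm\<^esub> v = a \<odot>\<^bsub>Qm\<^esub> v \<oplus>\<^bsub>Qm\<^esub> b \<odot>\<^bsub>Qm\<^esub> v"
  proof (intro allI impI)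
    fix a b v assume ab: "a \<in> carrier R \<and> b \<in> carrier R \<and> v \<in> carrier Qm"
    then obtain c where "c \<in> carrier M" "v = cls c" by (metis quotientE)
    then show "(a \<oplus> b) \<odot>\<^bsub>Qm\<^esub> v = a \<odot>\<^bsub>Qm\<^esub> v \<oplus>\<^bsub>Qm\<^esub> b \<odot>\<^bsub>Qm\<^esub> v"
      using ab by (simp add: quotient_smult quotient_add smult_l_distr)
  qed
  show "\<forall>a v w. a \<in> carrier R \<and> v \<in> carrier Qm \<and> w \<in> carrier Qm \<longrightarrow>
    a \<odot>\<^bsub>Qm\<^esub> (v \<oplus>\<^bsub>Qm\<^esub> w) = a \<odot>\<^bsub>Qm\<^esub> v \<oplus>\<^bsub>Qm\<^esub> a \<odot>\<^bsub>Qm\<^esub> w"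
  proof (intro allI impI)
    fix a v w assume ab: "a \<in> carrier R \<and> v \<in> carrier Qm \<and> w \<in> carrier Qm"
    then obtain b c where "b \<in> carrier M" "v = cls b" "c \<in> carrier M" "w = cls c" by (metis quotientE)
    then show "a \<odot>\<^bsub>Qm\<^esub> (v \<oplus>\<^bsub>Qm\<^esub> w) = a \<odot>\<^bsub>Qm\<^esub> v \<oplus>\<^bsub>Qm\<^esub> a \<odot>\<^bsub>Qm\<^esub> w"
      using ab by (simp add: quotient_smult quotient_add smult_r_distr)
  qed
qed

end

locale presentation = cring R for R (structure) +
  fixes G :: "'g set" and rels
  assumes rels: "rels \<subseteq> carrier (free_module R G)"
begin

abbreviation "F \<equiv> free_module R G"
abbreviation "Pm \<equiv> presented_module R G rels"
abbreviation "gen \<equiv> presented_gen R G rels"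

lemma relation_submodule: "submodule R (relation_module R G rels) F"
  unfolding relation_module_def by (rule module.span_is_submodule[OF free_module_is_module rels])

lemma quotient: "module_quotient R F (relation_module R G rels)"
  by (intro module_quotient.intro module_quotient_axioms.intro free_module_is_module relation_submodule)

abbreviation "pcls v \<equiv> relation_module R G rels +>\<^bsub>F\<^esub> v"

lemmas pcls_eq_iff = module_quotient.cls_eq_iff[OF quotient]
  and pcls_add = module_quotient.quotient_add[OF quotient, folded presented_module_def]
  and pcls_zero = module_quotient.quotient_zero[OF quotient, folded presented_module_def]
  and pcls_smult = module_quotient.quotient_smult[OF quotient, folded presented_module_def]
  and pcls_carrier = module_quotient.quotient_carrier[OF quotient, folded presented_module_def]
  and pcls_closed = module_quotient.cls_closed[OF quotient, folded presented_module_def]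
  and pclsE = module_quotient.quotientE[OF quotient, folded presented_module_def]
  and Pm_module = module_quotient.quotient_is_module[OF quotient, folded presented_module_def]

lemma gen_cls: "gen x = pcls (free_gen R x)"
  by (simp add: presented_gen_def)

text \<open>The universal property of a presentation, in the form of an upper bound for the relations.\<close>

lemma relation_module_subset:
  assumes "submodule R W F" "rels \<subseteq> W"
  shows "relation_module R G rels \<subseteq> W"
  unfolding relation_module_def by (rule module.span_is_subset[OF free_module_is_module assms(2,1)])

lemma rels_zero:
  assumes r: "r \<in> rels"
  shows "pcls r = \<zero>\<^bsub>Pm\<^esub>"
proof -
  interpret free: module R F by (rule free_module_is_module)
  have "r \<in> relation_module R G rels"
    unfolding relation_module_def using module.in_own_span[OF free_module_is_module rels] r by blast
  moreover have rc: "r \<in> carrier F" using r rels by blast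
  moreover have "r \<ominus>\<^bsub>F\<^esub> \<zero>\<^bsub>F\<^esub> = r"
  proof -
    have "\<ominus>\<^bsub>F\<^esub> \<zero>\<^bsub>F\<^esub> = \<zero>\<^bsub>F\<^esub>"
      by (rule free.M.minus_equality[OF free.M.l_zero]) (rule free.M.zero_closed)+
    then show ?thesis unfolding a_minus_def using free.M.r_zero[OF rc] by (simp only:)
  qed
  ultimately show ?thesis unfolding pcls_zero
    using pcls_eq_iff[OF rc free.M.zero_closed] by (simp only:)
qed

lemma rels_eq:
  assumes r: "v \<ominus>\<^bsub>F\<^esub> w \<in> rels" and vw: "v \<in> carrier F" "w \<in> carrier F"
  shows "pcls v = pcls w"
proof -
  have "v \<ominus>\<^bsub>F\<^esub> w \<in> relation_module R G rels"
    unfolding relation_module_def using module.in_own_span[OF free_module_is_module rels] r by blast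
  then show ?thesis using pcls_eq_iff[OF vw] by (simp only:)
qed

lemma gen_closed: "x \<in> G \<Longrightarrow> gen x \<in> carrier Pm"
  unfolding gen_cls by (rule pcls_closed[OF free_gen_closed])

text \<open>Scalar multiples of the generators suffice as base case, since the coefficients can be absorbed there.\<close>

lemma presented_induct [consumes 1, case_names zero gen add]:
  assumes x: "x \<in> carrier Pm" and zero: "P \<zero>\<^bsub>Pm\<^esub>"
    and gen: "\<And>r g. r \<in> carrier R \<Longrightarrow> g \<in> G \<Longrightarrow> P (r \<odot>\<^bsub>Pm\<^esub> gen g)"
    and add: "\<And>x y. x \<in> carrier Pm \<Longrightarrow> y \<in> carrier Pm \<Longrightarrow> P x \<Longrightarrow> P y \<Longrightarrow> P (x \<oplus>\<^bsub>Pm\<^esub> y)"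
  shows "P x"
proof -
  obtain v where v: "v \<in> carrier F" "x = pcls v" using x by (rule pclsE)
  have "P (pcls v)" using v(1)
  proof (induction v rule: free_module_induct)
    case zero then show ?case using assms(2) unfolding pcls_zero .
  next
    case (gen r g)
    have "P (r \<odot>\<^bsub>Pm\<^esub> gen g)" by (rule assms(3)[OF gen])
    then show ?case unfolding gen_cls pcls_smult[OF gen(1) free_gen_closed[OF gen(2)]] .
  next
    case (add v w)
    from assms(4)[OF pcls_closed[OF add(1)] pcls_closed[OF add(2)] add(3,4)] show ?case
      unfolding pcls_add[OF add(1,2)] .
  qed
  then show ?thesis using v(2) by simp
qed

end

section \<open>Lifting to polynomials in the differentials\<close>

text \<open>Polynomials in the first \<open>n\<close> variables are generated by constants and these variables; this reduces
identities for derivations to the generators.\<close>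

lemma mpoly_carrier_induct [consumes 1, case_names const var add mult]:
  assumes p: "p \<in> carrier (mpoly_ring n)"
    and c: "\<And>c. P (pconst c)" and v: "\<And>i. i < n \<Longrightarrow> P (pvar i)"
    and a: "\<And>p q. p \<in> carrier (mpoly_ring n) \<Longrightarrow> q \<in> carrier (mpoly_ring n) \<Longrightarrow> P p \<Longrightarrow> P q \<Longrightarrow> P (p + q)"
    and m: "\<And>p q. p \<in> carrier (mpoly_ring n) \<Longrightarrow> q \<in> carrier (mpoly_ring n) \<Longrightarrow> P p \<Longrightarrow> P q \<Longrightarrow> P (p * q)"
  shows "P p"
proof -
  have single: "P (single k d)" if "k \<in> monomials n e" for k d e
    using that
  proof (induction e arbitrary: k)
    case 0
    then show ?case using c by (simp add: monomials_0)
  next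
    case (Suc e)
    obtain i l where i: "i < n" "l \<in> monomials n e" "k = single i 1 + l"
      using Suc.prems by (rule monomials_SucE)
    have "single l d \<in> carrier (mpoly_ring n)"
      using i(2) by (intro mpoly_carrier_single) (simp add: monomials_def)
    from m[OF mpoly_carrier_var[OF i(1)] this v[OF i(1)] Suc.IH[OF i(2)]]
    show ?case unfolding i(3) by (simp only: mult_single mult_1)
  qed
  have sum: "(\<Sum>k\<in>A. single k (lookup p k)) \<in> carrier (mpoly_ring n) \<and>
      P (\<Sum>k\<in>A. single k (lookup p k))" if "finite A" "A \<subseteq> keys p" for A
    using that
  proof (induction A rule: finite_induct)
    case empty
    then show ?case using c[of 0] by simp
  next
    case (insert k A)
    then have k: "keys k \<subseteq> {..<n}" using p by (simp add: mpoly_carrier_iff)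
    then have "k \<in> monomials n (monomial_degree k)" by (simp add: monomials_def)
    then have "P (single k (lookup p k))" by (rule single)
    moreover have "single k (lookup p k) \<in> carrier (mpoly_ring n)"
      using k by (intro mpoly_carrier_single) simp
    ultimately show ?case using insert a by simp
  qed
  from sum[of "keys p"] show ?thesis using poly_mapping_sum_single[of "keys p" p] by simp
qed

text \<open>Homogeneity in the differentials only: the coefficients are arbitrary.\<close>

definition t_homogeneous :: "nat \<Rightarrow> ('r::comm_ring_1) mpoly \<Rightarrow> bool" where
  "t_homogeneous q p \<longleftrightarrow> (\<forall>m\<in>keys p. monomial_degree m = q)"

lemma t_homogeneous_zero [simp]: "t_homogeneous q 0"
  by (simp add: t_homogeneous_def)

lemma t_homogeneous_single: "monomial_degree m = q \<Longrightarrow> t_homogeneous q (single m c)"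
  by (simp add: t_homogeneous_def)

lemma t_homogeneous_add: "t_homogeneous q p \<Longrightarrow> t_homogeneous q p' \<Longrightarrow> t_homogeneous q (p + p')"
  unfolding t_homogeneous_def using keys_add[of p p'] by blast

lemma t_homogeneous_mult: "t_homogeneous q p \<Longrightarrow> t_homogeneous r p' \<Longrightarrow> t_homogeneous (q + r) (p * p')"
  unfolding t_homogeneous_def using keys_mult[of p p'] by (fastforce simp: monomial_degree_add)

lemma t_homogeneous_sum: "(\<And>a. a \<in> A \<Longrightarrow> t_homogeneous q (F a)) \<Longrightarrow> t_homogeneous q (sum F A)"
  by (induction A rule: infinite_finite_induct) (auto intro: t_homogeneous_add)

lemma t_homogeneous_const_mult: "t_homogeneous q p \<Longrightarrow> t_homogeneous q (pconst c * p)"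
  using t_homogeneous_mult[of 0 "pconst c" q p] t_homogeneous_single[of 0 0 c] by simp

lemma t_homogeneous_linear_poly: "t_homogeneous 1 (linear_poly n g)"
  unfolding linear_poly_def by (intro t_homogeneous_sum t_homogeneous_single) simp

lemma t_homogeneous_prod_mset:
  "(\<And>w. w \<in># U \<Longrightarrow> t_homogeneous 1 (F w)) \<Longrightarrow> t_homogeneous (size U) (\<Prod>w\<in>#U. F w)"
proof (induction U)
  case empty
  then show ?case using t_homogeneous_single[of 0 0 1] by simp
next
  case (add w U)
  then have "t_homogeneous (1 + size U) (F w * (\<Prod>w\<in>#U. F w))" by (intro t_homogeneous_mult) auto
  then show ?case by simp
qed

text \<open>The polynomial \<open>\<Sum> (\<partial>p/\<partial>x\<^sub>i) T\<^sub>i\<close> in the variables \<open>T\<^sub>i = dx\<^sub>i\<close>, with coefficients in the polynomial ring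
in the \<open>x\<^sub>i\<close>.\<close>

definition total_differential :: "nat \<Rightarrow> ('k::field) mpoly \<Rightarrow> 'k mpoly mpoly" where
  "total_differential n p = linear_poly n (\<lambda>i. pderivative i p)"

lemma total_differential_add: "total_differential n (p + q) = total_differential n p + total_differential n q"
  by (simp add: total_differential_def linear_poly_def pderivative_add single_add sum.distrib)

lemma total_differential_minus: "total_differential n (p - q) = total_differential n p - total_differential n q"
  by (simp add: total_differential_def linear_poly_def pderivative_minus single_diff sum_subtractf)

lemma total_differential_mult:
  "total_differential n (p * q) = pconst p * total_differential n q + pconst q * total_differential n p"
  by (simp add: total_differential_def linear_poly_def pderivative_mult single_add sum.distrib sum_distrib_left mult_single)

lemma total_differential_const: "total_differential n (pconst c) = 0"
  by (simp add: total_differential_def linear_poly_def)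

lemma total_differential_var: "i < n \<Longrightarrow> total_differential n (pvar i) = pvar i"
proof -
  assume i: "i < n"
  have "total_differential n (pvar i) = (\<Sum>j<n. if j = i then pvar i else 0 :: 'a mpoly mpoly)"
    unfolding total_differential_def linear_poly_def
    by (intro sum.cong refl) (simp add: pderivative_single lookup_single when_def)
  then show ?thesis using i by simp
qed

lemma t_homogeneous_total_differential: "t_homogeneous 1 (total_differential n p)"
  unfolding total_differential_def by (rule t_homogeneous_linear_poly)

context hypersurface
begin

abbreviation "df \<equiv> total_differential n f"

definition "Jac = gen3 (pconst f) df 0"

text \<open>Congruence modulo \<open>f\<close> and \<open>df\<close>, that is, equality in the symmetric algebra of the differentials of \<open>R\<close>.\<close>

definition cong_jac :: "'k mpoly mpoly \<Rightarrow> 'k mpoly mpoly \<Rightarrow> bool" (infix \<open>\<simeq>\<^sub>J\<close> 50) where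
  "u \<simeq>\<^sub>J v \<longleftrightarrow> u - v \<in> Jac"

lemma cong_refl [simp]: "u \<simeq>\<^sub>J u"
  by (simp add: cong_jac_def Jac_def)

lemma cong_trans [trans]: "u \<simeq>\<^sub>J v \<Longrightarrow> v \<simeq>\<^sub>J w \<Longrightarrow> u \<simeq>\<^sub>J w"
  using gen3_add[of "u - v" "pconst f" df 0 "v - w"] by (simp add: cong_jac_def Jac_def)

lemma cong_sym: "u \<simeq>\<^sub>J v \<Longrightarrow> v \<simeq>\<^sub>J u"
  using gen3_mult[of "u - v" "pconst f" df 0 "-1"] by (simp add: cong_jac_def Jac_def)

lemma cong_add: "u \<simeq>\<^sub>J v \<Longrightarrow> u' \<simeq>\<^sub>J v' \<Longrightarrow> u + u' \<simeq>\<^sub>J v + v'"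
  using gen3_add[of "u - v" "pconst f" df 0 "u' - v'"] by (simp add: cong_jac_def Jac_def algebra_simps)

lemma cong_mult: "u \<simeq>\<^sub>J v \<Longrightarrow> u' \<simeq>\<^sub>J v' \<Longrightarrow> u * u' \<simeq>\<^sub>J v * v'"
proof -
  assume "u \<simeq>\<^sub>J v" "u' \<simeq>\<^sub>J v'"
  then have "u' * (u - v) + v * (u' - v') \<in> Jac" unfolding cong_jac_def Jac_def by (intro gen3_add gen3_mult)
  then show ?thesis by (simp add: cong_jac_def algebra_simps)
qed

lemma cong_minus: "u \<simeq>\<^sub>J v \<Longrightarrow> u' \<simeq>\<^sub>J v' \<Longrightarrow> u - u' \<simeq>\<^sub>J v - v'"
  using gen3_minus[of "u - v" "pconst f" df 0 "u' - v'"] by (simp add: cong_jac_def Jac_def algebra_simps)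

lemma cong_sum: "(\<And>a. a \<in> A \<Longrightarrow> F a \<simeq>\<^sub>J H a) \<Longrightarrow> sum F A \<simeq>\<^sub>J sum H A"
  by (induction A rule: infinite_finite_induct) (auto intro: cong_add)

lemma cong_zero_iff: "u \<simeq>\<^sub>J 0 \<longleftrightarrow> u \<in> Jac"
  by (simp add: cong_jac_def)

lemma f_multiple_cong: "pconst (f * s) * u \<simeq>\<^sub>J 0"
  unfolding cong_zero_iff Jac_def
  by (rule gen3I[of _ _ "pconst s * u" _ 0 _ 0]) (simp add: mult_single flip: mult.assoc)

lemma pconst_cong:
  assumes "p \<in> carrier S" "q \<in> carrier S" "rc p = rc q"
  shows "pconst p \<simeq>\<^sub>J pconst q"
proof -
  obtain s where "p - q = f * s" using rc_eq_iff assms by blast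
  then have "pconst p - pconst q = pconst (f * s) * 1" by (simp flip: single_diff)
  then show ?thesis using f_multiple_cong[of s 1] unfolding cong_jac_def by simp
qed

lemma rep_cong:
  assumes "p \<in> carrier S" shows "pconst (rep (rc p)) \<simeq>\<^sub>J pconst p"
  using assms rep[of "rc p"] by (intro pconst_cong) auto

lemma rep_add_cong: "a \<in> carrier R \<Longrightarrow> b \<in> carrier R \<Longrightarrow> pconst (rep (a \<oplus>\<^bsub>R\<^esub> b)) \<simeq>\<^sub>J pconst (rep a) + pconst (rep b)"
proof -
  assume ab: "a \<in> carrier R" "b \<in> carrier R"
  have "a \<oplus>\<^bsub>R\<^esub> b = rc (rep a + rep b)" using ab rep R_add by metis
  then show ?thesis using rep_cong[of "rep a + rep b"] rep_closed ab by (simp add: single_add)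
qed

lemma rep_mult_cong: "a \<in> carrier R \<Longrightarrow> b \<in> carrier R \<Longrightarrow> pconst (rep (a \<otimes>\<^bsub>R\<^esub> b)) \<simeq>\<^sub>J pconst (rep a) * pconst (rep b)"
proof -
  assume ab: "a \<in> carrier R" "b \<in> carrier R"
  have "a \<otimes>\<^bsub>R\<^esub> b = rc (rep a * rep b)" using ab rep R_mult by metis
  then show ?thesis using rep_cong[of "rep a * rep b"] rep_closed ab by (simp add: mult_single)
qed

lemma rep_zero_cong: "pconst (rep \<zero>\<^bsub>R\<^esub>) \<simeq>\<^sub>J 0"
  using rep_cong[of 0] by (simp add: R_zero)

lemma rep_one_cong: "pconst (rep \<one>\<^bsub>R\<^esub>) \<simeq>\<^sub>J 1"
  using rep_cong[of 1] by (simp add: R_one)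

lemma total_differential_cong:
  assumes "p \<in> carrier S" "q \<in> carrier S" "rc p = rc q"
  shows "total_differential n p \<simeq>\<^sub>J total_differential n q"
proof -
  obtain s where s: "p - q = f * s" using rc_eq_iff assms by blast
  have "total_differential n p - total_differential n q = pconst f * total_differential n s + df * pconst s + 0 * 0"
    unfolding total_differential_minus[symmetric] s total_differential_mult by (simp add: mult.commute)
  then show ?thesis unfolding cong_jac_def Jac_def by (rule gen3I)
qed

text \<open>The value on the element \<open>v\<close> of a free \<open>R\<close>-module of the map that sends a generator \<open>g\<close> to \<open>t g\<close>. Since
coefficients in \<open>R\<close> have to be represented by polynomials, it is linear only modulo \<open>f\<close> and \<open>df\<close>.\<close>

definition lift_sum :: "('g \<Rightarrow> 'k mpoly mpoly) \<Rightarrow> ('g \<Rightarrow> 'k mpoly set) \<Rightarrow> 'k mpoly mpoly" where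
  "lift_sum t v = (\<Sum>g\<in>{g. v g \<noteq> \<zero>\<^bsub>R\<^esub>}. pconst (rep (v g)) * t g)"

lemma lift_sum_superset:
  assumes "finite A" "{g. v g \<noteq> \<zero>\<^bsub>R\<^esub>} \<subseteq> A"
  shows "lift_sum t v \<simeq>\<^sub>J (\<Sum>g\<in>A. pconst (rep (v g)) * t g)"
proof -
  let ?B = "{g. v g \<noteq> \<zero>\<^bsub>R\<^esub>}"
  have "(\<Sum>g\<in>A - ?B. pconst (rep (v g)) * t g) \<simeq>\<^sub>J (\<Sum>g\<in>A - ?B. 0 * t g)"
    using rep_zero_cong by (intro cong_sum cong_mult) auto
  then have "(\<Sum>g\<in>A - ?B. pconst (rep (v g)) * t g) + lift_sum t v \<simeq>\<^sub>J 0 + lift_sum t v"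
    by (intro cong_add) simp_all
  moreover have "(\<Sum>g\<in>A. pconst (rep (v g)) * t g) = (\<Sum>g\<in>A - ?B. pconst (rep (v g)) * t g) + lift_sum t v"
    unfolding lift_sum_def by (rule sum.subset_diff[OF assms(2,1)])
  ultimately show ?thesis by (simp add: cong_sym)
qed

lemma lift_sum_add:
  assumes "v \<in> carrier (free_module R G)" "w \<in> carrier (free_module R G)"
  shows "lift_sum t (v \<oplus>\<^bsub>free_module R G\<^esub> w) \<simeq>\<^sub>J lift_sum t v + lift_sum t w"
proof -
  interpret R: cring R by (rule R_cring)
  let ?A = "{g. v g \<noteq> \<zero>\<^bsub>R\<^esub>} \<union> {g. w g \<noteq> \<zero>\<^bsub>R\<^esub>}"
  have fin: "finite ?A" and c: "\<And>g. v g \<in> carrier R" "\<And>g. w g \<in> carrier R" using assms by (auto simp: free_module_carrier)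
  have "{g. v g \<oplus>\<^bsub>R\<^esub> w g \<noteq> \<zero>\<^bsub>R\<^esub>} \<subseteq> ?A"
    unfolding Collect_disj_eq[symmetric] by (rule Collect_mono) (use R.l_zero[OF R.zero_closed] in metis)
  then have "lift_sum t (v \<oplus>\<^bsub>free_module R G\<^esub> w) \<simeq>\<^sub>J (\<Sum>g\<in>?A. pconst (rep (v g \<oplus>\<^bsub>R\<^esub> w g)) * t g)"
    unfolding free_module_simps by (rule lift_sum_superset[OF fin])
  also have "\<dots> \<simeq>\<^sub>J (\<Sum>g\<in>?A. (pconst (rep (v g)) + pconst (rep (w g))) * t g)"
    by (intro cong_sum cong_mult rep_add_cong c cong_refl)
  also have "\<dots> = (\<Sum>g\<in>?A. pconst (rep (v g)) * t g) + (\<Sum>g\<in>?A. pconst (rep (w g)) * t g)"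
    by (simp only: distrib_right sum.distrib)
  also have "\<dots> \<simeq>\<^sub>J lift_sum t v + lift_sum t w"
    by (intro cong_add cong_sym[OF lift_sum_superset[OF fin]]) auto
  finally show ?thesis .
qed

lemma lift_sum_smult:
  assumes "v \<in> carrier (free_module R G)" "r \<in> carrier R"
  shows "lift_sum t (r \<odot>\<^bsub>free_module R G\<^esub> v) \<simeq>\<^sub>J pconst (rep r) * lift_sum t v"
proof -
  interpret R: cring R by (rule R_cring)
  let ?A = "{g. v g \<noteq> \<zero>\<^bsub>R\<^esub>}"
  have fin: "finite ?A" and c: "\<And>g. v g \<in> carrier R" using assms by (auto simp: free_module_carrier)
  have "{g. r \<otimes>\<^bsub>R\<^esub> v g \<noteq> \<zero>\<^bsub>R\<^esub>} \<subseteq> ?A"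
    by (rule Collect_mono) (use R.r_null[OF assms(2)] in metis)
  then have "lift_sum t (r \<odot>\<^bsub>free_module R G\<^esub> v) \<simeq>\<^sub>J (\<Sum>g\<in>?A. pconst (rep (r \<otimes>\<^bsub>R\<^esub> v g)) * t g)"
    unfolding free_module_simps by (rule lift_sum_superset[OF fin])
  also have "\<dots> \<simeq>\<^sub>J (\<Sum>g\<in>?A. (pconst (rep r) * pconst (rep (v g))) * t g)"
    by (intro cong_sum cong_mult rep_mult_cong c cong_refl assms(2))
  also have "\<dots> = pconst (rep r) * lift_sum t v"
    by (simp only: lift_sum_def sum_distrib_left mult.assoc)
  finally show ?thesis .
qed

lemma lift_sum_zero: "lift_sum t \<zero>\<^bsub>free_module R G\<^esub> = 0"
  by (simp add: lift_sum_def)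

lemma lift_sum_gen: "lift_sum t (free_gen R x) \<simeq>\<^sub>J t x"
proof -
  have "lift_sum t (free_gen R x) \<simeq>\<^sub>J (\<Sum>g\<in>{x}. pconst (rep (free_gen R x g)) * t g)"
    by (rule lift_sum_superset) (auto simp: free_gen_def)
  also have "\<dots> = pconst (rep \<one>\<^bsub>R\<^esub>) * t x" by (simp add: free_gen_def)
  also have "\<dots> \<simeq>\<^sub>J 1 * t x" by (intro cong_mult rep_one_cong cong_refl)
  finally show ?thesis by simp
qed

lemma lift_sum_diff:
  assumes v: "v \<in> carrier (free_module R G)" and w: "w \<in> carrier (free_module R G)"
  shows "lift_sum t (v \<ominus>\<^bsub>free_module R G\<^esub> w) \<simeq>\<^sub>J lift_sum t v - lift_sum t w"
proof -
  interpret F: module R "free_module R G" by (rule cring.free_module_is_module[OF R_cring])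
  have c: "v \<ominus>\<^bsub>free_module R G\<^esub> w \<in> carrier (free_module R G)" by (rule F.M.minus_closed[OF v w])
  have "(v \<ominus>\<^bsub>free_module R G\<^esub> w) \<oplus>\<^bsub>free_module R G\<^esub> w = v"
    unfolding a_minus_def using v w F.M.a_assoc F.M.l_neg F.M.r_zero F.M.a_inv_closed by metis
  then have "lift_sum t v \<simeq>\<^sub>J lift_sum t (v \<ominus>\<^bsub>free_module R G\<^esub> w) + lift_sum t w"
    using lift_sum_add[OF c w] by metis
  then show ?thesis using cong_sym cong_minus[OF _ cong_refl[of "lift_sum t w"]] by fastforce
qed

lemma t_homogeneous_lift_sum:
  assumes "v \<in> carrier (free_module R G)" "\<And>g. g \<in> G \<Longrightarrow> t_homogeneous q (t g)"
  shows "t_homogeneous q (lift_sum t v)"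
  unfolding lift_sum_def using assms
  by (intro t_homogeneous_sum t_homogeneous_const_mult) (auto simp: free_module_carrier)

text \<open>The elements with lift zero form a submodule, so a submodule of relations lifts to zero as soon as its generators do.\<close>

lemma lift_kernel_submodule:
  "submodule R {v \<in> carrier (free_module R G). lift_sum t v \<simeq>\<^sub>J 0} (free_module R G)"
proof -
  interpret F: module R "free_module R G" by (rule cring.free_module_is_module[OF R_cring])
  show ?thesis
  proof (rule submodule.intro)
    show "module R (free_module R G)" by (rule F.module_axioms)
    show "{v \<in> carrier (free_module R G). lift_sum t v \<simeq>\<^sub>J 0} \<subseteq> carrier (free_module R G)" by blast
    show "\<zero>\<^bsub>free_module R G\<^esub> \<in> {v \<in> carrier (free_module R G). lift_sum t v \<simeq>\<^sub>J 0}"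
      using F.M.zero_closed lift_sum_zero[of t G] cong_refl by (intro CollectI conjI) auto
    fix v assume v: "v \<in> {v \<in> carrier (free_module R G). lift_sum t v \<simeq>\<^sub>J 0}"
    { fix w assume w: "w \<in> {v \<in> carrier (free_module R G). lift_sum t v \<simeq>\<^sub>J 0}"
      have "lift_sum t (v \<oplus>\<^bsub>free_module R G\<^esub> w) \<simeq>\<^sub>J lift_sum t v + lift_sum t w" using v w by (intro lift_sum_add) auto
      also have "\<dots> \<simeq>\<^sub>J 0 + 0" using v w by (intro cong_add) auto
      finally show "v \<oplus>\<^bsub>free_module R G\<^esub> w \<in> {v \<in> carrier (free_module R G). lift_sum t v \<simeq>\<^sub>J 0}"
        using v w F.M.a_closed by auto }
    { fix r assume r: "r \<in> carrier R"
      have "lift_sum t (r \<odot>\<^bsub>free_module R G\<^esub> v) \<simeq>\<^sub>J pconst (rep r) * lift_sum t v" using v r by (intro lift_sum_smult) auto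
      also have "\<dots> \<simeq>\<^sub>J pconst (rep r) * 0" using v by (intro cong_mult) auto
      finally show "r \<odot>\<^bsub>free_module R G\<^esub> v \<in> {v \<in> carrier (free_module R G). lift_sum t v \<simeq>\<^sub>J 0}"
        using v r F.smult_closed by auto }
  qed
qed

text \<open>A chosen lift of an element of a presented module. It depends on choices, but only up to congruence, provided that
the relations lift to zero.\<close>

definition lift_of :: "'g set \<Rightarrow> ('g \<Rightarrow> 'k mpoly set) set \<Rightarrow> ('g \<Rightarrow> 'k mpoly mpoly) \<Rightarrow>
    ('g \<Rightarrow> 'k mpoly set) set \<Rightarrow> 'k mpoly mpoly" where
  "lift_of G rels t x = lift_sum t (SOME v. v \<in> carrier (free_module R G) \<and> x = relation_module R G rels +>\<^bsub>free_module R G\<^esub> v)"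

context
  fixes G :: "'g set" and rels and t
  assumes rels: "rels \<subseteq> carrier (free_module R G)" and kill: "\<And>r. r \<in> rels \<Longrightarrow> lift_sum t r \<simeq>\<^sub>J 0"
begin

lemma presentation_R: "presentation R G rels"
  by (intro presentation.intro presentation_axioms.intro R_cring rels)

lemma lift_of_choice:
  assumes "x \<in> carrier (presented_module R G rels)"
  shows "\<exists>v. v \<in> carrier (free_module R G) \<and> x = relation_module R G rels +>\<^bsub>free_module R G\<^esub> v \<and> lift_of G rels t x = lift_sum t v"
proof -
  have "\<exists>v. v \<in> carrier (free_module R G) \<and> x = relation_module R G rels +>\<^bsub>free_module R G\<^esub> v"
    using presentation.pclsE[OF presentation_R assms] by blast
  from someI_ex[OF this] show ?thesis unfolding lift_of_def by blast
qed

lemma lift_of_cls: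
  assumes v: "v \<in> carrier (free_module R G)"
  shows "lift_of G rels t (relation_module R G rels +>\<^bsub>free_module R G\<^esub> v) \<simeq>\<^sub>J lift_sum t v"
proof -
  obtain w where w: "w \<in> carrier (free_module R G)"
    "relation_module R G rels +>\<^bsub>free_module R G\<^esub> v = relation_module R G rels +>\<^bsub>free_module R G\<^esub> w"
    "lift_of G rels t (relation_module R G rels +>\<^bsub>free_module R G\<^esub> v) = lift_sum t w"
    using lift_of_choice[OF presentation.pcls_closed[OF presentation_R v]] by blast
  have "w \<ominus>\<^bsub>free_module R G\<^esub> v \<in> relation_module R G rels"
    using presentation.pcls_eq_iff[OF presentation_R w(1) v] w(2) by metis
  moreover have "relation_module R G rels \<subseteq> {v \<in> carrier (free_module R G). lift_sum t v \<simeq>\<^sub>J 0}"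
    using rels kill by (intro presentation.relation_module_subset[OF presentation_R lift_kernel_submodule]) auto
  ultimately have "lift_sum t (w \<ominus>\<^bsub>free_module R G\<^esub> v) \<simeq>\<^sub>J 0" by blast
  then have "lift_sum t w - lift_sum t v \<simeq>\<^sub>J 0"
    using cong_trans[OF cong_sym[OF lift_sum_diff[OF w(1) v]]] by blast
  then show ?thesis unfolding w(3) by (simp add: cong_jac_def)
qed

lemma lift_of_add:
  assumes "x \<in> carrier (presented_module R G rels)" "y \<in> carrier (presented_module R G rels)"
  shows "lift_of G rels t (x \<oplus>\<^bsub>presented_module R G rels\<^esub> y) \<simeq>\<^sub>J lift_of G rels t x + lift_of G rels t y"
proof -
  obtain v where v: "v \<in> carrier (free_module R G)" "x = relation_module R G rels +>\<^bsub>free_module R G\<^esub> v" "lift_of G rels t x = lift_sum t v"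
    using lift_of_choice[OF assms(1)] by blast
  obtain w where w: "w \<in> carrier (free_module R G)" "y = relation_module R G rels +>\<^bsub>free_module R G\<^esub> w" "lift_of G rels t y = lift_sum t w"
    using lift_of_choice[OF assms(2)] by blast
  interpret F: module R "free_module R G" by (rule cring.free_module_is_module[OF R_cring])
  have "lift_of G rels t (x \<oplus>\<^bsub>presented_module R G rels\<^esub> y) \<simeq>\<^sub>J lift_sum t (v \<oplus>\<^bsub>free_module R G\<^esub> w)"
    unfolding v(2) w(2) presentation.pcls_add[OF presentation_R v(1) w(1)]
    by (rule lift_of_cls[OF F.M.a_closed[OF v(1) w(1)]])
  also have "\<dots> \<simeq>\<^sub>J lift_of G rels t x + lift_of G rels t y" unfolding v(3) w(3) by (rule lift_sum_add[OF v(1) w(1)])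
  finally show ?thesis .
qed

lemma lift_of_smult:
  assumes "x \<in> carrier (presented_module R G rels)" "r \<in> carrier R"
  shows "lift_of G rels t (r \<odot>\<^bsub>presented_module R G rels\<^esub> x) \<simeq>\<^sub>J pconst (rep r) * lift_of G rels t x"
proof -
  obtain v where v: "v \<in> carrier (free_module R G)" "x = relation_module R G rels +>\<^bsub>free_module R G\<^esub> v" "lift_of G rels t x = lift_sum t v"
    using lift_of_choice[OF assms(1)] by blast
  interpret F: module R "free_module R G" by (rule cring.free_module_is_module[OF R_cring])
  have "lift_of G rels t (r \<odot>\<^bsub>presented_module R G rels\<^esub> x) \<simeq>\<^sub>J lift_sum t (r \<odot>\<^bsub>free_module R G\<^esub> v)"
    unfolding v(2) presentation.pcls_smult[OF presentation_R assms(2) v(1)]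
    by (rule lift_of_cls[OF F.smult_closed[OF assms(2) v(1)]])
  also have "\<dots> \<simeq>\<^sub>J pconst (rep r) * lift_of G rels t x" unfolding v(3) by (rule lift_sum_smult[OF v(1) assms(2)])
  finally show ?thesis .
qed

lemma lift_of_zero: "lift_of G rels t \<zero>\<^bsub>presented_module R G rels\<^esub> \<simeq>\<^sub>J 0"
proof -
  interpret F: module R "free_module R G" by (rule cring.free_module_is_module[OF R_cring])
  show ?thesis unfolding presentation.pcls_zero[OF presentation_R]
    using lift_of_cls[OF F.M.zero_closed] unfolding lift_sum_zero .
qed

lemma lift_of_gen: "x \<in> G \<Longrightarrow> lift_of G rels t (presented_gen R G rels x) \<simeq>\<^sub>J t x"
  unfolding presentation.gen_cls[OF presentation_R]
  by (rule cong_trans[OF lift_of_cls[OF cring.free_gen_closed[OF R_cring]] lift_sum_gen])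

lemma t_homogeneous_lift_of:
  assumes "x \<in> carrier (presented_module R G rels)" "\<And>g. g \<in> G \<Longrightarrow> t_homogeneous q (t g)"
  shows "t_homogeneous q (lift_of G rels t x)"
proof -
  obtain v where v: "v \<in> carrier (free_module R G)" "lift_of G rels t x = lift_sum t v"
    using lift_of_choice[OF assms(1)] by blast
  show ?thesis unfolding v(2) by (rule t_homogeneous_lift_sum[OF v(1) assms(2)])
qed

end

end

section \<open>Symmetric powers of the differentials\<close>

lemma with_grading_simps [simp]:
  "carrier (with_grading M g) = carrier M" "\<zero>\<^bsub>with_grading M g\<^esub> = \<zero>\<^bsub>M\<^esub>"
  "x \<oplus>\<^bsub>with_grading M g\<^esub> y = x \<oplus>\<^bsub>M\<^esub> y" "r \<odot>\<^bsub>with_grading M g\<^esub> x = r \<odot>\<^bsub>M\<^esub> x"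
  "module_part (with_grading M g) = g"
  by (simp_all add: with_grading_def)

lemma module_with_grading: "module R M \<Longrightarrow> module R (with_grading M g)"
proof -
  assume "module R M"
  then interpret module R M .
  show ?thesis
  proof (rule module_criteria)
    show "\<forall>v\<in>carrier (with_grading M g). \<exists>w\<in>carrier (with_grading M g). v \<oplus>\<^bsub>with_grading M g\<^esub> w = \<zero>\<^bsub>with_grading M g\<^esub>"
      using M.r_neg M.a_inv_closed unfolding with_grading_simps by blast
  qed (simp_all add: with_grading_def smult_l_distr smult_r_distr smult_assoc1 M.a_ac R.is_cring)
qed

context hypersurface
begin

abbreviation "K \<equiv> hypersurface_scalars n f"
abbreviation "krel \<equiv> kaehler_relations R K"
abbreviation "Om \<equiv> kaehler_differentials R K"
abbreviation "D \<equiv> kaehler_d R K"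
abbreviation "\<delta> \<equiv> free_gen R"
abbreviation "FR \<equiv> free_module R (carrier R)"

lemma K_sub: "k \<in> K \<Longrightarrow> k \<in> carrier R"
  by (auto simp: hypersurface_scalars_def mpoly_const_def)

lemma krelE:
  assumes "r \<in> krel"
  obtains (add) a b where "a \<in> carrier R" "b \<in> carrier R" "r = \<delta> (a \<oplus>\<^bsub>R\<^esub> b) \<ominus>\<^bsub>FR\<^esub> (\<delta> a \<oplus>\<^bsub>FR\<^esub> \<delta> b)"
    | (mult) a b where "a \<in> carrier R" "b \<in> carrier R"
      "r = \<delta> (a \<otimes>\<^bsub>R\<^esub> b) \<ominus>\<^bsub>FR\<^esub> (a \<odot>\<^bsub>FR\<^esub> \<delta> b \<oplus>\<^bsub>FR\<^esub> b \<odot>\<^bsub>FR\<^esub> \<delta> a)"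
    | (const) k where "k \<in> K" "r = \<delta> k"
  using assms unfolding kaehler_relations_def Let_def by blast

lemma krel_add: "a \<in> carrier R \<Longrightarrow> b \<in> carrier R \<Longrightarrow> \<delta> (a \<oplus>\<^bsub>R\<^esub> b) \<ominus>\<^bsub>FR\<^esub> (\<delta> a \<oplus>\<^bsub>FR\<^esub> \<delta> b) \<in> krel"
  and krel_mult: "a \<in> carrier R \<Longrightarrow> b \<in> carrier R \<Longrightarrow>
    \<delta> (a \<otimes>\<^bsub>R\<^esub> b) \<ominus>\<^bsub>FR\<^esub> (a \<odot>\<^bsub>FR\<^esub> \<delta> b \<oplus>\<^bsub>FR\<^esub> b \<odot>\<^bsub>FR\<^esub> \<delta> a) \<in> krel"
  and krel_const: "k \<in> K \<Longrightarrow> \<delta> k \<in> krel"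
  unfolding kaehler_relations_def Let_def by blast+

lemmas \<delta>_closed = cring.free_gen_closed[OF R_cring]
lemmas FR_module = cring.free_module_is_module[OF R_cring]

lemma krel_sub: "krel \<subseteq> carrier FR"
proof
  interpret R: cring R by (rule R_cring)
  interpret F: module R FR by (rule FR_module)
  fix r assume "r \<in> krel"
  then show "r \<in> carrier FR"
  proof (cases rule: krelE)
    case (add a b)
    show ?thesis unfolding add(3)
      by (intro F.M.minus_closed F.M.a_closed \<delta>_closed R.a_closed add(1,2))
  next
    case (mult a b)
    show ?thesis unfolding mult(3)
      by (intro F.M.minus_closed F.M.a_closed F.smult_closed \<delta>_closed R.m_closed mult(1,2))
  next
    case (const k)
    show ?thesis unfolding const(2) by (intro \<delta>_closed K_sub const(1))
  qed
qed

abbreviation "dlift a \<equiv> total_differential n (rep a)"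

lemma dlift_add: "a \<in> carrier R \<Longrightarrow> b \<in> carrier R \<Longrightarrow> dlift (a \<oplus>\<^bsub>R\<^esub> b) \<simeq>\<^sub>J dlift a + dlift b"
  unfolding total_differential_add[symmetric]
  by (rule total_differential_cong) (metis rep R_add rc_closed mpoly_carrier_add cring.cring_simprules(1)[OF R_cring])+

lemma dlift_mult: "a \<in> carrier R \<Longrightarrow> b \<in> carrier R \<Longrightarrow> dlift (a \<otimes>\<^bsub>R\<^esub> b) \<simeq>\<^sub>J pconst (rep a) * dlift b + pconst (rep b) * dlift a"
  unfolding total_differential_mult[symmetric]
  by (rule total_differential_cong) (metis rep R_mult rc_closed mpoly_carrier_mult cring.cring_simprules(5)[OF R_cring])+

lemma dlift_rc: "p \<in> carrier S \<Longrightarrow> dlift (rc p) \<simeq>\<^sub>J total_differential n p"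
  using rep[of "rc p"] by (intro total_differential_cong) simp_all

lemma dlift_const: "k \<in> K \<Longrightarrow> dlift k \<simeq>\<^sub>J 0"
proof -
  assume "k \<in> K"
  then obtain c where k: "k = rc (pconst c)" unfolding hypersurface_scalars_def mpoly_const_def by (rule imageE)
  show ?thesis unfolding k using dlift_rc[of "pconst c"] unfolding total_differential_const by simp
qed

text \<open>The total differential satisfies the rules of a derivation exactly, and passing to representatives of
residue classes changes it by a multiple of \<open>f\<close> and of \<open>df\<close>.\<close>

lemma krel_kill: "r \<in> krel \<Longrightarrow> lift_sum dlift r \<simeq>\<^sub>J 0"
proof -
  interpret R: cring R by (rule R_cring)
  interpret F: module R FR by (rule FR_module)
  assume "r \<in> krel"
  then show ?thesis
  proof (cases rule: krelE)
    case (add a b)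
    note c = \<delta>_closed[OF add(1)] \<delta>_closed[OF add(2)] \<delta>_closed[OF R.a_closed[OF add(1,2)]]
    have "lift_sum dlift r \<simeq>\<^sub>J lift_sum dlift (\<delta> (a \<oplus>\<^bsub>R\<^esub> b)) - lift_sum dlift (\<delta> a \<oplus>\<^bsub>FR\<^esub> \<delta> b)"
      unfolding add(3) by (rule lift_sum_diff[OF c(3) F.M.a_closed[OF c(1,2)]])
    also have "\<dots> \<simeq>\<^sub>J dlift (a \<oplus>\<^bsub>R\<^esub> b) - (lift_sum dlift (\<delta> a) + lift_sum dlift (\<delta> b))"
      by (intro cong_minus lift_sum_gen lift_sum_add[OF c(1,2)])
    also have "\<dots> \<simeq>\<^sub>J (dlift a + dlift b) - (dlift a + dlift b)"
      by (intro cong_minus cong_add lift_sum_gen dlift_add add(1,2))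
    finally show ?thesis by simp
  next
    case (mult a b)
    note c = \<delta>_closed[OF mult(1)] \<delta>_closed[OF mult(2)] \<delta>_closed[OF R.m_closed[OF mult(1,2)]]
    note d = F.smult_closed[OF mult(1) c(2)] F.smult_closed[OF mult(2) c(1)]
    have "lift_sum dlift r \<simeq>\<^sub>J lift_sum dlift (\<delta> (a \<otimes>\<^bsub>R\<^esub> b)) - lift_sum dlift (a \<odot>\<^bsub>FR\<^esub> \<delta> b \<oplus>\<^bsub>FR\<^esub> b \<odot>\<^bsub>FR\<^esub> \<delta> a)"
      unfolding mult(3) by (rule lift_sum_diff[OF c(3) F.M.a_closed[OF d]])
    also have "\<dots> \<simeq>\<^sub>J dlift (a \<otimes>\<^bsub>R\<^esub> b) - (lift_sum dlift (a \<odot>\<^bsub>FR\<^esub> \<delta> b) + lift_sum dlift (b \<odot>\<^bsub>FR\<^esub> \<delta> a))"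
      by (intro cong_minus lift_sum_gen lift_sum_add[OF d])
    also have "\<dots> \<simeq>\<^sub>J (pconst (rep a) * dlift b + pconst (rep b) * dlift a) -
        (pconst (rep a) * lift_sum dlift (\<delta> b) + pconst (rep b) * lift_sum dlift (\<delta> a))"
      by (intro cong_minus cong_add dlift_mult lift_sum_smult[OF c(2) mult(1)] lift_sum_smult[OF c(1) mult(2)] mult(1,2))
    also have "\<dots> \<simeq>\<^sub>J (pconst (rep a) * dlift b + pconst (rep b) * dlift a) - (pconst (rep a) * dlift b + pconst (rep b) * dlift a)"
      by (intro cong_minus cong_add cong_mult lift_sum_gen cong_refl)
    finally show ?thesis by simp
  next
    case (const k)
    have "lift_sum dlift (\<delta> k) \<simeq>\<^sub>J dlift k" by (rule lift_sum_gen)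
    then show ?thesis unfolding const(2) by (rule cong_trans[OF _ dlift_const[OF const(1)]])
  qed
qed

lemma Om_presented: "Om = with_grading (presented_module R (carrier R) krel) (module_part Om)"
  by (simp add: kaehler_differentials_def kaehler_module_def)

lemma Om_simps:
  "carrier Om = carrier (presented_module R (carrier R) krel)" "\<zero>\<^bsub>Om\<^esub> = \<zero>\<^bsub>presented_module R (carrier R) krel\<^esub>"
  "x \<oplus>\<^bsub>Om\<^esub> y = x \<oplus>\<^bsub>presented_module R (carrier R) krel\<^esub> y" "r \<odot>\<^bsub>Om\<^esub> x = r \<odot>\<^bsub>presented_module R (carrier R) krel\<^esub> x"
  by (simp_all add: kaehler_differentials_def kaehler_module_def)

lemma krel_presentation: "presentation R (carrier R) krel"
  by (rule presentation_R[OF krel_sub krel_kill])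

lemma Om_module: "module R Om"
  by (subst Om_presented) (rule module_with_grading[OF presentation.Pm_module[OF krel_presentation]])

lemma D_gen: "D = presented_gen R (carrier R) krel"
  by (simp add: kaehler_d_def)

lemma D_closed: "a \<in> carrier R \<Longrightarrow> D a \<in> carrier Om"
  unfolding D_gen Om_simps by (rule presentation.gen_closed[OF krel_presentation])

lemma D_add: "a \<in> carrier R \<Longrightarrow> b \<in> carrier R \<Longrightarrow> D (a \<oplus>\<^bsub>R\<^esub> b) = D a \<oplus>\<^bsub>Om\<^esub> D b"
proof -
  interpret R: cring R by (rule R_cring)
  interpret F: module R FR by (rule FR_module)
  assume ab: "a \<in> carrier R" "b \<in> carrier R"
  note c = \<delta>_closed[OF ab(1)] \<delta>_closed[OF ab(2)] \<delta>_closed[OF R.a_closed[OF ab]]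
  show ?thesis
    unfolding D_gen presentation.gen_cls[OF krel_presentation] Om_simps presentation.pcls_add[OF krel_presentation c(1,2)]
    by (rule presentation.rels_eq[OF krel_presentation krel_add[OF ab] c(3) F.M.a_closed[OF c(1,2)]])
qed

lemma D_mult: "a \<in> carrier R \<Longrightarrow> b \<in> carrier R \<Longrightarrow> D (a \<otimes>\<^bsub>R\<^esub> b) = a \<odot>\<^bsub>Om\<^esub> D b \<oplus>\<^bsub>Om\<^esub> b \<odot>\<^bsub>Om\<^esub> D a"
proof -
  interpret R: cring R by (rule R_cring)
  interpret F: module R FR by (rule FR_module)
  assume ab: "a \<in> carrier R" "b \<in> carrier R"
  note c = \<delta>_closed[OF ab(1)] \<delta>_closed[OF ab(2)] \<delta>_closed[OF R.m_closed[OF ab]]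
  note d = F.smult_closed[OF ab(1) c(2)] F.smult_closed[OF ab(2) c(1)]
  show ?thesis
    unfolding D_gen presentation.gen_cls[OF krel_presentation] Om_simps
      presentation.pcls_smult[OF krel_presentation ab(1) c(2)] presentation.pcls_smult[OF krel_presentation ab(2) c(1)]
      presentation.pcls_add[OF krel_presentation d]
    by (rule presentation.rels_eq[OF krel_presentation krel_mult[OF ab] c(3) F.M.a_closed[OF d]])
qed

lemma D_const: "D (rc (pconst c)) = \<zero>\<^bsub>Om\<^esub>"
proof -
  have "rc (pconst c) \<in> K" unfolding hypersurface_scalars_def mpoly_const_def by (rule rangeI)
  from presentation.rels_zero[OF krel_presentation krel_const[OF this]]
  show ?thesis unfolding D_gen presentation.gen_cls[OF krel_presentation] Om_simps .
qed

abbreviation "lam1 \<equiv> lift_of (carrier R) krel dlift"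

lemma lam1_add: "x \<in> carrier Om \<Longrightarrow> y \<in> carrier Om \<Longrightarrow> lam1 (x \<oplus>\<^bsub>Om\<^esub> y) \<simeq>\<^sub>J lam1 x + lam1 y"
  and lam1_smult: "x \<in> carrier Om \<Longrightarrow> r \<in> carrier R \<Longrightarrow> lam1 (r \<odot>\<^bsub>Om\<^esub> x) \<simeq>\<^sub>J pconst (rep r) * lam1 x"
  and lam1_zero: "lam1 \<zero>\<^bsub>Om\<^esub> \<simeq>\<^sub>J 0"
  and lam1_D: "a \<in> carrier R \<Longrightarrow> lam1 (D a) \<simeq>\<^sub>J dlift a"
  unfolding Om_simps D_gen
  using lift_of_add[OF krel_sub krel_kill] lift_of_smult[OF krel_sub krel_kill] lift_of_zero[OF krel_sub krel_kill]
    lift_of_gen[OF krel_sub krel_kill] by blast+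

lemma t_homogeneous_lam1: "x \<in> carrier Om \<Longrightarrow> t_homogeneous 1 (lam1 x)"
  unfolding Om_simps by (rule t_homogeneous_lift_of[OF krel_sub krel_kill]) (assumption | rule t_homogeneous_total_differential)+

abbreviation "sgen q \<equiv> sym_generators Om q"
abbreviation "srel q \<equiv> sym_relations R Om q"
abbreviation "Fs q \<equiv> free_module R (sgen q)"
abbreviation "Sy q \<equiv> sym_power R q Om"
abbreviation "sp q \<equiv> sym_product R q Om"
abbreviation "plift U \<equiv> (\<Prod>w\<in>#U. lam1 w)"
abbreviation "lamq q \<equiv> lift_of (sgen q) (srel q) plift"

lemma sgen_iff: "U \<in> sgen q \<longleftrightarrow> (\<forall>w. w \<in># U \<longrightarrow> w \<in> carrier Om) \<and> size U = q"
  unfolding sym_generators_def by blast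

lemma sgen_add: "x \<in> carrier Om \<Longrightarrow> U \<in> sgen p \<Longrightarrow> add_mset x U \<in> sgen (Suc p)"
  unfolding sgen_iff by (metis insert_iff set_mset_add_mset_insert size_add_mset)

lemma srelE:
  assumes "r \<in> srel q"
  obtains (add) x y U p where "x \<in> carrier Om" "y \<in> carrier Om" "U \<in> sgen p" "q = Suc p"
      "r = \<delta> (add_mset (x \<oplus>\<^bsub>Om\<^esub> y) U) \<ominus>\<^bsub>Fs q\<^esub> (\<delta> (add_mset x U) \<oplus>\<^bsub>Fs q\<^esub> \<delta> (add_mset y U))"
    | (smult) a x U p where "a \<in> carrier R" "x \<in> carrier Om" "U \<in> sgen p" "q = Suc p"
      "r = \<delta> (add_mset (a \<odot>\<^bsub>Om\<^esub> x) U) \<ominus>\<^bsub>Fs q\<^esub> (a \<odot>\<^bsub>Fs q\<^esub> \<delta> (add_mset x U))"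
  using assms unfolding sym_relations_def Let_def by blast

lemma srel_add: "x \<in> carrier Om \<Longrightarrow> y \<in> carrier Om \<Longrightarrow> U \<in> sgen p \<Longrightarrow>
    \<delta> (add_mset (x \<oplus>\<^bsub>Om\<^esub> y) U) \<ominus>\<^bsub>Fs (Suc p)\<^esub> (\<delta> (add_mset x U) \<oplus>\<^bsub>Fs (Suc p)\<^esub> \<delta> (add_mset y U)) \<in> srel (Suc p)"
  and srel_smult: "a \<in> carrier R \<Longrightarrow> x \<in> carrier Om \<Longrightarrow> U \<in> sgen p \<Longrightarrow>
    \<delta> (add_mset (a \<odot>\<^bsub>Om\<^esub> x) U) \<ominus>\<^bsub>Fs (Suc p)\<^esub> (a \<odot>\<^bsub>Fs (Suc p)\<^esub> \<delta> (add_mset x U)) \<in> srel (Suc p)"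
  unfolding sym_relations_def Let_def by blast+

lemma srel_sub: "srel q \<subseteq> carrier (Fs q)"
proof
  interpret O: module R Om by (rule Om_module)
  interpret F: module R "Fs q" by (rule FR_module)
  fix r assume "r \<in> srel q"
  then show "r \<in> carrier (Fs q)"
  proof (cases rule: srelE)
    case (add x y U p)
    show ?thesis unfolding add(5) using sgen_add[OF _ add(3)] unfolding add(4)[symmetric]
      by (intro F.M.minus_closed F.M.a_closed \<delta>_closed) (use add(1,2) O.M.a_closed in metis)+
  next
    case (smult a x U p)
    show ?thesis unfolding smult(5) using sgen_add[OF _ smult(3)] unfolding smult(4)[symmetric]
      by (intro F.M.minus_closed F.smult_closed \<delta>_closed smult(1)) (use smult(1,2) O.smult_closed in metis)+
  qed
qed

text \<open>A product of lifts is multilinear in its factors.\<close>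

lemma srel_kill: "r \<in> srel q \<Longrightarrow> lift_sum plift r \<simeq>\<^sub>J 0"
proof -
  interpret O: module R Om by (rule Om_module)
  interpret F: module R "Fs q" by (rule FR_module)
  assume "r \<in> srel q"
  then show ?thesis
  proof (cases rule: srelE)
    case (add x y U p)
    have c: "\<delta> (add_mset x U) \<in> carrier (Fs q)" "\<delta> (add_mset y U) \<in> carrier (Fs q)" "\<delta> (add_mset (x \<oplus>\<^bsub>Om\<^esub> y) U) \<in> carrier (Fs q)"
      unfolding add(4) by (intro \<delta>_closed sgen_add add(1-3) O.M.a_closed)+
    have "lift_sum plift r \<simeq>\<^sub>J lift_sum plift (\<delta> (add_mset (x \<oplus>\<^bsub>Om\<^esub> y) U)) - lift_sum plift (\<delta> (add_mset x U) \<oplus>\<^bsub>Fs q\<^esub> \<delta> (add_mset y U))"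
      unfolding add(5) by (rule lift_sum_diff[OF c(3) F.M.a_closed[OF c(1,2)]])
    also have "\<dots> \<simeq>\<^sub>J plift (add_mset (x \<oplus>\<^bsub>Om\<^esub> y) U) - (lift_sum plift (\<delta> (add_mset x U)) + lift_sum plift (\<delta> (add_mset y U)))"
      by (intro cong_minus lift_sum_gen lift_sum_add[OF c(1,2)])
    also have "\<dots> \<simeq>\<^sub>J lam1 (x \<oplus>\<^bsub>Om\<^esub> y) * plift U - (plift (add_mset x U) + plift (add_mset y U))"
      by (intro cong_minus cong_add lift_sum_gen) simp
    also have "\<dots> \<simeq>\<^sub>J (lam1 x + lam1 y) * plift U - (lam1 x * plift U + lam1 y * plift U)"
      by (intro cong_minus cong_add cong_mult cong_refl lam1_add add(1,2)) simp_all
    finally show ?thesis by (simp add: distrib_right)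
  next
    case (smult a x U p)
    have c: "\<delta> (add_mset x U) \<in> carrier (Fs q)" "\<delta> (add_mset (a \<odot>\<^bsub>Om\<^esub> x) U) \<in> carrier (Fs q)"
      unfolding smult(4) by (intro \<delta>_closed sgen_add smult(1-3) O.smult_closed)+
    have "lift_sum plift r \<simeq>\<^sub>J lift_sum plift (\<delta> (add_mset (a \<odot>\<^bsub>Om\<^esub> x) U)) - lift_sum plift (a \<odot>\<^bsub>Fs q\<^esub> \<delta> (add_mset x U))"
      unfolding smult(5) by (rule lift_sum_diff[OF c(2) F.smult_closed[OF smult(1) c(1)]])
    also have "\<dots> \<simeq>\<^sub>J plift (add_mset (a \<odot>\<^bsub>Om\<^esub> x) U) - pconst (rep a) * lift_sum plift (\<delta> (add_mset x U))"
      by (intro cong_minus lift_sum_gen lift_sum_smult[OF c(1) smult(1)])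
    also have "\<dots> \<simeq>\<^sub>J lam1 (a \<odot>\<^bsub>Om\<^esub> x) * plift U - pconst (rep a) * plift (add_mset x U)"
      by (intro cong_minus cong_mult cong_refl lift_sum_gen) simp
    also have "\<dots> \<simeq>\<^sub>J (pconst (rep a) * lam1 x) * plift U - pconst (rep a) * (lam1 x * plift U)"
      by (intro cong_minus cong_mult cong_refl lam1_smult smult(1,2)) simp
    finally show ?thesis by (simp add: mult.assoc)
  qed
qed

lemma Sy_presented: "Sy q = with_grading (presented_module R (sgen q) (srel q)) (module_part (Sy q))"
  by (simp add: sym_power_def sym_module_def)

lemma Sy_simps:
  "carrier (Sy q) = carrier (presented_module R (sgen q) (srel q))" "\<zero>\<^bsub>Sy q\<^esub> = \<zero>\<^bsub>presented_module R (sgen q) (srel q)\<^esub>"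
  "x \<oplus>\<^bsub>Sy q\<^esub> y = x \<oplus>\<^bsub>presented_module R (sgen q) (srel q)\<^esub> y" "r \<odot>\<^bsub>Sy q\<^esub> x = r \<odot>\<^bsub>presented_module R (sgen q) (srel q)\<^esub> x"
  by (simp_all add: sym_power_def sym_module_def)

lemma srel_presentation: "presentation R (sgen q) (srel q)"
  by (rule presentation_R[OF srel_sub[of q] srel_kill[of _ q]])

lemma Sy_module: "module R (Sy q)"
  by (subst Sy_presented) (rule module_with_grading[OF presentation.Pm_module[OF srel_presentation]])

lemma sp_gen: "sp q = presented_gen R (sgen q) (srel q)"
  by (simp add: sym_product_def)

lemma sp_closed: "U \<in> sgen q \<Longrightarrow> sp q U \<in> carrier (Sy q)"
  unfolding sp_gen Sy_simps by (rule presentation.gen_closed[OF srel_presentation])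

lemma sp_add:
  assumes "x \<in> carrier Om" "y \<in> carrier Om" "U \<in> sgen p"
  shows "sp (Suc p) (add_mset (x \<oplus>\<^bsub>Om\<^esub> y) U) = sp (Suc p) (add_mset x U) \<oplus>\<^bsub>Sy (Suc p)\<^esub> sp (Suc p) (add_mset y U)"
proof -
  interpret O: module R Om by (rule Om_module)
  interpret F: module R "Fs (Suc p)" by (rule FR_module)
  have c: "\<delta> (add_mset x U) \<in> carrier (Fs (Suc p))" "\<delta> (add_mset y U) \<in> carrier (Fs (Suc p))" "\<delta> (add_mset (x \<oplus>\<^bsub>Om\<^esub> y) U) \<in> carrier (Fs (Suc p))"
    by (intro \<delta>_closed sgen_add assms O.M.a_closed)+
  show ?thesis
    unfolding sp_gen presentation.gen_cls[OF srel_presentation] Sy_simps presentation.pcls_add[OF srel_presentation c(1,2)]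
    by (rule presentation.rels_eq[OF srel_presentation srel_add[OF assms] c(3) F.M.a_closed[OF c(1,2)]])
qed

lemma sp_smult:
  assumes "a \<in> carrier R" "x \<in> carrier Om" "U \<in> sgen p"
  shows "sp (Suc p) (add_mset (a \<odot>\<^bsub>Om\<^esub> x) U) = a \<odot>\<^bsub>Sy (Suc p)\<^esub> sp (Suc p) (add_mset x U)"
proof -
  interpret O: module R Om by (rule Om_module)
  interpret F: module R "Fs (Suc p)" by (rule FR_module)
  have c: "\<delta> (add_mset x U) \<in> carrier (Fs (Suc p))" "\<delta> (add_mset (a \<odot>\<^bsub>Om\<^esub> x) U) \<in> carrier (Fs (Suc p))"
    by (intro \<delta>_closed sgen_add assms O.smult_closed)+
  show ?thesis
    unfolding sp_gen presentation.gen_cls[OF srel_presentation] Sy_simps presentation.pcls_smult[OF srel_presentation assms(1) c(1)]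
    by (rule presentation.rels_eq[OF srel_presentation srel_smult[OF assms] c(2) F.smult_closed[OF assms(1) c(1)]])
qed

lemma sp_zero:
  assumes "U \<in> sgen p"
  shows "sp (Suc p) (add_mset \<zero>\<^bsub>Om\<^esub> U) = \<zero>\<^bsub>Sy (Suc p)\<^esub>"
proof -
  interpret O: module R Om by (rule Om_module)
  interpret Y: module R "Sy (Suc p)" by (rule Sy_module)
  have "sp (Suc p) (add_mset (\<zero>\<^bsub>R\<^esub> \<odot>\<^bsub>Om\<^esub> \<zero>\<^bsub>Om\<^esub>) U) = \<zero>\<^bsub>R\<^esub> \<odot>\<^bsub>Sy (Suc p)\<^esub> sp (Suc p) (add_mset \<zero>\<^bsub>Om\<^esub> U)"
    by (intro sp_smult O.R.zero_closed O.M.zero_closed assms)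
  then show ?thesis
    unfolding O.smult_l_null[OF O.M.zero_closed] Y.smult_l_null[OF sp_closed[OF sgen_add[OF O.M.zero_closed assms]]] .
qed

lemma lamq_add: "x \<in> carrier (Sy q) \<Longrightarrow> y \<in> carrier (Sy q) \<Longrightarrow> lamq q (x \<oplus>\<^bsub>Sy q\<^esub> y) \<simeq>\<^sub>J lamq q x + lamq q y"
  and lamq_smult: "x \<in> carrier (Sy q) \<Longrightarrow> r \<in> carrier R \<Longrightarrow> lamq q (r \<odot>\<^bsub>Sy q\<^esub> x) \<simeq>\<^sub>J pconst (rep r) * lamq q x"
  and lamq_zero: "lamq q \<zero>\<^bsub>Sy q\<^esub> \<simeq>\<^sub>J 0"
  and lamq_sp: "U \<in> sgen q \<Longrightarrow> lamq q (sp q U) \<simeq>\<^sub>J plift U"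
  unfolding Sy_simps sp_gen
  using lift_of_add[OF srel_sub[of q] srel_kill[of _ q]] lift_of_smult[OF srel_sub[of q] srel_kill[of _ q]] lift_of_zero[OF srel_sub[of q] srel_kill[of _ q]]
    lift_of_gen[OF srel_sub[of q] srel_kill[of _ q]] by blast+

lemma t_homogeneous_lamq: "x \<in> carrier (Sy q) \<Longrightarrow> t_homogeneous q (lamq q x)"
proof -
  assume x: "x \<in> carrier (Sy q)"
  have "t_homogeneous q (plift U)" if "U \<in> sgen q" for U
    using t_homogeneous_prod_mset[of U lam1] t_homogeneous_lam1 that unfolding sgen_iff by metis
  then show ?thesis using x unfolding Sy_simps by (intro t_homogeneous_lift_of[OF srel_sub[of q] srel_kill[of _ q]])
qed

end

section \<open>The symmetric power as a graded piece of a polynomial ring modulo two equations\<close>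

lemma replicate_mset_add: "replicate_mset (a + b) x = replicate_mset a x + replicate_mset b x"
  by (induction a) simp_all

context hypersurface
begin

text \<open>The coefficients of lifts are arbitrary polynomials; this projection makes them polynomials in the first \<open>n\<close> variables,
so that they define elements of \<open>R\<close>.\<close>

definition retract :: "'k mpoly \<Rightarrow> 'k mpoly" where
  "retract = peval pconst (\<lambda>v. if v < n then pvar v else 0)"

lemma retract_add: "retract (p + q) = retract p + retract q"
  and retract_mult: "retract (p * q) = retract p * retract q"
  and retract_zero: "retract 0 = 0" and retract_one: "retract 1 = 1"
  unfolding retract_def by (simp_all only: peval_add peval_mult peval_zero peval_one coefficient_hom_single)

lemma retract_const: "retract (pconst c) = pconst c"
  unfolding retract_def by (rule peval_const[OF coefficient_hom_single])

lemma retract_var: "retract (pvar i) = (if i < n then pvar i else 0)"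
  unfolding retract_def by (rule peval_var[OF coefficient_hom_single])

lemma retract_closed [simp]: "retract p \<in> carrier S"
proof (induction p rule: mpoly_ring_induct)
  case (var i)
  then show ?case unfolding retract_var using mpoly_carrier_var[of i n 1] by (metis mpoly_carrier_zero)
qed (simp_all add: retract_const retract_add retract_mult)

lemma retract_id: "p \<in> carrier S \<Longrightarrow> retract p = p"
proof (induction p rule: mpoly_carrier_induct)
  case (var i)
  then show ?case by (simp only: retract_var if_True)
qed (simp_all add: retract_const retract_add retract_mult)

text \<open>The multiset of the differentials \<open>dx\<^sub>i\<close>, each repeated as often as the exponent of the monomial says; it stands for the
product \<open>T\<^sup>m\<close>.\<close>

definition dmset :: "(nat \<Rightarrow>\<^sub>0 nat) \<Rightarrow> ('k mpoly set \<Rightarrow> 'k mpoly set) set multiset" where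
  "dmset m = (\<Sum>i<n. replicate_mset (lookup m i) (D (rc (pvar i))))"

lemma dmset_zero: "dmset 0 = {#}"
  by (simp add: dmset_def)

lemma dmset_add: "dmset (m + l) = dmset m + dmset l"
  by (simp add: dmset_def lookup_add sum.distrib replicate_mset_add)

lemma dmset_var: "i < n \<Longrightarrow> dmset (single i 1) = {#D (rc (pvar i))#}"
proof -
  assume i: "i < n"
  have "dmset (single i 1) = (\<Sum>j<n. if j = i then {#D (rc (pvar i))#} else {#})"
    unfolding dmset_def by (intro sum.cong refl) (simp add: lookup_single when_def)
  then show ?thesis using i by simp
qed

lemma dmset_var_add: "i < n \<Longrightarrow> dmset (single i 1 + m) = add_mset (D (rc (pvar i))) (dmset m)"
  unfolding dmset_add by (simp only: dmset_var add_mset_add_single[of _ "dmset m"] add.commute)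

lemma pvar_closed: "i < n \<Longrightarrow> pvar i \<in> carrier S"
  by (rule mpoly_carrier_var)

lemma dmset_sgen: "m \<in> monomials n q \<Longrightarrow> dmset m \<in> sgen q"
proof (induction q arbitrary: m)
  case 0
  then show ?case by (simp add: monomials_0 dmset_zero sym_generators_def)
next
  case (Suc q)
  obtain i l where i: "i < n" "l \<in> monomials n q" "m = single i 1 + l"
    using Suc.prems by (rule monomials_SucE)
  show ?case unfolding i(3) dmset_var_add[OF i(1)]
    by (intro sgen_add D_closed rc_closed pvar_closed i(1) Suc.IH i(2))
qed

abbreviation "gm q m \<equiv> sp q (dmset m)"

lemma gm_closed: "m \<in> monomials n q \<Longrightarrow> gm q m \<in> carrier (Sy q)"
  by (intro sp_closed dmset_sgen)

text \<open>The map back from polynomials in the differentials to the symmetric power: \<open>T\<^sup>m\<close> goes to the product of the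
\<open>dx\<^sub>i\<close>, and terms of degree other than \<open>q\<close> go to zero.\<close>

definition Psi :: "nat \<Rightarrow> 'k mpoly mpoly \<Rightarrow> (('k mpoly set \<Rightarrow> 'k mpoly set) set multiset \<Rightarrow> 'k mpoly set) set" where
  "Psi q p = finsum (Sy q) (\<lambda>m. rc (retract (lookup p m)) \<odot>\<^bsub>Sy q\<^esub> gm q m) (monomials n q)"

lemma Psi_term_closed: "m \<in> monomials n q \<Longrightarrow> rc (retract c) \<odot>\<^bsub>Sy q\<^esub> gm q m \<in> carrier (Sy q)"
  by (intro module.smult_closed[OF Sy_module] rc_closed retract_closed gm_closed)

lemma Psi_closed: "Psi q p \<in> carrier (Sy q)"
proof -
  interpret Y: module R "Sy q" by (rule Sy_module)
  show ?thesis unfolding Psi_def by (rule Y.M.finsum_closed) (intro Pi_I Psi_term_closed)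
qed

lemma Psi_add: "Psi q (p + p') = Psi q p \<oplus>\<^bsub>Sy q\<^esub> Psi q p'"
proof -
  interpret Y: module R "Sy q" by (rule Sy_module)
  have "Psi q (p + p') = finsum (Sy q) (\<lambda>m. rc (retract (lookup p m)) \<odot>\<^bsub>Sy q\<^esub> gm q m \<oplus>\<^bsub>Sy q\<^esub>
      rc (retract (lookup p' m)) \<odot>\<^bsub>Sy q\<^esub> gm q m) (monomials n q)"
    unfolding Psi_def
  proof (rule Y.M.finsum_cong')
    fix m assume m: "m \<in> monomials n q"
    show "rc (retract (lookup (p + p') m)) \<odot>\<^bsub>Sy q\<^esub> gm q m =
      rc (retract (lookup p m)) \<odot>\<^bsub>Sy q\<^esub> gm q m \<oplus>\<^bsub>Sy q\<^esub> rc (retract (lookup p' m)) \<odot>\<^bsub>Sy q\<^esub> gm q m"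
      unfolding lookup_add retract_add R_add[symmetric, OF retract_closed retract_closed]
      by (rule Y.smult_l_distr[OF rc_closed[OF retract_closed] rc_closed[OF retract_closed] gm_closed[OF m]])
  qed (intro refl Pi_I Y.M.a_closed Psi_term_closed | assumption)+
  also have "\<dots> = Psi q p \<oplus>\<^bsub>Sy q\<^esub> Psi q p'"
    unfolding Psi_def by (rule Y.M.finsum_addf) (intro Pi_I Psi_term_closed | assumption)+
  finally show ?thesis .
qed

lemma Psi_smult: "Psi q (pconst s * p) = rc (retract s) \<odot>\<^bsub>Sy q\<^esub> Psi q p"
proof -
  interpret Y: module R "Sy q" by (rule Sy_module)
  have "rc (retract s) \<odot>\<^bsub>Sy q\<^esub> Psi q p = finsum (Sy q) (\<lambda>m. rc (retract s) \<odot>\<^bsub>Sy q\<^esub> (rc (retract (lookup p m)) \<odot>\<^bsub>Sy q\<^esub> gm q m)) (monomials n q)"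
    unfolding Psi_def
    by (rule Y.finsum_smult_ldistr) (intro finite_monomials rc_closed retract_closed Pi_I Psi_term_closed | assumption)+
  also have "\<dots> = Psi q (pconst s * p)"
    unfolding Psi_def
  proof (rule Y.M.finsum_cong')
    fix m assume m: "m \<in> monomials n q"
    show "rc (retract s) \<odot>\<^bsub>Sy q\<^esub> (rc (retract (lookup p m)) \<odot>\<^bsub>Sy q\<^esub> gm q m) =
        rc (retract (lookup (pconst s * p) m)) \<odot>\<^bsub>Sy q\<^esub> gm q m"
      unfolding lookup_const_mult retract_mult R_mult[symmetric, OF retract_closed retract_closed]
      by (rule Y.smult_assoc1[symmetric, OF rc_closed[OF retract_closed] rc_closed[OF retract_closed] gm_closed[OF m]])
  qed (intro refl Pi_I Psi_term_closed | assumption)+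
  finally show ?thesis by (rule sym)
qed

lemma smult_R_zero: "x \<in> carrier (Sy q) \<Longrightarrow> rc 0 \<odot>\<^bsub>Sy q\<^esub> x = \<zero>\<^bsub>Sy q\<^esub>"
  using module.smult_l_null[OF Sy_module] by (simp add: R_zero)

lemma Psi_zero: "Psi q 0 = \<zero>\<^bsub>Sy q\<^esub>"
  using Psi_smult[of q 0 0] unfolding retract_zero smult_R_zero[OF Psi_closed] by simp

lemma Psi_single: "m \<in> monomials n q \<Longrightarrow> Psi q (single m c) = rc (retract c) \<odot>\<^bsub>Sy q\<^esub> gm q m"
proof -
  interpret Y: module R "Sy q" by (rule Sy_module)
  assume m: "m \<in> monomials n q"
  have "Psi q (single m c) = finsum (Sy q) (\<lambda>l. if m = l then rc (retract c) \<odot>\<^bsub>Sy q\<^esub> gm q l else \<zero>\<^bsub>Sy q\<^esub>) (monomials n q)"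
    unfolding Psi_def
  proof (rule Y.M.finsum_cong')
    fix l assume l: "l \<in> monomials n q"
    show "rc (retract (lookup (single m c) l)) \<odot>\<^bsub>Sy q\<^esub> gm q l =
      (if m = l then rc (retract c) \<odot>\<^bsub>Sy q\<^esub> gm q l else \<zero>\<^bsub>Sy q\<^esub>)"
      using smult_R_zero[OF gm_closed[OF l]] by (simp add: lookup_single when_def retract_zero)
  next
    show "(\<lambda>l. if m = l then rc (retract c) \<odot>\<^bsub>Sy q\<^esub> gm q l else \<zero>\<^bsub>Sy q\<^esub>) \<in> monomials n q \<rightarrow> carrier (Sy q)"
    proof (rule Pi_I)
      fix l assume l: "l \<in> monomials n q"
      show "(if m = l then rc (retract c) \<odot>\<^bsub>Sy q\<^esub> gm q l else \<zero>\<^bsub>Sy q\<^esub>) \<in> carrier (Sy q)"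
        using Psi_term_closed[OF l, of c] Y.M.zero_closed by (simp split: if_split)
    qed
  qed (rule refl)
  also have "\<dots> = rc (retract c) \<odot>\<^bsub>Sy q\<^esub> gm q m"
    by (rule Y.M.finsum_singleton[OF m finite_monomials]) (intro Pi_I Psi_term_closed)
  finally show ?thesis .
qed

lemma Psi_single_not: "m \<notin> monomials n q \<Longrightarrow> Psi q (single m c) = \<zero>\<^bsub>Sy q\<^esub>"
proof -
  interpret Y: module R "Sy q" by (rule Sy_module)
  assume m: "m \<notin> monomials n q"
  have "Psi q (single m c) = finsum (Sy q) (\<lambda>l. \<zero>\<^bsub>Sy q\<^esub>) (monomials n q)"
    unfolding Psi_def
  proof (rule Y.M.finsum_cong')
    fix l assume l: "l \<in> monomials n q"
    then have "m \<noteq> l" using m by blast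
    then show "rc (retract (lookup (single m c) l)) \<odot>\<^bsub>Sy q\<^esub> gm q l = \<zero>\<^bsub>Sy q\<^esub>"
      using smult_R_zero[OF gm_closed[OF l]] by (simp add: lookup_single when_def retract_zero)
  qed (intro refl Pi_I Y.M.zero_closed)+
  then show ?thesis by (simp only: Y.M.finsum_zero)
qed

lemma Psi_monomial: "m \<in> monomials n q \<Longrightarrow> Psi q (single m 1) = gm q m"
  unfolding Psi_single retract_one using module.smult_one[OF Sy_module gm_closed] by (simp add: R_one)

text \<open>The chain rule \<open>ds = \<Sum> (\<partial>s/\<partial>x\<^sub>i) dx\<^sub>i\<close>, multiplied by a product of differentials: both sides are derivations
in \<open>s\<close> that agree on constants and variables.\<close>

lemma Psi_differential:
  assumes U: "U \<in> sgen p"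
    and IH: "\<And>m. m \<in> monomials n (Suc r) \<Longrightarrow> Psi (Suc (p + r)) (single m 1 * w) = sp (Suc (p + r)) (U + dmset m)"
    and m: "m \<in> monomials n r" and s: "s \<in> carrier S"
  shows "Psi (Suc (p + r)) (single m 1 * w * total_differential n s) =
    sp (Suc (p + r)) (add_mset (D (rc s)) (U + dmset m))"
proof -
  let ?q = "Suc (p + r)" and ?w = "single m 1 * w"
  interpret Y: module R "Sy ?q" by (rule Sy_module)
  interpret O: module R Om by (rule Om_module)
  have V: "U + dmset m \<in> sgen (p + r)"
    using U dmset_sgen[OF m] unfolding sgen_iff by (metis size_union union_iff)
  show ?thesis using s
  proof (induction s rule: mpoly_carrier_induct)
    case (const c)
    show ?case unfolding total_differential_const D_const using Psi_zero[of ?q] sp_zero[OF V] by simp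
  next
    case (var i)
    have "?w * total_differential n (pvar i) = single (single i 1 + m) 1 * w"
    proof -
      have "single (single i 1 + m) 1 * w = pvar i * single m 1 * w"
        by (simp only: mult_single mult_1)
      then show ?thesis unfolding total_differential_var[OF var] by (simp only: mult_ac)
    qed
    moreover have "single i 1 + m \<in> monomials n (Suc r)"
      using monomials_add[OF monomials_var[OF var] m] by simp
    moreover have "U + dmset (single i 1 + m) = add_mset (D (rc (pvar i))) (U + dmset m)"
      unfolding dmset_var_add[OF var] by simp
    ultimately show ?case using IH by metis
  next
    case (add s t)
    have "?w * total_differential n (s + t) = ?w * total_differential n s + ?w * total_differential n t"
      by (simp only: total_differential_add distrib_left)
    then show ?case unfolding R_add[symmetric, OF add(1,2)] D_add[OF rc_closed[OF add(1)] rc_closed[OF add(2)]]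
      using Psi_add add(3,4) sp_add[OF D_closed[OF rc_closed[OF add(1)]] D_closed[OF rc_closed[OF add(2)]] V] by metis
  next
    case (mult s t)
    note c = rc_closed[OF mult(1)] rc_closed[OF mult(2)]
    note d = D_closed[OF c(1)] D_closed[OF c(2)]
    have "?w * total_differential n (s * t) = pconst s * (?w * total_differential n t) + pconst t * (?w * total_differential n s)"
      unfolding total_differential_mult distrib_left by (simp only: mult_ac)
    then have "Psi ?q (?w * total_differential n (s * t)) =
      rc s \<odot>\<^bsub>Sy ?q\<^esub> sp ?q (add_mset (D (rc t)) (U + dmset m)) \<oplus>\<^bsub>Sy ?q\<^esub> rc t \<odot>\<^bsub>Sy ?q\<^esub> sp ?q (add_mset (D (rc s)) (U + dmset m))"
      by (simp only: Psi_add Psi_smult retract_id[OF mult(1)] retract_id[OF mult(2)] mult(3,4))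
    also have "\<dots> = sp ?q (add_mset (rc s \<odot>\<^bsub>Om\<^esub> D (rc t)) (U + dmset m)) \<oplus>\<^bsub>Sy ?q\<^esub> sp ?q (add_mset (rc t \<odot>\<^bsub>Om\<^esub> D (rc s)) (U + dmset m))"
      by (simp only: sp_smult[OF c(1) d(2) V] sp_smult[OF c(2) d(1) V])
    also have "\<dots> = sp ?q (add_mset (D (rc (s * t))) (U + dmset m))"
      unfolding R_mult[symmetric, OF mult(1,2)] D_mult[OF c]
      by (rule sp_add[symmetric, OF O.smult_closed[OF c(1) d(2)] O.smult_closed[OF c(2) d(1)] V])
    finally show ?case .
  qed
qed

lemma D_f: "D (rc f) = \<zero>\<^bsub>Om\<^esub>"
proof -
  have "rc f = rc (pconst 0)" using rc_eq_iff[OF f_carrier, of "pconst 0"] by (simp, intro bexI[of _ 1]) simp_all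
  then show ?thesis using D_const by metis
qed

lemma Psi_monomial_df: "m \<in> monomials n r \<Longrightarrow> Psi (Suc r) (single m 1 * df) = \<zero>\<^bsub>Sy (Suc r)\<^esub>"
proof -
  assume m: "m \<in> monomials n r"
  have "{#} \<in> sgen 0" unfolding sgen_iff by simp
  from Psi_differential[OF this _ m f_carrier, of 1] Psi_monomial[of _ "Suc r"]
  have "Psi (Suc r) (single m 1 * df) = sp (Suc r) (add_mset (D (rc f)) (dmset m))" by simp
  also have "\<dots> = \<zero>\<^bsub>Sy (Suc r)\<^esub>" unfolding D_f by (rule sp_zero[OF dmset_sgen[OF m]])
  finally show ?thesis .
qed

lemma Psi_f: "Psi q (pconst f * p) = \<zero>\<^bsub>Sy q\<^esub>"
proof -
  have "rc f = rc 0" using rc_eq_iff[OF f_carrier, of 0] by (simp, intro bexI[of _ 1]) simp_all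
  then show ?thesis unfolding Psi_smult retract_id[OF f_carrier] using smult_R_zero[OF Psi_closed] by simp
qed

lemma Psi_df: "Psi q (df * p) = \<zero>\<^bsub>Sy q\<^esub>"
proof (induction p rule: poly_mapping_induct_sum)
  case zero
  then show ?case using Psi_zero by simp
next
  case (single m c)
  interpret Y: module R "Sy q" by (rule Sy_module)
  have e: "df * single m c = pconst c * (single m 1 * df)"
    by (subst single_mult_eq) (simp only: mult_ac)
  have "Psi q (single m 1 * df) = \<zero>\<^bsub>Sy q\<^esub>"
  proof (cases "q > 0 \<and> m \<in> monomials n (q - 1)")
    case True
    then show ?thesis using Psi_monomial_df[of m "q - 1"] by simp
  next
    case False
    have "single i 1 + m \<notin> monomials n q" for i
    proof
      assume a: "single i 1 + m \<in> monomials n q"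
      have "keys m \<subseteq> keys (single i 1 + m)"
        by (simp add: subset_iff in_keys_iff lookup_add)
      then have "q = Suc (monomial_degree m)" "keys m \<subseteq> {..<n}"
        using a unfolding monomials_def by (auto simp: monomial_degree_add)
      then show False using False unfolding monomials_def by simp
    qed
    then have z: "Psi q (single (single i 1 + m) a) = \<zero>\<^bsub>Sy q\<^esub>" for i a
      by (rule Psi_single_not)
    have "Psi q (\<Sum>i\<in>A. single (single i 1 + m) (pderivative i f)) = \<zero>\<^bsub>Sy q\<^esub>" if "finite A" for A
      using that
    proof (induction A rule: finite_induct)
      case empty
      then show ?case using Psi_zero by simp
    next
      case (insert i A)
      show ?case unfolding sum.insert[OF insert.hyps(1,2)] Psi_add z insert.IH by (rule Y.M.r_zero[OF Y.M.zero_closed])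
    qed
    moreover have "single m 1 * df = (\<Sum>i<n. single (single i 1 + m) (pderivative i f))"
      by (simp add: total_differential_def linear_poly_def sum_distrib_left mult_single add.commute)
    ultimately show ?thesis by simp
  qed
  then show ?case unfolding e Psi_smult
    using module.smult_r_null[OF Sy_module] rc_closed[OF retract_closed] by simp
next
  case (add p p')
  interpret Y: module R "Sy q" by (rule Sy_module)
  show ?case unfolding distrib_left Psi_add add by (rule Y.M.r_zero[OF Y.M.zero_closed])
qed

lemma Psi_Jac: "u \<in> Jac \<Longrightarrow> Psi q u = \<zero>\<^bsub>Sy q\<^esub>"
proof -
  interpret Y: module R "Sy q" by (rule Sy_module)
  assume "u \<in> Jac"
  then obtain v w where u: "u = pconst f * v + df * w" unfolding Jac_def gen3_def by auto
  show ?thesis unfolding u Psi_add Psi_f Psi_df by (rule Y.M.r_zero[OF Y.M.zero_closed])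
qed

lemma Psi_cong: "u \<simeq>\<^sub>J v \<Longrightarrow> Psi q u = Psi q v"
proof -
  interpret Y: module R "Sy q" by (rule Sy_module)
  assume "u \<simeq>\<^sub>J v"
  then have "Psi q ((u - v) + v) = \<zero>\<^bsub>Sy q\<^esub> \<oplus>\<^bsub>Sy q\<^esub> Psi q v" unfolding Psi_add cong_jac_def by (simp only: Psi_Jac)
  then show ?thesis by (simp only: diff_add_cancel Y.M.l_zero[OF Psi_closed])
qed

text \<open>The lift of one factor at a time is expanded in the \<open>T\<^sub>i\<close>, which move into the monomial; hence the statement for all
\<open>m\<close>. The chain rule recovers the factor from its expansion.\<close>

lemma Psi_plift:
  assumes "U \<in> sgen p" "m \<in> monomials n r"
  shows "Psi (p + r) (single m 1 * plift U) = sp (p + r) (U + dmset m)"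
  using assms
proof (induction U arbitrary: p r m)
  case empty
  then have "p = 0" unfolding sgen_iff by simp
  then show ?case using Psi_monomial[OF empty(2)] by simp
next
  case (add x U)
  define p' where "p' = size U"
  have all: "\<forall>w. w \<in># add_mset x U \<longrightarrow> w \<in> carrier Om" and sz: "size (add_mset x U) = p"
    using add.prems(1) unfolding sgen_iff by (rule conjunct1, rule conjunct2)
  have p: "p = Suc p'" using sz unfolding p'_def size_add_mset by (rule sym)
  have mem: "w \<in> carrier Om" if "w \<in># add_mset x U" for w
    using spec[OF all, of w] that by (rule mp)
  have U: "U \<in> sgen p'" unfolding sgen_iff p'_def
  proof (intro conjI allI impI refl)
    fix w assume "w \<in># U"
    then have "w \<in># add_mset x U" by simp
    then show "w \<in> carrier Om" by (rule mem)
  qed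
  have xc: "x \<in> carrier Om" by (rule mem) simp
  let ?q = "Suc (p' + r)" and ?w = "single m 1 * plift U"
  interpret Y: module R "Sy ?q" by (rule Sy_module)
  interpret O: module R Om by (rule Om_module)
  have V: "U + dmset m \<in> sgen (p' + r)"
    using U dmset_sgen[OF add.prems(2)] unfolding sgen_iff by (metis size_union union_iff)
  have IH: "Psi ?q (single m 1 * plift U) = sp ?q (U + dmset m)" if "m \<in> monomials n (Suc r)" for m
    using add.IH[OF U that] by simp
  have xc': "x \<in> carrier (presented_module R (carrier R) krel)" using xc unfolding Om_simps .
  have "x \<in> carrier Om \<and> Psi ?q (?w * lam1 x) = sp ?q (add_mset x (U + dmset m))" using xc'
  proof (induction x rule: presentation.presented_induct[OF krel_presentation, consumes 1])
    case 1
    have "?w * lam1 \<zero>\<^bsub>Om\<^esub> \<simeq>\<^sub>J ?w * 0" by (intro cong_mult cong_refl lam1_zero)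
    then have "Psi ?q (?w * lam1 \<zero>\<^bsub>Om\<^esub>) = Psi ?q (?w * 0)" by (rule Psi_cong)
    then show ?case unfolding Om_simps(2)[symmetric] mult_zero_right Psi_zero sp_zero[OF V] using O.M.zero_closed by blast
  next
    case (2 a b)
    note d = D_closed[OF 2(2)]
    have "?w * lam1 (a \<odot>\<^bsub>Om\<^esub> D b) \<simeq>\<^sub>J ?w * (pconst (rep a) * dlift b)"
      by (intro cong_mult cong_refl cong_trans[OF lam1_smult[OF d 2(1)]] lam1_D 2(2))
    then have "Psi ?q (?w * lam1 (a \<odot>\<^bsub>Om\<^esub> D b)) = Psi ?q (?w * (pconst (rep a) * dlift b))" by (rule Psi_cong)
    also have "?w * (pconst (rep a) * dlift b) = pconst (rep a) * (?w * dlift b)" by (simp only: mult_ac)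
    also have "Psi ?q \<dots> = a \<odot>\<^bsub>Sy ?q\<^esub> Psi ?q (?w * dlift b)"
      unfolding Psi_smult retract_id[OF rep_closed[OF 2(1)]] rc_rep[OF 2(1)] ..
    also have "Psi ?q (?w * dlift b) = sp ?q (add_mset (D b) (U + dmset m))"
      using Psi_differential[OF U IH add.prems(2) rep_closed[OF 2(2)]] unfolding rc_rep[OF 2(2)] .
    also have "a \<odot>\<^bsub>Sy ?q\<^esub> \<dots> = sp ?q (add_mset (a \<odot>\<^bsub>Om\<^esub> D b) (U + dmset m))"
      by (rule sp_smult[symmetric, OF 2(1) d V])
    finally show ?case unfolding Om_simps(4)[symmetric] D_gen[symmetric] using O.smult_closed[OF 2(1) d] by blast
  next
    case (3 x y)
    then have xy: "x \<in> carrier Om" "y \<in> carrier Om" by blast+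
    have "?w * lam1 (x \<oplus>\<^bsub>Om\<^esub> y) \<simeq>\<^sub>J ?w * (lam1 x + lam1 y)"
      by (intro cong_mult cong_refl lam1_add xy)
    then have "Psi ?q (?w * lam1 (x \<oplus>\<^bsub>Om\<^esub> y)) = Psi ?q (?w * (lam1 x + lam1 y))" by (rule Psi_cong)
    also have "\<dots> = sp ?q (add_mset x (U + dmset m)) \<oplus>\<^bsub>Sy ?q\<^esub> sp ?q (add_mset y (U + dmset m))"
      unfolding distrib_left Psi_add using 3(3,4) by metis
    also have "\<dots> = sp ?q (add_mset (x \<oplus>\<^bsub>Om\<^esub> y) (U + dmset m))" by (rule sp_add[symmetric, OF xy V])
    finally show ?case unfolding Om_simps(3)[symmetric] using O.M.a_closed[OF xy] by blast
  qed
  then show ?case unfolding p by (simp add: mult_ac)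
qed

text \<open>It suffices to consider products of elements of the module of differentials.\<close>

lemma Psi_lamq:
  assumes x: "x \<in> carrier (Sy q)"
  shows "Psi q (lamq q x) = x"
proof -
  interpret Y: module R "Sy q" by (rule Sy_module)
  have x': "x \<in> carrier (presented_module R (sgen q) (srel q))" using x unfolding Sy_simps .
  have "x \<in> carrier (Sy q) \<and> Psi q (lamq q x) = x" using x'
  proof (induction x rule: presentation.presented_induct[OF srel_presentation, consumes 1])
    case 1
    have "Psi q (lamq q \<zero>\<^bsub>Sy q\<^esub>) = Psi q 0" by (rule Psi_cong[OF lamq_zero])
    then show ?case unfolding Psi_zero Sy_simps(2)[symmetric] using Y.M.zero_closed by blast
  next
    case (2 a U)
    note c = sp_closed[OF 2(2)]
    have "lamq q (a \<odot>\<^bsub>Sy q\<^esub> sp q U) \<simeq>\<^sub>J pconst (rep a) * plift U"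
      by (rule cong_trans[OF lamq_smult[OF c 2(1)] cong_mult[OF cong_refl lamq_sp[OF 2(2)]]])
    then have "Psi q (lamq q (a \<odot>\<^bsub>Sy q\<^esub> sp q U)) = Psi q (pconst (rep a) * plift U)" by (rule Psi_cong)
    also have "\<dots> = a \<odot>\<^bsub>Sy q\<^esub> Psi q (plift U)"
      unfolding Psi_smult retract_id[OF rep_closed[OF 2(1)]] rc_rep[OF 2(1)] ..
    also have "Psi q (plift U) = sp q U"
      using Psi_plift[OF 2(2), of 0 0] by (simp add: monomials_0 dmset_zero)
    finally show ?case unfolding Sy_simps(4)[symmetric] sp_gen[symmetric] using Y.smult_closed[OF 2(1) c] by blast
  next
    case (3 x y)
    then have xy: "x \<in> carrier (Sy q)" "y \<in> carrier (Sy q)" by blast+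
    have "Psi q (lamq q (x \<oplus>\<^bsub>Sy q\<^esub> y)) = Psi q (lamq q x + lamq q y)" by (rule Psi_cong[OF lamq_add[OF xy]])
    also have "\<dots> = x \<oplus>\<^bsub>Sy q\<^esub> y" unfolding Psi_add using 3(3,4) by metis
    finally show ?case unfolding Sy_simps(3)[symmetric] using Y.M.a_closed[OF xy] by blast
  qed
  then show ?thesis by blast
qed

end

section \<open>Homomorphisms, duals and ranks\<close>

lemma module_homI:
  assumes "\<And>x. x \<in> carrier M \<Longrightarrow> h x \<in> carrier N"
    and "\<And>x y. x \<in> carrier M \<Longrightarrow> y \<in> carrier M \<Longrightarrow> h (x \<oplus>\<^bsub>M\<^esub> y) = h x \<oplus>\<^bsub>N\<^esub> h y"
    and "\<And>r x. r \<in> carrier R \<Longrightarrow> x \<in> carrier M \<Longrightarrow> h (r \<odot>\<^bsub>M\<^esub> x) = r \<odot>\<^bsub>N\<^esub> h x"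
  shows "h \<in> LinearCombinations.module_hom R M N"
  unfolding LinearCombinations.module_hom_def using assms by blast

lemma module_homD:
  assumes "h \<in> LinearCombinations.module_hom R M N"
  shows "x \<in> carrier M \<Longrightarrow> h x \<in> carrier N"
    and "x \<in> carrier M \<Longrightarrow> y \<in> carrier M \<Longrightarrow> h (x \<oplus>\<^bsub>M\<^esub> y) = h x \<oplus>\<^bsub>N\<^esub> h y"
    and "r \<in> carrier R \<Longrightarrow> x \<in> carrier M \<Longrightarrow> h (r \<odot>\<^bsub>M\<^esub> x) = r \<odot>\<^bsub>N\<^esub> h x"
  using assms unfolding LinearCombinations.module_hom_def by blast+

lemma module_hom_zero:
  assumes "module R M" "module R N" and h: "h \<in> LinearCombinations.module_hom R M N"
  shows "h \<zero>\<^bsub>M\<^esub> = \<zero>\<^bsub>N\<^esub>"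
proof -
  interpret M: module R M by fact
  interpret N: module R N by fact
  have "h (\<zero>\<^bsub>R\<^esub> \<odot>\<^bsub>M\<^esub> \<zero>\<^bsub>M\<^esub>) = \<zero>\<^bsub>R\<^esub> \<odot>\<^bsub>N\<^esub> h \<zero>\<^bsub>M\<^esub>" by (rule module_homD(3)[OF h M.R.zero_closed M.M.zero_closed])
  then show ?thesis
    unfolding M.smult_l_null[OF M.M.zero_closed] N.smult_l_null[OF module_homD(1)[OF h M.M.zero_closed]] .
qed

lemma module_hom_finsum:
  assumes M: "module R M" and N: "module R N" and h: "h \<in> LinearCombinations.module_hom R M N"
    and "finite A" "\<And>a. a \<in> A \<Longrightarrow> F a \<in> carrier M"
  shows "h (finsum M F A) = finsum N (\<lambda>a. h (F a)) A"
  using assms(4,5)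
proof (induction A rule: finite_induct)
  case empty
  interpret M: module R M by fact
  interpret N: module R N by fact
  show ?case unfolding M.M.finsum_empty N.M.finsum_empty by (rule module_hom_zero[OF M N h])
next
  case (insert a A)
  interpret M: module R M by fact
  interpret N: module R N by fact
  have c: "F a \<in> carrier M" "F \<in> A \<rightarrow> carrier M" using insert.prems by blast+
  have d: "h (F a) \<in> carrier N" "(\<lambda>a. h (F a)) \<in> A \<rightarrow> carrier N"
    using module_homD(1)[OF h] c by blast+
  have IH: "h (finsum M F A) = finsum N (\<lambda>a. h (F a)) A" using insert.IH insert.prems by blast
  show ?case unfolding M.M.finsum_insert[OF insert.hyps(1,2) c(2,1)] N.M.finsum_insert[OF insert.hyps(1,2) d(2,1)]
    using module_homD(2)[OF h c(1) M.M.finsum_closed[OF c(2)]] IH by (simp only:)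
qed

lemma ring_as_module_simps [simp]:
  "carrier (ring_as_module R) = carrier R" "\<zero>\<^bsub>ring_as_module R\<^esub> = \<zero>\<^bsub>R\<^esub>"
  "x \<oplus>\<^bsub>ring_as_module R\<^esub> y = x \<oplus>\<^bsub>R\<^esub> y" "x \<odot>\<^bsub>ring_as_module R\<^esub> y = x \<otimes>\<^bsub>R\<^esub> y"
  "module_part (ring_as_module R) = ring_part R"
  by (simp_all add: ring_as_module_def)

lemma ring_as_module_module: "cring R \<Longrightarrow> module R (ring_as_module R)"
proof -
  assume "cring R"
  then interpret cring R .
  show ?thesis
  proof (rule module_criteria)
    show "\<forall>v\<in>carrier (ring_as_module R). \<exists>w\<in>carrier (ring_as_module R). v \<oplus>\<^bsub>ring_as_module R\<^esub> w = \<zero>\<^bsub>ring_as_module R\<^esub>"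
      using r_neg a_inv_closed unfolding ring_as_module_simps by blast
  qed (simp_all add: is_cring a_ac m_assoc l_distr r_distr)
qed

lemma finsum_ring_as_module: "finsum (ring_as_module R) = finsum R"
  by (simp add: finsum_def ring_as_module_def fun_eq_iff finprod_def)

abbreviation "functionals R M \<equiv> LinearCombinations.module_hom R M (ring_as_module R)"

lemma functionalI:
  assumes "\<And>x. x \<in> carrier M \<Longrightarrow> h x \<in> carrier R"
    and "\<And>x y. x \<in> carrier M \<Longrightarrow> y \<in> carrier M \<Longrightarrow> h (x \<oplus>\<^bsub>M\<^esub> y) = h x \<oplus>\<^bsub>R\<^esub> h y"
    and "\<And>r x. r \<in> carrier R \<Longrightarrow> x \<in> carrier M \<Longrightarrow> h (r \<odot>\<^bsub>M\<^esub> x) = r \<otimes>\<^bsub>R\<^esub> h x"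
  shows "h \<in> functionals R M"
  using assms by (intro module_homI) (simp_all only: ring_as_module_simps)

lemmas functionalD = module_homD[where N = "ring_as_module R" and R = R for R, unfolded ring_as_module_simps]

lemma dual_simps [simp]:
  "carrier (dual_module R M) = functionals R M \<inter> extensional (carrier M)"
  "\<zero>\<^bsub>dual_module R M\<^esub> = (\<lambda>x\<in>carrier M. \<zero>\<^bsub>R\<^esub>)"
  "h \<oplus>\<^bsub>dual_module R M\<^esub> k = (\<lambda>x\<in>carrier M. h x \<oplus>\<^bsub>R\<^esub> k x)"
  "r \<odot>\<^bsub>dual_module R M\<^esub> h = (\<lambda>x\<in>carrier M. r \<otimes>\<^bsub>R\<^esub> h x)"
  "module_part (dual_module R M) e = graded_hom R M (ring_as_module R) e \<inter> extensional (carrier M)"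
  by (simp_all add: dual_module_def)

lemma dual_closedI: "module R M \<Longrightarrow> h \<in> functionals R M \<Longrightarrow> restrict h (carrier M) \<in> carrier (dual_module R M)"
proof -
  assume M: "module R M" and h: "h \<in> functionals R M"
  interpret M: module R M by (rule M)
  have "restrict h (carrier M) \<in> functionals R M"
    using functionalD[OF h] by (intro functionalI) (simp_all add: M.M.a_closed M.smult_closed)
  then show ?thesis by simp
qed

lemma dual_is_module:
  assumes M: "module R M"
  shows "module R (dual_module R M)"
proof -
  interpret M: module R M by (rule M)
  let ?V = "dual_module R M"
  have func: "h \<in> functionals R M" if "h \<in> carrier ?V" for h using that by simp
  have val: "h x \<in> carrier R" if "h \<in> carrier ?V" "x \<in> carrier M" for h x
    by (rule functionalD(1)[OF func[OF that(1)] that(2)])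
  have ext: "(\<And>x. x \<in> carrier M \<Longrightarrow> h x = k x) \<Longrightarrow> h = k" if "h \<in> extensional (carrier M)" "k \<in> extensional (carrier M)" for h k :: "'c \<Rightarrow> 'a"
    by (rule extensionalityI[OF that])
  have exV: "h \<in> extensional (carrier M)" if "h \<in> carrier ?V" for h using that by simp
  show ?thesis
  proof (rule module_criteria)
    show "cring R" by (rule M.R.is_cring)
    have "(\<lambda>x. \<zero>\<^bsub>R\<^esub>) \<in> functionals R M" by (intro functionalI) simp_all
    then show "\<zero>\<^bsub>?V\<^esub> \<in> carrier ?V" using dual_closedI[OF M] by (simp only: dual_simps)
    show "\<forall>h k. h \<in> carrier ?V \<and> k \<in> carrier ?V \<longrightarrow> h \<oplus>\<^bsub>?V\<^esub> k \<in> carrier ?V"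
    proof (intro allI impI)
      fix h k assume hk: "h \<in> carrier ?V \<and> k \<in> carrier ?V"
      have "(\<lambda>x. h x \<oplus>\<^bsub>R\<^esub> k x) \<in> functionals R M"
        using functionalD[OF func, of h] functionalD[OF func, of k] hk
        by (intro functionalI) (simp_all add: M.R.a_ac M.R.r_distr)
      then show "h \<oplus>\<^bsub>?V\<^esub> k \<in> carrier ?V" using dual_closedI[OF M] by (simp only: dual_simps)
    qed
    show "\<forall>h\<in>carrier ?V. \<exists>k\<in>carrier ?V. h \<oplus>\<^bsub>?V\<^esub> k = \<zero>\<^bsub>?V\<^esub>"
    proof
      fix h assume h: "h \<in> carrier ?V"
      have "(\<lambda>x. \<ominus>\<^bsub>R\<^esub> h x) \<in> functionals R M"
        using functionalD[OF func[OF h]] by (intro functionalI) (simp_all add: M.R.minus_add M.R.r_minus)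
      then have "(\<lambda>x\<in>carrier M. \<ominus>\<^bsub>R\<^esub> h x) \<in> carrier ?V" by (rule dual_closedI[OF M])
      moreover have "h \<oplus>\<^bsub>?V\<^esub> (\<lambda>x\<in>carrier M. \<ominus>\<^bsub>R\<^esub> h x) = \<zero>\<^bsub>?V\<^esub>"
        unfolding dual_simps by (rule restrict_ext) (simp add: val[OF h] M.R.r_neg)
      ultimately show "\<exists>k\<in>carrier ?V. h \<oplus>\<^bsub>?V\<^esub> k = \<zero>\<^bsub>?V\<^esub>" by blast
    qed
    show "\<forall>c h. c \<in> carrier R \<and> h \<in> carrier ?V \<longrightarrow> c \<odot>\<^bsub>?V\<^esub> h \<in> carrier ?V"
    proof (intro allI impI)
      fix c h assume ch: "c \<in> carrier R \<and> h \<in> carrier ?V"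
      have "(\<lambda>x. c \<otimes>\<^bsub>R\<^esub> h x) \<in> functionals R M"
        using functionalD[OF func, of h] ch by (intro functionalI) (simp_all add: M.R.r_distr M.R.m_lcomm)
      then show "c \<odot>\<^bsub>?V\<^esub> h \<in> carrier ?V" using dual_closedI[OF M] by (simp only: dual_simps)
    qed
    show "\<forall>v w. v \<in> carrier ?V \<and> w \<in> carrier ?V \<longrightarrow> v \<oplus>\<^bsub>?V\<^esub> w = w \<oplus>\<^bsub>?V\<^esub> v"
      using val unfolding dual_simps(3) by (intro allI impI restrict_ext) (simp add: M.R.a_comm)
    show "\<forall>v w x. v \<in> carrier ?V \<and> w \<in> carrier ?V \<and> x \<in> carrier ?V \<longrightarrow> v \<oplus>\<^bsub>?V\<^esub> w \<oplus>\<^bsub>?V\<^esub> x = v \<oplus>\<^bsub>?V\<^esub> (w \<oplus>\<^bsub>?V\<^esub> x)"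
      using val unfolding dual_simps(3) by (intro allI impI restrict_ext) (simp add: M.R.a_assoc)
    show "\<forall>v\<in>carrier ?V. v \<oplus>\<^bsub>?V\<^esub> \<zero>\<^bsub>?V\<^esub> = v"
    proof
      fix v assume v: "v \<in> carrier ?V"
      show "v \<oplus>\<^bsub>?V\<^esub> \<zero>\<^bsub>?V\<^esub> = v" unfolding dual_simps(2,3)
        by (rule ext[OF restrict_extensional exV[OF v]]) (simp add: val[OF v])
    qed
    show "\<forall>a b v. a \<in> carrier R \<and> b \<in> carrier R \<and> v \<in> carrier ?V \<longrightarrow> a \<otimes>\<^bsub>R\<^esub> b \<odot>\<^bsub>?V\<^esub> v = a \<odot>\<^bsub>?V\<^esub> (b \<odot>\<^bsub>?V\<^esub> v)"
      using val unfolding dual_simps(4) by (intro allI impI restrict_ext) (simp add: M.R.m_assoc)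
    show "\<forall>v\<in>carrier ?V. \<one>\<^bsub>R\<^esub> \<odot>\<^bsub>?V\<^esub> v = v"
    proof
      fix v assume v: "v \<in> carrier ?V"
      show "\<one>\<^bsub>R\<^esub> \<odot>\<^bsub>?V\<^esub> v = v" unfolding dual_simps(4)
        by (rule ext[OF restrict_extensional exV[OF v]]) (simp add: val[OF v])
    qed
    show "\<forall>a b v. a \<in> carrier R \<and> b \<in> carrier R \<and> v \<in> carrier ?V \<longrightarrow> (a \<oplus>\<^bsub>R\<^esub> b) \<odot>\<^bsub>?V\<^esub> v = a \<odot>\<^bsub>?V\<^esub> v \<oplus>\<^bsub>?V\<^esub> b \<odot>\<^bsub>?V\<^esub> v"
      using val unfolding dual_simps(3,4) by (intro allI impI restrict_ext) (simp add: M.R.l_distr)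
    show "\<forall>a v w. a \<in> carrier R \<and> v \<in> carrier ?V \<and> w \<in> carrier ?V \<longrightarrow> a \<odot>\<^bsub>?V\<^esub> (v \<oplus>\<^bsub>?V\<^esub> w) = a \<odot>\<^bsub>?V\<^esub> v \<oplus>\<^bsub>?V\<^esub> a \<odot>\<^bsub>?V\<^esub> w"
      using val unfolding dual_simps(3,4) by (intro allI impI restrict_ext) (simp add: M.R.r_distr)
  qed
qed

text \<open>The canonical map of a module to its bidual.\<close>

definition evaluation :: "('a, 'c) graded_ring_scheme \<Rightarrow> ('a, 'b, 'd) graded_module_scheme \<Rightarrow> 'b \<Rightarrow> ('b \<Rightarrow> 'a) \<Rightarrow> 'a" where
  "evaluation R M x = (\<lambda>h\<in>carrier (dual_module R M). h x)"

lemma evaluation_functional: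
  assumes M: "module R M" and x: "x \<in> carrier M"
  shows "(\<lambda>h. h x) \<in> functionals R (dual_module R M)"
proof (rule functionalI)
  fix h k r assume h: "h \<in> carrier (dual_module R M)"
  have "h \<in> functionals R M" using h by simp
  then show "h x \<in> carrier R" using x by (rule functionalD(1))
  show "(h \<oplus>\<^bsub>dual_module R M\<^esub> k) x = h x \<oplus>\<^bsub>R\<^esub> k x" using x by simp
  show "(r \<odot>\<^bsub>dual_module R M\<^esub> h) x = r \<otimes>\<^bsub>R\<^esub> h x" using x by simp
qed

lemma evaluation_closed:
  "module R M \<Longrightarrow> x \<in> carrier M \<Longrightarrow> evaluation R M x \<in> carrier (dual_module R (dual_module R M))"
  unfolding evaluation_def by (rule dual_closedI[OF dual_is_module evaluation_functional])

lemma evaluation_hom: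
  assumes M: "module R M"
  shows "evaluation R M \<in> LinearCombinations.module_hom R M (dual_module R (dual_module R M))"
proof (rule module_homI)
  fix x y r assume x: "x \<in> carrier M"
  show "evaluation R M x \<in> carrier (dual_module R (dual_module R M))" by (rule evaluation_closed[OF M x])
  show "evaluation R M (r \<odot>\<^bsub>M\<^esub> x) = r \<odot>\<^bsub>dual_module R (dual_module R M)\<^esub> evaluation R M x" if "r \<in> carrier R"
    unfolding evaluation_def dual_simps(4)[of R "dual_module R M"]
    using that x by (intro restrict_ext) (simp add: functionalD(3))
  show "evaluation R M (x \<oplus>\<^bsub>M\<^esub> y) = evaluation R M x \<oplus>\<^bsub>dual_module R (dual_module R M)\<^esub> evaluation R M y" if "y \<in> carrier M"
    unfolding evaluation_def dual_simps(3)[of R "dual_module R M"]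
    using that x by (intro restrict_ext) (simp add: functionalD(2))
qed

lemma evaluation_graded:
  assumes M: "module R M" and part: "\<And>i. module_part M i \<subseteq> carrier M"
  shows "evaluation R M \<in> graded_hom R M (dual_module R (dual_module R M)) 0"
  unfolding graded_hom_def
proof (intro CollectI conjI allI subsetI evaluation_hom[OF M])
  fix i y assume "y \<in> evaluation R M ` module_part M i"
  then obtain x where y: "y = evaluation R M x" and x: "x \<in> module_part M i" by (rule imageE)
  have xc: "x \<in> carrier M" using x part by blast
  have "evaluation R M x \<in> carrier (dual_module R (dual_module R M))" by (rule evaluation_closed[OF M xc])
  then have f: "evaluation R M x \<in> functionals R (dual_module R M)" "evaluation R M x \<in> extensional (carrier (dual_module R M))"
    unfolding dual_simps(1)[of R "dual_module R M"] by (rule IntD1, rule IntD2)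
  have "evaluation R M x \<in> graded_hom R (dual_module R M) (ring_as_module R) i"
    unfolding graded_hom_def
  proof (intro CollectI conjI allI subsetI f(1))
    fix e z assume "z \<in> evaluation R M x ` module_part (dual_module R M) e"
    then obtain h where z: "z = evaluation R M x h" and h: "h \<in> module_part (dual_module R M) e" by (rule imageE)
    have hg: "h \<in> graded_hom R M (ring_as_module R) e" and he: "h \<in> extensional (carrier M)"
      using h unfolding dual_simps by (rule IntD1, rule IntD2)
    have "h \<in> functionals R M" using hg unfolding graded_hom_def mem_Collect_eq by (rule conjunct1)
    then have "h \<in> carrier (dual_module R M)" using he by simp
    then have "z = h x" unfolding z evaluation_def by simp
    also have "h x \<in> module_part (ring_as_module R) (i + e)" using hg x unfolding graded_hom_def by blast
    finally show "z \<in> module_part (ring_as_module R) (e + i)" by (simp only: add.commute)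
  qed
  then show "y \<in> module_part (dual_module R (dual_module R M)) (i + 0)"
    unfolding y using f(2) by simp
qed

lemma graded_free_simps [simp]:
  "carrier (graded_free_module R m a) = carrier (free_module R {..<m})"
  "\<zero>\<^bsub>graded_free_module R m a\<^esub> = (\<lambda>g. \<zero>\<^bsub>R\<^esub>)"
  "v \<oplus>\<^bsub>graded_free_module R m a\<^esub> w = (\<lambda>g. v g \<oplus>\<^bsub>R\<^esub> w g)"
  "r \<odot>\<^bsub>graded_free_module R m a\<^esub> v = (\<lambda>g. r \<otimes>\<^bsub>R\<^esub> v g)"
  by (simp_all add: graded_free_module_def)

text \<open>The zero module is always a free quotient, so the set of ranks in the definition is \<open>{0}\<close> and its maximum is
meaningful.\<close>

lemma free_rank_zero:
  assumes R: "cring R" and M: "module R M"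
    and none: "\<And>m a h. h \<in> graded_hom R M (graded_free_module R m a) 0 \<Longrightarrow>
      h ` carrier M = carrier (graded_free_module R m a) \<Longrightarrow> m = 0"
  shows "free_rank R M = 0"
proof -
  interpret R: cring R by (rule R)
  interpret M: module R M by (rule M)
  let ?z = "\<lambda>g :: nat. \<zero>\<^bsub>R\<^esub>"
  have c: "carrier (free_module R {..<0}) = {?z}"
  proof (intro equalityI subsetI)
    fix v :: "nat \<Rightarrow> 'a" assume "v \<in> carrier (free_module R {..<0})"
    then have "v = ?z" unfolding free_module_carrier by (intro HOL.ext) blast
    then show "v \<in> {?z}" by (simp only: singleton_iff)
  next
    fix v assume "v \<in> {?z}"
    then show "v \<in> carrier (free_module R {..<0})" by (simp add: free_module_carrier)
  qed
  have zero_hom: "(\<lambda>x. ?z) \<in> graded_hom R M (graded_free_module R 0 a) 0" for a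
    unfolding graded_hom_def
  proof (intro CollectI conjI allI module_homI)
    show "(\<lambda>x. ?z) ` module_part M i \<subseteq> module_part (graded_free_module R 0 a) (i + 0)" for i
      by (auto simp: graded_free_module_def free_module_carrier)
  qed (simp_all add: free_module_carrier)
  have zero_onto: "(\<lambda>x. ?z) ` carrier M = carrier (graded_free_module R 0 a)" for a
    unfolding graded_free_simps c using M.M.zero_closed by blast
  have "{m. \<exists>a. \<exists>\<phi>\<in>graded_hom R M (graded_free_module R m a) 0. \<phi> ` carrier M = carrier (graded_free_module R m a)} = {0}"
  proof (intro equalityI subsetI)
    fix m assume "m \<in> {m. \<exists>a. \<exists>\<phi>\<in>graded_hom R M (graded_free_module R m a) 0. \<phi> ` carrier M = carrier (graded_free_module R m a)}"
    then show "m \<in> {0}" using none[of _ m] by (elim CollectE exE bexE) (simp only: singleton_iff)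
  next
    fix m :: nat assume "m \<in> {0}"
    then have m: "m = 0" by simp
    show "m \<in> {m. \<exists>a. \<exists>\<phi>\<in>graded_hom R M (graded_free_module R m a) 0. \<phi> ` carrier M = carrier (graded_free_module R m a)}"

      unfolding m by (rule CollectI, rule exI[of _ "\<lambda>_. 0"], rule bexI[where x = "\<lambda>x. ?z"], rule zero_onto, rule zero_hom)
  qed
  then show ?thesis unfolding free_rank_def by simp
qed

definition (in cring) free_functional :: "('g \<Rightarrow> 'a) \<Rightarrow> ('g \<Rightarrow> 'a) \<Rightarrow> 'a" where
  "free_functional t v = finsum R (\<lambda>g. v g \<otimes> t g) {g. v g \<noteq> \<zero>}"

context cring
begin

lemma free_functional_superset:
  assumes "finite A" "{g. v g \<noteq> \<zero>} \<subseteq> A" "\<And>g. v g \<in> carrier R" "\<And>g. g \<in> A \<Longrightarrow> t g \<in> carrier R"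
  shows "free_functional t v = finsum R (\<lambda>g. v g \<otimes> t g) A"
  unfolding free_functional_def
proof (rule add.finprod_mono_neutral_cong_left[OF assms(1,2)])
  show "v g \<otimes> t g = \<zero>" if "g \<in> A - {g. v g \<noteq> \<zero>}" for g
    using that assms(4)[of g] by simp
  show "(\<lambda>g. v g \<otimes> t g) \<in> A \<rightarrow> carrier R" using assms(3,4) by blast
qed simp

lemma free_functional_add:
  assumes t: "\<And>g. g \<in> G \<Longrightarrow> t g \<in> carrier R"
    and v: "v \<in> carrier (free_module R G)" and w: "w \<in> carrier (free_module R G)"
  shows "free_functional t (v \<oplus>\<^bsub>free_module R G\<^esub> w) = free_functional t v \<oplus> free_functional t w"
proof -
  let ?A = "{g. v g \<noteq> \<zero>} \<union> {g. w g \<noteq> \<zero>}"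
  have A: "finite ?A" "?A \<subseteq> G" and c: "\<And>g. v g \<in> carrier R" "\<And>g. w g \<in> carrier R"
    using v w by (auto simp: free_module_carrier)
  have t': "\<And>g. g \<in> ?A \<Longrightarrow> t g \<in> carrier R" using t A(2) by blast
  have "free_functional t (v \<oplus>\<^bsub>free_module R G\<^esub> w) = finsum R (\<lambda>g. (v g \<oplus> w g) \<otimes> t g) ?A"
    unfolding free_module_simps by (rule free_functional_superset[OF A(1)]) (use c t' in auto)
  also have "\<dots> = finsum R (\<lambda>g. v g \<otimes> t g \<oplus> w g \<otimes> t g) ?A"
    by (rule finsum_cong') (use c t' in \<open>auto simp: l_distr\<close>)
  also have "\<dots> = finsum R (\<lambda>g. v g \<otimes> t g) ?A \<oplus> finsum R (\<lambda>g. w g \<otimes> t g) ?A"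
    by (rule finsum_addf) (use c t' in auto)
  also have "\<dots> = free_functional t v \<oplus> free_functional t w"
    using free_functional_superset[OF A(1) _ c(1) t'] free_functional_superset[OF A(1) _ c(2) t'] by simp
  finally show ?thesis .
qed

lemma free_functional_smult:
  assumes t: "\<And>g. g \<in> G \<Longrightarrow> t g \<in> carrier R"
    and v: "v \<in> carrier (free_module R G)" and r: "r \<in> carrier R"
  shows "free_functional t (r \<odot>\<^bsub>free_module R G\<^esub> v) = r \<otimes> free_functional t v"
proof -
  let ?A = "{g. v g \<noteq> \<zero>}"
  have A: "finite ?A" "?A \<subseteq> G" and c: "\<And>g. v g \<in> carrier R" using v by (auto simp: free_module_carrier)
  have t': "\<And>g. g \<in> ?A \<Longrightarrow> t g \<in> carrier R" using t A(2) by blast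
  have "free_functional t (r \<odot>\<^bsub>free_module R G\<^esub> v) = finsum R (\<lambda>g. (r \<otimes> v g) \<otimes> t g) ?A"
    unfolding free_module_simps by (rule free_functional_superset[OF A(1)]) (use c t' r in auto)
  also have "\<dots> = finsum R (\<lambda>g. r \<otimes> (v g \<otimes> t g)) ?A"
    by (rule finsum_cong') (use c t' r in \<open>auto simp: m_assoc\<close>)
  also have "\<dots> = r \<otimes> free_functional t v" unfolding free_functional_def
    by (rule finsum_rdistr[OF A(1) r, symmetric]) (use c t' in auto)
  finally show ?thesis .
qed

lemma free_functional_minus:
  assumes t: "\<And>g. g \<in> G \<Longrightarrow> t g \<in> carrier R"
    and v: "v \<in> carrier (free_module R G)" and w: "w \<in> carrier (free_module R G)"
    and eq: "free_functional t v = free_functional t w"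
  shows "free_functional t (v \<ominus>\<^bsub>free_module R G\<^esub> w) = \<zero>"
proof -
  interpret F: module R "free_module R G" by (rule free_module_is_module)
  have closed: "free_functional t u \<in> carrier R" if u: "u \<in> carrier (free_module R G)" for u
    unfolding free_functional_def using t u by (intro finsum_closed) (auto simp: free_module_carrier)
  have c: "v \<ominus>\<^bsub>free_module R G\<^esub> w \<in> carrier (free_module R G)" by (rule F.M.minus_closed[OF v w])
  have "(v \<ominus>\<^bsub>free_module R G\<^esub> w) \<oplus>\<^bsub>free_module R G\<^esub> w = v"
    unfolding a_minus_def using v w F.M.a_assoc F.M.l_neg F.M.r_zero F.M.a_inv_closed by metis
  then have "free_functional t (v \<ominus>\<^bsub>free_module R G\<^esub> w) \<oplus> free_functional t w = \<zero> \<oplus> free_functional t w"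
    using free_functional_add[OF t c w] closed[OF w] eq by simp
  then show ?thesis using closed[OF c] closed[OF w] by (simp del: l_zero)
qed

lemma free_functional_kernel:
  assumes t: "\<And>g. g \<in> G \<Longrightarrow> t g \<in> carrier R"
  shows "submodule R {v \<in> carrier (free_module R G). free_functional t v = \<zero>} (free_module R G)"
proof -
  interpret F: module R "free_module R G" by (rule free_module_is_module)
  note add = free_functional_add[OF t] and smult = free_functional_smult[OF t]
  show ?thesis
  proof (rule submodule.intro)
    show "\<zero>\<^bsub>free_module R G\<^esub> \<in> {v \<in> carrier (free_module R G). free_functional t v = \<zero>}"
      using F.M.zero_closed by (simp add: free_functional_def)
    fix v assume v: "v \<in> {v \<in> carrier (free_module R G). free_functional t v = \<zero>}"
    show "v \<oplus>\<^bsub>free_module R G\<^esub> w \<in> {v \<in> carrier (free_module R G). free_functional t v = \<zero>}"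
      if "w \<in> {v \<in> carrier (free_module R G). free_functional t v = \<zero>}" for w
      using v that add[where v = v and w = w] F.M.a_closed[of v w] by simp
    show "r \<odot>\<^bsub>free_module R G\<^esub> v \<in> {v \<in> carrier (free_module R G). free_functional t v = \<zero>}" if "r \<in> carrier R" for r
      using v that smult[where v = v and r = r] F.smult_closed[of r v] by simp
  qed (use F.module_axioms in auto)
qed

lemma free_functional_gen:
  assumes "x \<in> G" "\<And>g. g \<in> G \<Longrightarrow> t g \<in> carrier R"
  shows "free_functional t (free_gen R x) = t x"
proof -
  have "free_functional t (free_gen R x) = finsum R (\<lambda>g. free_gen R x g \<otimes> t g) {x}"
    using assms by (intro free_functional_superset) (auto simp: free_gen_def)
  then show ?thesis using assms by (simp add: free_gen_def)
qed

end

text \<open>Over the fraction field the functional extends to a nonzero functional, so the vector space is not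
zero. Finite generation ensures that the dimension, which is a least cardinality of a finite generating set, is attained.\<close>

lemma (in "domain") module_rank_positive:
  assumes N: "module R N" and Y: "finite Y" "Y \<subseteq> carrier N"
    and gen: "\<And>W. submodule R W N \<Longrightarrow> Y \<subseteq> W \<Longrightarrow> carrier N \<subseteq> W"
    and \<chi>_closed: "\<And>x. x \<in> carrier N \<Longrightarrow> \<chi> x \<in> carrier R"
    and \<chi>_add: "\<And>x y. x \<in> carrier N \<Longrightarrow> y \<in> carrier N \<Longrightarrow> \<chi> (x \<oplus>\<^bsub>N\<^esub> y) = \<chi> x \<oplus> \<chi> y"
    and \<chi>_smult: "\<And>r x. r \<in> carrier R \<Longrightarrow> x \<in> carrier N \<Longrightarrow> \<chi> (r \<odot>\<^bsub>N\<^esub> x) = r \<otimes> \<chi> x"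
    and x0: "x0 \<in> carrier N" "\<chi> x0 \<noteq> \<zero>"
  shows "module_rank R N \<ge> 1"
proof -
  let ?T = "carrier R - {\<zero>}"
  interpret loc: domain_localization R ?T by (rule fraction_field_localization)
  interpret N: module R N by (rule N)
  let ?L = "fraction_field R" and ?\<iota> = "\<lambda>r. fraction R ?T r \<one>"
  interpret L: field ?L by (rule fraction_field_is_field)
  have L: "cring ?L" by (rule L.is_cring)
  interpret \<iota>: ring_hom_ring R ?L ?\<iota> by (rule loc.fraction_one_hom)
  let ?G = "carrier N"
  let ?F = "free_module ?L ?G" and ?\<delta> = "free_gen ?L"
  define rels where "rels = {?\<delta> (x \<oplus>\<^bsub>N\<^esub> y) \<ominus>\<^bsub>?F\<^esub> (?\<delta> x \<oplus>\<^bsub>?F\<^esub> ?\<delta> y) | x y. x \<in> ?G \<and> y \<in> ?G}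
     \<union> {?\<delta> (r \<odot>\<^bsub>N\<^esub> x) \<ominus>\<^bsub>?F\<^esub> (?\<iota> r \<odot>\<^bsub>?F\<^esub> ?\<delta> x) | r x. r \<in> carrier R \<and> x \<in> ?G}"
  have relsE: "(\<exists>x y. x \<in> ?G \<and> y \<in> ?G \<and> v = ?\<delta> (x \<oplus>\<^bsub>N\<^esub> y) \<ominus>\<^bsub>?F\<^esub> (?\<delta> x \<oplus>\<^bsub>?F\<^esub> ?\<delta> y)) \<or>
    (\<exists>r x. r \<in> carrier R \<and> x \<in> ?G \<and> v = ?\<delta> (r \<odot>\<^bsub>N\<^esub> x) \<ominus>\<^bsub>?F\<^esub> (?\<iota> r \<odot>\<^bsub>?F\<^esub> ?\<delta> x))" if "v \<in> rels" for v
    using that unfolding rels_def by blast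
  have rel_add: "?\<delta> (x \<oplus>\<^bsub>N\<^esub> y) \<ominus>\<^bsub>?F\<^esub> (?\<delta> x \<oplus>\<^bsub>?F\<^esub> ?\<delta> y) \<in> rels" if "x \<in> ?G" "y \<in> ?G" for x y
    using that unfolding rels_def by blast
  have rel_smult: "?\<delta> (r \<odot>\<^bsub>N\<^esub> x) \<ominus>\<^bsub>?F\<^esub> (?\<iota> r \<odot>\<^bsub>?F\<^esub> ?\<delta> x) \<in> rels" if "r \<in> carrier R" "x \<in> ?G" for r x
    using that unfolding rels_def by blast
  interpret F: module ?L ?F by (rule L.free_module_is_module)
  have d: "?\<delta> x \<in> carrier ?F" if "x \<in> ?G" for x by (rule L.free_gen_closed[OF that])
  have dadd: "?\<delta> x \<oplus>\<^bsub>?F\<^esub> ?\<delta> y \<in> carrier ?F" if "x \<in> ?G" "y \<in> ?G" for x y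
    by (intro F.M.a_closed d that)
  have dsm: "?\<iota> r \<odot>\<^bsub>?F\<^esub> ?\<delta> x \<in> carrier ?F" if "r \<in> carrier R" "x \<in> ?G" for r x
    by (intro F.smult_closed d that \<iota>.hom_closed)
  have rels_sub: "rels \<subseteq> carrier ?F"
  proof
    fix v assume "v \<in> rels"
    from relsE[OF this] show "v \<in> carrier ?F"
    proof (elim disjE exE conjE)
      fix x y assume c: "x \<in> ?G" "y \<in> ?G" and v: "v = ?\<delta> (x \<oplus>\<^bsub>N\<^esub> y) \<ominus>\<^bsub>?F\<^esub> (?\<delta> x \<oplus>\<^bsub>?F\<^esub> ?\<delta> y)"
      show "v \<in> carrier ?F" unfolding v by (rule F.M.minus_closed[OF d[OF N.M.a_closed[OF c]] dadd[OF c]])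
    next
      fix r x assume c: "r \<in> carrier R" "x \<in> ?G" and v: "v = ?\<delta> (r \<odot>\<^bsub>N\<^esub> x) \<ominus>\<^bsub>?F\<^esub> (?\<iota> r \<odot>\<^bsub>?F\<^esub> ?\<delta> x)"
      show "v \<in> carrier ?F" unfolding v by (rule F.M.minus_closed[OF d[OF N.smult_closed[OF c]] dsm[OF c]])
    qed
  qed
  have pres: "presentation ?L ?G rels" by (intro presentation.intro presentation_axioms.intro L rels_sub)
  let ?E = "presented_module ?L ?G rels"
  have E: "extend_scalars R ?L ?\<iota> N = ?E" unfolding extend_scalars_def Let_def rels_def ..
  have Emod: "module ?L ?E" by (rule presentation.Pm_module[OF pres])
  interpret V: vectorspace ?L ?E by (intro vectorspace.intro Emod L.field_axioms)
  let ?g = "presented_gen ?L ?G rels"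
  note gcl = presentation.gen_closed[OF pres]
  have gadd: "?g (x \<oplus>\<^bsub>N\<^esub> y) = ?g x \<oplus>\<^bsub>?E\<^esub> ?g y" if c: "x \<in> ?G" "y \<in> ?G" for x y
    unfolding presentation.gen_cls[OF pres] presentation.pcls_add[OF pres d[OF c(1)] d[OF c(2)]]
    by (rule presentation.rels_eq[OF pres rel_add[OF c] d[OF N.M.a_closed[OF c]] dadd[OF c]])
  have gsm: "?g (r \<odot>\<^bsub>N\<^esub> x) = ?\<iota> r \<odot>\<^bsub>?E\<^esub> ?g x" if c: "r \<in> carrier R" "x \<in> ?G" for r x
    unfolding presentation.gen_cls[OF pres] presentation.pcls_smult[OF pres \<iota>.hom_closed[OF c(1)] d[OF c(2)]]
    by (rule presentation.rels_eq[OF pres rel_smult[OF c] d[OF N.smult_closed[OF c]] dsm[OF c]])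
  let ?B = "?g ` Y"
  have B: "?B \<subseteq> carrier ?E" using Y(2) gcl by blast
  have W: "submodule ?L (V.span ?B) ?E" by (rule V.span_is_submodule[OF B])
  have Bs: "?B \<subseteq> V.span ?B" by (rule V.in_own_span[OF B])
  let ?W = "{x \<in> ?G. ?g x \<in> V.span ?B}"
  have gW: "?G \<subseteq> ?W"
  proof (rule gen)
    show "submodule R ?W N"
    proof (rule submodule.intro)
      have z: "\<zero>\<^bsub>N\<^esub> = \<zero> \<odot>\<^bsub>N\<^esub> \<zero>\<^bsub>N\<^esub>" by (rule N.smult_l_null[OF N.M.zero_closed, symmetric])
      have "?g \<zero>\<^bsub>N\<^esub> = ?\<iota> \<zero> \<odot>\<^bsub>?E\<^esub> ?g \<zero>\<^bsub>N\<^esub>" by (subst z) (rule gsm[OF zero_closed N.M.zero_closed])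
      also have "\<dots> = \<zero>\<^bsub>?E\<^esub>" using V.smult_l_null[OF gcl[OF N.M.zero_closed]] \<iota>.hom_zero by (simp only:)
      finally have "?g \<zero>\<^bsub>N\<^esub> \<in> V.span ?B" using submodule.zero_closed[OF W] by (simp only:)
      then show "\<zero>\<^bsub>N\<^esub> \<in> ?W" by (intro CollectI conjI N.M.zero_closed)
      show "?W \<subseteq> carrier N" by (rule Collect_restrict)
      show "module R N" by (rule N)
      fix x assume x: "x \<in> ?W"
      then have x: "x \<in> ?G" "?g x \<in> V.span ?B" by simp_all
      show "r \<odot>\<^bsub>N\<^esub> x \<in> ?W" if r: "r \<in> carrier R" for r
        using submodule.smult_closed[OF W \<iota>.hom_closed[OF r] x(2)] N.smult_closed[OF r x(1)]
        unfolding gsm[OF r x(1), symmetric] by (intro CollectI conjI)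
      fix y assume "y \<in> ?W"
      then have y: "y \<in> ?G" "?g y \<in> V.span ?B" by simp_all
      show "x \<oplus>\<^bsub>N\<^esub> y \<in> ?W"
        using submodule.m_closed[OF W x(2) y(2)] N.M.a_closed[OF x(1) y(1)]
        unfolding gadd[OF x(1) y(1), symmetric] by (intro CollectI conjI)
    qed
    show "Y \<subseteq> ?W" using Bs Y(2) by blast
  qed
  have "y \<in> V.span ?B" if "y \<in> carrier ?E" for y using that
  proof (induction y rule: presentation.presented_induct[OF pres, consumes 1])
    case 1 show ?case by (rule submodule.zero_closed[OF W])
  next
    case (2 r x) show ?case by (rule submodule.smult_closed[OF W 2(1) CollectD[OF subsetD[OF gW 2(2)], THEN conjunct2]])
  next
    case (3 x y) show ?case by (rule submodule.m_closed[OF W 3(3,4)])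
  qed
  then have "V.gen_set ?B" using V.span_is_subset2[OF B] by blast
  then have "\<exists>A. finite A \<and> card A = card ?B \<and> A \<subseteq> carrier ?E \<and> V.gen_set A"
    using B Y(1) by (intro exI[of _ ?B]) simp
  then have "\<exists>m A. finite A \<and> card A = m \<and> A \<subseteq> carrier ?E \<and> V.gen_set A" by blast
  from LeastI_ex[OF this] obtain A where A: "finite A" "card A = V.dim" "A \<subseteq> carrier ?E" "V.gen_set A"
    unfolding V.dim_def by blast
  have "V.dim \<noteq> 0"
  proof
    assume "V.dim = 0"
    then have "A = {}" using A(1,2) by simp
    have Ez: "carrier ?E \<subseteq> {\<zero>\<^bsub>?E\<^esub>}"
    proof
      fix y assume "y \<in> carrier ?E"
      then have "y \<in> V.span {}" using A(4) \<open>A = {}\<close> by (simp only:)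
      then obtain a B where "y = V.lincomb a B" "B \<subseteq> {}" unfolding V.span_def by blast
      then have "y = V.lincomb a {}" by simp
      then show "y \<in> {\<zero>\<^bsub>?E\<^esub>}" unfolding V.lincomb_def V.M.finsum_empty by (simp only: singleton_iff)
    qed
    let ?t = "\<lambda>x. ?\<iota> (\<chi> x)"
    have t: "?t g \<in> carrier ?L" if "g \<in> ?G" for g by (intro \<iota>.hom_closed \<chi>_closed that)
    have fgen: "L.free_functional ?t (?\<delta> x) = ?t x" if "x \<in> ?G" for x
      by (rule L.free_functional_gen[where t = ?t, OF that]) (rule t)
    have fadd: "L.free_functional ?t (v \<oplus>\<^bsub>?F\<^esub> w) = L.free_functional ?t v \<oplus>\<^bsub>?L\<^esub> L.free_functional ?t w"
      if "v \<in> carrier ?F" "w \<in> carrier ?F" for v w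
      by (rule L.free_functional_add[where t = ?t, OF _ that]) (rule t)
    have fsmult: "L.free_functional ?t (r \<odot>\<^bsub>?F\<^esub> v) = r \<otimes>\<^bsub>?L\<^esub> L.free_functional ?t v"
      if "v \<in> carrier ?F" "r \<in> carrier ?L" for r v
      by (rule L.free_functional_smult[where t = ?t, OF _ that]) (rule t)
    have fminus: "L.free_functional ?t (v \<ominus>\<^bsub>?F\<^esub> w) = \<zero>\<^bsub>?L\<^esub>"
      if "v \<in> carrier ?F" "w \<in> carrier ?F" "L.free_functional ?t v = L.free_functional ?t w" for v w
      by (rule L.free_functional_minus[where t = ?t, OF _ that]) (rule t)
    let ?K = "{v \<in> carrier ?F. L.free_functional ?t v = \<zero>\<^bsub>?L\<^esub>}"
    have "rels \<subseteq> ?K"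
    proof
      fix v assume vr: "v \<in> rels"
      from relsE[OF vr] have "L.free_functional ?t v = \<zero>\<^bsub>?L\<^esub>"
      proof (elim disjE exE conjE)
        fix x y assume c: "x \<in> ?G" "y \<in> ?G" and v: "v = ?\<delta> (x \<oplus>\<^bsub>N\<^esub> y) \<ominus>\<^bsub>?F\<^esub> (?\<delta> x \<oplus>\<^bsub>?F\<^esub> ?\<delta> y)"
        show "L.free_functional ?t v = \<zero>\<^bsub>?L\<^esub>" unfolding v
        proof (rule fminus[OF d[OF N.M.a_closed[OF c]] dadd[OF c]])
          show "L.free_functional ?t (?\<delta> (x \<oplus>\<^bsub>N\<^esub> y)) = L.free_functional ?t (?\<delta> x \<oplus>\<^bsub>?F\<^esub> ?\<delta> y)"
            unfolding fadd[OF d[OF c(1)] d[OF c(2)]] fgen[OF c(1)] fgen[OF c(2)] fgen[OF N.M.a_closed[OF c]]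
              \<chi>_add[OF c] by (rule \<iota>.hom_add[OF \<chi>_closed[OF c(1)] \<chi>_closed[OF c(2)]])
        qed
      next
        fix r x assume c: "r \<in> carrier R" "x \<in> ?G" and v: "v = ?\<delta> (r \<odot>\<^bsub>N\<^esub> x) \<ominus>\<^bsub>?F\<^esub> (?\<iota> r \<odot>\<^bsub>?F\<^esub> ?\<delta> x)"
        show "L.free_functional ?t v = \<zero>\<^bsub>?L\<^esub>" unfolding v
        proof (rule fminus[OF d[OF N.smult_closed[OF c]] dsm[OF c]])
          show "L.free_functional ?t (?\<delta> (r \<odot>\<^bsub>N\<^esub> x)) = L.free_functional ?t (?\<iota> r \<odot>\<^bsub>?F\<^esub> ?\<delta> x)"
            unfolding fsmult[OF d[OF c(2)] \<iota>.hom_closed[OF c(1)]] fgen[OF c(2)] fgen[OF N.smult_closed[OF c]]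
              \<chi>_smult[OF c] by (rule \<iota>.hom_mult[OF c(1) \<chi>_closed[OF c(2)]])
        qed
      qed
      then show "v \<in> ?K" using vr rels_sub by blast
    qed
    note rels_K = this
    have sub: "relation_module ?L ?G rels \<subseteq> ?K"
      by (rule presentation.relation_module_subset[OF pres L.free_functional_kernel[of ?G ?t] rels_K]) (rule t)
    have "?g x0 = \<zero>\<^bsub>?E\<^esub>" using Ez gcl[OF x0(1)] by blast
    then have dz: "?\<delta> x0 \<ominus>\<^bsub>?F\<^esub> \<zero>\<^bsub>?F\<^esub> \<in> relation_module ?L ?G rels"
      unfolding presentation.gen_cls[OF pres] presentation.pcls_zero[OF pres]
      using presentation.pcls_eq_iff[OF pres d[OF x0(1)] F.M.zero_closed] by (simp only:)
    have dz': "?\<delta> x0 \<ominus>\<^bsub>?F\<^esub> \<zero>\<^bsub>?F\<^esub> = ?\<delta> x0"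
    proof -
      have "\<ominus>\<^bsub>?F\<^esub> \<zero>\<^bsub>?F\<^esub> = \<zero>\<^bsub>?F\<^esub>"
        by (rule F.M.minus_equality[OF F.M.l_zero]) (rule F.M.zero_closed)+
      then show ?thesis unfolding a_minus_def using F.M.r_zero[OF d[OF x0(1)]] by (simp only:)
    qed
    have "L.free_functional ?t (?\<delta> x0) = \<zero>\<^bsub>?L\<^esub>"
      using subsetD[OF sub dz] unfolding dz' mem_Collect_eq by (rule conjunct2)
    then have "?t x0 = \<zero>\<^bsub>?L\<^esub>" unfolding fgen[OF x0(1)] .
    then have "fraction R ?T (\<chi> x0) \<one> = fraction R ?T \<zero> \<one>" by (simp only: loc.localization_zero)
    then have "\<chi> x0 \<otimes> \<one> = \<zero> \<otimes> \<one>"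
      using loc.fraction_eq_iff[OF \<chi>_closed[OF x0(1)] loc.T_one zero_closed loc.T_one] by (simp only:)
    then show False using x0 \<chi>_closed[OF x0(1)] by simp
  qed
  then show ?thesis unfolding module_rank_def E by simp
qed

text \<open>Multiplication by \<open>r\<close> factors through a free module with coordinates \<open>\<psi> a\<close>. Dually, \<open>r h = \<Sum> h(g\<^sub>a) \<psi>\<^sub>a\<close>
for every functional \<open>h\<close>, so \<open>r \<xi>(h) = h(\<Sum> \<xi>(\<psi>\<^sub>a) g\<^sub>a)\<close>.\<close>

lemma bidual_multiple_is_evaluation:
  assumes M: "module R M" and A: "finite A" and g: "\<And>a. a \<in> A \<Longrightarrow> g a \<in> carrier M"
    and \<psi>: "\<And>a. a \<in> A \<Longrightarrow> \<psi> a \<in> functionals R M" and r: "r \<in> carrier R"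
    and fac: "\<And>x. x \<in> carrier M \<Longrightarrow> r \<odot>\<^bsub>M\<^esub> x = finsum M (\<lambda>a. \<psi> a x \<odot>\<^bsub>M\<^esub> g a) A"
    and \<xi>: "\<xi> \<in> carrier (dual_module R (dual_module R M))"
  shows "\<exists>w\<in>carrier M. \<forall>h\<in>carrier (dual_module R M). r \<otimes>\<^bsub>R\<^esub> \<xi> h = h w"
proof -
  interpret M: module R M by (rule M)
  let ?V = "dual_module R M" and ?\<rho> = "\<lambda>a. restrict (\<psi> a) (carrier M)"
  interpret V: module R ?V by (rule dual_is_module[OF M])
  have Rm: "module R (ring_as_module R)" by (rule ring_as_module_module[OF M.R.is_cring])
  have \<xi>f: "\<xi> \<in> functionals R ?V" using \<xi> unfolding dual_simps(1)[of R ?V] by (rule IntD1)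
  have \<rho>: "?\<rho> a \<in> carrier ?V" if "a \<in> A" for a by (rule dual_closedI[OF M \<psi>[OF that]])
  have \<xi>\<rho>: "\<xi> (?\<rho> a) \<in> carrier R" if "a \<in> A" for a by (rule functionalD(1)[OF \<xi>f \<rho>[OF that]])
  have exV: "h \<in> extensional (carrier M)" if "h \<in> carrier ?V" for h
    using that unfolding dual_simps(1) by (rule IntD2)
  let ?w = "finsum M (\<lambda>a. \<xi> (?\<rho> a) \<odot>\<^bsub>M\<^esub> g a) A"
  have w: "?w \<in> carrier M" by (rule M.M.finsum_closed) (intro Pi_I M.smult_closed \<xi>\<rho> g)
  have "r \<otimes>\<^bsub>R\<^esub> \<xi> h = h ?w" if h: "h \<in> carrier ?V" for h
  proof -
    have hf: "h \<in> functionals R M" using h by simp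
    have hg: "h (g a) \<in> carrier R" if "a \<in> A" for a by (rule functionalD(1)[OF hf g[OF that]])
    have t: "h (g a) \<odot>\<^bsub>?V\<^esub> ?\<rho> a \<in> carrier ?V" if "a \<in> A" for a by (rule V.smult_closed[OF hg[OF that] \<rho>[OF that]])
    let ?s = "finsum ?V (\<lambda>a. h (g a) \<odot>\<^bsub>?V\<^esub> ?\<rho> a) A"
    have s: "?s \<in> carrier ?V" by (rule V.M.finsum_closed) (intro Pi_I t)
    have "r \<odot>\<^bsub>?V\<^esub> h = ?s"
    proof (rule extensionalityI)
      show "r \<odot>\<^bsub>?V\<^esub> h \<in> extensional (carrier M)" "?s \<in> extensional (carrier M)"
        by (rule exV, rule V.smult_closed[OF r h], rule exV, rule s)
      fix x assume x: "x \<in> carrier M"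
      have c: "\<psi> a x \<odot>\<^bsub>M\<^esub> g a \<in> carrier M" if "a \<in> A" for a
        by (rule M.smult_closed[OF functionalD(1)[OF \<psi>[OF that] x] g[OF that]])
      have "(r \<odot>\<^bsub>?V\<^esub> h) x = h (r \<odot>\<^bsub>M\<^esub> x)" using x functionalD(3)[OF hf r x] by simp
      also have "\<dots> = finsum (ring_as_module R) (\<lambda>a. h (\<psi> a x \<odot>\<^bsub>M\<^esub> g a)) A"
        unfolding fac[OF x] by (rule module_hom_finsum[OF M Rm hf A c])
      also have "\<dots> = finsum R (\<lambda>a. (h (g a) \<odot>\<^bsub>?V\<^esub> ?\<rho> a) x) A"
        unfolding finsum_ring_as_module
      proof (rule M.R.finsum_cong')
        fix a assume a: "a \<in> A"
        have "h (\<psi> a x \<odot>\<^bsub>M\<^esub> g a) = \<psi> a x \<otimes>\<^bsub>R\<^esub> h (g a)"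
          by (rule functionalD(3)[OF hf functionalD(1)[OF \<psi>[OF a] x] g[OF a]])
        then show "h (\<psi> a x \<odot>\<^bsub>M\<^esub> g a) = (h (g a) \<odot>\<^bsub>?V\<^esub> ?\<rho> a) x"
          using x M.R.m_comm[OF functionalD(1)[OF \<psi>[OF a] x] hg[OF a]] by simp
      next
        show "(\<lambda>a. (h (g a) \<odot>\<^bsub>?V\<^esub> ?\<rho> a) x) \<in> A \<rightarrow> carrier R"
          by (intro Pi_I functionalD(1)[OF evaluation_functional[OF M x]] t)
      qed (rule refl)
      also have "\<dots> = ?s x"
        using module_hom_finsum[OF dual_is_module[OF M] Rm evaluation_functional[OF M x] A t] unfolding finsum_ring_as_module by (rule sym)
      finally show "(r \<odot>\<^bsub>?V\<^esub> h) x = ?s x" .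
    qed
    then have "r \<otimes>\<^bsub>R\<^esub> \<xi> h = \<xi> ?s" using functionalD(3)[OF \<xi>f r h] by (simp only:)
    also have "\<dots> = finsum (ring_as_module R) (\<lambda>a. \<xi> (h (g a) \<odot>\<^bsub>?V\<^esub> ?\<rho> a)) A"
      by (rule module_hom_finsum[OF dual_is_module[OF M] Rm \<xi>f A t])
    also have "\<dots> = finsum (ring_as_module R) (\<lambda>a. h (\<xi> (?\<rho> a) \<odot>\<^bsub>M\<^esub> g a)) A"
      unfolding finsum_ring_as_module
    proof (rule M.R.finsum_cong')
      fix a assume a: "a \<in> A"
      show "\<xi> (h (g a) \<odot>\<^bsub>?V\<^esub> ?\<rho> a) = h (\<xi> (?\<rho> a) \<odot>\<^bsub>M\<^esub> g a)"
        unfolding functionalD(3)[OF \<xi>f hg[OF a] \<rho>[OF a]] functionalD(3)[OF hf \<xi>\<rho>[OF a] g[OF a]]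
        by (rule M.R.m_comm[OF hg[OF a] \<xi>\<rho>[OF a]])
    next
      show "(\<lambda>a. h (\<xi> (?\<rho> a) \<odot>\<^bsub>M\<^esub> g a)) \<in> A \<rightarrow> carrier R"
        by (intro Pi_I functionalD(1)[OF hf] M.smult_closed \<xi>\<rho> g)
    qed (rule refl)
    also have "\<dots> = h ?w"
      by (rule module_hom_finsum[OF M Rm hf A, symmetric]) (intro M.smult_closed \<xi>\<rho> g)
    finally show ?thesis .
  qed
  then show ?thesis using w by (intro bexI[of _ ?w] ballI)
qed

text \<open>The coordinates of the factorization are functionals, and an element on which they vanish is annihilated by the
nonzero divisor \<open>r\<close>.\<close>

lemma functionals_separate:
  assumes M: "module R M"
    and \<psi>: "\<And>a. a \<in> A \<Longrightarrow> \<psi> a \<in> functionals R M"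
    and g: "\<And>a. a \<in> A \<Longrightarrow> g a \<in> carrier M"
    and fac: "\<And>x. x \<in> carrier M \<Longrightarrow> r \<odot>\<^bsub>M\<^esub> x = finsum M (\<lambda>a. \<psi> a x \<odot>\<^bsub>M\<^esub> g a) A"
    and regular: "\<And>x. x \<in> carrier M \<Longrightarrow> r \<odot>\<^bsub>M\<^esub> x = \<zero>\<^bsub>M\<^esub> \<Longrightarrow> x = \<zero>\<^bsub>M\<^esub>"
    and x: "x \<in> carrier M" and y: "y \<in> carrier M" and eq: "\<And>h. h \<in> carrier (dual_module R M) \<Longrightarrow> h x = h y"
  shows "x = y"
proof -
  interpret M: module R M by (rule M)
  let ?z = "x \<ominus>\<^bsub>M\<^esub> y"
  have z: "?z \<in> carrier M" by (rule M.M.minus_closed[OF x y])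
  have zy: "?z \<oplus>\<^bsub>M\<^esub> y = x"
    unfolding a_minus_def using x y M.M.a_assoc M.M.l_neg M.M.r_zero M.M.a_inv_closed by metis
  have \<psi>z: "\<psi> a ?z = \<zero>\<^bsub>R\<^esub>" if a: "a \<in> A" for a
  proof -
    note f = functionalD[OF \<psi>[OF a]]
    have e: "\<psi> a x = \<psi> a y" using eq[OF dual_closedI[OF M \<psi>[OF a]]] x y by simp
    have "\<psi> a ?z \<oplus>\<^bsub>R\<^esub> \<psi> a y = \<zero>\<^bsub>R\<^esub> \<oplus>\<^bsub>R\<^esub> \<psi> a y" using f(2)[OF z y] unfolding zy e M.R.l_zero[OF f(1)[OF y]] by (rule sym)
    then show ?thesis by (rule M.R.add.r_cancel[OF _ f(1)[OF z] M.R.zero_closed f(1)[OF y]])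
  qed
  have "r \<odot>\<^bsub>M\<^esub> ?z = finsum M (\<lambda>a. \<zero>\<^bsub>M\<^esub>) A" unfolding fac[OF z]
  proof (rule M.M.finsum_cong')
    show "\<psi> a ?z \<odot>\<^bsub>M\<^esub> g a = \<zero>\<^bsub>M\<^esub>" if "a \<in> A" for a unfolding \<psi>z[OF that] by (rule M.smult_l_null[OF g[OF that]])
  qed (intro refl Pi_I M.M.zero_closed)+
  then have "?z = \<zero>\<^bsub>M\<^esub>" using regular[OF z] by (simp only: M.M.finsum_zero)
  then show ?thesis using zy M.M.l_zero[OF y] by (simp only:)
qed

text \<open>For an element \<open>\<xi>\<close> of the bidual, \<open>r \<xi>\<close> and \<open>s \<xi>\<close> are evaluations at elements \<open>u\<close> and \<open>v\<close>. Then
\<open>s u = r v\<close>, so by regularity \<open>u\<close> is divisible by \<open>r\<close>, and \<open>\<xi>\<close> is the evaluation at the quotient.\<close>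

lemma reflexive_by_regular_pair:
  fixes R :: "('a, 'c) graded_ring_scheme" (structure)
  assumes "domain R" and M: "module R M" and A: "finite A" and g: "\<And>a. a \<in> A \<Longrightarrow> g a \<in> carrier M"
    and \<psi>: "\<And>a. a \<in> A \<Longrightarrow> \<psi> a \<in> functionals R M" and \<psi>': "\<And>a. a \<in> A \<Longrightarrow> \<psi>' a \<in> functionals R M"
    and r: "r \<in> carrier R" "r \<noteq> \<zero>" and s: "s \<in> carrier R"
    and fac: "\<And>x. x \<in> carrier M \<Longrightarrow> r \<odot>\<^bsub>M\<^esub> x = finsum M (\<lambda>a. \<psi> a x \<odot>\<^bsub>M\<^esub> g a) A"
    and fac': "\<And>x. x \<in> carrier M \<Longrightarrow> s \<odot>\<^bsub>M\<^esub> x = finsum M (\<lambda>a. \<psi>' a x \<odot>\<^bsub>M\<^esub> g a) A"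
    and regular: "\<And>x. x \<in> carrier M \<Longrightarrow> r \<odot>\<^bsub>M\<^esub> x = \<zero>\<^bsub>M\<^esub> \<Longrightarrow> x = \<zero>\<^bsub>M\<^esub>"
    and regular': "\<And>x y. x \<in> carrier M \<Longrightarrow> y \<in> carrier M \<Longrightarrow> s \<odot>\<^bsub>M\<^esub> x = r \<odot>\<^bsub>M\<^esub> y \<Longrightarrow> \<exists>w\<in>carrier M. x = r \<odot>\<^bsub>M\<^esub> w"
    and \<xi>: "\<xi> \<in> carrier (dual_module R (dual_module R M))"
  shows "\<exists>w\<in>carrier M. \<xi> = evaluation R M w"
proof -
  interpret domain R by fact
  interpret M: module R M by (rule M)
  let ?V = "dual_module R M"
  have \<xi>f: "\<xi> \<in> functionals R ?V" "\<xi> \<in> extensional (carrier ?V)"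
    using \<xi> unfolding dual_simps(1)[of R ?V] by (rule IntD1, rule IntD2)
  from bidual_multiple_is_evaluation[OF M A g \<psi> r(1) fac \<xi>]
  obtain u where u: "u \<in> carrier M" "\<forall>h\<in>carrier ?V. r \<otimes> \<xi> h = h u" by (rule bexE)
  from bidual_multiple_is_evaluation[OF M A g \<psi>' s fac' \<xi>]
  obtain v where v: "v \<in> carrier M" "\<forall>h\<in>carrier ?V. s \<otimes> \<xi> h = h v" by (rule bexE)
  have "s \<odot>\<^bsub>M\<^esub> u = r \<odot>\<^bsub>M\<^esub> v"
  proof (rule functionals_separate[OF M \<psi> g fac regular M.smult_closed[OF s u(1)] M.smult_closed[OF r(1) v(1)]])
    fix h assume h: "h \<in> carrier ?V"
    have hf: "h \<in> functionals R M" using h by simp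
    show "h (s \<odot>\<^bsub>M\<^esub> u) = h (r \<odot>\<^bsub>M\<^esub> v)"
      unfolding functionalD(3)[OF hf s u(1)] functionalD(3)[OF hf r(1) v(1)]
        u(2)[rule_format, OF h, symmetric] v(2)[rule_format, OF h, symmetric]
      by (rule m_lcomm[OF s r(1) functionalD(1)[OF \<xi>f(1) h]])
  qed
  from regular'[OF u(1) v(1) this] obtain w where w: "w \<in> carrier M" "u = r \<odot>\<^bsub>M\<^esub> w" by (rule bexE)
  have "\<xi> = evaluation R M w"
  proof (rule extensionalityI[OF \<xi>f(2)])
    show "evaluation R M w \<in> extensional (carrier ?V)" unfolding evaluation_def by (rule restrict_extensional)
    fix h assume h: "h \<in> carrier ?V"
    have hf: "h \<in> functionals R M" using h by simp
    have "r \<otimes> \<xi> h = r \<otimes> h w" using u(2)[rule_format, OF h] functionalD(3)[OF hf r(1) w(1)] unfolding w(2) by (simp only:)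
    then have "\<xi> h = h w" using m_lcancel[OF r(2,1) functionalD(1)[OF \<xi>f(1) h] functionalD(1)[OF hf w(1)]] by (simp only:)
    then show "\<xi> h = evaluation R M w h" using h by (simp add: evaluation_def)
  qed
  then show ?thesis using w(1) by (intro bexI)
qed

section \<open>The symmetric powers are reflexive\<close>

lemma pconst_sum: "(\<Sum>i\<in>A. pconst (F i)) = pconst (sum F A)"
  by (induction A rule: infinite_finite_induct) (simp_all add: single_add)

lemma pconst_mult: "pconst (a * b) = pconst a * pconst b"
  by (simp add: mult_single)

lemma pconst_power: "pconst (a ^ k) = pconst a ^ k"
  by (induction k) (simp_all add: pconst_mult)

context hypersurface
begin

text \<open>If \<open>h = \<Sum> h\<^sub>i (\<partial>f/\<partial>x\<^sub>i)\<close>, the substitution \<open>T\<^sub>i \<mapsto> h T\<^sub>i - h\<^sub>i df\<close> annihilates \<open>df\<close>, and modulo \<open>df\<close> it is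
multiplication of \<open>T\<^sub>i\<close> by \<open>h\<close>. It is \<open>h\<close> times a section of the projection from the free module on the \<open>T\<^sub>i\<close> onto
the module of differentials.\<close>

definition splitting :: "'k mpoly \<Rightarrow> (nat \<Rightarrow> 'k mpoly) \<Rightarrow>
    'k mpoly mpoly \<Rightarrow> 'k mpoly mpoly" where
  "splitting h hv = peval pconst (\<lambda>j. pconst h * pvar j - pconst (hv j) * df)"

lemma splitting_add: "splitting h hv (u + v) = splitting h hv u + splitting h hv v"
  and splitting_minus: "splitting h hv (u - v) = splitting h hv u - splitting h hv v"
  and splitting_mult: "splitting h hv (u * v) = splitting h hv u * splitting h hv v"
  and splitting_zero: "splitting h hv 0 = 0"
  and splitting_const: "splitting h hv (pconst c) = pconst c"
  and splitting_var: "splitting h hv (pvar i) = pconst h * pvar i - pconst (hv i) * df"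
  unfolding splitting_def
  by (simp_all only: peval_add peval_minus peval_mult peval_zero peval_const peval_var coefficient_hom_single)

lemma df_sum: "df = (\<Sum>i<n. pconst (pderivative i f) * pvar i)"
  unfolding total_differential_def linear_poly_def by (intro sum.cong refl) (simp only: mult_single add_0_left mult_1_right)

lemma splitting_df:
  assumes h: "h = (\<Sum>i<n. hv i * pderivative i f)"
  shows "splitting h hv df = 0"
proof -
  have "splitting h hv (\<Sum>i\<in>A. pconst (pderivative i f) * pvar i) =
    (\<Sum>i\<in>A. pconst (pderivative i f) * (pconst h * pvar i - pconst (hv i) * df))" if "finite A" for A
    using that by (induction A rule: finite_induct)
      (simp_all only: sum.empty sum.insert splitting_zero splitting_add splitting_mult splitting_const splitting_var not_False_eq_True)
  then have "splitting h hv df = (\<Sum>i<n. pconst (pderivative i f) * (pconst h * pvar i - pconst (hv i) * df))"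
    by (subst df_sum) simp
  also have "\<dots> = pconst h * (\<Sum>i<n. pconst (pderivative i f) * pvar i) - (\<Sum>i<n. pconst (hv i * pderivative i f)) * df"
    unfolding right_diff_distrib sum_subtractf sum_distrib_left sum_distrib_right pconst_mult by (simp only: mult_ac)
  also have "\<dots> = pconst h * df - pconst h * df" unfolding df_sum[symmetric] pconst_sum h[symmetric] ..
  finally show ?thesis by simp
qed

lemma splitting_Jac:
  assumes "h = (\<Sum>i<n. hv i * pderivative i f)" "u \<in> Jac"
  shows "\<exists>v. splitting h hv u = pconst f * v"
proof -
  obtain v w where u: "u = pconst f * v + df * w" using assms(2) unfolding Jac_def gen3_def by auto
  show ?thesis unfolding u splitting_add splitting_mult splitting_const splitting_df[OF assms(1)] by auto
qed

lemma splitting_cong: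
  assumes h: "h = (\<Sum>i<n. hv i * pderivative i f)" and "u \<simeq>\<^sub>J v"
  shows "rc (retract (lookup (splitting h hv u) m)) = rc (retract (lookup (splitting h hv v) m))"
proof -
  obtain w where "splitting h hv (u - v) = pconst f * w"
    using splitting_Jac[OF h] assms(2) unfolding cong_jac_def by blast
  then have "splitting h hv u = splitting h hv v + pconst f * w" unfolding splitting_minus by (simp add: algebra_simps)
  then have "retract (lookup (splitting h hv u) m) - retract (lookup (splitting h hv v) m) =
    f * retract (lookup w m)"
    by (simp add: lookup_add lookup_const_mult retract_add retract_mult retract_id f_carrier)
  then show ?thesis using rc_eq_iff[OF retract_closed retract_closed] retract_closed by blast
qed

lemma splitting_single: "splitting h hv (single m c) \<simeq>\<^sub>J pconst (h ^ monomial_degree m) * single m c"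
proof (induction "monomial_degree m" arbitrary: m)
  case 0
  then have "m = 0" using monomial_degree_eq_0 by metis
  then show ?case by (simp add: splitting_const)
next
  case (Suc q)
  have "m \<noteq> 0" using Suc.hyps(2) by auto
  then obtain i where i: "lookup m i \<noteq> 0" by (metis poly_mapping_eqI lookup_zero)
  define l where "l = m - single i (1::nat)"
  have m: "m = single i 1 + l" unfolding l_def by (rule monomial_split[OF i])
  have l: "q = monomial_degree l" using Suc.hyps(2) unfolding m monomial_degree_add by simp
  have e: "single m c = pvar i * single l c" unfolding m by (simp only: mult_single mult_1)
  have "pconst (hv i) * df \<simeq>\<^sub>J 0" unfolding cong_zero_iff Jac_def by (rule gen3I[of _ _ 0 _ "pconst (hv i)" _ 0]) (simp add: mult.commute)
  then have "pconst h * pvar i - pconst (hv i) * df \<simeq>\<^sub>J pconst h * pvar i - 0" by (intro cong_minus cong_refl)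
  then have "splitting h hv (single m c) \<simeq>\<^sub>J (pconst h * pvar i - 0) * (pconst (h ^ q) * single l c)"
    unfolding e splitting_mult splitting_var using Suc.hyps(1)[OF l] l by (intro cong_mult) simp_all
  also have "(pconst h * pvar i - 0) * (pconst (h ^ q) * single l c) = pconst (h ^ Suc q) * single m c"
    unfolding e power_Suc pconst_mult by (simp only: diff_zero mult_ac)
  finally show ?case using Suc.hyps(2) by simp
qed

lemma splitting_homogeneous:
  assumes "t_homogeneous q p"
  shows "splitting h hv p \<simeq>\<^sub>J pconst (h ^ q) * p"
proof -
  let ?t = "\<lambda>m. single m (lookup p m)"
  have "splitting h hv (sum ?t A) \<simeq>\<^sub>J pconst (h ^ q) * sum ?t A" if "finite A" "A \<subseteq> keys p" for A
    using that
  proof (induction A rule: finite_induct)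
    case empty
    then show ?case by (simp add: splitting_zero)
  next
    case (insert m A)
    have "monomial_degree m = q" using assms insert.prems unfolding t_homogeneous_def by blast
    then show ?case
      unfolding sum.insert[OF insert.hyps(1,2)] splitting_add distrib_left
      using splitting_single[of h hv m] insert by (intro cong_add) auto
  qed
  from this[of "keys p"] show ?thesis
    unfolding poly_mapping_sum_single[OF finite_keys order_refl, of p, symmetric] by simp
qed

definition splitting_coord where
  "splitting_coord h hv q m x = rc (retract (lookup (splitting h hv (lamq q x)) m))"

text \<open>As the substitution annihilates \<open>df\<close>, the coefficients of the result depend only on the
element of the symmetric power, not on its lift.\<close>

lemma splitting_coord_functional:
  assumes h: "h = (\<Sum>i<n. hv i * pderivative i f)"
  shows "splitting_coord h hv q m \<in> functionals R (Sy q)"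
proof (rule functionalI)
  fix x assume x: "x \<in> carrier (Sy q)"
  show "splitting_coord h hv q m x \<in> carrier R" unfolding splitting_coord_def by (intro rc_closed retract_closed)
  show "splitting_coord h hv q m (x \<oplus>\<^bsub>Sy q\<^esub> y) = splitting_coord h hv q m x \<oplus>\<^bsub>R\<^esub> splitting_coord h hv q m y"
    if y: "y \<in> carrier (Sy q)" for y
    unfolding splitting_coord_def splitting_cong[OF h lamq_add[OF x y]] splitting_add lookup_add retract_add
    by (rule R_add[OF retract_closed retract_closed, symmetric])
  show "splitting_coord h hv q m (r \<odot>\<^bsub>Sy q\<^esub> x) = r \<otimes>\<^bsub>R\<^esub> splitting_coord h hv q m x" if r: "r \<in> carrier R" for r
    unfolding splitting_coord_def splitting_cong[OF h lamq_smult[OF x r]] splitting_mult splitting_const lookup_const_mult retract_mult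
      retract_id[OF rep_closed[OF r]] R_mult[OF rep_closed[OF r] retract_closed, symmetric] rc_rep[OF r] ..
qed

text \<open>Where \<open>h\<close> is invertible, the symmetric power is a direct summand of the free module on the monomials; here this is
written without denominators.\<close>

lemma splitting_identity:
  assumes x: "x \<in> carrier (Sy q)" and h: "h \<in> carrier S"
  shows "rc (h ^ q) \<odot>\<^bsub>Sy q\<^esub> x = finsum (Sy q) (\<lambda>m. splitting_coord h hv q m x \<odot>\<^bsub>Sy q\<^esub> gm q m) (monomials n q)"
proof -
  have "finsum (Sy q) (\<lambda>m. splitting_coord h hv q m x \<odot>\<^bsub>Sy q\<^esub> gm q m) (monomials n q) = Psi q (splitting h hv (lamq q x))"
    unfolding splitting_coord_def Psi_def ..
  also have "\<dots> = Psi q (pconst (h ^ q) * lamq q x)"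
    by (rule Psi_cong[OF splitting_homogeneous[OF t_homogeneous_lamq[OF x]]])
  also have "\<dots> = rc (h ^ q) \<odot>\<^bsub>Sy q\<^esub> x"
    unfolding Psi_smult Psi_lamq[OF x] retract_id[OF mpoly_carrier_power[OF h]] ..
  finally show ?thesis by (rule sym)
qed

text \<open>At the origin \<open>f\<close> and all its partial derivatives vanish, so nonzero polynomials in the
\<open>T\<^sub>i\<close> with coefficients in \<open>k\<close> survive there.\<close>

lemma pvar_power_notin_Jac:
  assumes "point_value (\<lambda>_. 0) f = 0" "\<And>i. i < n \<Longrightarrow> point_value (\<lambda>_. 0) (pderivative i f) = 0"
  shows "(pvar 0 :: 'k mpoly mpoly) ^ q \<notin> Jac"
proof
  let ?v = "point_value (\<lambda>_. 0) :: 'k mpoly \<Rightarrow> 'k"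
  have hom: "coefficient_hom ?v"
    unfolding coefficient_hom_def
    by (simp only: peval_zero peval_one peval_add peval_mult coefficient_hom_id simp_thms)
  let ?e = "peval ?v (\<lambda>_. 1)"
  note e = peval_mult[OF hom] peval_add[OF hom] peval_const[OF hom] peval_var[OF hom] peval_power[OF hom] peval_zero[OF hom]
  assume "(pvar 0 :: 'k mpoly mpoly) ^ q \<in> Jac"
  then obtain u w where u: "pvar 0 ^ q = pconst f * u + df * w" unfolding Jac_def gen3_def by auto
  have "?e df = (\<Sum>i<n. ?v (pderivative i f) * 1)"
    unfolding df_sum peval_sum[OF hom] e ..
  also have "\<dots> = 0" using assms(2) by simp
  finally have "?e (pconst f * u + df * w) = 0" unfolding e assms(1) by simp
  then show False unfolding u[symmetric] e by simp
qed

lemma cong_power: "u \<simeq>\<^sub>J v \<Longrightarrow> u ^ k \<simeq>\<^sub>J v ^ k"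
  by (induction k) (simp_all add: cong_mult)

text \<open>A lift of \<open>dx\<^sub>0\<^sup>q\<close> is \<open>T\<^sub>0\<^sup>q\<close>, so this product in the symmetric power is not zero when that power lies outside the
ideal.\<close>

lemma gm_nonzero:
  assumes "n > 0" "(pvar 0 :: 'k mpoly mpoly) ^ q \<notin> Jac"
  shows "single 0 q \<in> monomials n q" "gm q (single 0 q) \<noteq> \<zero>\<^bsub>Sy q\<^esub>"
proof -
  let ?m = "single 0 q :: nat \<Rightarrow>\<^sub>0 nat"
  show m: "?m \<in> monomials n q" using assms(1) by (simp add: monomials_def)
  let ?D = "D (rc (pvar 0))"
  have "dmset ?m = (\<Sum>i<n. if i = 0 then replicate_mset q ?D else {#})"
    unfolding dmset_def by (intro sum.cong refl) (simp add: lookup_single when_def)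
  also have "\<dots> = replicate_mset q ?D" using assms(1) by simp
  finally have dm: "dmset ?m = replicate_mset q ?D" .
  have "lam1 ?D \<simeq>\<^sub>J dlift (rc (pvar 0))" by (rule lam1_D[OF rc_closed[OF pvar_closed[OF assms(1)]]])
  also have "dlift (rc (pvar 0)) \<simeq>\<^sub>J total_differential n (pvar 0)" by (rule dlift_rc[OF pvar_closed[OF assms(1)]])
  also have "total_differential n (pvar 0) = pvar 0" by (rule total_differential_var[OF assms(1)])
  finally have p: "lam1 ?D ^ q \<simeq>\<^sub>J pvar 0 ^ q" by (rule cong_power)
  have l: "lamq q (gm q ?m) \<simeq>\<^sub>J lam1 ?D ^ q"
    using lamq_sp[OF dmset_sgen[OF m]] unfolding dm image_replicate_mset prod_mset_replicate_mset .
  have c: "lamq q (gm q ?m) \<simeq>\<^sub>J pvar 0 ^ q" by (rule cong_trans[OF l p])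
  show "gm q ?m \<noteq> \<zero>\<^bsub>Sy q\<^esub>"
  proof
    assume "gm q ?m = \<zero>\<^bsub>Sy q\<^esub>"
    then have "lamq q (gm q ?m) \<simeq>\<^sub>J 0" using lamq_zero[of q] by (simp only:)
    from cong_trans[OF cong_sym[OF c] this] show False using assms(2) unfolding cong_zero_iff by blast
  qed
qed

end

text \<open>Two elements of the Jacobian ideal of \<open>f\<close> whose powers form a regular sequence modulo \<open>f\<close> and \<open>df\<close>.\<close>

locale jacobian_regular_pair = hypersurface n f for n and f :: "('k::field) mpoly" +
  fixes a b av bv
  assumes ab_closed: "a \<in> carrier S" "b \<in> carrier S"
    and a_jac: "a = (\<Sum>i<n. av i * pderivative i f)" and b_jac: "b = (\<Sum>i<n. bv i * pderivative i f)"
    and regular_a: "\<And>q u. pconst (a ^ q) * u \<in> Jac \<Longrightarrow> u \<in> Jac"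
    and regular_b: "\<And>q u v. pconst (b ^ q) * u - pconst (a ^ q) * v \<in> Jac \<Longrightarrow> \<exists>w. u - pconst (a ^ q) * w \<in> Jac"
    and one_notin: "1 \<notin> Jac"
    and R_domain: "domain R"
begin

lemma rc_a_nonzero: "rc (a ^ q) \<noteq> \<zero>\<^bsub>R\<^esub>"
proof
  assume "rc (a ^ q) = \<zero>\<^bsub>R\<^esub>"
  then obtain s where "a ^ q = f * s" using rc_eq_zero_iff[OF mpoly_carrier_power[OF ab_closed(1)]] by blast
  then have "pconst (a ^ q) * 1 \<in> Jac" using f_multiple_cong[of s 1] unfolding cong_zero_iff by simp
  then show False using regular_a one_notin by blast
qed

lemma Sy_regular_a:
  assumes x: "x \<in> carrier (Sy q)" and z: "rc (a ^ q) \<odot>\<^bsub>Sy q\<^esub> x = \<zero>\<^bsub>Sy q\<^esub>"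
  shows "x = \<zero>\<^bsub>Sy q\<^esub>"
proof -
  note c = mpoly_carrier_power[OF ab_closed(1), of q]
  have "pconst (a ^ q) * lamq q x \<simeq>\<^sub>J pconst (rep (rc (a ^ q))) * lamq q x"
    by (intro cong_mult cong_refl cong_sym[OF rep_cong[OF c]])
  also have "\<dots> \<simeq>\<^sub>J lamq q (rc (a ^ q) \<odot>\<^bsub>Sy q\<^esub> x)" by (rule cong_sym[OF lamq_smult[OF x rc_closed[OF c]]])
  also have "\<dots> \<simeq>\<^sub>J 0" unfolding z by (rule lamq_zero)
  finally have "lamq q x \<in> Jac" unfolding cong_zero_iff by (rule regular_a)
  then have "Psi q (lamq q x) = \<zero>\<^bsub>Sy q\<^esub>" by (rule Psi_Jac)
  then show ?thesis unfolding Psi_lamq[OF x] .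
qed

text \<open>Regularity is transported from polynomials to the symmetric power by lifting and applying \<open>Psi\<close>.\<close>

lemma Sy_regular_b:
  assumes x: "x \<in> carrier (Sy q)" and y: "y \<in> carrier (Sy q)" and e: "rc (b ^ q) \<odot>\<^bsub>Sy q\<^esub> x = rc (a ^ q) \<odot>\<^bsub>Sy q\<^esub> y"
  shows "\<exists>w\<in>carrier (Sy q). x = rc (a ^ q) \<odot>\<^bsub>Sy q\<^esub> w"
proof -
  note c = mpoly_carrier_power[OF ab_closed(1), of q] and d = mpoly_carrier_power[OF ab_closed(2), of q]
  have "pconst (b ^ q) * lamq q x \<simeq>\<^sub>J pconst (rep (rc (b ^ q))) * lamq q x"
    by (intro cong_mult cong_refl cong_sym[OF rep_cong[OF d]])
  also have "\<dots> \<simeq>\<^sub>J lamq q (rc (b ^ q) \<odot>\<^bsub>Sy q\<^esub> x)" by (rule cong_sym[OF lamq_smult[OF x rc_closed[OF d]]])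
  also have "\<dots> \<simeq>\<^sub>J pconst (rep (rc (a ^ q))) * lamq q y" unfolding e by (rule lamq_smult[OF y rc_closed[OF c]])
  also have "\<dots> \<simeq>\<^sub>J pconst (a ^ q) * lamq q y" by (intro cong_mult cong_refl rep_cong[OF c])
  finally obtain w where "lamq q x \<simeq>\<^sub>J pconst (a ^ q) * w" unfolding cong_jac_def using regular_b by blast
  then have "Psi q (lamq q x) = Psi q (pconst (a ^ q) * w)" by (rule Psi_cong)
  then have "x = rc (a ^ q) \<odot>\<^bsub>Sy q\<^esub> Psi q w" unfolding Psi_lamq[OF x] Psi_smult retract_id[OF c] .
  then show ?thesis using Psi_closed by (rule bexI)
qed

lemma Sy_reflexive:
  assumes "\<xi> \<in> carrier (dual_module R (dual_module R (Sy q)))"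
  shows "\<exists>w\<in>carrier (Sy q). \<xi> = evaluation R (Sy q) w"
  by (rule reflexive_by_regular_pair[OF R_domain Sy_module finite_monomials[of n q] gm_closed
    splitting_coord_functional[OF a_jac] splitting_coord_functional[OF b_jac]
    rc_closed[OF mpoly_carrier_power[OF ab_closed(1), of q]] rc_a_nonzero rc_closed[OF mpoly_carrier_power[OF ab_closed(2), of q]]
    splitting_identity[OF _ ab_closed(1), of _ q av] splitting_identity[OF _ ab_closed(2), of _ q bv] Sy_regular_a Sy_regular_b assms])

lemma Sy_functionals_separate:
  assumes "x \<in> carrier (Sy q)" "y \<in> carrier (Sy q)" "\<And>h. h \<in> carrier (dual_module R (Sy q)) \<Longrightarrow> h x = h y"
  shows "x = y"
  by (rule functionals_separate[OF Sy_module splitting_coord_functional[OF a_jac] gm_closed splitting_identity[OF _ ab_closed(1), of _ q av]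
    Sy_regular_a assms])

end

section \<open>Free ranks\<close>

lemma point_value_vanishing:
  assumes p: "p \<in> graded_piece n (Suc d)" and Q: "\<And>v. v < n \<Longrightarrow> Q v = 0"
  shows "point_value Q p = 0"
  unfolding peval_def additive_extension_def
proof (rule sum.neutral, rule ballI)
  fix m assume "m \<in> keys p"
  then have m: "keys m \<subseteq> {..<n}" "monomial_degree m = Suc d"
    using p unfolding graded_piece_iff monomials_def by auto
  then have "m \<noteq> 0" by auto
  then obtain v where v: "v \<in> keys m" by (metis all_not_in_conv keys_eq_empty)
  then have "v < n" using m(1) by blast
  then have "Q v ^ lookup m v = 0" using Q v by (simp add: in_keys_iff power_0_left)
  then have "monomial_value Q m = 0" unfolding monomial_value_def using v by (intro prod_zero bexI) auto
  then show "lookup p m * monomial_value Q m = 0" by simp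
qed

text \<open>Every monomial of a multiple of \<open>f\<close> has degree at least that of \<open>f\<close>.\<close>

lemma multiple_of_higher_degree:
  assumes "p \<in> graded_piece n e" "p = f * s" "homogeneous_of_degree (Suc e) f"
  shows "p = 0"
proof (rule ccontr)
  assume "p \<noteq> 0"
  then obtain m where m: "m \<in> keys p" by (metis all_not_in_conv keys_eq_empty)
  then have "monomial_degree m = e" using assms(1) unfolding graded_piece_iff monomials_def by auto
  moreover obtain a b where "a \<in> keys f" "m = a + b" using m keys_mult[of f s] unfolding assms(2) by blast
  ultimately show False using assms(3) unfolding homogeneous_of_degree_def by (auto simp: monomial_degree_add)
qed

context hypersurface
begin

lemma R_part_iff:
  "r \<in> ring_part R i \<longleftrightarrow> (\<exists>p d. r = rc p \<and> p \<in> graded_piece n d \<and> i = int d) \<or> r = \<zero>\<^bsub>R\<^esub>"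
  by (auto simp: hypersurface_ring_def Let_def graded_piece_def)

lemma finsum_rc: "finite A \<Longrightarrow> (\<And>a. a \<in> A \<Longrightarrow> F a \<in> carrier S) \<Longrightarrow> finsum R (\<lambda>a. rc (F a)) A = rc (sum F A)"
proof (induction A rule: finite_induct)
  case empty
  interpret R: cring R by (rule R_cring)
  show ?case by (simp add: R_zero)
next
  case (insert a A)
  interpret R: cring R by (rule R_cring)
  have "finsum R (\<lambda>a. rc (F a)) (insert a A) = rc (F a) \<oplus>\<^bsub>R\<^esub> finsum R (\<lambda>a. rc (F a)) A"
    using insert.prems by (intro R.finsum_insert insert.hyps Pi_I rc_closed) blast+
  then show ?case using insert by (simp add: R_add mpoly_carrier_sum)
qed

lemma Om_part_closed: "module_part Om i \<subseteq> carrier Om"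
proof
  fix x assume x: "x \<in> module_part Om i"
  let ?M = "kaehler_module R K"
  have M: "module R ?M" unfolding kaehler_module_def by (rule presentation.Pm_module[OF krel_presentation])
  interpret M: module R ?M by (rule M)
  have c: "carrier Om = carrier ?M" by (simp add: kaehler_differentials_def)
  have gens: "{r \<odot>\<^bsub>?M\<^esub> D s | r s k l. r \<in> ring_part R k \<and> s \<in> ring_part R l \<and> k + l = i} \<subseteq> carrier ?M"
  proof (intro subsetI, elim CollectE exE conjE)
    fix y r s k l assume y: "y = r \<odot>\<^bsub>?M\<^esub> D s" "r \<in> ring_part R k" "s \<in> ring_part R l"
    have "r \<in> carrier R" "s \<in> carrier R"
      using y(2,3) unfolding R_part_iff by (auto intro: graded_piece_carrier M.R.zero_closed)
    then show "y \<in> carrier ?M" unfolding y(1) using D_closed unfolding c by (intro M.smult_closed)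
  qed
  have "x \<in> generate (add_monoid ?M) {r \<odot>\<^bsub>?M\<^esub> D s | r s k l. r \<in> ring_part R k \<and> s \<in> ring_part R l \<and> k + l = i}"
    using x by (simp only: kaehler_differentials_def with_grading_simps)
  from group.generate_in_carrier[OF M.M.a_group _ this] gens show "x \<in> carrier Om" unfolding c by simp
qed

lemma Sy_part_closed: "module_part (Sy q) i \<subseteq> carrier (Sy q)"
proof
  fix x assume x: "x \<in> module_part (Sy q) i"
  let ?M = "sym_module R q Om"
  have M: "module R ?M" unfolding sym_module_def by (rule presentation.Pm_module[OF srel_presentation])
  interpret M: module R ?M by (rule M)
  have c: "carrier (Sy q) = carrier ?M" by (simp add: sym_power_def)
  let ?H = "{a \<odot>\<^bsub>?M\<^esub> sp q (image_mset snd E) | a k E. a \<in> ring_part R k \<and> size E = q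
     \<and> (\<forall>(j, x) \<in> set_mset E. x \<in> module_part Om j) \<and> k + sum_mset (image_mset fst E) = i}"
  have gens: "?H \<subseteq> carrier ?M"
  proof (intro subsetI, elim CollectE exE conjE)
    fix y a k E assume y: "y = a \<odot>\<^bsub>?M\<^esub> sp q (image_mset snd E)" "a \<in> ring_part R k" "size E = q"
      "\<forall>(j, x) \<in> set_mset E. x \<in> module_part Om j"
    have "a \<in> carrier R"
      using y(2) unfolding R_part_iff by (auto intro: graded_piece_carrier M.R.zero_closed)
    moreover have "image_mset snd E \<in> sgen q"
      using y(3,4) Om_part_closed unfolding sgen_iff by fastforce
    from sp_closed[OF this] have "sp q (image_mset snd E) \<in> carrier ?M" unfolding c .
    ultimately show "y \<in> carrier ?M" unfolding y(1) by (rule M.smult_closed)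
  qed
  have "x \<in> generate (add_monoid ?M) ?H"
    using x by (simp only: sym_power_def with_grading_simps)
  from group.generate_in_carrier[OF M.M.a_group _ this] gens show "x \<in> carrier (Sy q)" unfolding c by simp
qed

lemma one_part: "\<one>\<^bsub>R\<^esub> \<in> ring_part R 0"
  unfolding R_part_iff R_one using graded_piece_const[of 1 n] by (intro disjI1 exI[of _ 1] exI[of _ 0]) simp

lemma D_var_part: "i < n \<Longrightarrow> D (rc (pvar i)) \<in> module_part Om 1"
proof -
  assume i: "i < n"
  let ?M = "kaehler_module R K"
  interpret M: module R ?M unfolding kaehler_module_def by (rule presentation.Pm_module[OF krel_presentation])
  have c: "carrier Om = carrier ?M" by (simp add: kaehler_differentials_def)
  have v: "rc (pvar i) \<in> ring_part R 1"
    unfolding R_part_iff using graded_piece_var[OF i] by (intro disjI1 exI[of _ "pvar i"] exI[of _ 1]) simp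
  have "D (rc (pvar i)) = \<one>\<^bsub>R\<^esub> \<odot>\<^bsub>?M\<^esub> D (rc (pvar i))"
    using D_closed[OF rc_closed[OF pvar_closed[OF i]]] unfolding c by (rule M.smult_one[symmetric])
  then have "D (rc (pvar i)) \<in> {r \<odot>\<^bsub>?M\<^esub> D s | r s k l. r \<in> ring_part R k \<and> s \<in> ring_part R l \<and> k + l = 1}"
    using one_part v by (intro CollectI exI conjI) (assumption | simp only: add_0_left)+
  then have "D (rc (pvar i)) \<in> generate (add_monoid ?M) {r \<odot>\<^bsub>?M\<^esub> D s | r s k l. r \<in> ring_part R k \<and> s \<in> ring_part R l \<and> k + l = 1}"
    by (rule generate.incl)
  then show ?thesis by (simp only: kaehler_differentials_def with_grading_simps)
qed

lemma in_sum_replicate_mset: "w \<in># (\<Sum>i\<in>A. replicate_mset (l i) (F i)) \<Longrightarrow> \<exists>i\<in>A. w = F i"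
  by (induction A rule: infinite_finite_induct) (auto split: if_splits)

lemma gm_part:
  assumes m: "m \<in> monomials n q"
  shows "gm q m \<in> module_part (Sy q) (int q)"
proof -
  let ?M = "sym_module R q Om"
  interpret M: module R ?M unfolding sym_module_def by (rule presentation.Pm_module[OF srel_presentation])
  have c: "carrier (Sy q) = carrier ?M" by (simp add: sym_power_def)
  let ?E = "image_mset (\<lambda>w. (1 :: int, w)) (dmset m)"
  have size: "size (dmset m) = q" using dmset_sgen[OF m] unfolding sgen_iff by (rule conjunct2)
  have deg: "image_mset fst ?E = replicate_mset q 1"
    using size by (simp add: multiset.map_comp comp_def image_mset_const_eq)
  have w: "w \<in> module_part Om 1" if w: "w \<in># dmset m" for w
  proof -
    obtain i where i: "i < n" "w = D (rc (pvar i))"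
      using in_sum_replicate_mset[OF w[unfolded dmset_def]] by blast
    show ?thesis unfolding i(2) by (rule D_var_part[OF i(1)])
  qed
  have snd: "image_mset snd ?E = dmset m" by (simp add: multiset.map_comp comp_def)
  have "gm q m = \<one>\<^bsub>R\<^esub> \<odot>\<^bsub>?M\<^esub> sp q (image_mset snd ?E)"
    unfolding snd using gm_closed[OF m] unfolding c by (rule M.smult_one[symmetric])
  moreover have "size ?E = q" "\<forall>(j, x) \<in> set_mset ?E. x \<in> module_part Om j" using size w by auto
  moreover have "0 + sum_mset (image_mset fst ?E) = int q" unfolding deg by (simp add: sum_mset_replicate_mset)
  ultimately have "gm q m \<in> {a \<odot>\<^bsub>?M\<^esub> sp q (image_mset snd E) | a k E. a \<in> ring_part R k \<and> size E = q
     \<and> (\<forall>(j, x) \<in> set_mset E. x \<in> module_part Om j) \<and> k + sum_mset (image_mset fst E) = int q}"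
    using one_part by (intro CollectI exI[of _ "\<one>\<^bsub>R\<^esub>"] exI[of _ 0] exI[of _ ?E] conjI)
  from generate.incl[OF this, of "add_monoid ?M"] show ?thesis
    by (simp only: sym_power_def with_grading_simps)
qed

text \<open>If the values of \<open>c\<close> on the generators \<open>T\<^sup>m\<close> have nonzero degree, they vanish at the origin. If the degree is
zero they are constants, and the relations \<open>T\<^sup>l df = 0\<close> give linear relations between the partial derivatives, so the
constants are zero. In both cases all values of \<open>c\<close> vanish at the origin, and \<open>1\<close> does not.\<close>

lemma no_unimodular_functional:
  assumes hom: "homogeneous_of_degree (Suc e) f" and e: "e \<ge> 1"
    and full: "graded_piece n N \<subseteq> form_ideal n {..<n} (\<lambda>i. pderivative i f) e N"
    and c: "c \<in> functionals R (Sy (Suc r))"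
    and deg: "\<And>x. x \<in> module_part (Sy (Suc r)) (int (Suc r)) \<Longrightarrow> c x \<in> ring_part R \<epsilon>"
    and x: "x \<in> carrier (Sy (Suc r))"
  shows "c x \<noteq> \<one>\<^bsub>R\<^esub>"
proof
  assume cx: "c x = \<one>\<^bsub>R\<^esub>"
  let ?q = "Suc r"
  interpret R: cring R by (rule R_cring)
  have Rm: "module R (ring_as_module R)" by (rule ring_as_module_module[OF R_cring])
  have "\<exists>p. p \<in> carrier S \<and> rc p = c (gm ?q m) \<and> (p \<noteq> 0 \<longrightarrow> (\<exists>d. \<epsilon> = int d \<and> p \<in> graded_piece n d))"
    if m: "m \<in> monomials n ?q" for m
    using deg[OF gm_part[OF m]] unfolding R_part_iff
  proof (elim disjE exE conjE)
    fix p d assume p: "c (gm ?q m) = rc p" "p \<in> graded_piece n d" "\<epsilon> = int d"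
    then show ?thesis using graded_piece_carrier by (intro exI[of _ p]) auto
  next
    assume "c (gm ?q m) = \<zero>\<^bsub>R\<^esub>"
    then show ?thesis unfolding R_zero by (intro exI[of _ 0]) simp
  qed
  then have "\<exists>P. \<forall>m\<in>monomials n ?q. P m \<in> carrier S \<and> rc (P m) = c (gm ?q m) \<and> (P m \<noteq> 0 \<longrightarrow> (\<exists>d. \<epsilon> = int d \<and> P m \<in> graded_piece n d))"
    by (intro bchoice ballI)
  then obtain P where P: "\<And>m. m \<in> monomials n ?q \<Longrightarrow> P m \<in> carrier S" "\<And>m. m \<in> monomials n ?q \<Longrightarrow> rc (P m) = c (gm ?q m)"
    "\<And>m. m \<in> monomials n ?q \<Longrightarrow> P m \<noteq> 0 \<Longrightarrow> \<exists>d. \<epsilon> = int d \<and> P m \<in> graded_piece n d" by blast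
  have val: "c (rc (retract s) \<odot>\<^bsub>Sy ?q\<^esub> gm ?q m) = rc (retract s * P m)" if m: "m \<in> monomials n ?q" for m s
    unfolding functionalD(3)[OF c rc_closed[OF retract_closed] gm_closed[OF m]] P(2)[OF m, symmetric]
    by (rule R_mult[OF retract_closed P(1)[OF m]])
  have zero: "point_value (\<lambda>_. 0) (P m) = 0" if m: "m \<in> monomials n ?q" for m
  proof (cases "\<epsilon> = 0")
    case False
    show ?thesis
    proof (cases "P m = 0")
      case True
      then show ?thesis by (simp add: point_value_simps)
    next
      case nz: False
      obtain d where d: "\<epsilon> = int d" "P m \<in> graded_piece n d" using P(3)[OF m nz] by blast
      then obtain d' where "d = Suc d'" using False by (cases d) auto
      then show ?thesis using point_value_vanishing[of "P m" n d' "\<lambda>_. 0"] d(2) by simp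
    qed
  next
    case True
    define k where "k l = lookup (P l) 0" for l
    have k: "P l = pconst (k l)" if l: "l \<in> monomials n ?q" for l
    proof (cases "P l = 0")
      case False
      then have "keys (P l) \<subseteq> {0}"
        using P(3)[OF l] True unfolding graded_piece_iff by (auto simp: monomials_0)
      from poly_mapping_sum_single[OF _ this] show ?thesis unfolding k_def by simp
    qed (simp add: k_def)
    obtain i l where il: "i < n" "l \<in> monomials n r" "m = single i 1 + l"
      using m by (rule monomials_SucE)
    have mon: "single v 1 + l \<in> monomials n ?q" if "v < n" for v
      using monomials_add[OF monomials_var[OF that] il(2)] by simp
    let ?t = "\<lambda>v. single (single v 1 + l) (pderivative v f)"
    (* The relation \<open>T\<^sup>l df = 0\<close> is chosen to involve the given monomial \<open>m = e\<^sub>i + l\<close>. *)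
    let ?u = "\<lambda>v. pderivative v f * P (single v 1 + l)"
    have der: "pderivative v f \<in> carrier S" for v by (rule mpoly_carrier_pderivative[OF f_carrier])
    have "c (Psi ?q (sum ?t A)) = rc (sum ?u A)" if "finite A" "A \<subseteq> {..<n}" for A
      using that
    proof (induction A rule: finite_induct)
      case empty
      show ?case unfolding sum.empty Psi_zero R_zero[symmetric]
        using module_hom_zero[OF Sy_module Rm c] by simp
    next
      case (insert v A)
      have v: "v < n" "A \<subseteq> {..<n}" using insert.prems by auto
      have s: "c (Psi ?q (?t v)) = rc (?u v)"
        using val[OF mon[OF v(1)], of "pderivative v f"] unfolding Psi_single[OF mon[OF v(1)]] retract_id[OF der] .
      have cl: "?u w \<in> carrier S" if "w < n" for w by (intro mpoly_carrier_mult der P(1) mon that)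
      have "sum ?u A \<in> carrier S" using cl v(2) by (intro mpoly_carrier_sum) blast
      then show ?case
        unfolding sum.insert[OF insert.hyps] Psi_add functionalD(2)[OF c Psi_closed Psi_closed] s insert.IH[OF v(2)]
        by (rule R_add[OF cl[OF v(1)]])
    qed
    from this[of "{..<n}"] have "rc (sum ?u {..<n}) = c (Psi ?q (sum ?t {..<n}))" by simp
    also have "sum ?t {..<n} = single l 1 * df"
      by (simp add: total_differential_def linear_poly_def sum_distrib_left mult_single add.commute)
    also have "c (Psi ?q (single l 1 * df)) = \<zero>\<^bsub>R\<^esub>"
      unfolding Psi_monomial_df[OF il(2)] using module_hom_zero[OF Sy_module Rm c] by simp
    finally have "rc (sum ?u {..<n}) = \<zero>\<^bsub>R\<^esub>" .
    moreover have u: "?u v = pconst (k (single v 1 + l)) * pderivative v f" if "v < n" for v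
      unfolding k[OF mon[OF that]] by (rule mult.commute)
    have dg: "pderivative v f \<in> graded_piece n e" for v
      using homogeneous_pderivative[OF hom] der by (simp add: graded_piece_def)
    have ug: "?u v \<in> graded_piece n e" if "v \<in> {..<n}" for v
      by (subst u[OF lessThan_iff[THEN iffD1, OF that]]) (rule graded_piece_cmult[OF dg])
    have sg: "sum ?u {..<n} \<in> graded_piece n e" by (rule graded_piece_sum[OF ug])
    ultimately obtain s where "sum ?u {..<n} = f * s"
      using rc_eq_zero_iff[OF graded_piece_carrier[OF sg]] by blast
    then have "sum ?u {..<n} = 0" by (rule multiple_of_higher_degree[OF sg _ hom])
    moreover have "(\<Sum>v<n. pconst (k (single v 1 + l)) * pderivative v f) = sum ?u {..<n}"
      by (rule sum.cong[OF refl], rule u[symmetric]) (simp only: lessThan_iff)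
    ultimately have "(\<Sum>v<n. pconst (k (single v 1 + l)) * pderivative v f) = 0" by (simp only:)
    from full_imp_independent[where h = "\<lambda>i. pderivative i f", OF dg e full this il(1)]
    have "k m = 0" unfolding il(3) .
    then show ?thesis unfolding k[OF m] by (simp add: point_value_simps)
  qed
  let ?s = "\<Sum>m\<in>monomials n ?q. retract (lookup (lamq ?q x) m) * P m"
  have cl: "retract (lookup (lamq ?q x) m) * P m \<in> carrier S" if "m \<in> monomials n ?q" for m
    by (intro mpoly_carrier_mult retract_closed P(1) that)
  have s: "?s \<in> carrier S" using cl by (intro mpoly_carrier_sum)
  have "c x = c (Psi ?q (lamq ?q x))" unfolding Psi_lamq[OF x] ..
  also have "\<dots> = finsum (ring_as_module R) (\<lambda>m. c (rc (retract (lookup (lamq ?q x) m)) \<odot>\<^bsub>Sy ?q\<^esub> gm ?q m)) (monomials n ?q)"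
    unfolding Psi_def by (rule module_hom_finsum[OF Sy_module Rm c finite_monomials Psi_term_closed])
  also have "\<dots> = finsum R (\<lambda>m. rc (retract (lookup (lamq ?q x) m) * P m)) (monomials n ?q)"
    unfolding finsum_ring_as_module by (rule R.finsum_cong') (intro refl Pi_I rc_closed cl val | assumption)+
  also have "\<dots> = rc ?s" by (rule finsum_rc[OF finite_monomials cl])
  finally have "rc 1 = rc ?s" unfolding cx R_one .
  then obtain t where t: "1 - ?s = f * t" using rc_eq_iff[OF mpoly_carrier_one s] by blast
  have "point_value (\<lambda>_. 0) f = 0"
    by (rule point_value_vanishing[of f n e]) (simp_all add: graded_piece_def f_carrier hom)
  then have "point_value (\<lambda>_. 0) (1 - ?s) = 0" unfolding t by (simp add: point_value_simps)
  moreover have "point_value (\<lambda>_. 0) ?s = 0"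
    unfolding peval_sum[OF coefficient_hom_id] peval_mult[OF coefficient_hom_id] using zero by simp
  ultimately show False by (simp add: peval_minus[OF coefficient_hom_id] peval_one[OF coefficient_hom_id])
qed

text \<open>A coordinate of a surjection onto a nonzero free module is a homogeneous functional that attains the value \<open>1\<close>. The
module \<open>M\<close> is the symmetric power itself or its bidual.\<close>

lemma free_rank_of_image_zero:
  assumes hom: "homogeneous_of_degree (Suc e) f" "e \<ge> 1"
    and full: "graded_piece n N \<subseteq> form_ideal n {..<n} (\<lambda>i. pderivative i f) e N"
    and M: "module R M" and \<pi>: "\<pi> \<in> graded_hom R (Sy (Suc r)) M 0" and onto: "carrier M \<subseteq> \<pi> ` carrier (Sy (Suc r))"
  shows "free_rank R M = 0"
proof (rule free_rank_zero[OF R_cring M])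
  fix m a h
  assume h: "h \<in> graded_hom R M (graded_free_module R m a) 0" and h_onto: "h ` carrier M = carrier (graded_free_module R m a)"
  interpret R: cring R by (rule R_cring)
  show "m = 0"
  proof (rule ccontr)
    assume "m \<noteq> 0"
    then have m: "0 < m" by simp
    have \<pi>h: "\<pi> \<in> LinearCombinations.module_hom R (Sy (Suc r)) M" and hh: "h \<in> LinearCombinations.module_hom R M (graded_free_module R m a)"
      using \<pi> h unfolding graded_hom_def by simp_all
    note p = module_homD[OF \<pi>h] and q = module_homD[OF hh, unfolded graded_free_simps]
    let ?c = "\<lambda>x. h (\<pi> x) 0"
    have c: "?c \<in> functionals R (Sy (Suc r))"
    proof (rule functionalI)
      fix x assume x: "x \<in> carrier (Sy (Suc r))"
      show "?c x \<in> carrier R" using q(1)[OF p(1)[OF x]] unfolding free_module_carrier by blast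
      show "?c (x \<oplus>\<^bsub>Sy (Suc r)\<^esub> y) = ?c x \<oplus>\<^bsub>R\<^esub> ?c y" if y: "y \<in> carrier (Sy (Suc r))" for y
        unfolding p(2)[OF x y] q(2)[OF p(1)[OF x] p(1)[OF y]] ..
      show "?c (s \<odot>\<^bsub>Sy (Suc r)\<^esub> x) = s \<otimes>\<^bsub>R\<^esub> ?c x" if s: "s \<in> carrier R" for s
        unfolding p(3)[OF s x] q(3)[OF s p(1)[OF x]] ..
    qed
    have deg: "?c x \<in> ring_part R (int (Suc r) - a 0)" if x: "x \<in> module_part (Sy (Suc r)) (int (Suc r))" for x
    proof -
      have "\<pi> x \<in> module_part M (int (Suc r) + 0)" using \<pi> x unfolding graded_hom_def by blast
      then have "h (\<pi> x) \<in> module_part (graded_free_module R m a) (int (Suc r) + 0 + 0)" using h unfolding graded_hom_def by blast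
      then show ?thesis using m by (simp only: graded_free_module_def with_grading_simps add_0_right mem_Collect_eq)
    qed
    have "free_gen R 0 \<in> carrier (free_module R {..<m})" using m by (intro R.free_gen_closed) simp
    then have "free_gen R 0 \<in> h ` carrier M" unfolding h_onto graded_free_simps .
    then obtain y where y: "free_gen R 0 = h y" "y \<in> carrier M" by (rule imageE)
    have "y \<in> \<pi> ` carrier (Sy (Suc r))" using y(2) onto by (rule rev_subsetD)
    then obtain x where x: "y = \<pi> x" "x \<in> carrier (Sy (Suc r))" by (rule imageE)
    have one: "?c x = \<one>\<^bsub>R\<^esub>" unfolding x(1)[symmetric] y(1)[symmetric] by (simp add: free_gen_def)
    have "?c x \<noteq> \<one>\<^bsub>R\<^esub>"
      by (rule no_unimodular_functional[where c = ?c and \<epsilon> = "int (Suc r) - a 0", OF hom full c _ x(2)]) (rule deg)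
    then show False using one by (rule notE)
  qed
qed

end

context jacobian_regular_pair
begin

lemma evaluation_onto: "carrier (dual_module R (dual_module R (Sy q))) \<subseteq> evaluation R (Sy q) ` carrier (Sy q)"
proof
  fix \<xi> assume "\<xi> \<in> carrier (dual_module R (dual_module R (Sy q)))"
  from Sy_reflexive[OF this] obtain w where "w \<in> carrier (Sy q)" "\<xi> = evaluation R (Sy q) w" by (rule bexE)
  then show "\<xi> \<in> evaluation R (Sy q) ` carrier (Sy q)" by (rule rev_image_eqI)
qed

text \<open>Some functional \<open>h\<close> does not vanish on a given nonzero element of the symmetric power, and \<open>\<xi> \<mapsto> \<xi>(h)\<close> is
then a nonzero functional on the bidual.\<close>

lemma reflexive_power_rank_positive:
  assumes "n > 0" "(pvar 0 :: 'k mpoly mpoly) ^ q \<notin> Jac"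
  shows "module_rank R (dual_module R (dual_module R (Sy q))) \<ge> 1"
proof -
  interpret R: "domain" R by (rule R_domain)
  interpret Y: module R "Sy q" by (rule Sy_module)
  let ?V = "dual_module R (Sy q)"
  let ?N = "dual_module R ?V" and ?ev = "evaluation R (Sy q)" and ?g = "gm q (single 0 q)"
  have V: "module R ?V" by (rule dual_is_module[OF Sy_module])
  have N: "module R ?N" by (rule dual_is_module[OF V])
  have ev: "?ev \<in> LinearCombinations.module_hom R (Sy q) ?N" by (rule evaluation_hom[OF Sy_module])
  note e = module_homD[OF ev]
  have Rm: "module R (ring_as_module R)" by (rule ring_as_module_module[OF R_cring])
  note g = gm_nonzero[OF assms]
  have "\<exists>h\<in>carrier ?V. h ?g \<noteq> \<zero>\<^bsub>R\<^esub>"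
  proof (rule ccontr)
    assume a: "\<not> ?thesis"
    have "?g = \<zero>\<^bsub>Sy q\<^esub>"
    proof (rule Sy_functionals_separate[OF gm_closed[OF g(1)] Y.M.zero_closed])
      fix h assume h: "h \<in> carrier ?V"
      then have hf: "h \<in> functionals R (Sy q)" unfolding dual_simps(1) by (rule IntD1)
      have "h ?g = \<zero>\<^bsub>R\<^esub>" by (rule ccontr, rule notE[OF a], rule bexI[OF _ h])
      then show "h ?g = h \<zero>\<^bsub>Sy q\<^esub>" using module_hom_zero[OF Sy_module Rm hf] unfolding ring_as_module_simps by (simp only:)
    qed
    then show False using g(2) by (rule notE[rotated])
  qed
  then obtain h where h: "h \<in> carrier ?V" "h ?g \<noteq> \<zero>\<^bsub>R\<^esub>" by (rule bexE)
  note \<chi> = functionalD[OF evaluation_functional[OF V h(1)]]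
  show ?thesis
  proof (rule R.module_rank_positive[where Y = "?ev ` gm q ` monomials n q" and \<chi> = "\<lambda>\<xi>. \<xi> h" and ?x0.0 = "?ev ?g"])
    show "module R ?N" by (rule N)
    show "finite (?ev ` gm q ` monomials n q)" by (intro finite_imageI finite_monomials)
    show "?ev ` gm q ` monomials n q \<subseteq> carrier ?N" unfolding image_image by (intro image_subsetI e(1) gm_closed)
    show "?ev ?g \<in> carrier ?N" by (rule e(1)[OF gm_closed[OF g(1)]])
    show "?ev ?g h \<noteq> \<zero>\<^bsub>R\<^esub>" unfolding evaluation_def restrict_apply'[OF h(1)] by (rule h(2))
  next
    fix W assume W: "submodule R W ?N" and sub: "?ev ` gm q ` monomials n q \<subseteq> W"
    show "carrier ?N \<subseteq> W"
    proof
      fix x assume x: "x \<in> carrier ?N"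
      obtain w where w: "x = ?ev w" "w \<in> carrier (Sy q)" using subsetD[OF evaluation_onto x] by (rule imageE)
      let ?t = "\<lambda>m. rc (retract (lookup (lamq q w) m)) \<odot>\<^bsub>Sy q\<^esub> gm q m"
      have "?ev (finsum (Sy q) ?t A) \<in> W" if "finite A" "A \<subseteq> monomials n q" for A
        using that
      proof (induction A rule: finite_induct)
        case empty
        show ?case unfolding Y.M.finsum_empty module_hom_zero[OF Sy_module N ev] by (rule submodule.zero_closed[OF W])
      next
        case (insert m A)
        have m: "m \<in> monomials n q" "A \<subseteq> monomials n q" using insert.prems by blast+
        have t: "?t \<in> A \<rightarrow> carrier (Sy q)" using m(2) by (intro Pi_I Psi_term_closed) (rule subsetD)
        have "?ev (?t m) \<in> W"
          unfolding e(3)[OF rc_closed[OF retract_closed] gm_closed[OF m(1)]]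
          by (rule submodule.smult_closed[OF W rc_closed[OF retract_closed] subsetD[OF sub imageI[OF imageI[OF m(1)]]]])
        then show ?case
          unfolding Y.M.finsum_insert[OF insert.hyps t Psi_term_closed[OF m(1)]]
            e(2)[OF Psi_term_closed[OF m(1)] Y.M.finsum_closed[OF t]]
          by (rule submodule.m_closed[OF W _ insert.IH[OF m(2)]])
      qed
      from this[OF finite_monomials order_refl] have "?ev (Psi q (lamq q w)) \<in> W" unfolding Psi_def .
      then show "x \<in> W" unfolding Psi_lamq[OF w(2)] w(1) .
    qed
  next
    fix x y assume x: "x \<in> carrier ?N"
    show "x h \<in> carrier R" by (rule \<chi>(1)[OF x])
    show "(x \<oplus>\<^bsub>?N\<^esub> y) h = x h \<oplus>\<^bsub>R\<^esub> y h" if "y \<in> carrier ?N" by (rule \<chi>(2)[OF x that])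
  next
    fix r x assume "r \<in> carrier R" "x \<in> carrier ?N"
    then show "(r \<odot>\<^bsub>?N\<^esub> x) h = r \<otimes>\<^bsub>R\<^esub> x h" by (rule \<chi>(3))
  qed
qed

end

section \<open>Hypersurfaces with an isolated singularity\<close>

text \<open>The point \<open>Q\<close> lies on the subspace to which is restricted.\<close>

lemma collapse_point_value:
  assumes "Q j \<noteq> 0"
  shows "point_value Q (collapse j (\<lambda>v. Q v / Q j) V p) = point_value Q p"
proof (induction p rule: mpoly_ring_induct)
  case (var i)
  show ?case using assms
    by (cases "i \<in> V") (simp_all only: collapse_var if_True if_False peval_mult peval_const peval_var coefficient_hom_id, simp)
qed (simp_all only: collapse_add collapse_mult collapse_const peval_add peval_mult coefficient_hom_id)

lemma three_other_indices:
  assumes "n \<ge> (4::nat)"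
  shows "\<exists>x y z. x < n \<and> y < n \<and> z < n \<and> x \<noteq> y \<and> x \<noteq> z \<and> y \<noteq> z \<and> j \<noteq> x \<and> j \<noteq> y \<and> j \<noteq> z"
proof -
  consider "j = 0" | "j = 1" | "j = 2" | "j > 2" by linarith
  then show ?thesis
  proof cases
    case 1 then show ?thesis using assms by (intro exI[of _ 1] exI[of _ 2] exI[of _ 3]) simp
  next
    case 2 then show ?thesis using assms by (intro exI[of _ 0] exI[of _ 2] exI[of _ 3]) simp
  next
    case 3 then show ?thesis using assms by (intro exI[of _ 0] exI[of _ 1] exI[of _ 3]) simp
  next
    case 4 then show ?thesis using assms by (intro exI[of _ 0] exI[of _ 1] exI[of _ 2]) simp
  qed
qed

text \<open>The line through the origin and a point \<open>Q\<close> with \<open>f(Q) \<noteq> 0\<close> is cut out by the forms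
\<open>x\<^sub>v - (Q\<^sub>v/Q\<^sub>j) x\<^sub>j\<close>. With \<open>n \<ge> 4\<close> there are at least three of them, and their \<open>N\<close>-th powers lie in the Jacobian ideal.\<close>

lemma isolated_singularity_regular_pair:
  fixes f :: "('k::alg_closed_field) mpoly"
  assumes n: "n \<ge> 4" and f: "f \<in> carrier (mpoly_ring n)" "f \<noteq> 0" "homogeneous_of_degree (Suc e) f"
    and full: "graded_piece n N \<subseteq> form_ideal n {..<n} (\<lambda>i. pderivative i f) e N"
    and one: "1 \<notin> hypersurface.Jac n f" and dom: "domain (hypersurface_ring n f)"
  shows "\<exists>a b av bv. jacobian_regular_pair n f a b av bv"
proof -
  interpret hypersurface n f by unfold_locales (rule f(1))
  obtain Q where Q: "point_value Q f \<noteq> 0" using nonvanishing_point[OF f(1,2)] by blast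
  have "f \<in> graded_piece n (Suc e)" using f by (simp add: graded_piece_def)
  from point_value_vanishing[OF this, of Q] Q obtain j where j: "j < n" "Q j \<noteq> 0" by blast
  define c where "c v = Q v / Q j" for v
  obtain x y z where xyz: "x < n" "y < n" "z < n" "x \<noteq> y" "x \<noteq> z" "y \<noteq> z" "j \<noteq> x" "j \<noteq> y" "j \<noteq> z"
    using three_other_indices[OF n, of j] by blast
  have lf: "line_form j c v \<in> carrier S" "\<exists>u. line_form j c v ^ N = (\<Sum>i<n. u i * pderivative i f)" if v: "v < n" for v
  proof -
    have g: "line_form j c v \<in> graded_piece n 1"
      by (intro graded_piece_minus graded_piece_cmult graded_piece_var v j(1))
    show "line_form j c v \<in> carrier S" by (rule graded_piece_carrier[OF g])
    have "line_form j c v ^ N \<in> graded_piece n (1 * N)" by (rule graded_piece_power[OF g])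
    then have "line_form j c v ^ N \<in> form_ideal n {..<n} (\<lambda>i. pderivative i f) e N" using full by auto
    then obtain u where "line_form j c v ^ N = (\<Sum>i<n. pderivative i f * u i)" unfolding form_ideal_def by blast
    then show "\<exists>u. line_form j c v ^ N = (\<Sum>i<n. u i * pderivative i f)" by (auto simp: mult.commute)
  qed
  interpret rd: regular_differential j x y z c f n "\<lambda>i. pderivative i f"
  proof unfold_locales
    show "collapse j c {x, y, z} f \<noteq> 0"
      using collapse_point_value[where Q = Q and j = j and V = "{x, y, z}" and p = f, OF j(2)] Q unfolding c_def[abs_def]
      by (auto simp: point_value_simps)
  qed (use xyz lf in blast)+
  have I: "rd.I = Jac" unfolding Jac_def total_differential_def ..
  obtain av where av: "line_form j c x ^ N = (\<Sum>i<n. av i * pderivative i f)" using lf(2)[OF xyz(1)] by blast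
  obtain bv where bv: "line_form j c y ^ N = (\<Sum>i<n. bv i * pderivative i f)" using lf(2)[OF xyz(2)] by blast
  have "jacobian_regular_pair n f (line_form j c x ^ N) (line_form j c y ^ N) av bv"
  proof (intro jacobian_regular_pair.intro jacobian_regular_pair_axioms.intro hypersurface_axioms)
    show "line_form j c x ^ N \<in> carrier S" "line_form j c y ^ N \<in> carrier S"
      by (intro mpoly_carrier_power lf(1) xyz)+
    show "u \<in> Jac" if "pconst ((line_form j c x ^ N) ^ q) * u \<in> Jac" for q u
    proof -
      have "pconst (line_form j c x) ^ (N * q) * u \<in> rd.I" using that unfolding I pconst_power power_mult .
      from rd.regular_x_power[OF this] show ?thesis unfolding I .
    qed
    show "\<exists>w. u - pconst ((line_form j c x ^ N) ^ q) * w \<in> Jac"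
      if "pconst ((line_form j c y ^ N) ^ q) * u - pconst ((line_form j c x ^ N) ^ q) * v \<in> Jac" for q u v
    proof -
      have "pconst (line_form j c y) ^ (N * q) * u - pconst (line_form j c x) ^ (N * q) * v \<in> rd.I"
        using that unfolding I pconst_power power_mult .
      from rd.regular_y_power[OF this] show ?thesis unfolding I pconst_power power_mult .
    qed
  qed (fact av bv one dom)+
  then show ?thesis by blast
qed

theorem theorem3p7:
  fixes n d :: nat and f :: "(nat \<Rightarrow>\<^sub>0 nat) \<Rightarrow>\<^sub>0 'k::alg_closed_field"
  defines "R \<equiv> hypersurface_ring n f"
    and "K \<equiv> hypersurface_scalars n f"
  assumes "n \<ge> 4"
    and "f \<in> carrier (mpoly_ring n)" and "f \<noteq> 0"
    and "homogeneous_of_degree d f" and "d \<ge> 2" and "\<not> CHAR('k) dvd d"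
    and "domain R"
    and "regular_outside R (hypersurface_maxideal n f)"
  shows "(\<forall>q\<ge>1. free_rank R (sym_power R q (kaehler_differentials R K)) = 0) \<and>
         (convergent (signature_quotient R K) \<and> differential_symmetric_signature R K = 0)"
proof -
  obtain e where d: "d = Suc e" and e: "e \<ge> 1" using \<open>d \<ge> 2\<close> by (cases d) auto
  interpret hyp: hypersurface n f by unfold_locales fact
  have hom: "homogeneous_of_degree (Suc e) f" using assms d by simp
  have "\<exists>N. graded_piece n N \<subseteq> form_ideal n {..<n} (\<lambda>i. pderivative i f) e N"
    using assms d by (intro jacobian_full) (simp_all add: R_def)
  then obtain N where full: "graded_piece n N \<subseteq> form_ideal n {..<n} (\<lambda>i. pderivative i f) e N" by blast
  obtain e' where e': "e = Suc e'" using e by (cases e) auto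
  have pvar: "(pvar 0 :: 'k mpoly mpoly) ^ q \<notin> hyp.Jac" for q
  proof (rule hyp.pvar_power_notin_Jac)
    show "point_value (\<lambda>_. 0) f = 0"
      using hom assms by (intro point_value_vanishing[of f n e]) (simp_all add: graded_piece_def)
    show "point_value (\<lambda>_. 0) (pderivative i f) = 0" for i
      using homogeneous_pderivative[OF hom, of i] mpoly_carrier_pderivative[OF hyp.f_carrier, of i]
      by (intro point_value_vanishing[of _ n e']) (simp_all add: graded_piece_def e')
  qed
  obtain a b av bv where "jacobian_regular_pair n f a b av bv"
    using isolated_singularity_regular_pair[OF \<open>n \<ge> 4\<close> assms(4,5) hom full _ \<open>domain R\<close>[unfolded R_def]] pvar[of 0] by auto
  then interpret jacobian_regular_pair n f a b av bv .
  note zero = hyp.free_rank_of_image_zero[OF hom e full]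
  let ?C = "reflexive_sym_differentials R K"
  have C: "?C q = dual_module hyp.R (dual_module hyp.R (hyp.Sy q))" for q
    unfolding reflexive_sym_differentials_def R_def K_def ..
  have Sy0: "free_rank hyp.R (hyp.Sy (Suc r)) = 0" for r
  proof (rule zero[OF hyp.Sy_module])
    show "(\<lambda>x. x) \<in> graded_hom hyp.R (hyp.Sy (Suc r)) (hyp.Sy (Suc r)) 0"
      unfolding graded_hom_def by (intro CollectI conjI allI module_homI) simp_all
    show "carrier (hyp.Sy (Suc r)) \<subseteq> (\<lambda>x. x) ` carrier (hyp.Sy (Suc r))" unfolding image_ident ..
  qed
  have C0: "free_rank R (?C (Suc r)) = 0" for r
    unfolding C unfolding R_def
    by (rule zero[OF dual_is_module[OF dual_is_module[OF hyp.Sy_module]] evaluation_graded[OF hyp.Sy_module hyp.Sy_part_closed] evaluation_onto])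
  have rank: "module_rank R (?C q) \<ge> 1" for q
    unfolding C unfolding R_def using \<open>n \<ge> 4\<close> by (intro reflexive_power_rank_positive pvar) simp
  have num: "(\<Sum>q\<le>M. free_rank R (?C q)) = free_rank R (?C 0)" for M
    by (induction M) (simp_all add: C0)
  have den: "(\<Sum>q\<le>M. module_rank R (?C q)) \<ge> Suc M" for M
    using sum_mono[of "{..M}" "\<lambda>_. 1" "\<lambda>q. module_rank R (?C q)"] rank by simp
  have "signature_quotient R K \<longlonglongrightarrow> 0"
  proof (rule tendsto_sandwich[of "\<lambda>_. 0" _ _ "\<lambda>M. real (free_rank R (?C 0)) * inverse (real (Suc M))"])
    show "\<forall>\<^sub>F M in sequentially. 0 \<le> signature_quotient R K M"
      unfolding signature_quotient_def by (intro always_eventually allI divide_nonneg_nonneg of_nat_0_le_iff)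
    show "\<forall>\<^sub>F M in sequentially. signature_quotient R K M \<le> real (free_rank R (?C 0)) * inverse (real (Suc M))"
    proof (rule always_eventually, rule allI)
      fix M
      have "real (Suc M) \<le> real (\<Sum>q\<le>M. module_rank R (?C q))" using den[of M] by (simp only: of_nat_le_iff)
      then show "signature_quotient R K M \<le> real (free_rank R (?C 0)) * inverse (real (Suc M))"
        unfolding signature_quotient_def num divide_inverse
        by (intro mult_left_mono le_imp_inverse_le) simp_all
    qed
    show "(\<lambda>M. real (free_rank R (?C 0)) * inverse (real (Suc M))) \<longlonglongrightarrow> 0"
      by (rule tendsto_mult_right_zero[OF LIMSEQ_inverse_real_of_nat])
  qed simp
  then have lim: "convergent (signature_quotient R K)" "differential_symmetric_signature R K = 0"
    unfolding differential_symmetric_signature_def by (blast intro: convergentI, rule limI)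
  have "free_rank R (sym_power R q (kaehler_differentials R K)) = 0" if "q \<ge> 1" for q
    using that Sy0[of "q - 1"] unfolding R_def K_def by simp
  then show ?thesis using lim by blast
qed

end
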